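(* Given any arbitrary online sequence of vertex or edge updates on an undirected graph with $n$ vertices, a DFS tree of the graph can be maintained by a semi-streaming algorithm using $O(n)$ space and $O(\log^2 n)$ passes over the input graph per update.
   Context: In the semi-streaming model the input graph is accessible only as a stream of its edges, which may be read in passes, and the algorithm may use only $O(n)$ words of local memory. A DFS tree of an undirected graph is a rooted spanning tree in which every non-tree edge joins a vertex to one of its ancestors in the tree. An update is one of: insertion of a vertex together with an arbitrary set of incident edges, deletion of a vertex, insertion of an edge, or deletion of an edge. Disconnected graphs are handled by adding a dummy vertex adjacent to all vertices (equivalently, a DFS forest). *)

theory Defs
  imports Complex_Main "HOL-Library.Landau_Symbols"
begin

section \<open>Graphs, updates and DFS trees\<close>

type_synonym 'a graph = "'a set \<times> 'a set set"

definition simple_graph :: "'a graph \<Rightarrow> bool" where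
  "simple_graph G \<longleftrightarrow>
     finite (fst G) \<and> snd G \<subseteq> {{u, v} | u v. u \<in> fst G \<and> v \<in> fst G \<and> u \<noteq> v}"

datatype update =
    Insert_Vertex nat "nat set"  \<comment> \<open>the new vertex and its neighbours\<close>
  | Delete_Vertex nat
  | Insert_Edge nat nat
  | Delete_Edge nat nat

fun valid_update :: "nat graph \<Rightarrow> update \<Rightarrow> bool" where
  "valid_update (V, E) (Insert_Vertex v X) \<longleftrightarrow> v \<notin> V \<and> X \<subseteq> V"
| "valid_update (V, E) (Delete_Vertex v) \<longleftrightarrow> v \<in> V"
| "valid_update (V, E) (Insert_Edge u v) \<longleftrightarrow> u \<in> V \<and> v \<in> V \<and> u \<noteq> v \<and> {u, v} \<notin> E"
| "valid_update (V, E) (Delete_Edge u v) \<longleftrightarrow> {u, v} \<in> E"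

fun apply_update :: "nat graph \<Rightarrow> update \<Rightarrow> nat graph" where
  "apply_update (V, E) (Insert_Vertex v X) = (insert v V, E \<union> (\<lambda>x. {v, x}) ` X)"
| "apply_update (V, E) (Delete_Vertex v) = (V - {v}, {e \<in> E. v \<notin> e})"
| "apply_update (V, E) (Insert_Edge u v) = (V, insert {u, v} E)"
| "apply_update (V, E) (Delete_Edge u v) = (V, E - {{u, v}})"

fun valid_updates :: "nat graph \<Rightarrow> update list \<Rightarrow> bool" where
  "valid_updates G [] \<longleftrightarrow> True"
| "valid_updates G (x # xs) \<longleftrightarrow> valid_update G x \<and> valid_updates (apply_update G x) xs"

definition graph_after :: "nat graph \<Rightarrow> update list \<Rightarrow> nat \<Rightarrow> nat graph" where
  "graph_after G us t = foldl apply_update G (take t us)"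

text \<open>A rooted tree is given by the set of its (parent, child) pairs.\<close>

definition rooted_spanning_tree :: "'a graph \<Rightarrow> 'a \<Rightarrow> ('a \<times> 'a) set \<Rightarrow> bool" where
  "rooted_spanning_tree G r T \<longleftrightarrow>
     r \<in> fst G \<and> T \<subseteq> fst G \<times> fst G \<and> (\<forall>(u, v) \<in> T. {u, v} \<in> snd G) \<and>
     (\<forall>u. (u, r) \<notin> T) \<and> (\<forall>v \<in> fst G - {r}. \<exists>!u. (u, v) \<in> T) \<and>
     (\<forall>v \<in> fst G. (r, v) \<in> T\<^sup>*)"

definition is_dfs_tree :: "'a graph \<Rightarrow> 'a \<Rightarrow> ('a \<times> 'a) set \<Rightarrow> bool" where
  "is_dfs_tree G r T \<longleftrightarrow>
     rooted_spanning_tree G r T \<and>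
     (\<forall>u v. {u, v} \<in> snd G \<and> (u, v) \<notin> T \<and> (v, u) \<notin> T \<longrightarrow> (u, v) \<in> T\<^sup>* \<or> (v, u) \<in> T\<^sup>*)"

text \<open>The dummy vertex \<open>None\<close>, adjacent to all vertices, takes care of disconnected graphs:
  a DFS tree of the augmented graph rooted at \<open>None\<close> is a DFS forest of the graph.\<close>

definition augment :: "'a graph \<Rightarrow> 'a option graph" where
  "augment G = (insert None (Some ` fst G),
                (\<lambda>e. Some ` e) ` snd G \<union> {{None, Some v} | v. v \<in> fst G})"


section \<open>Streaming programs\<close>

text \<open>
  A streaming program works on a random access memory of words (cells that have never been
  written contain 0). It sees the graph only through \<open>NEXT\<close>, which reads one edge of the
  current pass, and \<open>REWIND\<close>, which starts a new pass. The memory is the only store a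
  program has: it holds the variables and all the workspace. An expression nests a fixed number
  of operations, so evaluating it takes a constant number of words.
\<close>

datatype aexp =
    Const nat
  | Cell aexp  \<comment> \<open>indirect addressing\<close>
  | Plus aexp aexp
  | Minus aexp aexp
  | Times aexp aexp
  | Div aexp aexp
  | Mod aexp aexp

datatype com =
    SKIP
  | STORE aexp aexp  \<comment> \<open>address and value\<close>
  | SEQ com com
  | COND aexp com com
  | LOOP aexp com
  | NEXT
  | REWIND

type_synonym memory = "nat \<Rightarrow> nat"
type_synonym stream = "(nat \<times> nat) list"

fun aval :: "aexp \<Rightarrow> memory \<Rightarrow> nat" where
  "aval (Const c) m = c"
| "aval (Cell a) m = m (aval a m)"
| "aval (Plus a b) m = aval a m + aval b m"
| "aval (Minus a b) m = aval a m - aval b m"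
| "aval (Times a b) m = aval a m * aval b m"
| "aval (Div a b) m = aval a m div aval b m"
| "aval (Mod a b) m = aval a m mod aval b m"

text \<open>
  A configuration consists of the memory, the part of the current pass that has not been read
  yet, and the number of passes started so far. In \<open>exec \<sigma> S W c\<close>, \<open>\<sigma> i\<close> is the order in
  which pass \<open>i\<close> presents the edges, and a computation may only use the cells with addresses
  below \<open>S\<close> and words below \<open>W\<close>: it gets stuck when it tries to exceed a bound. \<open>NEXT\<close>
  sets cell 0 to 1 and delivers the endpoints of the edge in cells 1 and 2; at the end of a pass
  it sets cell 0 to 0. The guards of \<open>COND\<close> and \<open>LOOP\<close> are true if they are nonzero.
\<close>

type_synonym config = "memory \<times> stream \<times> nat"

inductive exec :: "(nat \<Rightarrow> stream) \<Rightarrow> nat \<Rightarrow> nat \<Rightarrow> com \<Rightarrow> config \<Rightarrow> config \<Rightarrow> bool"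
  for \<sigma> :: "nat \<Rightarrow> stream" and S W :: nat
where
  Skip: "exec \<sigma> S W SKIP x x"
| Store: "aval a m < S \<Longrightarrow> aval b m < W \<Longrightarrow>
    exec \<sigma> S W (STORE a b) (m, es, i) (m(aval a m := aval b m), es, i)"
| Seq: "exec \<sigma> S W c x y \<Longrightarrow> exec \<sigma> S W d y z \<Longrightarrow> exec \<sigma> S W (SEQ c d) x z"
| Cond_True: "aval a (fst x) \<noteq> 0 \<Longrightarrow> exec \<sigma> S W c x y \<Longrightarrow> exec \<sigma> S W (COND a c d) x y"
| Cond_False: "aval a (fst x) = 0 \<Longrightarrow> exec \<sigma> S W d x y \<Longrightarrow> exec \<sigma> S W (COND a c d) x y"
| Loop_False: "aval a (fst x) = 0 \<Longrightarrow> exec \<sigma> S W (LOOP a c) x x"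
| Loop_True: "aval a (fst x) \<noteq> 0 \<Longrightarrow> exec \<sigma> S W c x y \<Longrightarrow> exec \<sigma> S W (LOOP a c) y z \<Longrightarrow>
    exec \<sigma> S W (LOOP a c) x z"
| Next_Edge: "2 < S \<Longrightarrow> 1 < W \<Longrightarrow> u < W \<Longrightarrow> v < W \<Longrightarrow>
    exec \<sigma> S W NEXT (m, (u, v) # es, i) (m(0 := 1, 1 := u, 2 := v), es, i)"
| Next_End: "0 < S \<Longrightarrow> 0 < W \<Longrightarrow> exec \<sigma> S W NEXT (m, [], i) (m(0 := 0), [], i)"
| Rewind: "exec \<sigma> S W REWIND (m, es, i) (m, \<sigma> i, Suc i)"

inductive_cases exec_SkipE: "exec \<sigma> S W SKIP x z"
inductive_cases exec_StoreE: "exec \<sigma> S W (STORE a b) x z"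
inductive_cases exec_SeqE: "exec \<sigma> S W (SEQ c d) x z"
inductive_cases exec_CondE: "exec \<sigma> S W (COND a c d) x z"
inductive_cases exec_LoopE: "exec \<sigma> S W (LOOP a c) x z"
inductive_cases exec_NextE: "exec \<sigma> S W NEXT x z"
inductive_cases exec_RewindE: "exec \<sigma> S W REWIND x z"

lemma exec_deterministic:
  "exec \<sigma> S W c x y \<Longrightarrow> exec \<sigma> S W c x z \<Longrightarrow> z = y"
proof (induction arbitrary: z rule: exec.induct)
  case Skip
  then show ?case by (rule exec_SkipE)
next
  case Store
  from Store.prems show ?case by (rule exec_StoreE) simp
next
  case (Seq c x y d y')
  from Seq.prems show ?case
  proof (rule exec_SeqE)
    fix w
    assume "exec \<sigma> S W c x w" and w: "exec \<sigma> S W d w z"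
    then have "w = y" by (intro Seq.IH(1))
    with w show "z = y'" by (intro Seq.IH(2)) simp
  qed
next
  case Cond_True
  from Cond_True.prems show ?case
    by (rule exec_CondE) (erule Cond_True.IH, simp add: Cond_True.hyps)
next
  case Cond_False
  from Cond_False.prems show ?case
    by (rule exec_CondE) (simp add: Cond_False.hyps, erule Cond_False.IH)
next
  case Loop_False
  from Loop_False.prems show ?case
    by (rule exec_LoopE) (simp_all add: Loop_False.hyps)
next
  case (Loop_True a x c y y')
  from Loop_True.prems show ?case
  proof (rule exec_LoopE)
    assume "aval a (fst x) = 0"
    with Loop_True.hyps show "z = y'" by simp
  next
    fix w
    assume "exec \<sigma> S W c x w" and w: "exec \<sigma> S W (LOOP a c) w z"
    then have "w = y" by (intro Loop_True.IH(1))
    with w show "z = y'" by (intro Loop_True.IH(2)) simp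
  qed
next
  case Next_Edge
  from Next_Edge.prems show ?case by (rule exec_NextE) simp_all
next
  case Next_End
  from Next_End.prems show ?case by (rule exec_NextE) simp_all
next
  case Rewind
  from Rewind.prems show ?case by (rule exec_RewindE) simp
qed

definition fits :: "nat \<Rightarrow> nat \<Rightarrow> memory \<Rightarrow> bool" where
  "fits S W m \<longleftrightarrow> (\<forall>a. m a < W) \<and> (\<forall>a \<ge> S. m a = 0)"

text \<open>Every edge occurs exactly once, in an arbitrary orientation.\<close>

definition edge_stream :: "nat graph \<Rightarrow> stream \<Rightarrow> bool" where
  "edge_stream G es \<longleftrightarrow>
     distinct (map (\<lambda>(u, v). {u, v}) es) \<and> set (map (\<lambda>(u, v). {u, v}) es) = snd G"


section \<open>Maintaining a DFS tree in the semi-streaming model\<close>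

text \<open>
  \<open>preprocess\<close> is run once on the initial graph, \<open>process_update\<close> after every update. The
  tree is kept in memory as a table of (vertex, parent) pairs, whose \<open>i\<close>-th entry is stored
  at address \<open>table_base + table_stride * i\<close> and the next one (the stride lets programs
  interleave further tables with this one). Parent 0 stands for the dummy vertex and
  \<open>Suc u\<close> for the vertex \<open>u\<close>.
\<close>

record streaming_algorithm =
  preprocess :: com
  process_update :: com
  table_base :: nat
  table_stride :: nat

definition stored_tree ::
  "streaming_algorithm \<Rightarrow> nat \<Rightarrow> memory \<Rightarrow> (nat option \<times> nat option) set"
where
  "stored_tree A n m =
     (\<lambda>i. let a = table_base A + table_stride A * i
          in (case m (a + 1) of 0 \<Rightarrow> None | Suc u \<Rightarrow> Some u, Some (m a))) ` {..<n}"

text \<open>The initial memory holds the names of the vertices, as isolated vertices do not occur in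
  the stream of edges.\<close>

definition initial_memory :: "nat list \<Rightarrow> memory" where
  "initial_memory vs =
     (\<lambda>a. if a = 0 then length vs
          else if 3 \<le> a \<and> a < 3 + length vs then vs ! (a - 3) else 0)"

text \<open>The edges incident to an inserted vertex are not handed over separately: they are part of
  the stream of the updated graph.\<close>

fun announce :: "update \<Rightarrow> memory \<Rightarrow> memory" where
  "announce (Insert_Vertex v X) m = m(0 := 0, 1 := v, 2 := 0)"
| "announce (Delete_Vertex v) m = m(0 := 1, 1 := v, 2 := 0)"
| "announce (Insert_Edge u v) m = m(0 := 2, 1 := u, 2 := v)"
| "announce (Delete_Edge u v) m = m(0 := 3, 1 := u, 2 := v)"

text \<open>
  \<open>run_respects A S P W G us vs \<sigma>\<close>: started on \<open>G\<close>, whose vertices are listed by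
  \<open>vs\<close>, and given the updates \<open>us\<close> one after the other, \<open>A\<close> always terminates and
  has a DFS tree of the current graph in memory, while it uses only words below \<open>W\<close> and,
  whenever the current graph has \<open>n\<close> vertices, at most \<open>S n\<close> words of memory and
  at most \<open>P n\<close> passes for the update. \<open>\<sigma> t i\<close> is the \<open>i\<close>-th pass after \<open>t\<close>
  updates, and \<open>M t\<close> is the memory retained at that point (unique by
  \<open>exec_deterministic\<close>). The number of passes of the preprocessing is not restricted.
\<close>

definition run_respects ::
  "streaming_algorithm \<Rightarrow> (nat \<Rightarrow> nat) \<Rightarrow> (nat \<Rightarrow> nat) \<Rightarrow> nat \<Rightarrow> nat graph \<Rightarrow> update list \<Rightarrow>
   nat list \<Rightarrow> (nat \<Rightarrow> nat \<Rightarrow> stream) \<Rightarrow> bool"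
where
  "run_respects A S P W G us vs \<sigma> \<longleftrightarrow>
     (let n = (\<lambda>t. card (fst (graph_after G us t))) in
      \<exists>M :: nat \<Rightarrow> memory.
        fits (S (n 0)) W (initial_memory vs) \<and>
        (\<exists>es i. exec (\<sigma> 0) (S (n 0)) W (preprocess A) (initial_memory vs, [], 0) (M 0, es, i)) \<and>
        (\<forall>t < length us.
           fits (S (n (Suc t))) W (announce (us ! t) (M t)) \<and>
           (\<exists>es i. exec (\<sigma> (Suc t)) (S (n (Suc t))) W (process_update A)
                     (announce (us ! t) (M t), [], 0) (M (Suc t), es, i) \<and>
                   i \<le> P (n (Suc t)))) \<and>
        (\<forall>t \<le> length us.
           is_dfs_tree (augment (graph_after G us t)) None (stored_tree A (n t) (M t))))"

text \<open>
  The vertices are named by numbers below an arbitrary \<open>N\<close>, which is not known to the algorithm.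
  A word has \<open>O(log N)\<close> bits: the bound \<open>(N + 2) ^ c\<close> on its value, where \<open>c\<close> is a
  constant, is the usual word size for vertex names and polynomially bounded numbers.
\<close>

definition maintains_dfs_tree ::
  "streaming_algorithm \<Rightarrow> (nat \<Rightarrow> nat) \<Rightarrow> (nat \<Rightarrow> nat) \<Rightarrow> bool"
where
  "maintains_dfs_tree A S P \<longleftrightarrow>
     (\<exists>c. \<forall>N G us vs \<sigma>.
        simple_graph G \<and> valid_updates G us \<and>
        (\<forall>t \<le> length us. fst (graph_after G us t) \<subseteq> {..<N}) \<and>
        distinct vs \<and> set vs = fst G \<and>
        (\<forall>t \<le> length us. \<forall>i. edge_stream (graph_after G us t) (\<sigma> t i))
        \<longrightarrow> run_respects A S P ((N + 2) ^ c) G us vs \<sigma>)"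

end

theory Submission
  imports Defs
begin

text \<open>An update turns the DFS forest into a forest all of whose cross edges meet the path from one
  vertex to its root. Walking this path first, from the vertex to the root, yields a partial DFS
  tree such that the visited neighbours of every remaining tree of the old forest lie on one path
  of the new tree. This invariant survives every walk from an arbitrary vertex of a remaining tree
  up to the root of that tree, if the vertex is attached along the edge from the remaining tree to
  its most recently visited neighbour.

  One pass serves a whole round of such walks. For each vertex it records the neighbour visited
  last before the round, and the neighbour among its descendants in the old forest that branches
  off its heavy path at the lowest point. These edges suffice to walk until
  the heavy path of every tree that remained at the start of the round is visited. A subtree that
  hangs off a heavy path has at most half of the vertices, so that \<open>O(log n)\<close> rounds
  complete the tree, fewer than the bound asks for.\<close>

section \<open>Partial DFS traversals of a forest\<close>

text \<open>The obstacle is memory: within a round the visited set changes with every walk, yet the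
  edges cannot be read again and only a constant number of them per vertex can be kept. What saves
  the round is that the subtrees along a heavy path are nested. A neighbour \<open>w\<close> of the
  remaining subtree of \<open>z\<close> that was visited after the pass lies above \<open>z\<close>
  on the heavy path, so all that matters is whether \<open>w\<close> has a neighbour in the subtree
  of \<open>z\<close>. The descendant of \<open>w\<close> recorded by the pass settles this for all
  \<open>z\<close> on the path at once, because it lies in each of these subtrees in which
  \<open>w\<close> has any neighbour.

  The four updates differ only in the vertex \<open>a\<close> whose root path meets the cross edges:
  the inserted vertex, an endpoint of the inserted edge, the upper end of a deleted tree edge, the
  parent of a deleted vertex. The preprocessing inserts the vertices one by one, as its passes are
  not counted.

  Running time is not bounded either, which explains the quadratic searches: what would call for an
  auxiliary structure is recomputed from the columns of the table.\<close>

definition anc :: "(nat \<Rightarrow> nat) \<Rightarrow> nat \<Rightarrow> nat \<Rightarrow> bool" where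
  "anc f u v \<longleftrightarrow> (\<exists>k. (f ^^ k) v = u)"

lemma anc_refl [simp]: "anc f v v"
  unfolding anc_def by (rule exI[of _ 0]) simp

lemma anc_funpow [simp]: "anc f ((f ^^ k) v) v"
  unfolding anc_def by blast

lemma anc_trans:
  assumes "anc f u v" "anc f v w"
  shows "anc f u w"
proof -
  obtain k l where "(f ^^ k) v = u" "(f ^^ l) w = v" using assms unfolding anc_def by blast
  then have "(f ^^ (k + l)) w = u" by (simp add: funpow_add)
  then show ?thesis unfolding anc_def by blast
qed

lemma anc_step: "anc f u v \<longleftrightarrow> u = v \<or> anc f u (f v)"
proof
  assume "anc f u v"
  then obtain k where "(f ^^ k) v = u" unfolding anc_def by blast
  then show "u = v \<or> anc f u (f v)"
    by (cases k) (auto simp: funpow_swap1)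
next
  assume "u = v \<or> anc f u (f v)"
  then show "anc f u v"
  proof
    assume "anc f u (f v)"
    then obtain k where "(f ^^ k) (f v) = u" unfolding anc_def by blast
    then have "(f ^^ Suc k) v = u" by (simp add: funpow_swap1)
    then show ?thesis unfolding anc_def by blast
  qed simp
qed

text \<open>Two iterates of one vertex lie on a single orbit, and the one with more steps continues
  from the other. Root paths are chains for this reason.\<close>

lemma anc_comparable:
  assumes "anc f u w" "anc f v w"
  shows "anc f u v \<or> anc f v u"
proof -
  obtain k l where kl: "(f ^^ k) w = u" "(f ^^ l) w = v"
    using assms unfolding anc_def by blast
  have *: "anc f ((f ^^ j) w) ((f ^^ i) w)" if "i \<le> j" for i j
  proof -
    have "(f ^^ j) w = (f ^^ (j - i)) ((f ^^ i) w)"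
      using that by (metis comp_apply funpow_add le_add_diff_inverse2)
    then show ?thesis by simp
  qed
  show ?thesis using *[of k l] *[of l k] kl by (metis nle_le)
qed

lemma anc_closed:
  assumes "anc f u v" "P v" "\<And>w. P w \<Longrightarrow> P (f w)"
  shows "P u"
proof -
  obtain k where k: "(f ^^ k) v = u" using assms(1) unfolding anc_def by blast
  have "P ((f ^^ k) v)" for k by (induction k) (auto intro: assms)
  then show ?thesis using k by blast
qed

text \<open>Ancestry depends only on the parents inside a set closed under parents. So a tree that
  is extended without touching the parents of its old vertices keeps its old ancestor
  relation.\<close>

lemma anc_cong:
  assumes "anc f u v" "v \<in> D" "\<And>w. w \<in> D \<Longrightarrow> f w \<in> D" "\<And>w. w \<in> D \<Longrightarrow> g w = f w"
  shows "anc g u v"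
proof -
  obtain k where k: "(f ^^ k) v = u" using assms(1) unfolding anc_def by blast
  have "(f ^^ k) v \<in> D \<and> (g ^^ k) v = (f ^^ k) v" for k
    by (induction k) (auto simp: assms)
  then show ?thesis using k unfolding anc_def by metis
qed

text \<open>The rank \<open>r\<close> states acyclicity in a form that is easy to transport: an
  update can reuse the old rank, and the visit times are a rank of the new tree. The dummy root 0
  stays outside \<open>V\<close> and is its own parent, so that every root path ends in a fixed
  point.\<close>

definition forest :: "nat set \<Rightarrow> (nat \<Rightarrow> nat) \<Rightarrow> bool" where
  "forest V f \<longleftrightarrow> finite V \<and> 0 \<notin> V \<and> f 0 = 0 \<and> (\<forall>v\<in>V. f v \<in> insert 0 V) \<and>
     (\<exists>r :: nat \<Rightarrow> nat. \<forall>v\<in>V. r (f v) < r v)"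

context
  fixes V f assumes forest: "forest V f"
begin

lemma forest_closed: "v \<in> insert 0 V \<Longrightarrow> f v \<in> insert 0 V"
  using forest unfolding forest_def by auto

lemma forest_f0 [simp]: "f 0 = 0"
  using forest unfolding forest_def by blast

lemma forest_pos: "v \<in> V \<Longrightarrow> v \<noteq> 0"
  using forest unfolding forest_def by metis

lemma anc_0: "anc f u 0 \<longleftrightarrow> u = 0"
proof
  assume "anc f u 0"
  then show "u = 0" by (rule anc_closed) auto
qed simp

lemma anc_mem: "anc f u v \<Longrightarrow> v \<in> insert 0 V \<Longrightarrow> u \<in> insert 0 V"
  by (erule anc_closed[where P = "\<lambda>w. w \<in> insert 0 V"]) (assumption, rule forest_closed)

lemma anc_in: "anc f u v \<Longrightarrow> v \<in> insert 0 V \<Longrightarrow> u \<noteq> 0 \<Longrightarrow> u \<in> V"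
  using anc_mem by blast

lemma forest_rank:
  obtains r :: "nat \<Rightarrow> nat" where "\<And>v. v \<in> V \<Longrightarrow> r (f v) < r v"
    "\<And>u v. anc f u v \<Longrightarrow> v \<in> insert 0 V \<Longrightarrow> u \<noteq> v \<Longrightarrow> r u < r v"
proof -
  obtain r :: "nat \<Rightarrow> nat" where r: "\<And>v. v \<in> V \<Longrightarrow> r (f v) < r v"
    using forest unfolding forest_def by blast
  have *: "u = v \<or> r u < r v" if "anc f u v" "v \<in> insert 0 V" for u v
  proof -
    have "u \<in> insert 0 V \<and> (u = v \<or> r u < r v)"
      using that(1)
    proof (rule anc_closed)
      fix w assume w: "w \<in> insert 0 V \<and> (w = v \<or> r w < r v)"
      show "f w \<in> insert 0 V \<and> (f w = v \<or> r (f w) < r v)"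
      proof (cases "w = 0")
        case True
        then have "f w = w" using forest_f0 by simp
        then show ?thesis using w by (simp only:)
      next
        case False
        then have "w \<in> V" using w by simp
        then have "f w \<in> insert 0 V" "r (f w) < r w" using forest_closed[of w] r[of w] by simp_all
        moreover have "r w \<le> r v" using conjunct2[OF w] by (elim disjE) simp_all
        ultimately show ?thesis by simp
      qed
    qed (use that in simp)
    then show ?thesis by blast
  qed
  show ?thesis
  proof (rule that[of r])
    show "r (f v) < r v" if "v \<in> V" for v using r that .
    show "r u < r v" if "anc f u v" "v \<in> insert 0 V" "u \<noteq> v" for u v using *[OF that(1,2)] that(3) by simp
  qed
qed

lemma anc_antisym:
  assumes "anc f u v" "anc f v u" "v \<in> insert 0 V"
  shows "u = v"
proof (rule forest_rank)
  fix r :: "nat \<Rightarrow> nat"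
  assume r: "\<And>u v. anc f u v \<Longrightarrow> v \<in> insert 0 V \<Longrightarrow> u \<noteq> v \<Longrightarrow> r u < r v"
  show ?thesis
    using r[OF assms(1,3)] r[OF assms(2) anc_mem[OF assms(1,3)]] by (cases "u = v") auto
qed

lemma parent_neq: "v \<in> V \<Longrightarrow> f v \<noteq> v"
proof (rule forest_rank)
  fix r :: "nat \<Rightarrow> nat"
  assume v: "v \<in> V" and r: "\<And>v. v \<in> V \<Longrightarrow> r (f v) < r v"
  show "f v \<noteq> v" using r[OF v] by auto
qed

lemma not_anc_parent: "v \<in> V \<Longrightarrow> \<not> anc f v (f v)"
proof
  assume v: "v \<in> V" "anc f v (f v)"
  have "anc f (f v) v" by (subst anc_step) simp
  then show False using anc_antisym[OF v(2)] forest_closed[of v] parent_neq[of v] v(1) by auto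
qed

lemma anc_zero: "v \<in> insert 0 V \<Longrightarrow> anc f 0 v"
proof (rule forest_rank)
  fix r :: "nat \<Rightarrow> nat" assume r: "\<And>v. v \<in> V \<Longrightarrow> r (f v) < r v"
  assume "v \<in> insert 0 V"
  then show "anc f 0 v"
  proof (induction "r v" arbitrary: v rule: less_induct)
    case less
    show ?case
    proof (cases "v = 0")
      case False
      then have "anc f 0 (f v)" using less r[of v] forest_closed[of v] by auto
      then show ?thesis by (subst anc_step) simp
    qed simp
  qed
qed

text \<open>Ranks drop strictly until 0 is reached. This bounds the length of a walk by the number
  of vertices, and with it the clock.\<close>

lemma forest_path_inj:
  assumes "x \<in> insert 0 V" "\<And>j. j < K \<Longrightarrow> (f ^^ j) x \<noteq> 0"
  shows "inj_on (\<lambda>j. (f ^^ j) x) {..<K}"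
proof (rule forest_rank)
  fix r :: "nat \<Rightarrow> nat" assume r: "\<And>v. v \<in> V \<Longrightarrow> r (f v) < r v"
  have mem: "(f ^^ j) x \<in> insert 0 V" for j
    by (induction j) (use assms(1) forest_closed in auto)
  have dec: "r ((f ^^ (i + Suc d)) x) < r ((f ^^ i) x)" if "i + Suc d \<le> K" for i d
    using that
  proof (induction d)
    case 0
    then show ?case using r[of "(f ^^ i) x"] mem[of i] assms(2)[of i] by auto
  next
    case (Suc d)
    then show ?case using r[of "(f ^^ (i + Suc d)) x"] mem[of "i + Suc d"] assms(2)[of "i + Suc d"]
      by auto
  qed
  have ne: "(f ^^ i) x \<noteq> (f ^^ j) x" if "i < j" "j < K" for i j
    using dec[of i "j - Suc i"] that by auto
  show ?thesis
    unfolding inj_on_def by (metis ne lessThan_iff linorder_neqE_nat)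
qed

end

text \<open>The vertex \<open>a\<close> is what an update leaves behind: each cross edge has an end
  on the root path of \<open>a\<close>. For \<open>a = 0\<close> the exception is void, as 0 is the
  only ancestor of 0 and lies outside \<open>V\<close>, and \<open>f\<close> is a DFS
  forest.\<close>

definition almost_dfs :: "nat set \<Rightarrow> (nat \<Rightarrow> nat \<Rightarrow> bool) \<Rightarrow> (nat \<Rightarrow> nat) \<Rightarrow> nat \<Rightarrow> bool" where
  "almost_dfs V E f a \<longleftrightarrow> forest V f \<and> a \<in> insert 0 V \<and> (\<forall>u v. E u v \<longrightarrow> E v u) \<and>
     (\<forall>v\<in>V. f v \<noteq> 0 \<longrightarrow> E v (f v)) \<and>
     (\<forall>u\<in>V. \<forall>v\<in>V. E u v \<longrightarrow> anc f u v \<or> anc f v u \<or> anc f u a \<or> anc f v a)"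

definition sub :: "nat set \<Rightarrow> (nat \<Rightarrow> nat) \<Rightarrow> nat \<Rightarrow> nat set" where
  "sub V f v = {x \<in> V. anc f v x}"

lemma finite_sub: "forest V f \<Longrightarrow> finite (sub V f v)"
  unfolding forest_def sub_def by simp

text \<open>The time of the visit of a vertex is \<open>st\<close>, with 0 for unvisited vertices, and
  \<open>sp\<close> is the parent in the new tree.\<close>

definition partial_dfs ::
  "nat set \<Rightarrow> (nat \<Rightarrow> nat \<Rightarrow> bool) \<Rightarrow> (nat \<Rightarrow> nat) \<Rightarrow> (nat \<Rightarrow> nat) \<Rightarrow> (nat \<Rightarrow> nat) \<Rightarrow> nat \<Rightarrow> bool"
where
  "partial_dfs V E f st sp c \<longleftrightarrow>
     st 0 = 1 \<and> sp 0 = 0 \<and>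
     (\<forall>v\<in>V. st v \<noteq> 0 \<longrightarrow> st (f v) \<noteq> 0) \<and>
     (\<forall>v\<in>V. st v \<noteq> 0 \<longrightarrow> sp v \<in> insert 0 V \<and> st (sp v) \<noteq> 0 \<and> st (sp v) < st v \<and>
        (sp v \<noteq> 0 \<longrightarrow> E v (sp v))) \<and>
     c = Suc (card {v \<in> V. st v \<noteq> 0}) \<and> (\<forall>v\<in>V. st v \<le> c) \<and>
     (\<forall>u\<in>V. \<forall>v\<in>V. st u \<noteq> 0 \<longrightarrow> st v \<noteq> 0 \<longrightarrow> E u v \<longrightarrow> anc sp u v \<or> anc sp v u) \<and>
     (\<forall>z\<in>V. st z = 0 \<longrightarrow> st (f z) \<noteq> 0 \<longrightarrow>
        (\<exists>t \<in> insert 0 V. st t \<noteq> 0 \<and> (\<forall>x \<in> sub V f z. \<forall>w\<in>V. st w \<noteq> 0 \<longrightarrow> E x w \<longrightarrow> anc sp w t)))"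

lemma partial_dfsD:
  assumes "partial_dfs V E f st sp c"
  shows "st 0 = 1" "sp 0 = 0"
    "\<forall>v\<in>V. st v \<noteq> 0 \<longrightarrow> st (f v) \<noteq> 0"
    "\<forall>v\<in>V. st v \<noteq> 0 \<longrightarrow> sp v \<in> insert 0 V \<and> st (sp v) \<noteq> 0 \<and> st (sp v) < st v \<and>
        (sp v \<noteq> 0 \<longrightarrow> E v (sp v))"
    "c = Suc (card {v \<in> V. st v \<noteq> 0})" "\<forall>v\<in>V. st v \<le> c"
    "\<forall>u\<in>V. \<forall>v\<in>V. st u \<noteq> 0 \<longrightarrow> st v \<noteq> 0 \<longrightarrow> E u v \<longrightarrow> anc sp u v \<or> anc sp v u"
    "\<forall>z\<in>V. st z = 0 \<longrightarrow> st (f z) \<noteq> 0 \<longrightarrow>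
        (\<exists>t \<in> insert 0 V. st t \<noteq> 0 \<and> (\<forall>x \<in> sub V f z. \<forall>w\<in>V. st w \<noteq> 0 \<longrightarrow> E x w \<longrightarrow> anc sp w t))"
  using assms unfolding partial_dfs_def by - (elim conjE, assumption)+

text \<open>The old path is turned upside down: \<open>x\<close> becomes a child of
  \<open>s\<close>, and each old parent becomes a child of its old child, so that the upper end of
  the old path is the deepest vertex of the new one.\<close>

definition walked ::
  "(nat \<Rightarrow> nat) \<Rightarrow> nat \<Rightarrow> nat \<Rightarrow> nat \<Rightarrow> (nat \<Rightarrow> nat) \<Rightarrow> (nat \<Rightarrow> nat) \<Rightarrow> nat \<Rightarrow> (nat \<Rightarrow> nat) \<Rightarrow> (nat \<Rightarrow> nat) \<Rightarrow> bool"
where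
  "walked f s x k st sp c st' sp' \<longleftrightarrow>
     (\<forall>j<k. st' ((f ^^ j) x) = c + Suc j \<and>
        sp' ((f ^^ j) x) = (case j of 0 \<Rightarrow> s | Suc i \<Rightarrow> (f ^^ i) x)) \<and>
     (\<forall>v. v \<notin> (\<lambda>j. (f ^^ j) x) ` {..<k} \<longrightarrow> st' v = st v \<and> sp' v = sp v)"

lemma partial_dfs_init:
  assumes "forest V f" "st 0 = 1" "sp 0 = 0" "\<forall>v\<in>V. st v = 0"
  shows "partial_dfs V E f st sp 1"
proof -
  have "{v \<in> V. 0 < st v} = {}" using assms(4) by fastforce
  then have "card {v \<in> V. 0 < st v} = 0" by (metis card.empty)
  moreover have "\<exists>t\<in>insert 0 V. st t \<noteq> 0" using assms(2) by auto
  ultimately show ?thesis unfolding partial_dfs_def using assms by auto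
qed

section \<open>Extending a partial DFS tree by one walk\<close>

context
  fixes V E f a st sp c s x m st' sp' z
  assumes pre: "almost_dfs V E f a"
    and part: "partial_dfs V E f st sp c"
    and x: "x \<in> V" and z: "z = (f ^^ m) x" "st z = 0" "st (f z) \<noteq> 0"
    and s: "s \<in> insert 0 V" "st s \<noteq> 0" "s \<noteq> 0 \<longrightarrow> E x s"
    and best: "\<forall>y \<in> sub V f z. \<forall>w\<in>V. st w \<noteq> 0 \<longrightarrow> E y w \<longrightarrow> st w \<le> st s"
    and wal: "walked f s x (Suc m) st sp c st' sp'"
begin

text \<open>All visited neighbours of the remaining tree are ancestors of one vertex
  \<open>t\<close>, and \<open>s\<close> is the latest of them. Since times increase down the new
  tree, the others are ancestors of \<open>s\<close>, and hanging the reversed path below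
  \<open>s\<close> creates no cross edge. The assumption \<open>ac\<close> separates the very first
  walk, which starts in \<open>a\<close>, from the later ones, for which \<open>a\<close> has been
  visited.\<close>

lemma partial_dfs_walk:
  assumes ac: "st a \<noteq> 0 \<or> (x = a \<and> (\<forall>v\<in>V. st v = 0))"
  shows "partial_dfs V E f st' sp' (c + Suc m)"
    and "\<forall>v. st v \<noteq> 0 \<longrightarrow> st' v = st v"
    and "\<forall>v. st v = 0 \<longrightarrow> st' v = 0 \<or> c < st' v"
    and "st' z \<noteq> 0"
    and "\<forall>v. anc f v x \<longrightarrow> st' v \<noteq> 0"
proof -
  have F: "forest V f" and sym: "\<And>u v. E u v \<Longrightarrow> E v u" using pre unfolding almost_dfs_def by auto
  note anc0 = anc_0[OF F] and ancmem = anc_mem[OF F] and fclosed = forest_closed[OF F]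
    and f0 = forest_f0[OF F] and fpos = forest_pos[OF F] and finV = F[unfolded forest_def, THEN conjunct1]
  note PD = partial_dfsD[OF part]
  note st0 = PD(1) and sp0 = PD(2) and up = PD(3)[rule_format] and spv = PD(4)[rule_format]
    and c = PD(5) and le = PD(6)[rule_format] and comp = PD(7)[rule_format]
    and top = PD(8)[THEN bspec, THEN mp, THEN mp]
  \<comment> \<open>Old vertices keep their parents and \<open>D\<close> is closed under
    \<open>sp\<close>, so \<open>anc_cong\<close> carries the old ancestor relation over to
    \<open>sp'\<close>.\<close>
  define D where "D = {v \<in> insert 0 V. st v \<noteq> 0}"
  define p where "p j = (f ^^ j) x" for j
  have upanc: "st u \<noteq> 0" if "anc f u v" "v \<in> insert 0 V" "st v \<noteq> 0" for u v
  proof -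
    have "u \<in> insert 0 V \<and> st u \<noteq> 0"
      using that(1)
    proof (rule anc_closed)
      fix w assume w: "w \<in> insert 0 V \<and> st w \<noteq> 0"
      show "f w \<in> insert 0 V \<and> st (f w) \<noteq> 0"
        by (cases "w = 0") (use w fclosed[of w] up[of w] in \<open>auto simp: f0\<close>)
    qed (use that in simp)
    then show ?thesis by simp
  qed
  have pmem: "p j \<in> insert 0 V" for j unfolding p_def by (rule ancmem[of _ x]) (use x in auto)
  have panc: "anc f (p j) (p i)" if "i \<le> j" for i j
    unfolding p_def by (metis anc_funpow comp_apply funpow_add le_add_diff_inverse2 that)
  have pz: "p m = z" using z p_def by simp
  have punv: "st (p j) = 0" if "j \<le> m" for j
    using upanc[OF panc[OF that]] pmem[of j] z pz by auto
  have pV: "p j \<in> V" if "j \<le> m" for j using punv[OF that] st0 pmem[of j] by auto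
  have zV: "z \<in> V" using pV pz by auto
  have inj: "inj_on p {..<Suc m}"
    unfolding p_def
  proof (rule forest_path_inj[OF F])
    fix j assume "j < Suc m" then show "(f ^^ j) x \<noteq> 0" using pV[of j] fpos p_def by auto
  qed (use x in auto)
  define P where "P = p ` {..<Suc m}"
  have Pmem: "v \<in> P \<longleftrightarrow> (\<exists>j\<le>m. v = p j)" for v unfolding P_def by (auto simp: less_Suc_eq_le)
  have new: "st' (p j) = c + Suc j" "sp' (p j) = (case j of 0 \<Rightarrow> s | Suc i \<Rightarrow> p i)" if "j \<le> m" for j
    using wal that unfolding walked_def p_def by (auto simp: less_Suc_eq_le)
  have old: "st' v = st v" "sp' v = sp v" if "v \<notin> P" for v
    using wal that unfolding walked_def P_def p_def by auto
  have DP: "v \<notin> P" if "v \<in> D" for v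
  proof
    assume "v \<in> P"
    then obtain j where "j \<le> m" "v = p j" using Pmem by blast
    then show False using that punv[of j] unfolding D_def by simp
  qed
  have oldst: "st' v = st v" if "st v \<noteq> 0" for v
    using that old(1)[of v] punv Pmem[of v] by metis
  have Dsp: "sp w \<in> D" if "w \<in> D" for w
    using that spv[of w] unfolding D_def by (cases "w = 0") (auto simp: sp0 st0)
  have ancD: "anc sp' u v" if "anc sp u v" "v \<in> D" for u v
    using that by (rule anc_cong[where D = D]) (use Dsp old(2) DP in auto)
  have ancst: "u \<in> D \<and> (u = v \<or> st u < st v)" if "anc sp u v" "v \<in> D" for u v
    using that(1)
  proof (rule anc_closed)
    fix w assume w: "w \<in> D \<and> (w = v \<or> st w < st v)"
    show "sp w \<in> D \<and> (sp w = v \<or> st (sp w) < st v)"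
    proof (cases "w = 0")
      case True then show ?thesis using w by (simp add: sp0)
    next
      case False
      then show ?thesis using w Dsp[of w] spv[of w] unfolding D_def by auto
    qed
  qed (use that in simp)
  have sD: "s \<in> D" using s unfolding D_def by auto
  have ancps: "anc sp' s (p j)" if "j \<le> m" for j
    using that
  proof (induction j)
    case 0 then show ?case by (subst anc_step) (simp add: new)
  next
    case (Suc j) then show ?case by (subst anc_step) (simp add: new)
  qed
  have ancpp: "anc sp' (p i) (p j)" if "i \<le> j" "j \<le> m" for i j
    using that
  proof (induction j)
    case (Suc j)
    show ?case
    proof (cases "i = Suc j")
      case False
      then have "anc sp' (p i) (p j)" using Suc by auto
      then show ?thesis using Suc.prems by (subst anc_step) (simp add: new)
    qed simp
  qed simp
  have subz: "p j \<in> sub V f z" if "j \<le> m" for j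
    using panc[OF that] pV[OF that] unfolding sub_def pz by simp
  have D0: "0 \<in> D" unfolding D_def using st0 by simp
  have ancbest: "anc sp w s" if "y \<in> sub V f z" "w \<in> V" "st w \<noteq> 0" "E y w" for y w
  proof -
    obtain t where t: "t \<in> insert 0 V" "st t \<noteq> 0"
      "\<forall>x \<in> sub V f z. \<forall>w\<in>V. st w \<noteq> 0 \<longrightarrow> E x w \<longrightarrow> anc sp w t"
      using top[OF zV z(2,3)] by blast
    have tD: "t \<in> D" using t unfolding D_def by auto
    have wt: "anc sp w t" using t that by blast
    have wle: "st w \<le> st s" using best that by blast
    have st0w: "anc sp 0 v \<and> (v \<noteq> 0 \<longrightarrow> st 0 < st v)" if "v \<in> D" for v
      using that
    proof (induction "st v" arbitrary: v rule: less_induct)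
      case less
      show ?case
      proof (cases "v = 0")
        case False
        then have "sp v \<in> D" "st (sp v) < st v" using Dsp[OF less.prems] less.prems spv[of v]
          unfolding D_def by auto
        then have "anc sp 0 (sp v)" "sp v \<noteq> 0 \<longrightarrow> st 0 < st (sp v)" using less by auto
        then show ?thesis using \<open>st (sp v) < st v\<close> by (subst anc_step) (cases "sp v = 0"; auto)
      qed simp
    qed
    show ?thesis
    proof (cases "s = 0")
      \<comment> \<open>Every visited vertex of \<open>V\<close> is later than the dummy. So
        \<open>s = 0\<close> means that the remaining tree has no visited neighbour.\<close>
      case True
      have "w \<in> D" using that unfolding D_def by auto
      then have "st 0 < st w" using st0w[of w] fpos[OF that(2)] by auto
      then show ?thesis using wle True by simp
    next
      case False
      then have "anc sp s t" using t(3) s x subz[of 0] p_def by auto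
      \<comment> \<open>Both are ancestors of \<open>t\<close>, hence comparable; the order of their
        times decides the direction.\<close>
      then have "anc sp s w \<or> anc sp w s" using wt anc_comparable by blast
      then show ?thesis using ancst[of s w] that wle unfolding D_def by auto
    qed
  qed
  have ancnew: "anc sp' w (p j)" if "y \<in> sub V f z" "w \<in> V" "st w \<noteq> 0" "E y w" "j \<le> m" for y w j
    using anc_trans[OF ancD[OF ancbest[OF that(1-4)] sD] ancps[OF that(5)]] .
  have unv: "st y = 0" if "y \<in> sub V f u" "st u = 0" for y u
    using that upanc[of u y] unfolding sub_def by auto
  show "\<forall>v. st v \<noteq> 0 \<longrightarrow> st' v = st v" using oldst by blast
  show "\<forall>v. st v = 0 \<longrightarrow> st' v = 0 \<or> c < st' v"
    using old(1) new(1) Pmem by (metis add_Suc_right le_imp_less_Suc le_add1)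
  show "st' z \<noteq> 0" using new(1)[of m] pz by simp
  show "\<forall>v. anc f v x \<longrightarrow> st' v \<noteq> 0"
  proof (intro allI impI)
    fix v assume "anc f v x"
    then obtain j where j: "v = p j" unfolding anc_def p_def by blast
    show "st' v \<noteq> 0"
    proof (cases "j \<le> m")
      case True then show ?thesis using new j by simp
    next
      case False
      have "f z = p (Suc m)" using pz unfolding p_def by auto
      then have "anc f v (f z)" using j panc[of "Suc m" j] False by simp
      moreover have "f z \<in> insert 0 V" using zV fclosed by blast
      ultimately have "st v \<noteq> 0" using upanc z(3) by blast
      then show ?thesis using oldst by simp
    qed
  qed
  show "partial_dfs V E f st' sp' (c + Suc m)"
    unfolding partial_dfs_def
  proof (intro conjI ballI impI)
    show "st' 0 = 1" using oldst st0 by simp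
    show "sp' 0 = 0" using old(2) DP[OF D0] sp0 by simp
  next
    fix v assume v: "v \<in> V" "st' v \<noteq> 0"
    show "st' (f v) \<noteq> 0"
    proof (cases "v \<in> P")
      case True
      then obtain j where j: "j \<le> m" "v = p j" using Pmem by blast
      have fv: "f v = p (Suc j)" using j unfolding p_def by simp
      show ?thesis
      proof (cases "j = m")
        case True then show ?thesis using fv pz j z(3) oldst by auto
      next
        case False then show ?thesis using fv j new(1)[of "Suc j"] by simp
      qed
    next
      case False
      then show ?thesis using v up old(1) oldst by metis
    qed
  next
    fix v assume v: "v \<in> V" "st' v \<noteq> 0"
    have "sp' v \<in> insert 0 V \<and> st' (sp' v) \<noteq> 0 \<and> st' (sp' v) < st' v \<and> (sp' v \<noteq> 0 \<longrightarrow> E v (sp' v))"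
    proof (cases "v \<in> P")
      case True
      then obtain j where j: "j \<le> m" "v = p j" using Pmem by blast
      show ?thesis
      proof (cases j)
        case 0
        have "st s \<le> c" using s(1) le st0 c by (cases "s = 0") auto
        then show ?thesis using j 0 s oldst[of s] new[of 0] p_def by auto
      next
        case (Suc i)
        have "E (p (Suc i)) (p i)"
        proof -
          have "f (p i) = p (Suc i)" unfolding p_def by simp
          moreover have "p (Suc i) \<noteq> 0" using pV[of "Suc i"] j Suc fpos by auto
          ultimately have "E (p i) (p (Suc i))"
            using pre pV[of i] j Suc unfolding almost_dfs_def by (metis Suc_leD)
          then show ?thesis by (rule sym)
        qed
        then show ?thesis using j Suc new[of "Suc i"] new[of i] pV[of i] by auto
      qed
    next
      case False
      then show ?thesis using v spv[of v] old[of v] oldst[of "sp v"] by auto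
    qed
    then show "sp' v \<in> insert 0 V" "st' (sp' v) \<noteq> 0" "st' (sp' v) < st' v" "sp' v \<noteq> 0 \<Longrightarrow> E v (sp' v)"
      by blast+
  next
    have "{v \<in> V. st' v \<noteq> 0} = {v \<in> V. st v \<noteq> 0} \<union> P"
      using old(1) oldst new(1) pV Pmem by auto
    moreover have "{v \<in> V. st v \<noteq> 0} \<inter> P = {}" using punv Pmem by auto
    moreover have "card P = Suc m" unfolding P_def using card_image[OF inj] by simp
    moreover have "finite P" unfolding P_def by simp
    ultimately have "card {v \<in> V. st' v \<noteq> 0} = card {v \<in> V. st v \<noteq> 0} + Suc m"
      using finV by (simp add: card_Un_disjoint)
    then show "c + Suc m = Suc (card {v \<in> V. st' v \<noteq> 0})" using c by simp
  next
    fix v assume v: "v \<in> V"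
    show "st' v \<le> c + Suc m"
    proof (cases "v \<in> P")
      case True
      then show ?thesis using Pmem new(1) by auto
    next
      case False then show ?thesis using old(1) le[OF v] by simp
    qed
  next
    have *: "anc sp' u v" if "u \<in> V" "v \<in> P" "st u \<noteq> 0" "E v u" for u v
      using that ancnew[of v u] subz Pmem by auto
    fix u v assume uv: "u \<in> V" "v \<in> V" "st' u \<noteq> 0" "st' v \<noteq> 0" "E u v"
    show "anc sp' u v \<or> anc sp' v u"
    proof (cases "u \<in> P"; cases "v \<in> P")
      assume "u \<in> P" "v \<in> P"
      then obtain i j where "u = p i" "v = p j" "i \<le> m" "j \<le> m" using Pmem by auto
      then show ?thesis using ancpp by (metis nle_le)
    next
      assume "u \<in> P" "v \<notin> P"
      then show ?thesis using *[of v u] uv old(1) by auto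
    next
      assume "u \<notin> P" "v \<in> P"
      then show ?thesis using *[of u v] uv old(1) sym by auto
    next
      assume "u \<notin> P" "v \<notin> P"
      then have "u \<in> D" "v \<in> D" "anc sp u v \<or> anc sp v u"
        using comp[of u v] uv old(1) unfolding D_def by auto
      then show ?thesis using ancD by blast
    qed
  next
    fix y assume y: "y \<in> V" "st' y = 0" "st' (f y) \<noteq> 0"
    have sty: "st y = 0" using y oldst by metis
    have tz: "z \<in> insert 0 V" "st' z \<noteq> 0" using zV new(1)[of m] pz by auto
    show "\<exists>t\<in>insert 0 V. st' t \<noteq> 0 \<and> (\<forall>x\<in>sub V f y. \<forall>w\<in>V. st' w \<noteq> 0 \<longrightarrow> E x w \<longrightarrow> anc sp' w t)"
    \<comment> \<open>There are two kinds of remaining trees. One that has just been split off by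
      the walk lies below \<open>z\<close> in the old forest, and all its visited neighbours are
      ancestors of \<open>z\<close>, the deepest vertex of the new path. One that was there before
      keeps its old witness \<open>t\<close>.\<close>
    proof (cases "st (f y) = 0")
      case True
      then have "f y \<in> P" using y old(1) by metis
      then have "anc f z (f y)" using Pmem panc pz by auto
      then have sub: "sub V f y \<subseteq> sub V f z"
        unfolding sub_def using anc_trans[of f z y] anc_step[of f z y] by auto
      have "anc sp' w z" if "u \<in> sub V f y" "w \<in> V" "st' w \<noteq> 0" "E u w" for u w
      proof (cases "w \<in> P")
        case True then show ?thesis using Pmem ancpp pz by auto
      next
        case False then show ?thesis using ancnew[of u w m] that sub old(1) pz by auto
      qed
      then show ?thesis using tz by blast
    next
      case False
      then obtain t where t: "t \<in> insert 0 V" "st t \<noteq> 0"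
        "\<forall>x \<in> sub V f y. \<forall>w\<in>V. st w \<noteq> 0 \<longrightarrow> E x w \<longrightarrow> anc sp w t"
        using top[of y] y(1) sty by blast
      show ?thesis
      proof (cases "st a \<noteq> 0")
        case True
        \<comment> \<open>Such an edge would join two unvisited vertices. The root path of
          \<open>a\<close> is visited, so neither end lies on it, and the ends are comparable in the
          old forest. Then one of two distinct remaining trees would contain the root of the
          other.\<close>
        have noE: False if "u \<in> sub V f y" "w \<in> P" "E u w" for u w
        proof -
          obtain j where j: "j \<le> m" "w = p j" using \<open>w \<in> P\<close> Pmem by blast
          have w: "w \<in> V" "st w = 0" "anc f z w" using pV punv panc pz j by auto
          have u: "u \<in> V" "st u = 0" "anc f y u" using that unv[of u y] sty unfolding sub_def by auto
          have "a \<in> insert 0 V" using pre unfolding almost_dfs_def by blast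
          then have "\<not> anc f u a" "\<not> anc f w a" using upanc True u w by blast+
          then have "anc f u w \<or> anc f w u"
            using pre u w that(3) unfolding almost_dfs_def by blast
          then have "anc f y z \<or> anc f z y"
            using u(3) w(3) anc_trans anc_comparable by metis
          then have "y \<noteq> z \<longrightarrow> anc f y (f z) \<or> anc f z (f y)"
            using anc_step[of f y z] anc_step[of f z y] by auto
          moreover have "y \<noteq> z" using y(2) tz by auto
          ultimately show False using upanc fclosed[of z] fclosed[of y] zV y(1) z(2,3) sty
              \<open>st (f y) \<noteq> 0\<close> by blast
        qed
        have "anc sp' w t" if "u \<in> sub V f y" "w \<in> V" "st' w \<noteq> 0" "E u w" for u w
        proof -
          have "w \<notin> P" using noE that by blast
          then have "st w \<noteq> 0" using that(3) old(1)[of w] by metis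
          then have "anc sp w t" using that t by blast
          then show ?thesis using ancD[of w t] t unfolding D_def by auto
        qed
        then show ?thesis using t oldst by metis
      next
        \<comment> \<open>This is the first walk: the path is all that has been visited, and
          \<open>z\<close> is its deepest vertex.\<close>
        case False
        then have allz: "\<forall>v\<in>V. st v = 0" using ac by auto
        have "anc sp' w z" if "w \<in> V" "st' w \<noteq> 0" for w
        proof -
          have "w \<in> P" using that allz old(1)[of w] by metis
          then show ?thesis using Pmem ancpp[of _ m] pz by auto
        qed
        then show ?thesis using tz by blast
      qed
    qed
  qed
qed

end

text \<open>Visit times increase from parent to child and thus serve as the rank of the new
  forest.\<close>

lemma partial_dfs_done:
  assumes "almost_dfs V E f a" "partial_dfs V E f st sp c" "\<forall>v\<in>V. st v \<noteq> 0"
  shows "almost_dfs V E sp 0"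
proof -
  have F: "forest V f" using assms unfolding almost_dfs_def by auto
  note PD = partial_dfsD[OF assms(2)]
  have "\<forall>v\<in>V. st (sp v) < st v" "\<forall>v\<in>V. sp v \<in> insert 0 V" "sp 0 = 0"
    using PD(2,4) assms(3) by blast+
  then have "forest V sp" using F unfolding forest_def by blast
  moreover have "\<forall>v\<in>V. sp v \<noteq> 0 \<longrightarrow> E v (sp v)" using PD(4) assms(3) by blast
  moreover have "\<forall>u\<in>V. \<forall>v\<in>V. E u v \<longrightarrow> anc sp u v \<or> anc sp v u" using PD(7) assms(3) by blast
  moreover have "\<forall>u v. E u v \<longrightarrow> E v u" using assms(1) unfolding almost_dfs_def by blast
  ultimately show ?thesis unfolding almost_dfs_def by blast
qed

section \<open>Heavy paths and the halving of unvisited trees\<close>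

lemma almost_dfsD:
  assumes "almost_dfs V E f a"
  shows "forest V f" "a \<in> insert 0 V" "E u v \<Longrightarrow> E v u" "v \<in> V \<Longrightarrow> f v \<noteq> 0 \<Longrightarrow> E v (f v)"
    "u \<in> V \<Longrightarrow> v \<in> V \<Longrightarrow> E u v \<Longrightarrow> anc f u v \<or> anc f v u \<or> anc f u a \<or> anc f v a"
  using assms unfolding almost_dfs_def by blast+

text \<open>The value 0 stands for the missing child of a leaf. Iterating \<open>hv\<close> runs
  downwards: for \<open>z \<noteq> 0\<close>, \<open>anc hv z u\<close> says that \<open>z\<close>
  is on the heavy path starting at \<open>u\<close>. With \<open>hv 0 = 0\<close> the path ends in a
  fixed point, and the dummy selects no heavy child among the roots.\<close>

definition heavy :: "nat set \<Rightarrow> (nat \<Rightarrow> nat) \<Rightarrow> (nat \<Rightarrow> nat) \<Rightarrow> bool" where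
  "heavy V f hv \<longleftrightarrow> hv 0 = 0 \<and>
     (\<forall>u\<in>V. hv u \<in> insert 0 V \<and> (hv u \<noteq> 0 \<longrightarrow> f (hv u) = u)) \<and>
     (\<forall>c\<in>V. f c \<noteq> 0 \<longrightarrow> hv (f c) \<noteq> 0 \<and> card (sub V f c) \<le> card (sub V f (hv (f c))))"

context
  fixes V f hv assumes F: "forest V f" and H: "heavy V f hv"
begin

lemma heavy_0: "hv 0 = 0" using H unfolding heavy_def by blast

lemma heavy_mem: "u \<in> insert 0 V \<Longrightarrow> hv u \<in> insert 0 V"
  using H unfolding heavy_def by (metis insert_iff)

lemma heavy_parent: "u \<in> V \<Longrightarrow> hv u \<noteq> 0 \<Longrightarrow> f (hv u) = u"
  using H unfolding heavy_def by blast

lemma hp_mem: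
  assumes "anc hv z u" "u \<in> V" "z \<noteq> 0"
  shows "z \<in> V" "anc f u z"
proof -
  have "z = 0 \<or> (z \<in> V \<and> anc f u z)"
    using assms(1)
  proof (rule anc_closed)
    fix w assume w: "w = 0 \<or> (w \<in> V \<and> anc f u w)"
    show "hv w = 0 \<or> (hv w \<in> V \<and> anc f u (hv w))"
    proof (cases "w = 0 \<or> hv w = 0")
      case True then show ?thesis using heavy_0 by metis
    next
      case False
      then have "w \<in> V" "anc f u w" using w by auto
      then show ?thesis
        using heavy_parent[of w] heavy_mem[of w] False anc_step[of f u "hv w"] by auto
    qed
  qed (use assms in simp)
  then show "z \<in> V" "anc f u z" using assms by auto
qed

text \<open>Parents retrace a heavy path step by step, so it has no gaps.\<close>

lemma hp_between:
  assumes "anc hv z u" "z \<noteq> 0" "u \<in> V" "anc f u w" "anc f w z"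
  shows "anc hv z w"
proof -
  obtain k where "(hv ^^ k) u = z" using assms(1) unfolding anc_def by blast
  then show ?thesis using assms(2,5)
  proof (induction k arbitrary: z)
    case 0
    then have "w = u" using anc_antisym[OF F] assms(3,4) by (metis funpow_0 insertCI)
    then show ?case using 0 by simp
  next
    case (Suc k)
    define z1 where "z1 = (hv ^^ k) u"
    have z: "z = hv z1" using Suc.prems(1) z1_def by simp
    have z1: "z1 \<noteq> 0" using z Suc.prems(2) heavy_0 by metis
    have "z1 \<in> V" using hp_mem(1)[of z1 u] z1 assms(3) z1_def by simp
    then have fz: "f z = z1" using heavy_parent z Suc.prems(2) by blast
    have zz1: "anc hv z z1" using anc_step[of hv z z1] z by simp
    show ?case
    proof (cases "w = z")
      case False
      then have "anc f w z1" using Suc.prems(3) anc_step[of f w z] fz by simp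
      then have "anc hv z1 w" using Suc.IH[of z1] z1 z1_def by simp
      then show ?thesis using zz1 anc_trans by blast
    qed simp
  qed
qed

lemma sub_mono: "anc f u v \<Longrightarrow> sub V f v \<subseteq> sub V f u"
  unfolding sub_def using anc_trans by blast

text \<open>Consider the point where the path from \<open>z\<close> down to \<open>v\<close> leaves
  the heavy path of \<open>z\<close>. The heavy sibling there has a subtree at least as large as the
  light one and disjoint from it, and both fit below \<open>z\<close>. The induction climbs from
  \<open>v\<close> to that point; subtrees only grow on the way.\<close>

lemma light_halves:
  assumes "z \<in> V" "v \<in> V" "anc f z v" "\<not> anc hv v z"
  shows "2 * card (sub V f v) \<le> card (sub V f z)"
proof -
  obtain k where "(f ^^ k) v = z" using assms(3) unfolding anc_def by blast
  then show ?thesis using assms(2,4)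
  proof (induction k arbitrary: v)
    case 0
    then show ?case by simp
  next
    case (Suc k)
    define u where "u = f v"
    have uz: "(f ^^ k) u = z" using Suc.prems(1) by (simp add: funpow_swap1 u_def)
    then have zu: "anc f z u" unfolding anc_def by blast
    have u0: "u \<noteq> 0"
    proof
      assume "u = 0"
      then have "z = 0" using zu anc_0[OF F] by metis
      then show False using assms(1) forest_pos[OF F] by blast
    qed
    have uV: "u \<in> V" using u0 Suc.prems(2) forest_closed[OF F, of v] u_def by simp
    have uv: "anc f u v" using anc_step[of f u v] u_def by simp
    show ?case
    proof (cases "anc hv u z")
      case True
      define h where "h = hv u"
      have h: "h \<noteq> 0" "card (sub V f v) \<le> card (sub V f h)"
        using H Suc.prems(2) u0 unfolding heavy_def u_def h_def by blast+
      have hV: "h \<in> V" "f h = u" using h heavy_mem[of u] heavy_parent[of u] uV h_def by auto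
      have "v \<noteq> h"
      proof
        assume "v = h"
        then have "anc hv v z" using True anc_trans[of hv v u z] anc_step[of hv v u] h_def by simp
        then show False using Suc.prems by simp
      qed
      then have "\<not> anc f v h" "\<not> anc f h v"
        using anc_step[of f v h] anc_step[of f h v] hV u_def not_anc_parent[OF F] Suc.prems(2) hV
        by metis+
      then have disj: "sub V f v \<inter> sub V f h = {}"
        unfolding sub_def using anc_comparable[of f v _ h] by blast
      have "anc f u h" using anc_step[of f u h] hV by simp
      then have "sub V f v \<union> sub V f h \<subseteq> sub V f u" using sub_mono uv by blast
      then have "card (sub V f v) + card (sub V f h) \<le> card (sub V f u)"
        using card_mono[OF finite_sub[OF F]] card_Un_disjoint[OF finite_sub[OF F] finite_sub[OF F] disj] by metis
      moreover have "card (sub V f u) \<le> card (sub V f z)"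
        using card_mono[OF finite_sub[OF F] sub_mono[OF zu]] .
      ultimately show ?thesis using h by linarith
    next
      case False
      have "card (sub V f v) \<le> card (sub V f u)"
        using card_mono[OF finite_sub[OF F] sub_mono[OF uv]] .
      then show ?thesis using Suc.IH[OF uz uV False] by linarith
    qed
  qed
qed

end

lemma unvisited_root:
  assumes F: "forest V f" and st0: "st 0 \<noteq> 0" and v: "v \<in> V" "st v = 0"
  obtains z :: nat where "z \<in> V" "anc f z v" "st z = (0::nat)" "st (f z) \<noteq> 0"
proof -
  obtain r :: "nat \<Rightarrow> nat" where r: "\<And>v. v \<in> V \<Longrightarrow> r (f v) < r v"
    using forest_rank[OF F] by metis
  have "\<exists>z\<in>V. anc f z v \<and> st z = 0 \<and> st (f z) \<noteq> 0"
    using v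
  proof (induction "r v" arbitrary: v rule: less_induct)
    case less
    show ?case
    proof (cases "st (f v) = 0")
      case True
      then have "f v \<noteq> 0" using st0 by metis
      then have "f v \<in> V" using forest_closed[OF F, of v] less.prems by simp
      then obtain z where "z \<in> V" "anc f z (f v)" "st z = 0" "st (f z) \<noteq> 0"
        using less.hyps[of "f v"] r less.prems True by blast
      then show ?thesis using anc_step[of f z v] by blast
    next
      case False
      then show ?thesis using less.prems anc_refl by blast
    qed
  qed
  then show ?thesis using that by blast
qed

text \<open>The tree that contained \<open>v\<close> at the start of the round had a root
  \<open>z\<close>, whose heavy path is visited by now. So \<open>v\<close> is off this path and has
  at most half of the subtree of \<open>z\<close>. The exponent counts completed rounds.\<close>

lemma round_halves:
  assumes F: "forest V f" and H: "heavy V f hv" and st0: "st0 0 \<noteq> 0"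
    and bound: "\<forall>v\<in>V. st0 v = 0 \<longrightarrow> card (sub V f v) * 2 ^ k \<le> n"
    and ext: "\<forall>v. st0 v \<noteq> 0 \<longrightarrow> st v \<noteq> (0::nat)"
    and fin: "\<forall>z\<in>V. st0 z = (0::nat) \<longrightarrow> st0 (f z) \<noteq> 0 \<longrightarrow> (\<forall>u. u \<noteq> 0 \<longrightarrow> anc hv u z \<longrightarrow> st u \<noteq> 0)"
  shows "\<forall>v\<in>V. st v = 0 \<longrightarrow> card (sub V f v) * 2 ^ Suc k \<le> n"
proof (intro ballI impI)
  fix v assume v: "v \<in> V" "st v = 0"
  then have "st0 v = 0" using ext by metis
  then obtain z where z: "z \<in> V" "anc f z v" "st0 z = 0" "st0 (f z) \<noteq> 0"
    using unvisited_root[where st = st0, OF F st0 v(1)] by blast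
  have "v \<noteq> 0" using v forest_pos[OF F] by blast
  then have "\<not> anc hv v z" using fin z v(2) by metis
  then have "2 * card (sub V f v) \<le> card (sub V f z)" using light_halves[OF F H z(1) v(1) z(2)] by blast
  then have "2 * card (sub V f v) * 2 ^ k \<le> card (sub V f z) * 2 ^ k" by (rule mult_right_mono) simp
  also have "\<dots> \<le> n" using bound z by blast
  finally show "card (sub V f v) * 2 ^ Suc k \<le> n" by (simp add: mult_ac)
qed

text \<open>What one pass records: for each vertex the neighbour visited last, and the descendant
  adjacent to it whose branch leaves its heavy path at the lowest point.\<close>

definition known ::
  "nat set \<Rightarrow> (nat \<Rightarrow> nat \<Rightarrow> bool) \<Rightarrow> (nat \<Rightarrow> nat) \<Rightarrow> (nat \<Rightarrow> nat) \<Rightarrow> (nat \<Rightarrow> nat) \<Rightarrow> (nat \<Rightarrow> nat) \<Rightarrow> (nat \<Rightarrow> nat) \<Rightarrow> bool"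
where
  "known V E f hv st b e \<longleftrightarrow>
     (\<forall>v\<in>V. b v \<in> insert 0 V \<and> st (b v) \<noteq> 0 \<and> (b v \<noteq> 0 \<longrightarrow> E v (b v)) \<and>
        (\<forall>w\<in>V. st w \<noteq> 0 \<longrightarrow> E v w \<longrightarrow> st w \<le> st (b v))) \<and>
     (\<forall>u\<in>V. e u \<in> V \<and> anc f u (e u) \<and> (e u \<noteq> u \<longrightarrow> E u (e u)) \<and>
        (\<forall>z x. z \<noteq> 0 \<longrightarrow> anc hv z u \<longrightarrow> x \<in> V \<longrightarrow> E u x \<longrightarrow> anc f z x \<longrightarrow> anc f z (e u)))"

text \<open>The neutral values before any edge is read: the dummy is the earliest visited vertex,
  and \<open>e v = v\<close> stands for the absence of a recorded descendant.\<close>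

lemma known_init:
  assumes "st 0 \<noteq> 0" "\<forall>v\<in>V. b v = 0" "\<forall>v\<in>V. e v = v"
  shows "known V (\<lambda>_ _. False) f hv st b e"
  unfolding known_def using assms by auto

text \<open>The vertex \<open>z\<close> is the first on the heavy path of \<open>u\<close> whose
  subtree misses \<open>e u\<close>, or 0 if there is none. The subtrees along the path are nested,
  so a neighbour \<open>v\<close> in the subtree of \<open>z\<close> can replace \<open>e u\<close>
  in every role, and any other \<open>v\<close> reaches no subtree that \<open>e u\<close> does not.
  Only one direction is added; an undirected edge takes two steps.\<close>

lemma known_step:
  assumes F: "forest V f" and H: "heavy V f hv" and K: "known V E f hv st b e"
    and u: "u \<in> V" and v: "v \<in> V"
    and z: "anc hv z u" "z = 0 \<or> \<not> anc f z (e u)"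
      "\<forall>y. anc hv y u \<longrightarrow> anc f y (e u) \<or> anc hv y z"
    and b': "b' = (if st (b u) < st v then b(u := v) else b)"
    and e': "e' = (if z \<noteq> 0 \<and> anc f z v then e(u := v) else e)"
    and E': "E' = (\<lambda>x y. E x y \<or> (x = u \<and> y = v))"
  shows "known V E' f hv st b' e'"
proof -
  note K1 = K[unfolded known_def, THEN conjunct1, THEN bspec]
    and K2 = K[unfolded known_def, THEN conjunct2, THEN bspec]
  have B: "b' w \<in> insert 0 V \<and> st (b' w) \<noteq> 0 \<and> (b' w \<noteq> 0 \<longrightarrow> E' w (b' w)) \<and>
        (\<forall>x\<in>V. st x \<noteq> 0 \<longrightarrow> E' w x \<longrightarrow> st x \<le> st (b' w))" if w: "w \<in> V" for w
  proof (cases "w = u \<and> st (b u) < st v")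
    case True
    have "st x \<le> st v" if "x \<in> V" "st x \<noteq> 0" "E' u x" for x
    proof (cases "x = v")
      case False
      then have "st x \<le> st (b u)" using K1[OF u] that E' by blast
      then show ?thesis using True by simp
    qed simp
    then show ?thesis using True b' v E' by simp
  next
    case False
    then have bw: "b' w = b w" using b' by simp
    have "st x \<le> st (b w)" if "x \<in> V" "st x \<noteq> 0" "E' w x" for x
    proof (cases "w = u \<and> x = v")
      case True then show ?thesis using False by simp
    next
      case False
      then show ?thesis using K1[OF w] that E' by blast
    qed
    then show ?thesis using K1[OF w] bw E' by simp
  qed
  have Ee: "e' w \<in> V \<and> anc f w (e' w) \<and> (e' w \<noteq> w \<longrightarrow> E' w (e' w)) \<and>
        (\<forall>y x. y \<noteq> 0 \<longrightarrow> anc hv y w \<longrightarrow> x \<in> V \<longrightarrow> E' w x \<longrightarrow> anc f y x \<longrightarrow> anc f y (e' w))"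
    if w: "w \<in> V" for w
  proof (cases "w = u")
    case False
    then have "e' w = e w" using e' by simp
    then show ?thesis using K2[OF w] False E' by simp
  next
    case True
    note old = K2[OF u]
    show ?thesis
    proof (cases "z \<noteq> 0 \<and> anc f z v")
      case new: True
      have zV: "z \<in> V" "anc f u z" using hp_mem[OF F H z(1) u] new by blast+
      have "anc f y v" if y: "y \<noteq> 0" "anc hv y u" "x \<in> V" "E' u x" "anc f y x" for x y
      proof (cases "anc hv z y")
        case True
        then have "anc f y z" using hp_mem(2)[OF F H True] hp_mem(1)[OF F H y(2) u y(1)] new by blast
        then show ?thesis using new anc_trans by blast
      next
        case False
        then have yz: "anc hv y z" using anc_comparable[OF y(2) z(1)] by blast
        show ?thesis
        proof (cases "x = v")
          case True then show ?thesis using y by simp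
        next
          case False
          then have "E u x" using y E' by blast
          then have "anc f y (e u)" using old y by blast
          moreover have "anc f z y" using hp_mem(2)[OF F H yz zV(1) y(1)] .
          ultimately have "anc f z (e u)" using anc_trans by blast
          then show ?thesis using z(2) new by blast
        qed
      qed
      then show ?thesis using True new e' v E' zV anc_trans[of f u z v] by simp
    next
      case same: False
      have "anc f y (e u)" if y: "y \<noteq> 0" "anc hv y u" "x \<in> V" "E' u x" "anc f y x" for x y
      proof (cases "E u x")
        case True then show ?thesis using old y by blast
      next
        case False
        then have xv: "x = v" using y E' by blast
        show ?thesis
        proof (rule ccontr)
          assume "\<not> anc f y (e u)"
          then have yz: "anc hv y z" using z(3) y(2) by blast
          have z0: "z \<noteq> 0"
          proof
            assume "z = 0"
            then have "anc hv y 0" using yz by simp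
            then have "y = 0" by (rule anc_closed) (simp_all add: heavy_0[OF F H])
            then show False using y(1) by simp
          qed
          have "z \<in> V" using hp_mem(1)[OF F H z(1) u z0] .
          then have "anc f z y" using hp_mem(2)[OF F H yz _ y(1)] by blast
          then have "anc f z v" using y(5) xv anc_trans by blast
          then show False using same z0 by blast
        qed
      qed
      then show ?thesis using True same e' old E' by auto
    qed
  qed
  show ?thesis unfolding known_def using B Ee by blast
qed

lemma visited_anc:
  fixes st :: "nat \<Rightarrow> nat"
  assumes F: "forest V f" and up: "\<forall>v\<in>V. st v \<noteq> 0 \<longrightarrow> st (f v) \<noteq> 0" and s0: "st 0 \<noteq> 0"
    and uv: "anc f u v" "v \<in> insert 0 V" "st v \<noteq> 0"
  shows "st u \<noteq> 0"
proof -
  have "u \<in> insert 0 V \<and> st u \<noteq> 0"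
    using uv(1)
  proof (rule anc_closed)
    fix x assume x: "x \<in> insert 0 V \<and> st x \<noteq> 0"
    show "f x \<in> insert 0 V \<and> st (f x) \<noteq> 0"
    proof (cases "x = 0")
      case True then show ?thesis using s0 forest_f0[OF F] by simp
    next
      case False
      then show ?thesis using x up forest_closed[OF F, of x] by blast
    qed
  qed (use uv in simp)
  then show ?thesis by simp
qed

text \<open>Visited sets are closed under parents. Hence a neighbour of \<open>y\<close> that is visited after
  the pass is an ancestor of \<open>z\<close> and lies on the heavy path from \<open>z0\<close> to \<open>z\<close>.\<close>

lemma known_covers:
  assumes pre: "almost_dfs V E f a" and H: "heavy V f hv" and K: "known V E f hv st0 b e"
    and up0: "\<forall>v\<in>V. st0 v \<noteq> 0 \<longrightarrow> st0 (f v) \<noteq> 0" and s00: "st0 0 \<noteq> 0" and a: "st0 a \<noteq> 0"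
    and up: "\<forall>v\<in>V. st v \<noteq> 0 \<longrightarrow> st (f v) \<noteq> 0" and s0: "st 0 \<noteq> 0"
    and ext: "\<forall>v. st0 v \<noteq> 0 \<longrightarrow> st v = st0 v"
    and z0: "z0 \<in> V" "st0 (f z0) \<noteq> (0::nat)" and z: "anc hv z z0" "z \<noteq> 0" "st z = 0"
    and y: "y \<in> V" "anc f z y" and w: "w \<in> V" "st w \<noteq> (0::nat)" "E y w"
  shows "st w \<le> st (b y) \<or> anc f z (e w)"
proof -
  have F: "forest V f" and sym: "\<And>u v. E u v \<Longrightarrow> E v u" using pre unfolding almost_dfs_def by auto
  note upanc = visited_anc[OF F]
  show ?thesis
  proof (cases "st0 w = 0")
    case False
    then have "st0 w \<le> st0 (b y)" "st0 (b y) \<noteq> 0"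
      using K y(1) w unfolding known_def by blast+
    then show ?thesis using ext False by metis
  next
    case True
    have zV: "z \<in> V" "anc f z0 z" using hp_mem[OF F H z(1) z0(1) z(2)] by blast+
    have sty: "st y = 0" using upanc[OF up s0 y(2)] y z by blast
    have "st0 y = 0" using sty ext by metis
    have aV: "a \<in> insert 0 V" using pre unfolding almost_dfs_def by blast
    have "\<not> anc f y a" "\<not> anc f w a"
      using upanc[OF up0 s00 _ aV a] True \<open>st0 y = 0\<close> by blast+
    then have "anc f y w \<or> anc f w y"
      using pre y(1) w(1,3) unfolding almost_dfs_def by blast
    then have wy: "anc f w y" using upanc[OF up s0, of y w] sty w by blast
    have "\<not> anc f z w" using upanc[OF up s0, of z w] z w by blast
    then have wz: "anc f w z" using anc_comparable[OF wy y(2)] by blast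
    \<comment> \<open>Everything strictly above \<open>z0\<close> was visited before the pass, while
      \<open>w\<close> was not.\<close>
    have "anc f z0 w"
    proof (rule ccontr)
      assume n: "\<not> anc f z0 w"
      then have "anc f w z0" using anc_comparable[OF wz zV(2)] by blast
      then have "anc f w (f z0)" using n anc_step[of f w z0] anc_refl by metis
      then have "st0 w \<noteq> 0" using upanc[OF up0 s00] z0 forest_closed[OF F, of z0] by blast
      then show False using True by simp
    qed
    then have "anc hv z w" using hp_between[OF F H z(1,2) z0(1)] wz by blast
    then have "anc f z (e w)" using K w sym y z(2) unfolding known_def by blast
    then show ?thesis by blast
  qed
qed

text \<open>Graphs speak of codes, programs of row numbers. A bijection that fixes 0 and commutes
  with parents and edges carries the property over; it is applied in both directions, before and
  after the rerooting.\<close>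

lemma almost_dfs_transfer:
  assumes A: "almost_dfs V E f a" and g: "bij_betw g V V'" "g 0 = 0" and z: "0 \<notin> V'" "f' 0 = 0"
    and f': "\<forall>v\<in>V. f' (g v) = g (f v)"
    and E': "\<forall>u\<in>V. \<forall>v\<in>V. E' (g u) (g v) \<longleftrightarrow> E u v" and sym: "\<forall>u v. E' u v \<longrightarrow> E' v u"
  shows "almost_dfs V' E' f' (g a)"
proof -
  have F: "forest V f" using A unfolding almost_dfs_def by blast
  have gi: "g u \<in> insert 0 V'" if "u \<in> insert 0 V" for u
    using that g bij_betwE[OF g(1)] by auto
  have gz: "g u = 0 \<longleftrightarrow> u = 0" if "u \<in> insert 0 V" for u
    using that g z bij_betwE[OF g(1)] by auto
  have it: "(f' ^^ k) (g v) = g ((f ^^ k) v) \<and> (f ^^ k) v \<in> insert 0 V" if "v \<in> insert 0 V" for k v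
  proof (induction k)
    case 0 then show ?case using that by simp
  next
    case (Suc k)
    have "f' (g x) = g (f x)" if "x \<in> insert 0 V" for x
      using that f' g(2) z(2) forest_f0[OF F] by auto
    then show ?case using Suc forest_closed[OF F] by simp
  qed
  have ga: "anc f' (g u) (g v)" if "anc f u v" "v \<in> insert 0 V" for u v
    using that it unfolding anc_def by metis
  obtain r :: "nat \<Rightarrow> nat" where r: "\<And>v. v \<in> V \<Longrightarrow> r (f v) < r v"
    using forest_rank[OF F] by metis
  have V': "V' = g ` V" using g(1) by (simp add: bij_betw_def)
  define h where "h = the_inv_into (insert 0 V) g"
  have inj: "inj_on g (insert 0 V)"
    using g z unfolding bij_betw_def by auto
  have h: "h (g u) = u" if "u \<in> insert 0 V" for u
    unfolding h_def using the_inv_into_f_f[OF inj that] .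
  have "forest V' f'"
    unfolding forest_def
  proof (intro conjI)
    show "finite V'" using F V' unfolding forest_def by simp
    show "\<forall>v\<in>V'. f' v \<in> insert 0 V'"
      using f' V' gi forest_closed[OF F] by auto
    have "r (h (f' v)) < r (h v)" if v: "v \<in> V'" for v
    proof -
      obtain u where u: "u \<in> V" "v = g u" using v V' by blast
      then show ?thesis using r[of u] f' h[of u] h[of "f u"] forest_closed[OF F, of u] by simp
    qed
    then show "\<exists>r::nat \<Rightarrow> nat. \<forall>v\<in>V'. r (f' v) < r v" by (intro exI[of _ "\<lambda>v. r (h v)"]) blast
  qed (use z in auto)
  moreover have "g a \<in> insert 0 V'"
  proof (rule gi)
    show "a \<in> insert 0 V" using A unfolding almost_dfs_def by blast
  qed
  moreover have "\<forall>v\<in>V'. f' v \<noteq> 0 \<longrightarrow> E' v (f' v)"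
  proof (intro ballI impI)
    fix v assume v: "v \<in> V'" "f' v \<noteq> 0"
    then obtain u where u: "u \<in> V" "v = g u" using V' by blast
    then have fu: "f' v = g (f u)" using f' by simp
    then have "f u \<noteq> 0" using v(2) g(2) by metis
    then have "f u \<in> V" "E u (f u)"
      using forest_closed[OF F u(1)[THEN insertI2]] almost_dfsD(4)[OF A u(1)] by simp_all
    then show "E' v (f' v)" using E' u fu by simp
  qed
  moreover have "\<forall>u\<in>V'. \<forall>v\<in>V'. E' u v \<longrightarrow> anc f' u v \<or> anc f' v u \<or> anc f' u (g a) \<or> anc f' v (g a)"
  proof (intro ballI impI)
    fix u' v' assume "u' \<in> V'" "v' \<in> V'" "E' u' v'"
    then obtain u v where uv: "u \<in> V" "v \<in> V" "u' = g u" "v' = g v" using V' by blast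
    then have "E u v" using \<open>E' u' v'\<close> E' by simp
    then have "anc f u v \<or> anc f v u \<or> anc f u a \<or> anc f v a"
      using almost_dfsD(5)[OF A uv(1,2)] by simp
    moreover have "a \<in> insert 0 V" using almost_dfsD(2)[OF A] .
    ultimately show "anc f' u' v' \<or> anc f' v' u' \<or> anc f' u' (g a) \<or> anc f' v' (g a)"
      using ga[of u v] ga[of v u] ga[of u a] ga[of v a] uv by auto
  qed
  ultimately show ?thesis using sym unfolding almost_dfs_def by blast
qed

section \<open>Graph updates\<close>

text \<open>The vertex \<open>v\<close> of the graph has the code \<open>Suc v\<close>, the dummy root the code 0.\<close>

definition codes :: "nat graph \<Rightarrow> nat set" where
  "codes G = Suc ` fst G"

definition code_edge :: "nat graph \<Rightarrow> nat \<Rightarrow> nat \<Rightarrow> bool" where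
  "code_edge G c d \<longleftrightarrow> c \<noteq> 0 \<and> d \<noteq> 0 \<and> {c - 1, d - 1} \<in> snd G"

definition vertex_of :: "nat \<Rightarrow> nat option" where
  "vertex_of c = (case c of 0 \<Rightarrow> None | Suc u \<Rightarrow> Some u)"

lemma code_edge_sym: "code_edge G c d \<Longrightarrow> code_edge G d c"
  unfolding code_edge_def by (simp add: insert_commute)

lemma vertex_of_simps [simp]: "vertex_of 0 = None" "vertex_of (Suc u) = Some u"
  unfolding vertex_of_def by simp_all

lemma vertex_of_inj: "vertex_of c = vertex_of d \<longleftrightarrow> c = d"
  by (cases c; cases d) simp_all

text \<open>For \<open>a = 0\<close> every edge of the graph joins comparable vertices, because no
  vertex of \<open>V\<close> is an ancestor of 0. The edges added for the dummy vertex are harmless,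
  0 being an ancestor of every code.\<close>

lemma almost_dfs_is_dfs_tree:
  assumes G: "simple_graph G" and A: "almost_dfs (codes G) (code_edge G) f 0"
  shows "is_dfs_tree (augment G) None ((\<lambda>c. (vertex_of (f c), vertex_of c)) ` codes G)"
proof -
  define V where "V = codes G"
  define T where "T = (\<lambda>c. (vertex_of (f c), vertex_of c)) ` V"
  have F: "forest V f" using A unfolding almost_dfs_def V_def by blast
  have vo: "vertex_of c \<in> fst (augment G)" if "c \<in> insert 0 V" for c
    using that unfolding V_def codes_def augment_def by auto
  have vo2: "\<exists>c\<in>insert 0 V. v = vertex_of c" if "v \<in> fst (augment G)" for v
    using that unfolding V_def codes_def augment_def by force
  have T: "(vertex_of u, vertex_of c) \<in> T \<longleftrightarrow> c \<in> V \<and> u = f c" for u c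
    unfolding T_def using vertex_of_inj by auto
  have TT: "(vertex_of u, vertex_of c) \<in> T\<^sup>*" if "anc f u c" "c \<in> insert 0 V" for u c
  proof -
    have "u \<in> insert 0 V \<and> (vertex_of u, vertex_of c) \<in> T\<^sup>*"
      using that(1)
    proof (rule anc_closed)
      fix w assume w: "w \<in> insert 0 V \<and> (vertex_of w, vertex_of c) \<in> T\<^sup>*"
      show "f w \<in> insert 0 V \<and> (vertex_of (f w), vertex_of c) \<in> T\<^sup>*"
      proof (cases "w = 0")
        case True then show ?thesis using w forest_f0[OF F] by simp
      next
        case False
        then have "(vertex_of (f w), vertex_of w) \<in> T" using T w by blast
        then show ?thesis using w forest_closed[OF F, of w] by (meson converse_rtrancl_into_rtrancl)
      qed
    qed (use that in simp)
    then show ?thesis by blast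
  qed
  have edge: "{vertex_of c, vertex_of d} \<in> snd (augment G)" if cV: "c \<in> V" and cd: "d = 0 \<or> code_edge G c d" for c d
  proof (cases "d = 0")
    case True
    then show ?thesis using cV unfolding V_def codes_def augment_def by (auto simp: insert_commute)
  next
    case False
    then have e: "c \<noteq> 0" "d \<noteq> 0" "{c - 1, d - 1} \<in> snd G" using cd unfolding code_edge_def by blast+
    then obtain c' d' where cd: "c = Suc c'" "d = Suc d'" using not0_implies_Suc by blast
    then have "{c', d'} \<in> snd G" using e by simp
    then have "Some ` {c', d'} \<in> snd (augment G)" unfolding augment_def by (simp only: snd_conv) blast
    then show ?thesis using cd by simp
  qed
  have "rooted_spanning_tree (augment G) None T"
    unfolding rooted_spanning_tree_def
  proof (intro conjI ballI allI)
    show "None \<in> fst (augment G)" unfolding augment_def by simp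
    show "T \<subseteq> fst (augment G) \<times> fst (augment G)"
      unfolding T_def using vo forest_closed[OF F] by auto
    show "case x of (u, v) \<Rightarrow> {u, v} \<in> snd (augment G)" if "x \<in> T" for x
    proof -
      obtain c where c: "x = (vertex_of (f c), vertex_of c)" "c \<in> V" using \<open>x \<in> T\<close> T_def by blast
      have "f c = 0 \<or> code_edge G c (f c)" using A c unfolding almost_dfs_def V_def by blast
      then have "{vertex_of c, vertex_of (f c)} \<in> snd (augment G)" using edge[OF c(2)] by blast
      then show ?thesis using c(1) by (simp add: insert_commute)
    qed
    show "(u, None) \<notin> T" for u
    proof
      assume "(u, None) \<in> T"
      then obtain c where "c \<in> V" "vertex_of c = vertex_of 0" unfolding T_def by auto
      then show False using forest_pos[OF F] vertex_of_inj by blast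
    qed
    show "\<exists>!u. (u, v) \<in> T" if v: "v \<in> fst (augment G) - {None}" for v
    proof -
      obtain c where c: "c \<in> V" "v = vertex_of c" using v vo2 by fastforce
      show ?thesis
      proof (rule ex1I[of _ "vertex_of (f c)"])
        show "(vertex_of (f c), v) \<in> T" using T c by simp
        show "u = vertex_of (f c)" if "(u, v) \<in> T" for u
          using that c vertex_of_inj unfolding T_def by auto
      qed
    qed
    show "(None, v) \<in> T\<^sup>*" if v: "v \<in> fst (augment G)" for v
    proof -
      obtain c where c: "c \<in> insert 0 V" "v = vertex_of c" using v vo2 by blast
      have "anc f 0 c" using anc_zero[OF F c(1)] .
      then show ?thesis using TT[of 0 c] c by simp
    qed
  qed
  moreover have "(u, v) \<in> T\<^sup>* \<or> (v, u) \<in> T\<^sup>*" if uv: "{u, v} \<in> snd (augment G)" for u v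
  proof -
    consider e where "e \<in> snd G" "{u, v} = Some ` e" | w where "w \<in> fst G" "{u, v} = {None, Some w}"
      using uv unfolding augment_def by auto
    then show ?thesis
    proof cases
      case 1
      then obtain x y where xy: "u = Some x" "v = Some y" by blast
      have "Some ` e = Some ` {x, y}" using 1 xy by simp
      then have "e = {x, y}" by (rule inj_image_eq_iff[OF inj_Some, THEN iffD1])
      then have xyG: "{x, y} \<in> snd G" using 1(1) by simp
      moreover have "snd G \<subseteq> {{u, v} |u v. u \<in> fst G \<and> v \<in> fst G \<and> u \<noteq> v}"
        using G unfolding simple_graph_def by blast
      ultimately have "{x, y} \<in> {{u, v} |u v. u \<in> fst G \<and> v \<in> fst G \<and> u \<noteq> v}" by (rule rev_subsetD)
      then obtain u' v' where "{x, y} = {u', v'}" "u' \<in> fst G" "v' \<in> fst G" by auto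
      then have "x \<in> fst G" "y \<in> fst G" by (auto simp: doubleton_eq_iff)
      then have "code_edge G (Suc x) (Suc y)" "Suc x \<in> V" "Suc y \<in> V"
        using xyG unfolding code_edge_def V_def codes_def by simp_all
      then have "anc f (Suc x) (Suc y) \<or> anc f (Suc y) (Suc x) \<or> anc f (Suc x) 0 \<or> anc f (Suc y) 0"
        using almost_dfsD(5)[OF A] unfolding V_def by simp
      then have "anc f (Suc x) (Suc y) \<or> anc f (Suc y) (Suc x)" using anc_0[OF F] by simp
      then show ?thesis using TT[of "Suc x" "Suc y"] TT[of "Suc y" "Suc x"] xy
          \<open>Suc x \<in> V\<close> \<open>Suc y \<in> V\<close> by auto
    next
      case 2
      then have "Suc w \<in> V" unfolding V_def codes_def by auto
      then have "(None, Some w) \<in> T\<^sup>*" using TT[of 0 "Suc w"] anc_zero[OF F, of "Suc w"] by simp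
      then show ?thesis using 2 by (auto simp: doubleton_eq_iff)
    qed
  qed
  ultimately show ?thesis unfolding is_dfs_tree_def T_def V_def by blast
qed

section \<open>How the updates perturb a DFS forest\<close>

lemma almost_dfs_cong:
  assumes "almost_dfs V E f a" "\<forall>u\<in>V. \<forall>v\<in>V. E' u v \<longleftrightarrow> E u v" "\<forall>u v. E' u v \<longrightarrow> E' v u"
  shows "almost_dfs V E' f a"
proof -
  have F: "forest V f" using assms unfolding almost_dfs_def by blast
  have "E' v (f v)" if v: "v \<in> V" "f v \<noteq> 0" for v
  proof -
    have "E v (f v)" using assms(1) v unfolding almost_dfs_def by blast
    moreover have "f v \<in> V" using forest_closed[OF F, of v] v by simp
    ultimately show ?thesis using assms(2) v(1) by blast
  qed
  then show ?thesis using assms unfolding almost_dfs_def by blast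
qed

text \<open>The new vertex becomes a tree of its own, and every edge that could be a cross edge
  contains it. The relation \<open>E\<close> may already relate \<open>c\<close> to
  \<open>V\<close>; so the lemma serves vertex insertions as well as the preprocessing, which
  uncovers a fixed graph vertex by vertex.\<close>

lemma almost_dfs_insert:
  assumes A: "almost_dfs V E f 0" and c: "c \<notin> V" "c \<noteq> 0"
  shows "almost_dfs (insert c V) E (f(c := 0)) c"
proof -
  let ?f = "f(c := 0)"
  have F: "forest V f" using A unfolding almost_dfs_def by blast
  obtain r :: "nat \<Rightarrow> nat" where r: "\<And>v. v \<in> V \<Longrightarrow> r (f v) < r v"
    using forest_rank[OF F] by metis
  have fc: "f v \<noteq> c" if "v \<in> insert 0 V" for v
    using forest_closed[OF F that] c by auto
  have "forest (insert c V) ?f"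
    unfolding forest_def
  proof (intro conjI)
    show "finite (insert c V)" "0 \<notin> insert c V" "?f 0 = 0" using F c unfolding forest_def by auto
    show "\<forall>v\<in>insert c V. ?f v \<in> insert 0 (insert c V)"
    proof
      fix v assume "v \<in> insert c V"
      then show "?f v \<in> insert 0 (insert c V)"
        using forest_closed[OF F, of v] by (cases "v = c") auto
    qed
    \<comment> \<open>The new vertex has parent 0, so any rank above \<open>r 0\<close>
      does.\<close>
    have "(r(c := Suc (r 0))) (?f v) < (r(c := Suc (r 0))) v" if "v \<in> insert c V" for v
    proof (cases "v = c")
      case True then show ?thesis using c by simp
    next
      case False
      then have "v \<in> V" using that by simp
      then show ?thesis using r[of v] fc[of v] False by simp
    qed
    then show "\<exists>r::nat \<Rightarrow> nat. \<forall>v\<in>insert c V. r (?f v) < r v" by blast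
  qed
  moreover have "anc ?f u v" if "anc f u v" "v \<in> V" for u v
    using that(1)
  proof (rule anc_cong[where D = "insert 0 V"])
    fix w assume w: "w \<in> insert 0 V"
    show "f w \<in> insert 0 V" using forest_closed[OF F w] .
    show "?f w = f w" using w c by auto
  qed (use that in simp)
  moreover have "\<forall>v\<in>insert c V. ?f v \<noteq> 0 \<longrightarrow> E v (?f v)"
  proof (intro ballI impI)
    fix v assume v: "v \<in> insert c V" "?f v \<noteq> 0"
    then have "v \<in> V" "?f v = f v" by (auto split: if_splits)
    then show "E v (?f v)" using almost_dfsD(4)[OF A, of v] v(2) by simp
  qed
  moreover have "anc f u v \<or> anc f v u" if "u \<in> V" "v \<in> V" "E u v" for u v
  proof -
    have "\<not> anc f u 0" "\<not> anc f v 0" using that anc_0[OF F] forest_pos[OF F] by blast+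
    then show ?thesis using almost_dfsD(5)[OF A that] by blast
  qed
  moreover have "E u v \<longrightarrow> anc ?f u v \<or> anc ?f v u \<or> anc ?f u c \<or> anc ?f v c"
    if "u \<in> insert c V" "v \<in> insert c V" for u v
    using that calculation(2)[of u v] calculation(2)[of v u] calculation(4)[of u v] anc_refl[of ?f c]
    by blast
  ultimately show ?thesis using almost_dfsD(3)[OF A] unfolding almost_dfs_def by blast
qed

text \<open>The \<open>c\<close> obtained is the changed vertex nearest to \<open>u\<close> on the
  old path from \<open>v\<close>; beyond \<open>f c\<close> the path is therefore intact in
  \<open>f'\<close>.\<close>

lemma anc_cut:
  assumes "anc f u v"
  shows "anc f' u v \<or> (\<exists>c. f' c \<noteq> f c \<and> anc f c v \<and> anc f' u (f c))"
proof -
  obtain k where "(f ^^ k) v = u" using assms unfolding anc_def by blast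
  then show ?thesis
  proof (induction k arbitrary: v)
    case 0 then show ?case by simp
  next
    case (Suc k)
    then have "(f ^^ k) (f v) = u" by (simp add: funpow_swap1)
    then consider "anc f' u (f v)" | c where "f' c \<noteq> f c" "anc f c (f v)" "anc f' u (f c)"
      using Suc.IH by blast
    then show ?case
    proof cases
      case 1
      then show ?thesis using anc_step[of f' u v] anc_refl[of f v] by metis
    next
      case 2
      then show ?thesis using anc_step[of f c v] by blast
    qed
  qed
qed

text \<open>Common core of the two deletions, in which parents are only ever replaced by 0. If an
  edge loses its comparability, \<open>anc_cut\<close> yields a cut vertex \<open>c\<close> such
  that the upper end is still above \<open>f c\<close>, and the assumption \<open>cut\<close> places
  this end on the root path of \<open>a\<close>.\<close>

lemma almost_dfs_cut:
  assumes A: "almost_dfs V E f 0" and V': "V' \<subseteq> V" and f': "f' 0 = 0" "\<forall>v\<in>V. f' v = f v \<or> f' v = 0"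
    and sym: "\<forall>u v. E' u v \<longrightarrow> E' v u" and E': "\<forall>u\<in>V'. \<forall>v\<in>V'. E' u v \<longrightarrow> E u v"
    and f'V: "\<forall>v\<in>V'. f' v \<in> insert 0 V' \<and> (f' v \<noteq> 0 \<longrightarrow> E' v (f' v))" and a: "a \<in> insert 0 V'"
    and cut: "\<forall>c\<in>V. f' c \<noteq> f c \<longrightarrow> (\<forall>u\<in>V'. anc f' u (f c) \<longrightarrow> anc f' u a)"
  shows "almost_dfs V' E' f' a"
proof -
  have F: "forest V f" using A unfolding almost_dfs_def by blast
  obtain r :: "nat \<Rightarrow> nat" where r: "\<And>v. v \<in> V \<Longrightarrow> r (f v) < r v"
      "\<And>u v. anc f u v \<Longrightarrow> v \<in> insert 0 V \<Longrightarrow> u \<noteq> v \<Longrightarrow> r u < r v"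
    using forest_rank[OF F] by metis
  have "forest V' f'"
    unfolding forest_def
  proof (intro conjI)
    show "finite V'" "0 \<notin> V'" "f' 0 = 0" using F V' f' unfolding forest_def by (auto intro: finite_subset)
    show "\<forall>v\<in>V'. f' v \<in> insert 0 V'" using f'V by blast
    have "r (f' v) < r v" if "v \<in> V'" for v
    proof (cases "f' v = f v")
      case True then show ?thesis using r(1)[of v] that V' by auto
    next
      case False
      then have "f' v = 0" using f' that V' by blast
      \<comment> \<open>Redirecting a parent to the dummy respects the old rank, since 0 was an
        ancestor of \<open>v\<close> all along.\<close>
      moreover have "r 0 < r v" using r(2)[of 0 v] anc_zero[OF F, of v] that V' forest_pos[OF F, of v] by auto
      ultimately show ?thesis by simp
    qed
    then show "\<exists>r::nat \<Rightarrow> nat. \<forall>v\<in>V'. r (f' v) < r v" by blast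
  qed
  moreover have *: "anc f' u v \<or> anc f' u a" if uv: "u \<in> V'" "v \<in> V'" "anc f u v" for u v
  proof (rule ccontr)
    assume n: "\<not> ?thesis"
    then obtain c where c: "f' c \<noteq> f c" "anc f c v" "anc f' u (f c)" using anc_cut[OF uv(3), of f'] by blast
    then have "c \<noteq> 0" using f'(1) forest_f0[OF F] by metis
    then have "c \<in> V" using anc_in[OF F c(2)] uv V' by blast
    then show False using cut c uv n by blast
  qed
  moreover have "anc f u v \<or> anc f v u" if "u \<in> V'" "v \<in> V'" "E' u v" for u v
  proof -
    have uv: "u \<in> V" "v \<in> V" "E u v" using that V' E' by blast+
    then have "\<not> anc f u 0" "\<not> anc f v 0" using anc_0[OF F] forest_pos[OF F] by blast+
    then show ?thesis using almost_dfsD(5)[OF A uv] by blast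
  qed
  ultimately have "E' u v \<longrightarrow> anc f' u v \<or> anc f' v u \<or> anc f' u a \<or> anc f' v a"
    if "u \<in> V'" "v \<in> V'" for u v
    using that by metis
  then show ?thesis using \<open>forest V' f'\<close> sym f'V a unfolding almost_dfs_def by simp
qed

lemma insert_vertex_almost_dfs:
  assumes G: "simple_graph G" and u: "valid_update G (Insert_Vertex v X)"
    and A: "almost_dfs (codes G) (code_edge G) f 0"
  defines "G' \<equiv> apply_update G (Insert_Vertex v X)"
  shows "almost_dfs (codes G') (code_edge G') (f(Suc v := 0)) (Suc v)"
proof -
  obtain V E where VE: "G = (V, E)" by (cases G)
  have v: "v \<notin> V" using u VE by simp
  have G': "G' = (insert v V, E \<union> (\<lambda>x. {v, x}) ` X)" unfolding G'_def VE by simp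
  have "code_edge G' c d \<longleftrightarrow> code_edge G c d" if "c \<in> codes G" "d \<in> codes G" for c d
  proof -
    have "v \<noteq> c - 1" "v \<noteq> d - 1" using that v unfolding codes_def VE by auto
    then show ?thesis unfolding code_edge_def G' VE by auto
  qed
  then have "almost_dfs (codes G) (code_edge G') f 0"
    by (intro almost_dfs_cong[OF A]) (simp_all add: code_edge_sym)
  moreover have "Suc v \<notin> codes G" using v unfolding codes_def VE by auto
  ultimately have "almost_dfs (insert (Suc v) (codes G)) (code_edge G') (f(Suc v := 0)) (Suc v)"
    by (intro almost_dfs_insert) simp_all
  moreover have "codes G' = insert (Suc v) (codes G)" unfolding codes_def G' VE by simp
  ultimately show ?thesis by simp
qed

text \<open>The forest is unchanged, and the only edge that may be a cross edge contains
  \<open>Suc u\<close>, which lies on its own root path.\<close>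

lemma insert_edge_almost_dfs:
  assumes u: "valid_update G (Insert_Edge u v)"
    and A: "almost_dfs (codes G) (code_edge G) f 0"
  defines "G' \<equiv> apply_update G (Insert_Edge u v)"
  shows "almost_dfs (codes G') (code_edge G') f (Suc u)"
proof -
  obtain V E where VE: "G = (V, E)" by (cases G)
  have G': "G' = (V, insert {u, v} E)" unfolding G'_def VE by simp
  have c: "codes G' = codes G" unfolding codes_def G' VE by simp
  have F: "forest (codes G) f" using A unfolding almost_dfs_def by blast
  have mono: "code_edge G' c d" if "code_edge G c d" for c d
    using that unfolding code_edge_def G' VE by simp
  have "anc f c d \<or> anc f d c \<or> anc f c (Suc u) \<or> anc f d (Suc u)"
    if "c \<in> codes G" "d \<in> codes G" "code_edge G' c d" for c d
  proof (cases "code_edge G c d")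
    case True
    have "\<not> anc f c 0" "\<not> anc f d 0" using that anc_0[OF F] forest_pos[OF F] by blast+
    then show ?thesis using almost_dfsD(5)[OF A that(1,2) True] by blast
  next
    case False
    then have "{c - 1, d - 1} = {u, v}" "c \<noteq> 0" "d \<noteq> 0" using that(3) unfolding code_edge_def G' VE by auto
    then have "c = Suc u \<or> d = Suc u" by (auto simp: doubleton_eq_iff)
    then show ?thesis using anc_refl by metis
  qed
  moreover have "Suc u \<in> codes G" using u unfolding VE codes_def by simp
  moreover have "\<forall>c\<in>codes G. f c \<noteq> 0 \<longrightarrow> code_edge G' c (f c)" using A mono unfolding almost_dfs_def by blast
  ultimately show ?thesis
    unfolding almost_dfs_def c using F code_edge_sym by blast
qed

text \<open>If the edge is a tree edge, its upper end is chosen as \<open>a\<close>: every ancestor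
  that the lower part loses is on the root path of that end. If it is not a tree edge, no parent
  changes and \<open>Suc u\<close> is merely a default.\<close>

lemma delete_edge_almost_dfs:
  assumes G: "simple_graph G" and u: "valid_update G (Delete_Edge u v)"
    and A: "almost_dfs (codes G) (code_edge G) f 0"
  defines "G' \<equiv> apply_update G (Delete_Edge u v)"
  shows "almost_dfs (codes G') (code_edge G')
     (\<lambda>c. if c = Suc v \<and> f c = Suc u \<or> c = Suc u \<and> f c = Suc v then 0 else f c)
     (if f (Suc u) = Suc v then Suc v else Suc u)" (is "almost_dfs _ _ ?f ?a")
proof -
  obtain V E where VE: "G = (V, E)" by (cases G)
  have G': "G' = (V, E - {{u, v}})" unfolding G'_def VE by simp
  have c: "codes G' = codes G" unfolding codes_def G' VE by simp
  have F: "forest (codes G) f" using A unfolding almost_dfs_def by blast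
  have "{u, v} \<in> E" using u VE by simp
  then have uv: "u \<in> V" "v \<in> V" "u \<noteq> v"
    using G unfolding VE simple_graph_def by (auto simp: doubleton_eq_iff)
  have "almost_dfs (codes G) (code_edge G') ?f ?a"
  proof (rule almost_dfs_cut[OF A])
    show "?f 0 = 0" using forest_f0[OF F] by simp
    show "\<forall>v\<in>codes G. ?f v = f v \<or> ?f v = 0" by simp
    show "\<forall>u v. code_edge G' u v \<longrightarrow> code_edge G' v u" using code_edge_sym by blast
    show "\<forall>u\<in>codes G. \<forall>v\<in>codes G. code_edge G' u v \<longrightarrow> code_edge G u v"
      unfolding code_edge_def G' VE by simp
    show "?a \<in> insert 0 (codes G)" using uv unfolding codes_def VE by simp
    show "\<forall>c\<in>codes G. ?f c \<in> insert 0 (codes G) \<and> (?f c \<noteq> 0 \<longrightarrow> code_edge G' c (?f c))"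
    proof (intro ballI conjI impI)
      fix c assume c: "c \<in> codes G"
      then show "?f c \<in> insert 0 (codes G)" using forest_closed[OF F, of c] by simp
      assume n: "?f c \<noteq> 0"
      then have fc: "?f c = f c" "\<not> (c = Suc v \<and> f c = Suc u \<or> c = Suc u \<and> f c = Suc v)" "f c \<noteq> 0"
        by (auto split: if_splits)
      then have ce: "code_edge G c (f c)" using almost_dfsD(4)[OF A, of c] c by blast
      moreover have "{c - 1, f c - 1} \<noteq> {u, v}"
        using fc c ce unfolding code_edge_def by (auto simp: doubleton_eq_iff)
      ultimately show "code_edge G' c (?f c)" unfolding code_edge_def fc G' VE by simp
    qed
    show "\<forall>c\<in>codes G. ?f c \<noteq> f c \<longrightarrow> (\<forall>x\<in>codes G. anc ?f x (f c) \<longrightarrow> anc ?f x ?a)"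
    proof (intro ballI impI)
      fix c x assume "?f c \<noteq> f c" and x: "anc ?f x (f c)"
      then have *: "c = Suc v \<and> f c = Suc u \<or> c = Suc u \<and> f c = Suc v" by meson
      \<comment> \<open>Acyclicity excludes that each endpoint is the parent of the other, so the
        choice of \<open>?a\<close> is unambiguous.\<close>
      have n: "f (Suc v) \<noteq> Suc u" if "f (Suc u) = Suc v"
      proof -
        have "Suc u \<in> codes G" using uv unfolding codes_def VE by simp
        then have "\<not> anc f (Suc u) (f (Suc u))" using not_anc_parent[OF F] by blast
        then show ?thesis using anc_step[of f "Suc u" "Suc v"] that by auto
      qed
      have "f c = ?a"
        using * n by (elim disjE conjE) auto
      then show "anc ?f x ?a" using x by simp
    qed
  qed simp
  then show ?thesis using c by simp
qed

text \<open>The children of \<open>v\<close> become roots. Besides \<open>v\<close> itself, which is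
  gone, their subtrees lose the parent of \<open>v\<close> and its ancestors, and these form the
  root path of \<open>?a\<close>.\<close>

lemma delete_vertex_almost_dfs:
  assumes G: "simple_graph G" and u: "valid_update G (Delete_Vertex v)"
    and A: "almost_dfs (codes G) (code_edge G) f 0"
  defines "G' \<equiv> apply_update G (Delete_Vertex v)"
  shows "almost_dfs (codes G') (code_edge G') (\<lambda>c. if f c = Suc v then 0 else f c) (f (Suc v))"
    (is "almost_dfs _ _ ?f ?a")
proof -
  obtain V E where VE: "G = (V, E)" by (cases G)
  have G': "G' = (V - {v}, {e \<in> E. v \<notin> e})" unfolding G'_def VE by simp
  have c: "codes G' = codes G - {Suc v}" unfolding codes_def G' VE by auto
  have F: "forest (codes G) f" using A unfolding almost_dfs_def by blast
  have vV: "Suc v \<in> codes G" using u unfolding VE codes_def by simp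
  have fv: "f (Suc v) \<noteq> Suc v" using parent_neq[OF F vV] .
  show ?thesis
  proof (rule almost_dfs_cut[OF A])
    show "?f 0 = 0" using forest_f0[OF F] by simp
    show "codes G' \<subseteq> codes G" using c by blast
    show "\<forall>v\<in>codes G. ?f v = f v \<or> ?f v = 0" by simp
    show "\<forall>u v. code_edge G' u v \<longrightarrow> code_edge G' v u" using code_edge_sym by blast
    show "\<forall>u\<in>codes G'. \<forall>v\<in>codes G'. code_edge G' u v \<longrightarrow> code_edge G u v"
      unfolding code_edge_def G' VE by simp
    show "?a \<in> insert 0 (codes G')"
      using forest_closed[OF F vV[THEN insertI2]] fv unfolding c by simp
    show "\<forall>c\<in>codes G'. ?f c \<in> insert 0 (codes G') \<and> (?f c \<noteq> 0 \<longrightarrow> code_edge G' c (?f c))"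
    proof (intro ballI conjI impI)
      fix d assume d: "d \<in> codes G'"
      then have "f d \<in> insert 0 (codes G)" using forest_closed[OF F, of d] c by blast
      then show "?f d \<in> insert 0 (codes G')" unfolding c by simp
      assume n: "?f d \<noteq> 0"
      then have fd: "?f d = f d" "f d \<noteq> Suc v" "f d \<noteq> 0" by (auto split: if_splits)
      then have ce: "code_edge G d (f d)" using almost_dfsD(4)[OF A, of d] d c by blast
      moreover have "v \<notin> {d - 1, f d - 1}"
      proof -
        have "d \<noteq> Suc v" using d c by blast
        moreover have "d \<noteq> 0" using ce unfolding code_edge_def by blast
        ultimately have "v \<noteq> d - 1" by arith
        moreover have "v \<noteq> f d - 1" using fd(2,3) by arith
        ultimately show ?thesis by simp
      qed
      ultimately show "code_edge G' d (?f d)" unfolding code_edge_def fd G' VE by simp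
    qed
    show "\<forall>c\<in>codes G. ?f c \<noteq> f c \<longrightarrow> (\<forall>x\<in>codes G'. anc ?f x (f c) \<longrightarrow> anc ?f x ?a)"
    proof (intro ballI impI)
      fix d x assume "?f d \<noteq> f d" and x: "x \<in> codes G'" "anc ?f x (f d)"
      then have "f d = Suc v" by metis
      then have "anc ?f x (Suc v)" using x(2) by simp
      then have "anc ?f x (?f (Suc v))" using anc_step[of ?f x "Suc v"] x(1) c by blast
      then show "anc ?f x ?a" using fv by simp
    qed
  qed
qed

section \<open>Weakest preconditions of streaming programs\<close>

text \<open>Twenty registers are followed by rows of nine cells. Interleaving the columns lets the
  table grow without knowing its final length. Row 0 belongs to the dummy; row 1 begins at address
  29. Splitting a memory into \<open>\<rho>\<close> and \<open>\<kappa>\<close> turns address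
  arithmetic into function updates.\<close>

definition mem :: "(nat \<Rightarrow> nat) \<Rightarrow> (nat \<Rightarrow> nat \<Rightarrow> nat) \<Rightarrow> memory" where
  "mem \<rho> \<kappa> a = (if a < 20 then \<rho> a else \<kappa> ((a - 20) mod 9) ((a - 20) div 9))"

lemma mem_reg: "r < 20 \<Longrightarrow> mem \<rho> \<kappa> r = \<rho> r"
  unfolding mem_def by simp

lemma mem_col: "c < 9 \<Longrightarrow> mem \<rho> \<kappa> (20 + c + 9 * v) = \<kappa> c v"
  unfolding mem_def by simp

lemma mem_upd_reg: "r < 20 \<Longrightarrow> (mem \<rho> \<kappa>)(r := x) = mem (\<rho>(r := x)) \<kappa>"
  unfolding mem_def by (rule ext) auto

lemma mem_upd_col:
  assumes "c < 9"
  shows "(mem \<rho> \<kappa>)(20 + c + 9 * v := x) = mem \<rho> (\<kappa>(c := (\<kappa> c)(v := x)))"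
proof
  fix a
  show "((mem \<rho> \<kappa>)(20 + c + 9 * v := x)) a = mem \<rho> (\<kappa>(c := (\<kappa> c)(v := x))) a"
  proof (cases "a < 20")
    case True then show ?thesis by (simp add: mem_def)
  next
    case False
    define d w where "d = (a - 20) mod 9" and "w = (a - 20) div 9"
    have a: "a = 20 + d + 9 * w" using False unfolding d_def w_def by simp
    have d: "d < 9" unfolding d_def by simp
    have "a = 20 + c + 9 * v \<longleftrightarrow> d = c \<and> w = v"
    proof
      assume "a = 20 + c + 9 * v"
      then have e: "d + 9 * w = c + 9 * v" using a by simp
      have "(d + 9 * w) mod 9 = d" "(c + 9 * v) mod 9 = c" using d assms by simp_all
      then show "d = c \<and> w = v" using e by simp
    qed (use a in simp)
    then show ?thesis using a d by (auto simp: mem_col)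
  qed
qed

lemma mem_exists: "\<exists>\<rho> \<kappa>. m = mem \<rho> \<kappa>"
proof (intro exI)
  show "m = mem m (\<lambda>c v. m (20 + c + 9 * v))"
  proof
    fix a
    show "m a = mem m (\<lambda>c v. m (20 + c + 9 * v)) a"
    proof (cases "a < 20")
      case False
      then have "20 + (a - 20) mod 9 + 9 * ((a - 20) div 9) = a" by presburger
      then show ?thesis using False unfolding mem_def by simp
    qed (simp add: mem_def)
  qed
qed

section \<open>Derived expressions and counting loops\<close>

definition reg :: "nat \<Rightarrow> aexp" where "reg r = Cell (Const r)"
definition adr :: "nat \<Rightarrow> aexp \<Rightarrow> aexp" where "adr c e = Plus (Const (20 + c)) (Times (Const 9) e)"
definition col :: "nat \<Rightarrow> aexp \<Rightarrow> aexp" where "col c e = Cell (adr c e)"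
text \<open>Comparisons are made from truncated subtraction: of the two differences one vanishes,
  and their sum is the distance. A positive difference serves as truth in \<open>LT\<close>.\<close>

definition EQ :: "aexp \<Rightarrow> aexp \<Rightarrow> aexp" where "EQ a b = Minus (Const (Suc 0)) (Plus (Minus a b) (Minus b a))"
definition LT :: "aexp \<Rightarrow> aexp \<Rightarrow> aexp" where "LT a b = Minus b a"
definition NOT :: "aexp \<Rightarrow> aexp" where "NOT a = Minus (Const (Suc 0)) a"
definition SET :: "nat \<Rightarrow> aexp \<Rightarrow> com" where "SET r e = STORE (Const r) e"
definition PUT :: "nat \<Rightarrow> aexp \<Rightarrow> aexp \<Rightarrow> com" where "PUT c v e = STORE (adr c v) e"

abbreviation seq (infixr ";;" 55) where "c ;; d \<equiv> SEQ c d"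

lemma aval_simps [simp]:
  "r < 20 \<Longrightarrow> aval (reg r) (mem \<rho> \<kappa>) = \<rho> r"
  "aval (adr c e) m = 20 + c + 9 * aval e m"
  "c < 9 \<Longrightarrow> aval (col c e) (mem \<rho> \<kappa>) = \<kappa> c (aval e (mem \<rho> \<kappa>))"
  "aval (EQ a b) m = (if aval a m = aval b m then 1 else 0)"
  "aval (LT a b) m = aval b m - aval a m"
  "aval (NOT a) m = 1 - aval a m"
  unfolding reg_def adr_def col_def EQ_def LT_def NOT_def by (auto simp: mem_reg mem_col)

text \<open>Counting down from the number of rows lets the counter be its own guard and leaves out
  row 0. Accordingly the invariants speak about the rows above the counter.\<close>

definition FOR :: "nat \<Rightarrow> com \<Rightarrow> com" where
  "FOR r c = SET r (reg 3) ;; LOOP (reg r) (c ;; SET r (Minus (reg r) (Const (Suc 0))))"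

text \<open>Postconditions of code that neither reads the stream nor starts a pass, so that the last
  two components of the configuration are fixed.\<close>

definition lift :: "stream \<Rightarrow> nat \<Rightarrow> ((nat \<Rightarrow> nat) \<Rightarrow> (nat \<Rightarrow> nat \<Rightarrow> nat) \<Rightarrow> bool) \<Rightarrow> config \<Rightarrow> bool" where
  "lift es i P y \<longleftrightarrow> (\<exists>\<rho> \<kappa>. y = (mem \<rho> \<kappa>, es, i) \<and> P \<rho> \<kappa>)"

lemma liftI: "P \<rho> \<kappa> \<Longrightarrow> lift es i P (mem \<rho> \<kappa>, es, i)"
  unfolding lift_def by blast

section \<open>Weakest preconditions for total correctness under the bounds on addresses and
  words\<close>

locale machine =
  fixes \<sigma> :: "nat \<Rightarrow> stream" and S W :: nat
begin

text \<open>An execution has to exist, so termination and obedience to \<open>S\<close> and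
  \<open>W\<close> are part of every \<open>wp\<close> statement. Determinism allows equivalences
  rather than implications for the basic commands.\<close>

definition wp :: "com \<Rightarrow> (config \<Rightarrow> bool) \<Rightarrow> config \<Rightarrow> bool" where
  "wp c Q x \<longleftrightarrow> (\<exists>y. exec \<sigma> S W c x y \<and> Q y)"

lemma wp_mono: "wp c Q x \<Longrightarrow> (\<And>y. Q y \<Longrightarrow> Q' y) \<Longrightarrow> wp c Q' x"
  unfolding wp_def by blast

lemma wp_skip [simp]: "wp SKIP Q x \<longleftrightarrow> Q x"
proof -
  have "exec \<sigma> S W SKIP x y \<longleftrightarrow> y = x" for y
    using exec.Skip[of \<sigma> S W x] exec_deterministic by blast
  then show ?thesis unfolding wp_def by simp
qed

lemma wp_store: "wp (STORE a b) Q (m, es, i) \<longleftrightarrow>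
    aval a m < S \<and> aval b m < W \<and> Q (m(aval a m := aval b m), es, i)"
proof -
  have "exec \<sigma> S W (STORE a b) (m, es, i) y \<longleftrightarrow>
      aval a m < S \<and> aval b m < W \<and> y = (m(aval a m := aval b m), es, i)" for y
  proof
    assume "exec \<sigma> S W (STORE a b) (m, es, i) y"
    then show "aval a m < S \<and> aval b m < W \<and> y = (m(aval a m := aval b m), es, i)"
      by (rule exec_StoreE) simp
  next
    assume "aval a m < S \<and> aval b m < W \<and> y = (m(aval a m := aval b m), es, i)"
    then show "exec \<sigma> S W (STORE a b) (m, es, i) y" by (simp add: exec.Store)
  qed
  then show ?thesis unfolding wp_def by auto
qed

lemma wp_seq [simp]: "wp (c ;; d) Q x \<longleftrightarrow> wp c (wp d Q) x"
proof -
  have "exec \<sigma> S W (c ;; d) x y \<longleftrightarrow> (\<exists>z. exec \<sigma> S W c x z \<and> exec \<sigma> S W d z y)" for y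
  proof
    assume "exec \<sigma> S W (c ;; d) x y"
    then show "\<exists>z. exec \<sigma> S W c x z \<and> exec \<sigma> S W d z y" by (rule exec_SeqE) (rule exI, rule conjI)
  qed (use exec.Seq in blast)
  then show ?thesis unfolding wp_def by (simp only:) blast
qed

lemma wp_cond [simp]: "wp (COND a c d) Q x \<longleftrightarrow> (if aval a (fst x) \<noteq> 0 then wp c Q x else wp d Q x)"
proof (cases "aval a (fst x) = 0")
  case True
  have "exec \<sigma> S W (COND a c d) x y \<longleftrightarrow> exec \<sigma> S W d x y" for y
  proof
    assume "exec \<sigma> S W (COND a c d) x y"
    then show "exec \<sigma> S W d x y" by (rule exec_CondE) (simp_all add: True)
  qed (rule exec.Cond_False[OF True])
  then show ?thesis using True unfolding wp_def by simp
next
  case False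
  have "exec \<sigma> S W (COND a c d) x y \<longleftrightarrow> exec \<sigma> S W c x y" for y
  proof
    assume "exec \<sigma> S W (COND a c d) x y"
    then show "exec \<sigma> S W c x y" by (rule exec_CondE) (simp_all add: False)
  qed (rule exec.Cond_True[OF False])
  then show ?thesis using False unfolding wp_def by simp
qed

lemma wp_loop_unfold: "wp (LOOP a c) Q x \<longleftrightarrow> (if aval a (fst x) \<noteq> 0 then wp c (wp (LOOP a c) Q) x else Q x)"
proof (cases "aval a (fst x) = 0")
  case True
  have "exec \<sigma> S W (LOOP a c) x y \<longleftrightarrow> y = x" for y
    using exec.Loop_False[of a x \<sigma> S W c, OF True] exec_deterministic by blast
  then show ?thesis using True unfolding wp_def by auto
next
  case False
  have "exec \<sigma> S W (LOOP a c) x y \<longleftrightarrow> (\<exists>z. exec \<sigma> S W c x z \<and> exec \<sigma> S W (LOOP a c) z y)" for y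
  proof
    assume "exec \<sigma> S W (LOOP a c) x y"
    then show "\<exists>z. exec \<sigma> S W c x z \<and> exec \<sigma> S W (LOOP a c) z y"
      by (rule exec_LoopE) (use False in blast)+
  qed (use exec.Loop_True[of a x, OF False] in blast)
  then show ?thesis using False unfolding wp_def by (simp only: if_True not_False_eq_True) blast
qed

lemma wp_loop:
  fixes \<mu> :: "config \<Rightarrow> nat"
  assumes "I x"
    and "\<And>y. I y \<Longrightarrow> aval a (fst y) \<noteq> 0 \<Longrightarrow> wp c (\<lambda>z. I z \<and> \<mu> z < \<mu> y) y"
    and "\<And>y. I y \<Longrightarrow> aval a (fst y) = 0 \<Longrightarrow> Q y"
  shows "wp (LOOP a c) Q x"
  using assms(1)
proof (induction "\<mu> x" arbitrary: x rule: less_induct)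
  case less
  show ?case
  proof (cases "aval a (fst x) = 0")
    case True then show ?thesis using assms(3) less.prems by (subst wp_loop_unfold) simp
  next
    case False
    have "wp c (wp (LOOP a c) Q) x"
      using assms(2)[OF less.prems False] by (rule wp_mono) (use less.hyps in blast)
    then show ?thesis using False by (subst wp_loop_unfold) simp
  qed
qed

lemma wp_rewind [simp]: "wp REWIND Q (m, es, i) \<longleftrightarrow> Q (m, \<sigma> i, Suc i)"
proof -
  have "exec \<sigma> S W REWIND (m, es, i) y \<longleftrightarrow> y = (m, \<sigma> i, Suc i)" for y
    using exec.Rewind[of \<sigma> S W m es i] exec_deterministic by blast
  then show ?thesis unfolding wp_def by simp
qed

lemma wp_set [simp]: "r < 20 \<Longrightarrow> wp (SET r e) Q (mem \<rho> \<kappa>, es, i) \<longleftrightarrow>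
    r < S \<and> aval e (mem \<rho> \<kappa>) < W \<and> Q (mem (\<rho>(r := aval e (mem \<rho> \<kappa>))) \<kappa>, es, i)"
  unfolding SET_def wp_store by (simp add: mem_upd_reg)

lemma wp_put [simp]: "c < 9 \<Longrightarrow> wp (PUT c v e) Q (mem \<rho> \<kappa>, es, i) \<longleftrightarrow>
    20 + c + 9 * aval v (mem \<rho> \<kappa>) < S \<and> aval e (mem \<rho> \<kappa>) < W \<and>
    Q (mem \<rho> (\<kappa>(c := (\<kappa> c)(aval v (mem \<rho> \<kappa>) := aval e (mem \<rho> \<kappa>)))), es, i)"
  unfolding PUT_def wp_store by (simp add: mem_upd_col)

lemma wp_local_loop:
  fixes \<mu> :: "(nat \<Rightarrow> nat) \<Rightarrow> (nat \<Rightarrow> nat \<Rightarrow> nat) \<Rightarrow> nat"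
  assumes init: "I \<rho> \<kappa>"
    and step: "\<And>\<rho> \<kappa>. I \<rho> \<kappa> \<Longrightarrow> aval a (mem \<rho> \<kappa>) \<noteq> 0 \<Longrightarrow>
      wp c (lift es i (\<lambda>\<rho>' \<kappa>'. I \<rho>' \<kappa>' \<and> \<mu> \<rho>' \<kappa>' < \<mu> \<rho> \<kappa>)) (mem \<rho> \<kappa>, es, i)"
    and fin: "\<And>\<rho> \<kappa>. I \<rho> \<kappa> \<Longrightarrow> aval a (mem \<rho> \<kappa>) = 0 \<Longrightarrow> Q (mem \<rho> \<kappa>, es, i)"
  shows "wp (LOOP a c) Q (mem \<rho> \<kappa>, es, i)"
  using init
proof (induction "\<mu> \<rho> \<kappa>" arbitrary: \<rho> \<kappa> rule: less_induct)
  case less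
  show ?case
  proof (cases "aval a (mem \<rho> \<kappa>) = 0")
    case True then show ?thesis using fin less.prems by (subst wp_loop_unfold) simp
  next
    case False
    have "wp c (wp (LOOP a c) Q) (mem \<rho> \<kappa>, es, i)"
      using step[OF less.prems False] by (rule wp_mono) (use less.hyps in \<open>auto simp: lift_def\<close>)
    then show ?thesis using False by (subst wp_loop_unfold) simp
  qed
qed

end

text \<open>\<open>room\<close> provides the registers and the rows 0 to \<open>n\<close>. The slack
  in \<open>word\<close> covers the clock, which reaches \<open>n + 1\<close>.\<close>

locale rows = machine +
  fixes n :: nat
  assumes room: "29 + 9 * n \<le> S" and word: "n + 5 < W"
begin

abbreviation V :: "nat set" where "V \<equiv> {1..n}"

lemma row_room_0 [simp]: "k < 29 \<Longrightarrow> k < S" using room by linarith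

lemma row_room [simp]: "v \<le> n \<Longrightarrow> k < 29 \<Longrightarrow> k + 9 * v < S" using room by linarith

lemma row_word [simp]: "v \<le> n + 5 \<Longrightarrow> v < W" using word by linarith

text \<open>The body starts with counter \<open>Suc k\<close> and has to establish the invariant for
  the state in which the counter is already \<open>k\<close>, because the decrement is a separate
  store after the body.\<close>

lemma wp_for:
  assumes r: "r < 20" "r \<noteq> 3" and n: "\<rho> 3 = n"
    and init: "I n (\<rho>(r := n)) \<kappa>"
    and step: "\<And>k \<rho> \<kappa>. k < n \<Longrightarrow> I (Suc k) \<rho> \<kappa> \<Longrightarrow> \<rho> r = Suc k \<Longrightarrow>
      wp c (lift es i (\<lambda>\<rho>' \<kappa>'. \<rho>' r = Suc k \<and> I k (\<rho>'(r := k)) \<kappa>')) (mem \<rho> \<kappa>, es, i)"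
    and fin: "\<And>\<rho> \<kappa>. I 0 \<rho> \<kappa> \<Longrightarrow> \<rho> r = 0 \<Longrightarrow> Q (mem \<rho> \<kappa>, es, i)"
  shows "wp (FOR r c) Q (mem \<rho> \<kappa>, es, i)"
proof -
  have body: "wp (LOOP (reg r) (c ;; SET r (Minus (reg r) (Const (Suc 0))))) Q (mem \<rho> \<kappa>, es, i)"
    if "I k \<rho> \<kappa>" "\<rho> r = k" "k \<le> n" for k \<rho> \<kappa>
    using that
  proof (induction k arbitrary: \<rho> \<kappa>)
    case 0
    then show ?case using fin r by (subst wp_loop_unfold) simp
  next
    case (Suc k)
    have "wp c (wp (SET r (Minus (reg r) (Const (Suc 0)))) (wp (LOOP (reg r) (c ;; SET r (Minus (reg r) (Const (Suc 0))))) Q))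
        (mem \<rho> \<kappa>, es, i)"
    proof (rule wp_mono[OF step[of k]])
      fix y assume "lift es i (\<lambda>\<rho>' \<kappa>'. \<rho>' r = Suc k \<and> I k (\<rho>'(r := k)) \<kappa>') y"
      then obtain \<rho>' \<kappa>' where y: "y = (mem \<rho>' \<kappa>', es, i)" "\<rho>' r = Suc k" "I k (\<rho>'(r := k)) \<kappa>'"
        unfolding lift_def by blast
      have "wp (LOOP (reg r) (c ;; SET r (Minus (reg r) (Const (Suc 0))))) Q (mem (\<rho>'(r := k)) \<kappa>', es, i)"
        by (rule Suc.IH[OF y(3)]) (use Suc.prems in simp_all)
      then show "wp (SET r (Minus (reg r) (Const (Suc 0)))) (wp (LOOP (reg r) (c ;; SET r (Minus (reg r) (Const (Suc 0))))) Q) y"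
        using y(1,2) Suc.prems r by simp
    qed (use Suc.prems in auto)
    then show ?case using Suc.prems r by (subst wp_loop_unfold) simp
  qed
  show ?thesis
    unfolding FOR_def using r n body[of n "\<rho>(r := n)" \<kappa>] init by simp
qed

end

text \<open>Outcome of a search for a code, with 0 for a code that has no row. Stale parent entries
  thereby turn into the dummy by themselves.\<close>

definition is_row :: "nat \<Rightarrow> (nat \<Rightarrow> nat) \<Rightarrow> nat \<Rightarrow> nat \<Rightarrow> bool" where
  "is_row n name q v \<longleftrightarrow> (v \<in> {1..n} \<and> Suc (name v) = q) \<or> (v = 0 \<and> (\<forall>v\<in>{1..n}. Suc (name v) \<noteq> q))"

text \<open>Registers: 3 number of rows, 4 start of the rerooting (a code), 5 and 6 clock, 7 and 8 loop
  counters, 9 and 10 positions in the old forest, 11 and 12 the edge to be attached, 13 and 14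
  arguments, 15 result of a search, 16 and 17 endpoints of the current edge, 18 rows in total.
  Columns: 0 name, 1 parent in the table, 2 parent in the old forest, 3 parent in the new tree,
  4 time of the visit, 5 size, 6 heavy child, 7 and 8 the edges recorded by the pass. Row 0 stands
  for the dummy root; columns 0 and 1 hold names and codes, the others row numbers.\<close>

definition LOOKUP :: com where
  "LOOKUP = SET 15 (Const 0) ;;
     FOR 8 (COND (EQ (Plus (col 0 (reg 8)) (Const (Suc 0))) (reg 14)) (SET 15 (reg 8)) SKIP)"

text \<open>The answer is register 13 itself or 0. Hence the test fails when register 13 is 0,
  although 0 is an ancestor of every row; the loop that descends a heavy path relies on this to stop
  at its end.\<close>

definition IN_SUBTREE :: com where
  "IN_SUBTREE = SET 10 (reg 14) ;;
     LOOP (Times (reg 10) (NOT (EQ (reg 10) (reg 13)))) (SET 10 (col 2 (reg 10)))"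

text \<open>Row 0 has a nonzero time, so the walk stops at the dummy at the latest.\<close>

definition WALK :: com where
  "WALK = LOOP (NOT (col 4 (reg 12)))
     (PUT 3 (reg 12) (reg 11) ;; SET 5 (Plus (reg 5) (Const (Suc 0))) ;; PUT 4 (reg 12) (reg 5) ;;
      SET 11 (reg 12) ;; SET 12 (col 2 (reg 12)))"

context rows
begin

lemma wp_lookup:
  assumes n: "\<rho> 3 = n"
    and Q: "\<And>v. is_row n (\<kappa> 0) (\<rho> 14) v \<Longrightarrow> Q (mem (\<rho>(15 := v, 8 := 0)) \<kappa>, es, i)"
  shows "wp LOOKUP Q (mem \<rho> \<kappa>, es, i)"
proof -
  define I where "I k \<rho>' \<kappa>' \<longleftrightarrow> (\<exists>v. \<rho>' = \<rho>(15 := v, 8 := k) \<and> \<kappa>' = \<kappa> \<and>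
      ((v \<in> V \<and> Suc (\<kappa> 0 v) = \<rho> 14) \<or> (v = 0 \<and> (\<forall>v\<in>{Suc k..n}. Suc (\<kappa> 0 v) \<noteq> \<rho> 14))))"
    for k and \<rho>' :: "nat \<Rightarrow> nat" and \<kappa>' :: "nat \<Rightarrow> nat \<Rightarrow> nat"
  show ?thesis
    unfolding LOOKUP_def
    apply simp
  proof (rule wp_for[where I = I])
    show "I n ((\<rho>(15 := 0))(8 := n)) \<kappa>" unfolding I_def by auto
    fix k \<rho>1 \<kappa>1 assume k: "k < n" and I: "I (Suc k) \<rho>1 \<kappa>1"
    then obtain v where v: "\<rho>1 = \<rho>(15 := v, 8 := Suc k)" "\<kappa>1 = \<kappa>"
      "(v \<in> V \<and> Suc (\<kappa> 0 v) = \<rho> 14) \<or> (v = 0 \<and> (\<forall>v\<in>{Suc (Suc k)..n}. Suc (\<kappa> 0 v) \<noteq> \<rho> 14))"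
      unfolding I_def by blast
    have *: "{Suc k..n} = insert (Suc k) {Suc (Suc k)..n}" using k by auto
    show "wp (COND (EQ (Plus (col 0 (reg 8)) (Const (Suc 0))) (reg 14)) (SET 15 (reg 8)) SKIP)
         (lift es i (\<lambda>\<rho>' \<kappa>'. \<rho>' 8 = Suc k \<and> I k (\<rho>'(8 := k)) \<kappa>')) (mem \<rho>1 \<kappa>1, es, i)"
    proof (cases "Suc (\<kappa> 0 (Suc k)) = \<rho> 14")
      case True
      then show ?thesis using k unfolding v
        by (simp, intro liftI) (auto simp: I_def fun_eq_iff)
    next
      case False
      then show ?thesis using k v(3) * unfolding v(1,2)
        by (simp, intro liftI) (auto simp: I_def fun_eq_iff)
    qed
  next
    fix \<rho>1 \<kappa>1 assume "I 0 \<rho>1 \<kappa>1"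
    then obtain v where v: "\<rho>1 = \<rho>(15 := v, 8 := 0)" "\<kappa>1 = \<kappa>"
      "(v \<in> V \<and> Suc (\<kappa> 0 v) = \<rho> 14) \<or> (v = 0 \<and> (\<forall>v\<in>{Suc 0..n}. Suc (\<kappa> 0 v) \<noteq> \<rho> 14))"
      unfolding I_def by blast
    then show "Q (mem \<rho>1 \<kappa>1, es, i)" using Q[of v] unfolding is_row_def by simp
  qed (use n in simp_all)
qed

lemma V_le: "v \<in> insert 0 V \<longleftrightarrow> v \<le> n" by auto

lemma wp_in_subtree:
  assumes F: "forest V (\<kappa> 2)" and q: "\<rho> 14 \<le> n"
    and Q: "Q (mem (\<rho>(10 := if anc (\<kappa> 2) (\<rho> 13) (\<rho> 14) then \<rho> 13 else 0)) \<kappa>, es, i)"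
  shows "wp IN_SUBTREE Q (mem \<rho> \<kappa>, es, i)"
proof -
  let ?f = "\<kappa> 2"
  obtain r :: "nat \<Rightarrow> nat" where r: "\<And>v. v \<in> V \<Longrightarrow> r (?f v) < r v"
    using forest_rank[OF F] by metis
  define I where "I \<rho>' \<kappa>' \<longleftrightarrow> (\<exists>w. \<rho>' = \<rho>(10 := w) \<and> \<kappa>' = \<kappa> \<and> w \<le> n \<and>
      (anc ?f (\<rho> 13) (\<rho> 14) \<longleftrightarrow> anc ?f (\<rho> 13) w))"
    for \<rho>' :: "nat \<Rightarrow> nat" and \<kappa>' :: "nat \<Rightarrow> nat \<Rightarrow> nat"
  have "wp (LOOP (Times (reg 10) (NOT (EQ (reg 10) (reg 13)))) (SET 10 (col 2 (reg 10)))) Q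
     (mem (\<rho>(10 := \<rho> 14)) \<kappa>, es, i)"
  proof (rule wp_local_loop[where I = I and \<mu> = "\<lambda>\<rho> \<kappa>. r (\<rho> 10)"])
    show "I (\<rho>(10 := \<rho> 14)) \<kappa>" unfolding I_def using q by blast
  next
    fix \<rho>1 \<kappa>1 assume I: "I \<rho>1 \<kappa>1" and a: "aval (Times (reg 10) (NOT (EQ (reg 10) (reg 13)))) (mem \<rho>1 \<kappa>1) \<noteq> 0"
    then obtain w where w: "\<rho>1 = \<rho>(10 := w)" "\<kappa>1 = \<kappa>" "w \<le> n"
      "anc ?f (\<rho> 13) (\<rho> 14) \<longleftrightarrow> anc ?f (\<rho> 13) w"
      unfolding I_def by blast
    have w2: "w \<in> V" "w \<noteq> \<rho> 13" using a w by (auto split: if_splits)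
    then have "?f w \<le> n" using forest_closed[OF F, of w] by auto
    moreover have "anc ?f (\<rho> 13) w \<longleftrightarrow> anc ?f (\<rho> 13) (?f w)" using w2 anc_step[of ?f "\<rho> 13" w] by auto
    ultimately have "I (\<rho>(10 := ?f w)) \<kappa>" unfolding I_def using w by blast
    then show "wp (SET 10 (col 2 (reg 10))) (lift es i (\<lambda>\<rho>' \<kappa>'. I \<rho>' \<kappa>' \<and> r (\<rho>' 10) < r (\<rho>1 10)))
         (mem \<rho>1 \<kappa>1, es, i)"
      unfolding w(1,2) using \<open>?f w \<le> n\<close> r[OF w2(1)] by (simp, intro liftI) simp
  next
    fix \<rho>1 \<kappa>1 assume I: "I \<rho>1 \<kappa>1" and a: "aval (Times (reg 10) (NOT (EQ (reg 10) (reg 13)))) (mem \<rho>1 \<kappa>1) = 0"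
    then obtain w where w: "\<rho>1 = \<rho>(10 := w)" "\<kappa>1 = \<kappa>" "w \<le> n"
      "anc ?f (\<rho> 13) (\<rho> 14) \<longleftrightarrow> anc ?f (\<rho> 13) w"
      unfolding I_def by blast
    have "w = 0 \<or> w = \<rho> 13" using a w by (auto split: if_splits)
    then have "w = (if anc ?f (\<rho> 13) (\<rho> 14) then \<rho> 13 else 0)"
      using w(4) anc_0[OF F, of "\<rho> 13"] anc_refl[of ?f w] by (metis (full_types))
    then show "Q (mem \<rho>1 \<kappa>1, es, i)" using Q w by simp
  qed
  then show ?thesis unfolding IN_SUBTREE_def using q by simp
qed

lemma wp_walk:
  assumes F: "forest V (\<kappa> 2)" and x: "\<rho> 12 \<le> n" and s: "\<rho> 11 \<le> n"
    and k: "\<forall>j<k. \<kappa> 4 ((\<kappa> 2 ^^ j) (\<rho> 12)) = 0" "\<kappa> 4 ((\<kappa> 2 ^^ k) (\<rho> 12)) \<noteq> 0" "\<kappa> 4 0 \<noteq> 0"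
    and c: "\<rho> 5 + k \<le> n + 1"
    and Q: "\<And>st' sp' s' x'. walked (\<kappa> 2) (\<rho> 11) (\<rho> 12) k (\<kappa> 4) (\<kappa> 3) (\<rho> 5) st' sp' \<Longrightarrow>
       Q (mem (\<rho>(5 := \<rho> 5 + k, 11 := s', 12 := x')) (\<kappa>(3 := sp', 4 := st')), es, i)"
  shows "wp WALK Q (mem \<rho> \<kappa>, es, i)"
proof -
  let ?f = "\<kappa> 2"
  define p where "p j = (?f ^^ j) (\<rho> 12)" for j
  have pn: "p j \<le> n" for j
  proof -
    have "p j \<in> insert 0 V"
      unfolding p_def by (rule anc_mem[OF F anc_funpow]) (use x in \<open>simp only: V_le\<close>)
    then show ?thesis by (simp only: V_le)
  qed
  have p0: "p j \<noteq> 0" if "j < k" for j using k that unfolding p_def by metis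
  have inj: "inj_on p {..<k}"
    using forest_path_inj[OF F, of "\<rho> 12" k] x V_le p0 unfolding p_def by blast
  define I where "I \<rho>' \<kappa>' \<longleftrightarrow> (\<exists>j st' sp'. j \<le> k \<and> walked ?f (\<rho> 11) (\<rho> 12) j (\<kappa> 4) (\<kappa> 3) (\<rho> 5) st' sp' \<and>
      \<rho>' = \<rho>(5 := \<rho> 5 + j, 11 := (case j of 0 \<Rightarrow> \<rho> 11 | Suc j' \<Rightarrow> p j'), 12 := p j) \<and>
      \<kappa>' = \<kappa>(3 := sp', 4 := st'))"
    for \<rho>' :: "nat \<Rightarrow> nat" and \<kappa>' :: "nat \<Rightarrow> nat \<Rightarrow> nat"
  \<comment> \<open>The vertex about to be examined has not been written by this walk, so the guard
    reads its time from before.\<close>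
  have stp: "st' (p j) = \<kappa> 4 (p j)" if "walked ?f (\<rho> 11) (\<rho> 12) j (\<kappa> 4) (\<kappa> 3) (\<rho> 5) st' sp'" "j \<le> k" for j st' sp'
  proof -
    have "p j \<notin> p ` {..<j}"
    proof (cases "j = k")
      case True
      then show ?thesis using k unfolding p_def by auto
    next
      case False
      show ?thesis
      proof
        assume "p j \<in> p ` {..<j}"
        then obtain i where "i < j" "p j = p i" by blast
        then show False using inj_onD[OF inj, of j i] False that(2) by simp
      qed
    qed
    then show ?thesis using that(1) unfolding walked_def p_def by blast
  qed
  show ?thesis
    unfolding WALK_def
  proof (rule wp_local_loop[where I = I and \<mu> = "\<lambda>\<rho>' \<kappa>. \<rho> 5 + k - \<rho>' 5"])
    show "I \<rho> \<kappa>"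
      unfolding I_def
    proof (intro exI conjI)
      show "walked ?f (\<rho> 11) (\<rho> 12) 0 (\<kappa> 4) (\<kappa> 3) (\<rho> 5) (\<kappa> 4) (\<kappa> 3)" unfolding walked_def by simp
      show "\<rho> = \<rho>(5 := \<rho> 5 + 0, 11 := (case 0 of 0 \<Rightarrow> \<rho> 11 | Suc j' \<Rightarrow> p j'), 12 := p 0)"
        unfolding p_def by simp
    qed simp_all
  next
    fix \<rho>1 \<kappa>1 assume I: "I \<rho>1 \<kappa>1" and a: "aval (NOT (col 4 (reg 12))) (mem \<rho>1 \<kappa>1) \<noteq> 0"
    then obtain j st' sp' where j: "j \<le> k" and w: "walked ?f (\<rho> 11) (\<rho> 12) j (\<kappa> 4) (\<kappa> 3) (\<rho> 5) st' sp'"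
      and r1: "\<rho>1 = \<rho>(5 := \<rho> 5 + j, 11 := (case j of 0 \<Rightarrow> \<rho> 11 | Suc j' \<Rightarrow> p j'), 12 := p j)"
      and k1: "\<kappa>1 = \<kappa>(3 := sp', 4 := st')"
      unfolding I_def by blast
    have "st' (p j) = 0" using a unfolding r1 k1 by simp
    then have jk: "j < k" using stp[OF w j] k(2) j unfolding p_def by (metis le_neq_implies_less)
    let ?s = "case j of 0 \<Rightarrow> \<rho> 11 | Suc j' \<Rightarrow> p j'"
    have s': "?s \<le> n" using s pn by (cases j) simp_all
    have fp: "?f (p j) = p (Suc j)" unfolding p_def by simp
    have "p i \<noteq> p j" "p j \<noteq> p i" if "i < j" for i using inj_onD[OF inj, of i j] jk that by auto
    then have "walked ?f (\<rho> 11) (\<rho> 12) (Suc j) (\<kappa> 4) (\<kappa> 3) (\<rho> 5) (st'(p j := Suc (\<rho> 5 + j))) (sp'(p j := ?s))"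
      using w unfolding walked_def p_def[symmetric]
      by (auto simp: less_Suc_eq lessThan_Suc split: nat.splits)
    then have "I (\<rho>(5 := Suc (\<rho> 5 + j), 11 := p j, 12 := p (Suc j)))
       (\<kappa>(3 := sp'(p j := ?s), 4 := st'(p j := Suc (\<rho> 5 + j))))"
      unfolding I_def using jk by (intro exI[of _ "Suc j"] exI conjI) auto
    then show "wp (PUT 3 (reg 12) (reg 11) ;; SET 5 (Plus (reg 5) (Const (Suc 0))) ;; PUT 4 (reg 12) (reg 5) ;;
      SET 11 (reg 12) ;; SET 12 (col 2 (reg 12)))
       (lift es i (\<lambda>\<rho>' \<kappa>'. I \<rho>' \<kappa>' \<and> \<rho> 5 + k - \<rho>' 5 < \<rho> 5 + k - \<rho>1 5)) (mem \<rho>1 \<kappa>1, es, i)"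
      unfolding r1 k1 using pn[of j] pn[of "Suc j"] s' c jk fp
      apply simp
      apply (intro liftI)
      apply (simp add: fun_upd_twist)
      done
  next
    fix \<rho>1 \<kappa>1 assume I: "I \<rho>1 \<kappa>1" and a: "aval (NOT (col 4 (reg 12))) (mem \<rho>1 \<kappa>1) = 0"
    then obtain j st' sp' where j: "j \<le> k" and w: "walked ?f (\<rho> 11) (\<rho> 12) j (\<kappa> 4) (\<kappa> 3) (\<rho> 5) st' sp'"
      and r1: "\<rho>1 = \<rho>(5 := \<rho> 5 + j, 11 := (case j of 0 \<Rightarrow> \<rho> 11 | Suc j' \<Rightarrow> p j'), 12 := p j)"
      and k1: "\<kappa>1 = \<kappa>(3 := sp', 4 := st')"
      unfolding I_def by blast
    have "st' (p j) \<noteq> 0" using a unfolding r1 k1 by simp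
    then have "\<kappa> 4 (p j) \<noteq> 0" using stp[OF w j] by simp
    then have "j = k" using k(1) j unfolding p_def by (metis le_neq_implies_less)
    then show "Q (mem \<rho>1 \<kappa>1, es, i)" using Q w unfolding r1 k1 by blast
  qed
qed

end

section \<open>The rerooting program\<close>

definition keeps :: "nat set \<Rightarrow> (nat \<Rightarrow> 'a) \<Rightarrow> (nat \<Rightarrow> 'a) \<Rightarrow> bool" where
  "keeps X g g' \<longleftrightarrow> (\<forall>r. r \<notin> X \<longrightarrow> g' r = g r)"

text \<open>The path consists of \<open>k\<close> distinct unvisited vertices, so the clock stays at
  or below \<open>card V + 1\<close> and fits into a word.\<close>

lemma unvisited_path_room:
  fixes st :: "nat \<Rightarrow> nat"
  assumes F: "forest V f" and x: "x \<in> insert 0 V" and s0: "st 0 \<noteq> 0"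
    and k: "\<forall>j<k. st ((f ^^ j) x) = 0"
  shows "Suc (card {v \<in> V. st v \<noteq> 0}) + k \<le> card V + 1"
proof -
  let ?p = "\<lambda>j. (f ^^ j) x"
  have p0: "?p j \<noteq> 0" if "j < k" for j using k s0 that by metis
  have inj: "inj_on ?p {..<k}" using forest_path_inj[OF F x] p0 by blast
  have "?p ` {..<k} \<subseteq> {v \<in> V. st v = 0}"
  proof
    fix v assume "v \<in> ?p ` {..<k}"
    then obtain j where j: "j < k" "v = ?p j" by blast
    have "v \<in> insert 0 V" unfolding j by (rule anc_mem[OF F anc_funpow x])
    moreover have "v \<noteq> 0" "st v = 0" using p0[OF j(1)] k j by simp_all
    ultimately show "v \<in> {v \<in> V. st v = 0}" by simp
  qed
  moreover have fin: "finite V" using F unfolding forest_def by blast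
  ultimately have "card (?p ` {..<k}) \<le> card {v \<in> V. st v = 0}" by (intro card_mono) simp_all
  then have "k \<le> card {v \<in> V. st v = 0}" using card_image[OF inj] by simp
  moreover have "card {v \<in> V. st v = 0} + card {v \<in> V. st v \<noteq> 0} = card V"
  proof -
    have "{v \<in> V. st v = 0} \<union> {v \<in> V. st v \<noteq> 0} = V" "{v \<in> V. st v = 0} \<inter> {v \<in> V. st v \<noteq> 0} = {}" by auto
    then show ?thesis using card_Un_disjoint[of "{v \<in> V. st v = 0}" "{v \<in> V. st v \<noteq> 0}"] fin by simp
  qed
  ultimately show ?thesis by linarith
qed

text \<open>Codes in column 1 become row numbers in column 2. Row 0 is initialised as well, because
  the time and the size of the dummy are read later and its cells may still hold vertex names of the
  initial memory.\<close>

definition ROWS :: com where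
  "ROWS = FOR 7 (SET 14 (col (Suc 0) (reg 7)) ;; LOOKUP ;; PUT 2 (reg 7) (reg 15) ;; PUT 4 (reg 7) (Const 0) ;;
       PUT 5 (reg 7) (Const 0) ;; PUT 6 (reg 7) (Const 0)) ;;
     PUT 2 (Const 0) (Const 0) ;; PUT 3 (Const 0) (Const 0) ;; PUT 4 (Const 0) (Const (Suc 0)) ;;
     PUT 5 (Const 0) (Const 0) ;; PUT 6 (Const 0) (Const 0) ;; SET 5 (Const (Suc 0))"

text \<open>Every vertex adds one to each of its ancestors. Climbing afresh from each vertex
  replaces a traversal with a stack.\<close>

definition SIZES :: com where
  "SIZES = FOR 7 (SET 9 (reg 7) ;;
     LOOP (reg 9) (PUT 5 (reg 9) (Plus (col 5 (reg 9)) (Const (Suc 0))) ;; SET 9 (col 2 (reg 9))))"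

text \<open>Row 0 has size 0, so the comparison with a child that is still missing always succeeds.
  The roots compete for an entry in row 0, which is erased at the end because the dummy has no heavy
  child.\<close>

definition HEAVY :: com where
  "HEAVY = FOR 7 (SET 9 (col 2 (reg 7)) ;;
       COND (LT (col 5 (col 6 (reg 9))) (col 5 (reg 7))) (PUT 6 (reg 9) (reg 7)) SKIP) ;;
     PUT 6 (Const 0) (Const 0)"

context rows
begin

lemma row_room_Suc [simp]: "v < n \<Longrightarrow> k < 38 \<Longrightarrow> k + 9 * v < S" using room by linarith

lemma wp_rows:
  assumes n: "\<rho> 3 = n" and out: "\<forall>v\<in>V. \<kappa> 1 v < W"
    and Q: "\<And>\<rho>' \<kappa>'. keeps {5, 7, 8, 14, 15} \<rho> \<rho>' \<Longrightarrow> \<rho>' 5 = 1 \<Longrightarrow> keeps {2, 3, 4, 5, 6} \<kappa> \<kappa>' \<Longrightarrow>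
      (\<forall>v\<in>V. is_row n (\<kappa> 0) (\<kappa> 1 v) (\<kappa>' 2 v) \<and> \<kappa>' 4 v = 0 \<and> \<kappa>' 5 v = 0 \<and> \<kappa>' 6 v = 0) \<Longrightarrow>
      \<kappa>' 2 0 = 0 \<Longrightarrow> \<kappa>' 3 0 = 0 \<Longrightarrow> \<kappa>' 4 0 = 1 \<Longrightarrow> \<kappa>' 5 0 = 0 \<Longrightarrow> \<kappa>' 6 0 = 0 \<Longrightarrow> Q (mem \<rho>' \<kappa>', es, i)"
  shows "wp ROWS Q (mem \<rho> \<kappa>, es, i)"
proof -
  define I where "I k \<rho>' \<kappa>' \<longleftrightarrow> keeps {7, 8, 14, 15} \<rho> \<rho>' \<and> keeps {2, 4, 5, 6} \<kappa> \<kappa>' \<and>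
      (\<forall>v\<in>{Suc k..n}. is_row n (\<kappa> 0) (\<kappa> 1 v) (\<kappa>' 2 v) \<and> \<kappa>' 4 v = 0 \<and> \<kappa>' 5 v = 0 \<and> \<kappa>' 6 v = 0)"
    for k and \<rho>' :: "nat \<Rightarrow> nat" and \<kappa>' :: "nat \<Rightarrow> nat \<Rightarrow> nat"
  show ?thesis
    unfolding ROWS_def wp_seq
  proof (rule wp_for[where I = I])
    show "I n (\<rho>(7 := n)) \<kappa>" unfolding I_def keeps_def by simp
    fix k \<rho>1 \<kappa>1 assume k: "k < n" and I: "I (Suc k) \<rho>1 \<kappa>1" and r: "\<rho>1 7 = Suc k"
    have kr: "keeps {7, 8, 14, 15} \<rho> \<rho>1" and kk: "keeps {2, 4, 5, 6} \<kappa> \<kappa>1"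
      and old: "\<forall>v\<in>{Suc (Suc k)..n}. is_row n (\<kappa> 0) (\<kappa> 1 v) (\<kappa>1 2 v) \<and> \<kappa>1 4 v = 0 \<and> \<kappa>1 5 v = 0 \<and> \<kappa>1 6 v = 0"
      using I unfolding I_def by blast+
    have c: "\<kappa>1 0 = \<kappa> 0" "\<kappa>1 1 = \<kappa> 1" "\<kappa>1 (Suc 0) = \<kappa> 1" using kk unfolding keeps_def by auto
    have r3: "\<rho>1 3 = n" using kr n unfolding keeps_def by auto
    have w: "\<kappa> 1 (Suc k) < W" using out k by auto
    show "wp (SET 14 (col (Suc 0) (reg 7)) ;; LOOKUP ;; PUT 2 (reg 7) (reg 15) ;; PUT 4 (reg 7) (Const 0) ;;
       PUT 5 (reg 7) (Const 0) ;; PUT 6 (reg 7) (Const 0))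
         (lift es i (\<lambda>\<rho>' \<kappa>'. \<rho>' 7 = Suc k \<and> I k (\<rho>'(7 := k)) \<kappa>')) (mem \<rho>1 \<kappa>1, es, i)"
      using r w r3
      apply (simp add: c)
      apply (rule wp_lookup)
       apply simp
      subgoal premises p for v
      proof -
        have v: "is_row n (\<kappa> 0) (\<kappa> 1 (Suc k)) v" using p c by simp
        have "v \<le> n" using v unfolding is_row_def by auto
        moreover have "{Suc k..n} = insert (Suc k) {Suc (Suc k)..n}" using k by auto
        ultimately show ?thesis
          using r k v old kr kk c
          apply simp
          apply (intro liftI)
          apply (auto simp: I_def keeps_def)
          done
      qed
      done
  next
    fix \<rho>1 \<kappa>1 assume I: "I 0 \<rho>1 \<kappa>1"
    show "wp (PUT 2 (Const 0) (Const 0)) (wp (PUT 3 (Const 0) (Const 0)) (wp (PUT 4 (Const 0) (Const (Suc 0)))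
      (wp (PUT 5 (Const 0) (Const 0)) (wp (PUT 6 (Const 0) (Const 0)) (wp (SET 5 (Const (Suc 0))) Q)))))
        (mem \<rho>1 \<kappa>1, es, i)"
      apply simp
      apply (rule Q)
      using I unfolding I_def keeps_def by auto
  qed (use n in simp_all)
qed

lemma wp_sizes:
  assumes n: "\<rho> 3 = n" and F: "forest V (\<kappa> 2)" and z: "\<forall>v\<le>n. \<kappa> 5 v = 0"
    and Q: "\<And>\<rho>' \<kappa>'. keeps {7, 9} \<rho> \<rho>' \<Longrightarrow> keeps {5} \<kappa> \<kappa>' \<Longrightarrow> \<kappa>' 5 0 = 0 \<Longrightarrow>
      (\<forall>v\<in>V. \<kappa>' 5 v = card (sub V (\<kappa> 2) v)) \<Longrightarrow> Q (mem \<rho>' \<kappa>', es, i)"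
  shows "wp SIZES Q (mem \<rho> \<kappa>, es, i)"
proof -
  let ?f = "\<kappa> 2"
  obtain r :: "nat \<Rightarrow> nat" where r: "\<And>v. v \<in> V \<Longrightarrow> r (?f v) < r v"
    using forest_rank[OF F] by metis
  define I where "I k \<rho>' \<kappa>' \<longleftrightarrow> keeps {7, 9} \<rho> \<rho>' \<and> keeps {5} \<kappa> \<kappa>' \<and> \<kappa>' 5 0 = 0 \<and>
      (\<forall>v\<in>V. \<kappa>' 5 v = card {j \<in> {Suc k..n}. anc ?f v j})"
    for k and \<rho>' :: "nat \<Rightarrow> nat" and \<kappa>' :: "nat \<Rightarrow> nat \<Rightarrow> nat"
  show ?thesis
    unfolding SIZES_def
  proof (rule wp_for[where I = I])
    show "I n (\<rho>(7 := n)) \<kappa>" unfolding I_def keeps_def using z by simp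
    fix k \<rho>1 \<kappa>1 assume k: "k < n" and I: "I (Suc k) \<rho>1 \<kappa>1" and r7: "\<rho>1 7 = Suc k"
    have kr: "keeps {7, 9} \<rho> \<rho>1" and kk: "keeps {5} \<kappa> \<kappa>1" and z1: "\<kappa>1 5 0 = 0"
      and old: "\<forall>v\<in>V. \<kappa>1 5 v = card {j \<in> {Suc (Suc k)..n}. anc ?f v j}"
      using I unfolding I_def by blast+
    have f1: "\<kappa>1 2 = ?f" using kk unfolding keeps_def by simp
    \<comment> \<open>During the climb from \<open>Suc k\<close>, the vertices strictly below the
      current position \<open>\<rho>' 9\<close> have already been counted.\<close>
    define J where "J \<rho>' \<kappa>' \<longleftrightarrow> keeps {9} \<rho>1 \<rho>' \<and> keeps {5} \<kappa>1 \<kappa>' \<and> \<rho>' 9 \<le> n \<and> anc ?f (\<rho>' 9) (Suc k) \<and>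
        \<kappa>' 5 0 = 0 \<and>
        (\<forall>v\<in>V. \<kappa>' 5 v = \<kappa>1 5 v + (if anc ?f v (Suc k) \<and> \<not> anc ?f v (\<rho>' 9) then 1 else 0))"
      for \<rho>' :: "nat \<Rightarrow> nat" and \<kappa>' :: "nat \<Rightarrow> nat \<Rightarrow> nat"
    have le: "\<kappa>1 5 v < n" if "v \<in> V" for v
    proof -
      have "card {j \<in> {Suc (Suc k)..n}. anc ?f v j} \<le> card {Suc (Suc k)..n}" by (rule card_mono) auto
      then show ?thesis using old that k by simp
    qed
    have "wp (LOOP (reg 9) (PUT 5 (reg 9) (Plus (col 5 (reg 9)) (Const (Suc 0))) ;; SET 9 (col 2 (reg 9))))
       (lift es i (\<lambda>\<rho>' \<kappa>'. \<rho>' 7 = Suc k \<and> I k (\<rho>'(7 := k)) \<kappa>')) (mem (\<rho>1(9 := Suc k)) \<kappa>1, es, i)"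
    proof (rule wp_local_loop[where I = J and \<mu> = "\<lambda>\<rho> \<kappa>. r (\<rho> 9)"])
      show "J (\<rho>1(9 := Suc k)) \<kappa>1" unfolding J_def keeps_def using k z1 by auto
    next
      fix \<rho>2 \<kappa>2 assume J: "J \<rho>2 \<kappa>2" and a: "aval (reg 9) (mem \<rho>2 \<kappa>2) \<noteq> 0"
      define w where "w = \<rho>2 9"
      have J1: "keeps {9} \<rho>1 \<rho>2" "keeps {5} \<kappa>1 \<kappa>2" and J2: "w \<le> n" "anc ?f w (Suc k)" "\<kappa>2 5 0 = 0"
        and J3: "\<forall>v\<in>V. \<kappa>2 5 v = \<kappa>1 5 v + (if anc ?f v (Suc k) \<and> \<not> anc ?f v w then 1 else 0)"
        using J unfolding J_def w_def by blast+
      have wV: "w \<in> V" using a J2(1) unfolding w_def by simp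
      have f2: "\<kappa>2 2 = ?f" using J1(2) f1 unfolding keeps_def by simp
      have fw: "?f w \<le> n" using forest_closed[OF F wV[THEN insertI2]] by auto
      have v2: "\<kappa>2 5 w = \<kappa>1 5 w" using J3 wV by simp
      have nf: "\<not> anc ?f w (?f w)" using not_anc_parent[OF F wV] .
      have eq: "anc ?f v w \<longleftrightarrow> anc ?f v (?f w)" if "v \<noteq> w" for v using anc_step[of ?f v w] that by blast
      have "J (\<rho>2(9 := ?f w)) (\<kappa>2(5 := (\<kappa>2 5)(w := Suc (\<kappa>2 5 w))))"
        unfolding J_def
      proof (intro conjI ballI)
        show "anc ?f ((\<rho>2(9 := ?f w)) 9) (Suc k)" using J2(2) anc_trans anc_step[of ?f "?f w" w] by auto
        fix v assume v: "v \<in> V"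
        show "(\<kappa>2(5 := (\<kappa>2 5)(w := Suc (\<kappa>2 5 w)))) 5 v =
          \<kappa>1 5 v + (if anc ?f v (Suc k) \<and> \<not> anc ?f v ((\<rho>2(9 := ?f w)) 9) then 1 else 0)"
          using J3 v J2(2) v2 nf eq[of v] by (cases "v = w") simp_all
      qed (use J1 fw J2(3) wV in \<open>auto simp: keeps_def\<close>)
      then show "wp (PUT 5 (reg 9) (Plus (col 5 (reg 9)) (Const (Suc 0))) ;; SET 9 (col 2 (reg 9)))
          (lift es i (\<lambda>\<rho>' \<kappa>'. J \<rho>' \<kappa>' \<and> r (\<rho>' 9) < r (\<rho>2 9))) (mem \<rho>2 \<kappa>2, es, i)"
        using r[OF wV] le[OF wV] v2 J2(1) fw f2 unfolding w_def
        apply simp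
        apply (intro liftI)
        apply simp
        done
    next
      fix \<rho>2 \<kappa>2 assume J: "J \<rho>2 \<kappa>2" and a: "aval (reg 9) (mem \<rho>2 \<kappa>2) = 0"
      have w0: "\<rho>2 9 = 0" using a by simp
      have J3: "\<forall>v\<in>V. \<kappa>2 5 v = \<kappa>1 5 v + (if anc ?f v (Suc k) then 1 else 0)"
        using J w0 anc_0[OF F] unfolding J_def by simp
      have "\<kappa>2 5 v = card {j \<in> {Suc k..n}. anc ?f v j}" if v: "v \<in> V" for v
      proof -
        have "{j \<in> {Suc k..n}. anc ?f v j} = {j \<in> {Suc (Suc k)..n}. anc ?f v j} \<union> (if anc ?f v (Suc k) then {Suc k} else {})"
          using k by (auto simp: not_less_eq_eq le_Suc_eq) (metis not_less_eq_eq le_antisym)+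
        moreover have "{j \<in> {Suc (Suc k)..n}. anc ?f v j} \<inter> (if anc ?f v (Suc k) then {Suc k} else {}) = {}" by auto
        ultimately have "card {j \<in> {Suc k..n}. anc ?f v j} =
          card {j \<in> {Suc (Suc k)..n}. anc ?f v j} + card (if anc ?f v (Suc k) then {Suc k} else {})"
          by (simp add: card_Un_disjoint)
        then show ?thesis using J3 old v by simp
      qed
      then have "I k (\<rho>2(7 := k)) \<kappa>2"
        using J kr kk unfolding I_def J_def keeps_def by auto
      then show "lift es i (\<lambda>\<rho>' \<kappa>'. \<rho>' 7 = Suc k \<and> I k (\<rho>'(7 := k)) \<kappa>') (mem \<rho>2 \<kappa>2, es, i)"
        using J r7 unfolding J_def keeps_def by (intro liftI) simp
    qed
    then show "wp (SET 9 (reg 7) ;;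
     LOOP (reg 9) (PUT 5 (reg 9) (Plus (col 5 (reg 9)) (Const (Suc 0))) ;; SET 9 (col 2 (reg 9))))
      (lift es i (\<lambda>\<rho>' \<kappa>'. \<rho>' 7 = Suc k \<and> I k (\<rho>'(7 := k)) \<kappa>')) (mem \<rho>1 \<kappa>1, es, i)"
      using r7 k by simp
  next
    fix \<rho>1 \<kappa>1 assume I: "I 0 \<rho>1 \<kappa>1"
    show "Q (mem \<rho>1 \<kappa>1, es, i)"
    proof (rule Q)
      show "\<forall>v\<in>V. \<kappa>1 5 v = card (sub V ?f v)" using I unfolding I_def sub_def by simp
    qed (use I in \<open>simp_all add: I_def\<close>)
  qed (use n in simp_all)
qed

lemma wp_heavy:
  assumes n: "\<rho> 3 = n" and F: "forest V (\<kappa> 2)" and z: "\<forall>v\<le>n. \<kappa> 6 v = 0" "\<kappa> 5 0 = 0"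
    and sz: "\<forall>v\<in>V. \<kappa> 5 v = card (sub V (\<kappa> 2) v)"
    and Q: "\<And>\<rho>' \<kappa>'. keeps {7, 9} \<rho> \<rho>' \<Longrightarrow> keeps {6} \<kappa> \<kappa>' \<Longrightarrow> heavy V (\<kappa> 2) (\<kappa>' 6) \<Longrightarrow> Q (mem \<rho>' \<kappa>', es, i)"
  shows "wp HEAVY Q (mem \<rho> \<kappa>, es, i)"
proof -
  let ?f = "\<kappa> 2"
  have sz1: "\<kappa> 5 v > 0" if "v \<in> V" for v
  proof -
    have "v \<in> sub V ?f v" using that unfolding sub_def by simp
    then have "sub V ?f v \<noteq> {}" by blast
    then show ?thesis using sz that finite_sub[OF F] by (simp add: card_gt_0_iff)
  qed
  have fle: "?f v \<le> n" if "v \<le> n" for v using forest_closed[OF F, of v] that by (simp only: V_le)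
  define I where "I k \<rho>' \<kappa>' \<longleftrightarrow> keeps {7, 9} \<rho> \<rho>' \<and> keeps {6} \<kappa> \<kappa>' \<and>
      (\<forall>u\<le>n. \<kappa>' 6 u = 0 \<or> \<kappa>' 6 u \<in> {Suc k..n} \<and> ?f (\<kappa>' 6 u) = u) \<and>
      (\<forall>c\<in>{Suc k..n}. \<kappa>' 6 (?f c) \<noteq> 0 \<and> \<kappa> 5 c \<le> \<kappa> 5 (\<kappa>' 6 (?f c)))"
    for k and \<rho>' :: "nat \<Rightarrow> nat" and \<kappa>' :: "nat \<Rightarrow> nat \<Rightarrow> nat"
  show ?thesis
    unfolding HEAVY_def wp_seq
  proof (rule wp_for[where I = I])
    show "I n (\<rho>(7 := n)) \<kappa>" unfolding I_def keeps_def using z by simp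
    fix k \<rho>1 \<kappa>1 assume k: "k < n" and I: "I (Suc k) \<rho>1 \<kappa>1" and r7: "\<rho>1 7 = Suc k"
    have kr: "keeps {7, 9} \<rho> \<rho>1" and kk: "keeps {6} \<kappa> \<kappa>1"
      and I1: "\<forall>u\<le>n. \<kappa>1 6 u = 0 \<or> \<kappa>1 6 u \<in> {Suc (Suc k)..n} \<and> ?f (\<kappa>1 6 u) = u"
      and I2: "\<forall>c\<in>{Suc (Suc k)..n}. \<kappa>1 6 (?f c) \<noteq> 0 \<and> \<kappa> 5 c \<le> \<kappa> 5 (\<kappa>1 6 (?f c))"
      using I unfolding I_def by blast+
    have c: "\<kappa>1 2 = ?f" "\<kappa>1 5 = \<kappa> 5" using kk unfolding keeps_def by simp_all
    define p where "p = ?f (Suc k)"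
    have p: "p \<le> n" using fle[of "Suc k"] k p_def by simp
    have ins: "{Suc k..n} = insert (Suc k) {Suc (Suc k)..n}" using k by auto
    show "wp (SET 9 (col 2 (reg 7)) ;;
       COND (LT (col 5 (col 6 (reg 9))) (col 5 (reg 7))) (PUT 6 (reg 9) (reg 7)) SKIP)
         (lift es i (\<lambda>\<rho>' \<kappa>'. \<rho>' 7 = Suc k \<and> I k (\<rho>'(7 := k)) \<kappa>')) (mem \<rho>1 \<kappa>1, es, i)"
    proof (cases "\<kappa> 5 (\<kappa>1 6 p) < \<kappa> 5 (Suc k)")
      case True
      have "I k (\<rho>1(9 := p, 7 := k)) (\<kappa>1(6 := (\<kappa>1 6)(p := Suc k)))"
        unfolding I_def
      proof (intro conjI allI ballI impI)
        fix u assume "u \<le> n"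
        then show "(\<kappa>1(6 := (\<kappa>1 6)(p := Suc k))) 6 u = 0 \<or>
          (\<kappa>1(6 := (\<kappa>1 6)(p := Suc k))) 6 u \<in> {Suc k..n} \<and> ?f ((\<kappa>1(6 := (\<kappa>1 6)(p := Suc k))) 6 u) = u"
          using I1 k p_def by auto
      next
        fix c assume c: "c \<in> {Suc k..n}"
        then show "(\<kappa>1(6 := (\<kappa>1 6)(p := Suc k))) 6 (?f c) \<noteq> 0" using I2 ins p_def by auto
        show "\<kappa> 5 c \<le> \<kappa> 5 ((\<kappa>1(6 := (\<kappa>1 6)(p := Suc k))) 6 (?f c))"
        proof (cases "c = Suc k")
          case False
          then have "\<kappa> 5 c \<le> \<kappa> 5 (\<kappa>1 6 (?f c))" using I2 c by simp
          then show ?thesis using True by (cases "?f c = p") simp_all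
        qed (simp add: p_def)
      qed (use kr kk in \<open>auto simp: keeps_def\<close>)
      then show ?thesis using True r7 p k p_def
        by (simp add: c, intro liftI) (simp add: fun_upd_twist)
    next
      case False
      have "\<kappa>1 6 p \<noteq> 0"
      proof
        assume "\<kappa>1 6 p = 0"
        then show False using False sz1[of "Suc k"] z(2) k by simp
      qed
      have "I k (\<rho>1(9 := p, 7 := k)) \<kappa>1"
        unfolding I_def
      proof (intro conjI allI ballI impI)
        fix u assume "u \<le> n"
        then show "\<kappa>1 6 u = 0 \<or> \<kappa>1 6 u \<in> {Suc k..n} \<and> ?f (\<kappa>1 6 u) = u"
          using I1 unfolding ins by blast
      next
        fix c assume c: "c \<in> {Suc k..n}"
        show "\<kappa>1 6 (?f c) \<noteq> 0" "\<kappa> 5 c \<le> \<kappa> 5 (\<kappa>1 6 (?f c))"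
          using I2 c False \<open>\<kappa>1 6 p \<noteq> 0\<close> unfolding ins p_def by (cases "c = Suc k"; simp)+
      qed (use kr kk in \<open>simp_all add: keeps_def\<close>)
      then show ?thesis using False r7 p k p_def
        by (simp add: c, intro liftI) (simp add: fun_upd_twist)
    qed
  next
    fix \<rho>1 \<kappa>1 assume I: "I 0 \<rho>1 \<kappa>1"
    have kr: "keeps {7, 9} \<rho> \<rho>1" and kk: "keeps {6} \<kappa> \<kappa>1"
      and I1: "\<forall>u\<le>n. \<kappa>1 6 u = 0 \<or> \<kappa>1 6 u \<in> {Suc 0..n} \<and> ?f (\<kappa>1 6 u) = u"
      and I2: "\<forall>c\<in>{Suc 0..n}. \<kappa>1 6 (?f c) \<noteq> 0 \<and> \<kappa> 5 c \<le> \<kappa> 5 (\<kappa>1 6 (?f c))"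
      using I unfolding I_def by blast+
    have "heavy V ?f ((\<kappa>1 6)(0 := 0))"
      unfolding heavy_def
    proof (intro conjI ballI impI)
      fix c assume c: "c \<in> V" "?f c \<noteq> 0"
      then have fc: "\<kappa>1 6 (?f c) \<noteq> 0" "\<kappa> 5 c \<le> \<kappa> 5 (\<kappa>1 6 (?f c))" using I2 by auto
      moreover have "?f c \<le> n" using fle[of c] c by simp
      ultimately have "\<kappa>1 6 (?f c) \<in> V" using I1[rule_format, of "?f c"] by auto
      then show "((\<kappa>1 6)(0 := 0)) (?f c) \<noteq> 0"
        "card (sub V ?f c) \<le> card (sub V ?f (((\<kappa>1 6)(0 := 0)) (?f c)))"
        using fc sz c by simp_all
    next
      fix u assume u: "u \<in> V"
      then have "u \<le> n" "u \<noteq> 0" by simp_all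
      then have "\<kappa>1 6 u = 0 \<or> \<kappa>1 6 u \<in> {Suc 0..n} \<and> ?f (\<kappa>1 6 u) = u" using I1 by blast
      then show "((\<kappa>1 6)(0 := 0)) u \<in> insert 0 V"
        "((\<kappa>1 6)(0 := 0)) u \<noteq> 0 \<Longrightarrow> ?f (((\<kappa>1 6)(0 := 0)) u) = u"
        using \<open>u \<noteq> 0\<close> by auto
    qed simp
    then show "wp (PUT 6 (Const 0) (Const 0)) Q (mem \<rho>1 \<kappa>1, es, i)"
      apply simp
      apply (rule Q)
      using kr kk unfolding keeps_def by simp_all
  qed (use n in simp_all)
qed

end

section \<open>Walking until one heavy path is visited\<close>

definition ATTACH :: com where
  "ATTACH = SET 11 (Const 0) ;; SET 12 (reg 13) ;;
     FOR 8 (SET 14 (reg 8) ;; IN_SUBTREE ;;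
       COND (Times (reg 10) (LT (col 4 (reg 11)) (col 4 (col 8 (reg 8)))))
         (SET 11 (col 8 (reg 8)) ;; SET 12 (reg 8)) SKIP ;;
       SET 14 (col 7 (reg 8)) ;; IN_SUBTREE ;;
       COND (Times (reg 10) (LT (col 4 (reg 11)) (col 4 (reg 8))))
         (SET 11 (reg 8) ;; SET 12 (reg 14)) SKIP) ;;
     WALK"

text \<open>The parent of the current vertex is always visited, so an unvisited vertex met on the
  way down is the root of a remaining tree. After \<open>ATTACH\<close> the same vertex is tested
  again, found visited, and left for its heavy child.\<close>

definition CHAIN :: com where
  "CHAIN = SET 13 (reg 7) ;;
     LOOP (reg 13) (COND (col 4 (reg 13)) (SET 13 (col 6 (reg 13))) ATTACH)"

lemma partial_dfs_c_le:
  assumes "forest V f" "partial_dfs V E f st sp c"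
  shows "c \<le> Suc (card V)"
proof -
  have "card {v \<in> V. st v \<noteq> 0} \<le> card V"
    using assms(1) unfolding forest_def by (intro card_mono) auto
  then show ?thesis using partial_dfsD(5)[OF assms(2)] by simp
qed

context rows
begin

lemma wp_test_subtree:
  assumes F: "forest V (\<kappa> 2)" and q: "aval e (mem \<rho> \<kappa>) = q" "q \<le> n"
    and w: "w = (if anc (\<kappa> 2) (\<rho> 13) q then \<rho> 13 else 0)"
    and c: "wp c Q (mem (\<rho>(14 := q, 10 := w)) \<kappa>, es, i)"
  shows "wp (SET 14 e ;; IN_SUBTREE ;; c) Q (mem \<rho> \<kappa>, es, i)"
proof -
  have "wp IN_SUBTREE (wp c Q) (mem (\<rho>(14 := q)) \<kappa>, es, i)"
    by (rule wp_in_subtree) (use F q c w in \<open>simp_all split del: if_split cong: if_cong\<close>)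
  then show ?thesis using q by simp
qed

text \<open>There are two kinds of candidates: a vertex \<open>j\<close> of the subtree with its
  recorded neighbour \<open>\<kappa> 8 j\<close>, and a visited \<open>j\<close> whose recorded
  descendant \<open>\<kappa> 7 j\<close> is in the subtree; the latter catches neighbours visited
  since the pass. All candidates are genuine edges, and by \<open>cov\<close> no visited neighbour
  of the subtree is later than the best of them. So the edge found is the one that
  \<open>partial_dfs_walk\<close> asks for.\<close>

lemma wp_attach:
  assumes pre: "almost_dfs V E (\<kappa> 2) a" and part: "partial_dfs V E (\<kappa> 2) (\<kappa> 4) (\<kappa> 3) (\<rho> 5)"
    and a: "\<kappa> 4 a \<noteq> 0" and n: "\<rho> 3 = n"
    and z: "\<rho> 13 \<in> V" "\<kappa> 4 (\<rho> 13) = 0" "\<kappa> 4 (\<kappa> 2 (\<rho> 13)) \<noteq> 0"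
    and b: "\<forall>v\<in>V. \<kappa> 8 v \<le> n \<and> \<kappa> 4 (\<kappa> 8 v) \<noteq> 0 \<and> (\<kappa> 8 v \<noteq> 0 \<longrightarrow> E v (\<kappa> 8 v))"
    and e: "\<forall>u\<in>V. \<kappa> 7 u \<in> V \<and> (\<kappa> 7 u \<noteq> u \<longrightarrow> E u (\<kappa> 7 u))"
    and cov: "\<forall>y\<in>V. \<forall>w\<in>V. anc (\<kappa> 2) (\<rho> 13) y \<longrightarrow> \<kappa> 4 w \<noteq> 0 \<longrightarrow> E y w \<longrightarrow>
       \<kappa> 4 w \<le> \<kappa> 4 (\<kappa> 8 y) \<or> anc (\<kappa> 2) (\<rho> 13) (\<kappa> 7 w)"
    and Q: "\<And>\<rho>' st' sp'. keeps {5, 8, 10, 11, 12, 14} \<rho> \<rho>' \<Longrightarrow>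
       partial_dfs V E (\<kappa> 2) st' sp' (\<rho>' 5) \<Longrightarrow> (\<forall>v. \<kappa> 4 v \<noteq> 0 \<longrightarrow> st' v = \<kappa> 4 v) \<Longrightarrow>
       (\<forall>v. \<kappa> 4 v = 0 \<longrightarrow> st' v = 0 \<or> \<rho> 5 < st' v) \<Longrightarrow> st' (\<rho> 13) \<noteq> 0 \<Longrightarrow> \<rho> 5 \<le> \<rho>' 5 \<Longrightarrow>
       Q (mem \<rho>' (\<kappa>(3 := sp', 4 := st')), es, i)"
  shows "wp ATTACH Q (mem \<rho> \<kappa>, es, i)"
proof -
  let ?f = "\<kappa> 2" and ?st = "\<kappa> 4"
  define z where "z = \<rho> 13"
  note PD = partial_dfsD[OF part]
  have F: "forest V ?f" and sym: "\<And>u v. E u v \<Longrightarrow> E v u" using almost_dfsD(1,3)[OF pre] .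
  have st0: "?st 0 \<noteq> 0" using PD(1) by simp
  have up: "\<forall>v\<in>V. ?st v \<noteq> 0 \<longrightarrow> ?st (?f v) \<noteq> 0" using PD(3) .
  define I where "I k \<rho>' \<kappa>' \<longleftrightarrow> keeps {8, 10, 11, 12, 14} \<rho> \<rho>' \<and> \<kappa>' = \<kappa> \<and>
      \<rho>' 11 \<le> n \<and> ?st (\<rho>' 11) \<noteq> 0 \<and> \<rho>' 12 \<in> V \<and> anc ?f z (\<rho>' 12) \<and> (\<rho>' 11 \<noteq> 0 \<longrightarrow> E (\<rho>' 12) (\<rho>' 11)) \<and>
      (\<forall>j\<in>{Suc k..n}. (anc ?f z j \<longrightarrow> ?st (\<kappa> 8 j) \<le> ?st (\<rho>' 11)) \<and>
         (?st j \<noteq> 0 \<longrightarrow> anc ?f z (\<kappa> 7 j) \<longrightarrow> ?st j \<le> ?st (\<rho>' 11)))"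
    for k and \<rho>' :: "nat \<Rightarrow> nat" and \<kappa>' :: "nat \<Rightarrow> nat \<Rightarrow> nat"
  have zV: "z \<in> V" "z \<noteq> 0" "z \<le> n" using z(1) unfolding z_def by auto
  have unv: "?st y = 0" if "anc ?f z y" "y \<in> V" for y
    using visited_anc[OF F up st0 that(1)] that(2) z(2) unfolding z_def by blast
  show ?thesis
    unfolding ATTACH_def wp_seq
    using zV n z_def apply simp
  proof (rule wp_for[where I = I])
    show "I n (\<rho>(11 := 0, 12 := \<rho> 13, 8 := n)) \<kappa>" unfolding I_def keeps_def using st0 zV z_def by auto
    fix k \<rho>1 \<kappa>1 assume k: "k < n" and I: "I (Suc k) \<rho>1 \<kappa>1" and r8: "\<rho>1 8 = Suc k"
    define s x j where "s = \<rho>1 11" and "x = \<rho>1 12" and "j = Suc k"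
    have kr: "keeps {8, 10, 11, 12, 14} \<rho> \<rho>1" and k1: "\<kappa>1 = \<kappa>"
      and I1: "s \<le> n" "?st s \<noteq> 0" "x \<in> V" "anc ?f z x" "s \<noteq> 0 \<longrightarrow> E x s"
      and I2: "\<forall>j\<in>{Suc (Suc k)..n}. (anc ?f z j \<longrightarrow> ?st (\<kappa> 8 j) \<le> ?st s) \<and>
         (?st j \<noteq> 0 \<longrightarrow> anc ?f z (\<kappa> 7 j) \<longrightarrow> ?st j \<le> ?st s)"
      using I unfolding I_def s_def x_def by blast+
    have j: "j \<in> V" "j \<le> n" using k unfolding j_def by auto
    have z1: "\<rho>1 13 = z" using kr z_def unfolding keeps_def by simp
    have bj: "\<kappa> 8 j \<le> n" "?st (\<kappa> 8 j) \<noteq> 0" "\<kappa> 8 j \<noteq> 0 \<longrightarrow> E j (\<kappa> 8 j)" using b j by blast+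
    have ej: "\<kappa> 7 j \<in> V" "\<kappa> 7 j \<le> n" "\<kappa> 7 j \<noteq> j \<longrightarrow> E j (\<kappa> 7 j)" using e j by auto
    define s1 x1 where "s1 = (if anc ?f z j \<and> ?st s < ?st (\<kappa> 8 j) then \<kappa> 8 j else s)"
      and "x1 = (if anc ?f z j \<and> ?st s < ?st (\<kappa> 8 j) then j else x)"
    have S1: "s1 \<le> n" "?st s1 \<noteq> 0" "x1 \<in> V" "anc ?f z x1" "s1 \<noteq> 0 \<longrightarrow> E x1 s1" "?st s \<le> ?st s1"
      "anc ?f z j \<longrightarrow> ?st (\<kappa> 8 j) \<le> ?st s1"
      unfolding s1_def x1_def using I1 bj j by (auto split: if_splits)
    define s2 x2 where "s2 = (if anc ?f z (\<kappa> 7 j) \<and> ?st s1 < ?st j then j else s1)"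
      and "x2 = (if anc ?f z (\<kappa> 7 j) \<and> ?st s1 < ?st j then \<kappa> 7 j else x1)"
    \<comment> \<open>The subtree is unvisited whereas \<open>j\<close> has a positive time. So the
      entry is not the neutral value and records an actual edge.\<close>
    have "\<kappa> 7 j \<noteq> j" if "anc ?f z (\<kappa> 7 j)" "?st s1 < ?st j"
      using unv[OF that(1)] ej that(2) by auto
    then have S2: "s2 \<le> n" "?st s2 \<noteq> 0" "x2 \<in> V" "anc ?f z x2" "s2 \<noteq> 0 \<longrightarrow> E x2 s2" "?st s1 \<le> ?st s2"
      "anc ?f z (\<kappa> 7 j) \<longrightarrow> ?st j \<le> ?st s2"
      unfolding s2_def x2_def using S1 ej j sym by (auto split: if_splits)
    have x1n: "x1 \<le> n" "x2 \<le> n" using S1(3) S2(3) by auto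
    have I': "I k (\<rho>2(8 := k)) \<kappa>"
      if r2: "keeps {10, 11, 12, 14} \<rho>1 \<rho>2" "\<rho>2 11 = s2" "\<rho>2 12 = x2" for \<rho>2
      unfolding I_def
    proof (intro conjI ballI impI)
      fix j' assume j': "j' \<in> {Suc k..n}"
      show "?st (\<kappa> 8 j') \<le> ?st ((\<rho>2(8 := k)) 11)"
        if j'z: "anc ?f z j'"
      proof (cases "j' = j")
        case True then show ?thesis using S1(7) S2(6) j'z r2 by simp
      next
        case False
        then have "?st (\<kappa> 8 j') \<le> ?st s" using I2 j' j'z unfolding j_def by simp
        then show ?thesis using S1(6) S2(6) r2 by simp
      qed
      show "?st j' \<le> ?st ((\<rho>2(8 := k)) 11)"
        if j'z: "?st j' \<noteq> 0" "anc ?f z (\<kappa> 7 j')"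
      proof (cases "j' = j")
        case True then show ?thesis using S2(7) j'z r2 by simp
      next
        case False
        then have "?st j' \<le> ?st s" using I2 j' j'z unfolding j_def by simp
        then show ?thesis using S1(6) S2(6) r2 by simp
      qed
    qed (use kr S2 r2 in \<open>simp_all add: keeps_def\<close>)
    have r: "\<rho>1 8 = j" "\<rho>1 11 = s" "\<rho>1 12 = x" using r8 s_def x_def j_def by simp_all
    have second: "wp (SET 14 (col 7 (reg 8)) ;; IN_SUBTREE ;;
       COND (Times (reg 10) (LT (col 4 (reg 11)) (col 4 (reg 8))))
         (SET 11 (reg 8) ;; SET 12 (reg 14)) SKIP)
        (lift es i (\<lambda>\<rho>' \<kappa>'. \<rho>' 8 = Suc k \<and> I k (\<rho>'(8 := k)) \<kappa>'))
        (mem \<rho>2 \<kappa>, es, i)"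
      if r2: "keeps {10, 11, 12, 14} \<rho>1 \<rho>2" "\<rho>2 11 = s1" "\<rho>2 12 = x1" for \<rho>2
    proof -
      define w where "w = (if anc ?f z (\<kappa> 7 j) then z else 0)"
      let ?r = "\<rho>2(14 := \<kappa> 7 j, 10 := w)"
      have r3: "\<rho>2 8 = j" "\<rho>2 13 = z" using r2 r z1 unfolding keeps_def by simp_all
      have "wp (COND (Times (reg 10) (LT (col 4 (reg 11)) (col 4 (reg 8))))
         (SET 11 (reg 8) ;; SET 12 (reg 14)) SKIP)
         (lift es i (\<lambda>\<rho>' \<kappa>'. \<rho>' 8 = Suc k \<and> I k (\<rho>'(8 := k)) \<kappa>')) (mem ?r \<kappa>, es, i)"
      proof (cases "anc ?f z (\<kappa> 7 j) \<and> ?st s1 < ?st j")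
        case True
        then have "lift es i (\<lambda>\<rho>' \<kappa>'. \<rho>' 8 = Suc k \<and> I k (\<rho>'(8 := k)) \<kappa>')
          (mem (?r(11 := j, 12 := \<kappa> 7 j)) \<kappa>, es, i)"
          using r2 r3 by (intro liftI conjI I') (simp_all add: keeps_def s2_def x2_def j_def)
        then show ?thesis using True r2 r3 w_def zV j ej by simp
      next
        case False
        then have "s2 = s1" "x2 = x1" unfolding s2_def x2_def by auto
        then have "lift es i (\<lambda>\<rho>' \<kappa>'. \<rho>' 8 = Suc k \<and> I k (\<rho>'(8 := k)) \<kappa>') (mem ?r \<kappa>, es, i)"
          using r2 r3 by (intro liftI conjI I') (simp_all add: keeps_def j_def)
        then show ?thesis using False r2 r3 w_def by auto
      qed
      then show ?thesis
        by (rule wp_test_subtree[rotated -1]) (use F r3 ej w_def in simp_all)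
    qed
    define w where "w = (if anc ?f z j then z else 0)"
    have first: "wp (COND (Times (reg 10) (LT (col 4 (reg 11)) (col 4 (col 8 (reg 8)))))
         (SET 11 (col 8 (reg 8)) ;; SET 12 (reg 8)) SKIP ;;
       SET 14 (col 7 (reg 8)) ;; IN_SUBTREE ;;
       COND (Times (reg 10) (LT (col 4 (reg 11)) (col 4 (reg 8))))
         (SET 11 (reg 8) ;; SET 12 (reg 14)) SKIP)
         (lift es i (\<lambda>\<rho>' \<kappa>'. \<rho>' 8 = Suc k \<and> I k (\<rho>'(8 := k)) \<kappa>')) (mem (\<rho>1(14 := j, 10 := w)) \<kappa>, es, i)"
    proof (cases "anc ?f z j \<and> ?st s < ?st (\<kappa> 8 j)")
      case True
      then show ?thesis
        using second[of "\<rho>1(14 := j, 10 := w, 11 := \<kappa> 8 j, 12 := j)"] r w_def zV bj j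
        by (simp add: keeps_def s1_def x1_def)
    next
      case False
      then show ?thesis
        using second[of "\<rho>1(14 := j, 10 := w)"] r w_def zV bj j
        by (auto simp: keeps_def s1_def x1_def)
    qed
    show "wp (SET 14 (reg 8) ;; IN_SUBTREE ;;
       COND (Times (reg 10) (LT (col 4 (reg 11)) (col 4 (col 8 (reg 8)))))
         (SET 11 (col 8 (reg 8)) ;; SET 12 (reg 8)) SKIP ;;
       SET 14 (col 7 (reg 8)) ;; IN_SUBTREE ;;
       COND (Times (reg 10) (LT (col 4 (reg 11)) (col 4 (reg 8))))
         (SET 11 (reg 8) ;; SET 12 (reg 14)) SKIP)
         (lift es i (\<lambda>\<rho>' \<kappa>'. \<rho>' 8 = Suc k \<and> I k (\<rho>'(8 := k)) \<kappa>')) (mem \<rho>1 \<kappa>1, es, i)"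
      unfolding k1
      by (rule wp_test_subtree[rotated -1], rule first) (use F r j z1 w_def in simp_all)
  next
    fix \<rho>1 \<kappa>1 assume I: "I 0 \<rho>1 \<kappa>1"
    define s x where "s = \<rho>1 11" and "x = \<rho>1 12"
    have kr: "keeps {8, 10, 11, 12, 14} \<rho> \<rho>1" and k1: "\<kappa>1 = \<kappa>"
      and I1: "s \<le> n" "?st s \<noteq> 0" "x \<in> V" "anc ?f z x" "s \<noteq> 0 \<longrightarrow> E x s"
      and I2: "\<forall>j\<in>V. (anc ?f z j \<longrightarrow> ?st (\<kappa> 8 j) \<le> ?st s) \<and>
         (?st j \<noteq> 0 \<longrightarrow> anc ?f z (\<kappa> 7 j) \<longrightarrow> ?st j \<le> ?st s)"
      using I unfolding I_def s_def x_def by simp_all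
    obtain m where m: "(?f ^^ m) x = z" using I1(4) unfolding anc_def by blast
    have best: "\<forall>y\<in>sub V ?f z. \<forall>w\<in>V. ?st w \<noteq> 0 \<longrightarrow> E y w \<longrightarrow> ?st w \<le> ?st s"
    proof (intro ballI impI)
      fix y w assume y: "y \<in> sub V ?f z" and w: "w \<in> V" "?st w \<noteq> 0" "E y w"
      have y': "y \<in> V" "anc ?f z y" using y unfolding sub_def by simp_all
      then have "?st w \<le> ?st (\<kappa> 8 y) \<or> anc ?f z (\<kappa> 7 w)" using cov w unfolding z_def by blast
      then show "?st w \<le> ?st s"
      proof
        assume "?st w \<le> ?st (\<kappa> 8 y)"
        also have "\<dots> \<le> ?st s" using I2 y' by blast
        finally show ?thesis .
      qed (use I2 w in blast)
    qed
    have r5: "\<rho>1 5 = \<rho> 5" using kr unfolding keeps_def by simp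
    have unvp: "\<forall>j<Suc m. ?st ((?f ^^ j) x) = 0"
    proof (intro allI impI)
      fix j assume "j < Suc m"
      then have "anc ?f z ((?f ^^ j) x)"
        unfolding m[symmetric] by (metis anc_funpow comp_apply funpow_add le_add_diff_inverse2 less_Suc_eq_le)
      moreover have "(?f ^^ j) x \<in> insert 0 V" using anc_mem[OF F anc_funpow] I1(3) by blast
      moreover have "(?f ^^ j) x \<noteq> 0"
      proof
        assume "(?f ^^ j) x = 0"
        then have "anc ?f z 0" using calculation(1) by simp
        then show False using anc_0[OF F, of z] zV(2) by simp
      qed
      ultimately have "anc ?f z ((?f ^^ j) x)" "(?f ^^ j) x \<in> V" by simp_all
      then show "?st ((?f ^^ j) x) = 0" by (rule unv)
    qed
    show "wp WALK Q (mem \<rho>1 \<kappa>1, es, i)"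
      unfolding k1
    proof (rule wp_walk[where k = "Suc m"])
      show "forest V ?f" by (rule F)
      show "\<rho>1 12 \<le> n" "\<rho>1 11 \<le> n" using I1 unfolding s_def x_def by auto
      show "\<forall>j<Suc m. ?st ((?f ^^ j) (\<rho>1 12)) = 0" using unvp unfolding x_def .
      show "?st ((?f ^^ Suc m) (\<rho>1 12)) \<noteq> 0" using m z(3) unfolding x_def z_def by simp
      show "?st 0 \<noteq> 0" by (rule st0)
      have "Suc (card {v \<in> V. ?st v \<noteq> 0}) + Suc m \<le> card V + 1"
        by (rule unvisited_path_room[OF F _ st0 unvp]) (use I1(3) in simp)
      then show "\<rho>1 5 + Suc m \<le> n + 1" using PD(5) r5 by simp
      fix st' sp' s' x'
      assume w: "walked ?f (\<rho>1 11) (\<rho>1 12) (Suc m) ?st (\<kappa> 3) (\<rho>1 5) st' sp'"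
      then have w': "walked ?f s x (Suc m) ?st (\<kappa> 3) (\<rho> 5) st' sp'" unfolding s_def x_def r5 .
      have sV: "s \<in> insert 0 V" using I1(1) by (simp only: V_le)
      have ac: "?st a \<noteq> 0 \<or> (x = a \<and> (\<forall>v\<in>V. ?st v = 0))" using a by blast
      note W = partial_dfs_walk[OF pre part I1(3) m[symmetric] _ _ sV I1(2,5) best w' ac]
      have zz: "?st z = 0" "?st (?f z) \<noteq> 0" using z unfolding z_def by simp_all
      show "Q (mem (\<rho>1(5 := \<rho>1 5 + Suc m, 11 := s', 12 := x')) (\<kappa>(3 := sp', 4 := st')), es, i)"
        by (rule Q) (use W[OF zz] kr r5 z_def in \<open>simp_all add: keeps_def\<close>)
    qed
  qed (use n in simp_all)
qed

text \<open>The recorded edges refer to the times \<open>st0\<close> of the pass, while the walks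
  keep changing \<open>\<kappa> 4\<close>. The link is \<open>known_covers\<close>; it applies
  because the current vertex never leaves the heavy path of the start, whose parent was visited
  before the pass.\<close>

lemma wp_chain:
  assumes pre: "almost_dfs V E (\<kappa> 2) a" and H: "heavy V (\<kappa> 2) (\<kappa> 6)"
    and part: "partial_dfs V E (\<kappa> 2) (\<kappa> 4) (\<kappa> 3) (\<rho> 5)"
    and K: "known V E (\<kappa> 2) (\<kappa> 6) st0 (\<kappa> 8) (\<kappa> 7)"
    and up0: "\<forall>v\<in>V. st0 v \<noteq> 0 \<longrightarrow> st0 (\<kappa> 2 v) \<noteq> 0" and s00: "st0 0 \<noteq> 0" and a: "st0 a \<noteq> 0"
    and ext: "\<forall>v. st0 v \<noteq> 0 \<longrightarrow> \<kappa> 4 v = st0 v"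
    and n: "\<rho> 3 = n" and z0: "\<rho> 7 \<in> V" "st0 (\<kappa> 2 (\<rho> 7)) \<noteq> 0"
    and Q: "\<And>\<rho>' st' sp'. keeps {5, 8, 10, 11, 12, 13, 14} \<rho> \<rho>' \<Longrightarrow>
       partial_dfs V E (\<kappa> 2) st' sp' (\<rho>' 5) \<Longrightarrow> (\<forall>v. \<kappa> 4 v \<noteq> 0 \<longrightarrow> st' v = \<kappa> 4 v) \<Longrightarrow>
       (\<forall>v. \<kappa> 4 v = 0 \<longrightarrow> st' v = 0 \<or> \<rho> 5 < st' v) \<Longrightarrow> \<rho> 5 \<le> \<rho>' 5 \<Longrightarrow>
       (\<forall>u. u \<noteq> 0 \<longrightarrow> anc (\<kappa> 6) u (\<rho> 7) \<longrightarrow> st' u \<noteq> 0) \<Longrightarrow>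
       Q (mem \<rho>' (\<kappa>(3 := sp', 4 := st')), es, i)"
  shows "wp CHAIN Q (mem \<rho> \<kappa>, es, i)"
proof -
  let ?f = "\<kappa> 2" and ?hv = "\<kappa> 6"
  define z0 where "z0 = \<rho> 7"
  have z0V: "z0 \<in> V" "st0 (?f z0) \<noteq> 0" "z0 \<le> n" using z0 unfolding z0_def by auto
  have F: "forest V ?f" using almost_dfsD(1)[OF pre] .
  have finV: "finite V" by simp
  define I where "I \<rho>' \<kappa>' \<longleftrightarrow> keeps {5, 8, 10, 11, 12, 13, 14} \<rho> \<rho>' \<and> keeps {3, 4} \<kappa> \<kappa>' \<and>
      partial_dfs V E ?f (\<kappa>' 4) (\<kappa>' 3) (\<rho>' 5) \<and> (\<forall>v. \<kappa> 4 v \<noteq> 0 \<longrightarrow> \<kappa>' 4 v = \<kappa> 4 v) \<and>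
      (\<forall>v. \<kappa> 4 v = 0 \<longrightarrow> \<kappa>' 4 v = 0 \<or> \<rho> 5 < \<kappa>' 4 v) \<and> \<rho> 5 \<le> \<rho>' 5 \<and>
      \<rho>' 13 \<le> n \<and> anc ?hv (\<rho>' 13) z0 \<and> (\<rho>' 13 \<noteq> 0 \<longrightarrow> \<kappa>' 4 (?f (\<rho>' 13)) \<noteq> 0) \<and>
      (\<forall>u. u \<noteq> 0 \<longrightarrow> anc ?hv u z0 \<longrightarrow> \<kappa>' 4 u \<noteq> 0 \<or> anc ?hv u (\<rho>' 13))"
    for \<rho>' :: "nat \<Rightarrow> nat" and \<kappa>' :: "nat \<Rightarrow> nat \<Rightarrow> nat"
  \<comment> \<open>A turn either visits a vertex and stays in place, or moves to a child with a
    smaller subtree (or to 0) and visits nothing.\<close>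
  define \<mu> where "\<mu> \<rho>' \<kappa>' = card {v \<in> V. \<kappa>' 4 v = 0} + (if \<rho>' 13 = 0 then 0 else card (sub V ?f (\<rho>' 13)))"
    for \<rho>' :: "nat \<Rightarrow> nat" and \<kappa>' :: "nat \<Rightarrow> nat \<Rightarrow> nat"
  have "wp (LOOP (reg 13) (COND (col 4 (reg 13)) (SET 13 (col 6 (reg 13))) ATTACH)) Q
     (mem (\<rho>(13 := z0)) \<kappa>, es, i)"
  proof (rule wp_local_loop[where I = I and \<mu> = \<mu>])
    show "I (\<rho>(13 := z0)) \<kappa>"
      unfolding I_def using part z0V ext by (simp add: keeps_def)
  next
    fix \<rho>1 \<kappa>1 assume I: "I \<rho>1 \<kappa>1" and nz: "aval (reg 13) (mem \<rho>1 \<kappa>1) \<noteq> 0"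
    define z where "z = \<rho>1 13"
    have kr: "keeps {5, 8, 10, 11, 12, 13, 14} \<rho> \<rho>1" and kk: "keeps {3, 4} \<kappa> \<kappa>1"
      and part1: "partial_dfs V E ?f (\<kappa>1 4) (\<kappa>1 3) (\<rho>1 5)"
      and ext1: "\<forall>v. \<kappa> 4 v \<noteq> 0 \<longrightarrow> \<kappa>1 4 v = \<kappa> 4 v" "\<forall>v. \<kappa> 4 v = 0 \<longrightarrow> \<kappa>1 4 v = 0 \<or> \<rho> 5 < \<kappa>1 4 v" "\<rho> 5 \<le> \<rho>1 5"
      and z: "z \<le> n" "anc ?hv z z0" "z \<noteq> 0 \<longrightarrow> \<kappa>1 4 (?f z) \<noteq> 0"
      and old: "\<forall>u. u \<noteq> 0 \<longrightarrow> anc ?hv u z0 \<longrightarrow> \<kappa>1 4 u \<noteq> 0 \<or> anc ?hv u z"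
      using I unfolding I_def z_def by blast+
    have z0: "z \<noteq> 0" using nz unfolding z_def by simp
    have zV: "z \<in> V" using z(1) z0 by auto
    have c: "\<kappa>1 2 = ?f" "\<kappa>1 6 = ?hv" "\<kappa>1 7 = \<kappa> 7" "\<kappa>1 8 = \<kappa> 8" using kk unfolding keeps_def by simp_all
    note PD = partial_dfsD[OF part1]
    have st1: "\<kappa>1 4 0 \<noteq> 0" using PD(1) by simp
    have ext0: "\<forall>v. st0 v \<noteq> 0 \<longrightarrow> \<kappa>1 4 v = st0 v" using ext ext1(1) by metis
    show "wp (COND (col 4 (reg 13)) (SET 13 (col 6 (reg 13))) ATTACH)
        (lift es i (\<lambda>\<rho>' \<kappa>'. I \<rho>' \<kappa>' \<and> \<mu> \<rho>' \<kappa>' < \<mu> \<rho>1 \<kappa>1)) (mem \<rho>1 \<kappa>1, es, i)"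
    proof (cases "\<kappa>1 4 z = 0")
      case False
      have hvn: "?hv z \<le> n" using heavy_mem[OF F H zV[THEN insertI2]] by (simp only: V_le)
      have step: "anc ?hv (?hv z) z" using anc_step[of ?hv "?hv z" z] by simp
      have "I (\<rho>1(13 := ?hv z)) \<kappa>1"
        unfolding I_def
      proof (intro conjI allI impI)
        show "anc ?hv ((\<rho>1(13 := ?hv z)) 13) z0" using anc_trans[OF step z(2)] by simp
        show "\<kappa>1 4 (?f ((\<rho>1(13 := ?hv z)) 13)) \<noteq> 0" if "(\<rho>1(13 := ?hv z)) 13 \<noteq> 0"
          using heavy_parent[OF F H zV] that False by simp
        fix u assume u: "u \<noteq> 0" "anc ?hv u z0"
        show "\<kappa>1 4 u \<noteq> 0 \<or> anc ?hv u ((\<rho>1(13 := ?hv z)) 13)"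
        proof (cases "\<kappa>1 4 u = 0")
          case True
          then have "anc ?hv u z" using old u by (metis neq0_conv)
          moreover have "u \<noteq> z" using True False by metis
          ultimately have "anc ?hv u z" "u \<noteq> z" .
          then show ?thesis using anc_step[of ?hv u z] by simp
        qed simp
      qed (use kr kk part1 ext1 hvn in \<open>auto simp: keeps_def\<close>)
      moreover have "\<mu> (\<rho>1(13 := ?hv z)) \<kappa>1 < \<mu> \<rho>1 \<kappa>1"
      proof -
        have "card (sub V ?f z) > 0"
          using zV finite_sub[OF F] unfolding card_gt_0_iff sub_def by (auto intro: anc_refl)
        moreover have "card (sub V ?f (?hv z)) < card (sub V ?f z)" if "?hv z \<noteq> 0"
        proof (rule psubset_card_mono[OF finite_sub[OF F]])
          have hz: "?f (?hv z) = z" "?hv z \<in> V" using heavy_parent[OF F H zV that] hvn that by auto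
          have "anc ?f z (?hv z)" using anc_step[of ?f z "?hv z"] hz by simp
          moreover have "\<not> anc ?f (?hv z) z" using not_anc_parent[OF F hz(2)] hz(1) by simp
          ultimately show "sub V ?f (?hv z) \<subset> sub V ?f z"
            using zV anc_trans[of ?f z "?hv z"] unfolding sub_def by auto
        qed
        ultimately show ?thesis unfolding \<mu>_def using z0 z_def by simp
      qed
      ultimately show ?thesis
        using False hvn z_def c(2) by (simp, intro liftI) simp
    next
      case True
      have known1: "\<forall>v\<in>V. \<kappa> 8 v \<le> n \<and> \<kappa>1 4 (\<kappa> 8 v) \<noteq> 0 \<and> (\<kappa> 8 v \<noteq> 0 \<longrightarrow> E v (\<kappa> 8 v))"
      proof
        fix v assume v: "v \<in> V"
        have "\<kappa> 8 v \<in> insert 0 V" "st0 (\<kappa> 8 v) \<noteq> 0" "\<kappa> 8 v \<noteq> 0 \<longrightarrow> E v (\<kappa> 8 v)"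
          using K v unfolding known_def by blast+
        then show "\<kappa> 8 v \<le> n \<and> \<kappa>1 4 (\<kappa> 8 v) \<noteq> 0 \<and> (\<kappa> 8 v \<noteq> 0 \<longrightarrow> E v (\<kappa> 8 v))"
          using ext0 by auto
      qed
      have known2: "\<forall>u\<in>V. \<kappa> 7 u \<in> V \<and> (\<kappa> 7 u \<noteq> u \<longrightarrow> E u (\<kappa> 7 u))"
        using K unfolding known_def by blast
      have a1: "\<kappa>1 4 a \<noteq> 0" using a ext0 by metis
      have cov: "\<forall>y\<in>V. \<forall>w\<in>V. anc ?f z y \<longrightarrow> \<kappa>1 4 w \<noteq> 0 \<longrightarrow> E y w \<longrightarrow>
         \<kappa>1 4 w \<le> \<kappa>1 4 (\<kappa> 8 y) \<or> anc ?f z (\<kappa> 7 w)"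
        using known_covers[OF pre H K up0 s00 a PD(3) st1 ext0 z0V(1,2) z(2) z0 True] by blast
      have "wp ATTACH (lift es i (\<lambda>\<rho>' \<kappa>'. I \<rho>' \<kappa>' \<and> \<mu> \<rho>' \<kappa>' < \<mu> \<rho>1 \<kappa>1)) (mem \<rho>1 \<kappa>1, es, i)"
      proof (rule wp_attach[where E = E and a = a])
        fix \<rho>2 st' sp'
        assume k2: "keeps {5, 8, 10, 11, 12, 14} \<rho>1 \<rho>2" and p2: "partial_dfs V E (\<kappa>1 2) st' sp' (\<rho>2 5)"
          and e2: "\<forall>v. \<kappa>1 4 v \<noteq> 0 \<longrightarrow> st' v = \<kappa>1 4 v" "\<forall>v. \<kappa>1 4 v = 0 \<longrightarrow> st' v = 0 \<or> \<rho>1 5 < st' v"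
          and zv: "st' (\<rho>1 13) \<noteq> 0" and le2: "\<rho>1 5 \<le> \<rho>2 5"
        have z2: "\<rho>2 13 = z" using k2 unfolding keeps_def z_def by simp
        have "I \<rho>2 (\<kappa>1(3 := sp', 4 := st'))"
          unfolding I_def
        proof (intro conjI allI impI)
          show "keeps {5, 8, 10, 11, 12, 13, 14} \<rho> \<rho>2" using kr k2 unfolding keeps_def by simp
          show "keeps {3, 4} \<kappa> (\<kappa>1(3 := sp', 4 := st'))" using kk unfolding keeps_def by simp
          show "partial_dfs V E ?f ((\<kappa>1(3 := sp', 4 := st')) 4) ((\<kappa>1(3 := sp', 4 := st')) 3) (\<rho>2 5)"
            using p2 c by simp
          fix v
          show "(\<kappa>1(3 := sp', 4 := st')) 4 v = \<kappa> 4 v" if "\<kappa> 4 v \<noteq> 0"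
            using ext1(1) e2(1) that by simp
          show "(\<kappa>1(3 := sp', 4 := st')) 4 v = 0 \<or> \<rho> 5 < (\<kappa>1(3 := sp', 4 := st')) 4 v" if "\<kappa> 4 v = 0"
          proof (cases "\<kappa>1 4 v = 0")
            case True
            then have "st' v = 0 \<or> \<rho>1 5 < st' v" using e2(2) by blast
            then show ?thesis using ext1(3) by auto
          next
            case False
            then have "st' v = \<kappa>1 4 v" "\<rho> 5 < \<kappa>1 4 v" using e2(1) ext1(2) that by metis+
            then show ?thesis by simp
          qed
          show "(\<kappa>1(3 := sp', 4 := st')) 4 (?f (\<rho>2 13)) \<noteq> 0" if "\<rho>2 13 \<noteq> 0"
            using z(3) z0 e2(1) z2 by simp
          show "(\<kappa>1(3 := sp', 4 := st')) 4 v \<noteq> 0 \<or> anc ?hv v (\<rho>2 13)" if "v \<noteq> 0" "anc ?hv v z0"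
          proof -
            have "\<kappa>1 4 v \<noteq> 0 \<or> anc ?hv v z" using old that by blast
            then show ?thesis using e2(1) z2 by (metis fun_upd_same)
          qed
        qed (use z z2 le2 ext1(3) in simp_all)
        moreover have "\<mu> \<rho>2 (\<kappa>1(3 := sp', 4 := st')) < \<mu> \<rho>1 \<kappa>1"
        proof -
          have "{v \<in> V. st' v = 0} \<subset> {v \<in> V. \<kappa>1 4 v = 0}"
          proof
            show "{v \<in> V. st' v = 0} \<subseteq> {v \<in> V. \<kappa>1 4 v = 0}" using e2(1) by auto
            show "{v \<in> V. st' v = 0} \<noteq> {v \<in> V. \<kappa>1 4 v = 0}"
            proof
              assume eq: "{v \<in> V. st' v = 0} = {v \<in> V. \<kappa>1 4 v = 0}"
              have "z \<in> {v \<in> V. \<kappa>1 4 v = 0}" using True zV by simp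
              then have "st' z = 0" unfolding eq[symmetric] by simp
              then show False using zv z_def by simp
            qed
          qed
          then have "card {v \<in> V. st' v = 0} < card {v \<in> V. \<kappa>1 4 v = 0}"
            by (intro psubset_card_mono) simp_all
          then show ?thesis unfolding \<mu>_def using z2 z_def by simp
        qed
        ultimately show "lift es i (\<lambda>\<rho>' \<kappa>'. I \<rho>' \<kappa>' \<and> \<mu> \<rho>' \<kappa>' < \<mu> \<rho>1 \<kappa>1)
           (mem \<rho>2 (\<kappa>1(3 := sp', 4 := st')), es, i)"
          by (intro liftI) blast
      qed (use pre part1 a1 n kr zV True z z0 known1 known2 cov c in \<open>simp_all add: z_def[symmetric] keeps_def\<close>)
      then show ?thesis using True z_def by simp
    qed
  next
    fix \<rho>1 \<kappa>1 assume I: "I \<rho>1 \<kappa>1" and nz: "aval (reg 13) (mem \<rho>1 \<kappa>1) = 0"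
    have z: "\<rho>1 13 = 0" using nz by simp
    have kk: "keeps {3, 4} \<kappa> \<kappa>1" using I unfolding I_def by blast
    have eq: "\<kappa>1 = \<kappa>(3 := \<kappa>1 3, 4 := \<kappa>1 4)" using kk unfolding keeps_def by auto
    have hv0: "anc ?hv u 0 \<Longrightarrow> u = 0" for u
      by (erule anc_closed) (simp_all add: heavy_0[OF F H])
    have "Q (mem \<rho>1 (\<kappa>(3 := \<kappa>1 3, 4 := \<kappa>1 4)), es, i)"
    proof (rule Q)
      show "\<forall>u. u \<noteq> 0 \<longrightarrow> anc ?hv u (\<rho> 7) \<longrightarrow> \<kappa>1 4 u \<noteq> 0"
        using I z hv0 unfolding I_def z0_def by metis
    qed (use I in \<open>simp_all add: I_def\<close>)
    then show "Q (mem \<rho>1 \<kappa>1, es, i)" using eq by simp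
  qed
  then show ?thesis unfolding CHAIN_def using z0V z0_def by simp
qed

end

section \<open>Reading one pass and performing one round\<close>

definition RECORD :: "nat \<Rightarrow> nat \<Rightarrow> com" where
  "RECORD a b =
     COND (LT (col 4 (col 8 (reg a))) (col 4 (reg b))) (PUT 8 (reg a) (reg b)) SKIP ;;
     SET 13 (reg a) ;; SET 14 (col 7 (reg a)) ;; IN_SUBTREE ;;
     LOOP (reg 10) (SET 13 (col 6 (reg 13)) ;; IN_SUBTREE) ;;
     SET 14 (reg b) ;; IN_SUBTREE ;;
     COND (reg 10) (PUT 7 (reg a) (reg b)) SKIP"

text \<open>An edge with an endpoint that has no row is skipped: while the preprocessing grows the
  table, the stream already shows the edges of vertices to come.\<close>

definition EDGE :: com where
  "EDGE = SET 14 (Plus (reg (Suc 0)) (Const (Suc 0))) ;; LOOKUP ;; SET 16 (reg 15) ;;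
     SET 14 (Plus (reg 2) (Const (Suc 0))) ;; LOOKUP ;; SET 17 (reg 15) ;;
     COND (Times (reg 16) (reg 17)) (RECORD 16 17 ;; RECORD 17 16) SKIP"

definition PASS :: com where
  "PASS = FOR 7 (PUT 7 (reg 7) (reg 7) ;; PUT 8 (reg 7) (Const 0)) ;;
     REWIND ;; NEXT ;; LOOP (reg 0) (EDGE ;; NEXT)"

text \<open>Register 6 freezes the clock, and the guard asks whether the parent was visited before
  the pass, since the recorded edges are sufficient only below such parents. A tree split off in the
  meantime has to wait for the next round, unless it continues the heavy path being walked.\<close>

definition ROUND :: com where
  "ROUND = SET 6 (reg 5) ;; PASS ;;
     FOR 7 (COND (Times (col 4 (col 2 (reg 7))) (NOT (LT (reg 6) (col 4 (col 2 (reg 7)))))) CHAIN SKIP)"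

text \<open>The adjacency between rows that the part \<open>D\<close> of a pass has revealed so far;
  it ignores the orientation in the stream.\<close>

definition pairs_edge :: "(nat \<Rightarrow> nat) \<Rightarrow> stream \<Rightarrow> nat \<Rightarrow> nat \<Rightarrow> bool" where
  "pairs_edge name D x y \<longleftrightarrow> (\<exists>(u, v) \<in> set D. name x = u \<and> name y = v \<or> name x = v \<and> name y = u)"

lemma pairs_edge_Cons: "pairs_edge name ((u, v) # D) a b \<longleftrightarrow>
    (name a = u \<and> name b = v \<or> name a = v \<and> name b = u) \<or> pairs_edge name D a b"
  unfolding pairs_edge_def by simp

lemma known_cong:
  assumes "known V E f hv st b e" "\<forall>u\<in>V. \<forall>v\<in>V. E' u v \<longleftrightarrow> E u v"
  shows "known V E' f hv st b e"
proof -
  note K1 = assms(1)[unfolded known_def, THEN conjunct1, THEN bspec]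
    and K2 = assms(1)[unfolded known_def, THEN conjunct2, THEN bspec]
  show ?thesis
    unfolding known_def
  proof (intro conjI ballI allI impI)
    fix v assume v: "v \<in> V"
    show "b v \<in> insert 0 V" "st (b v) \<noteq> 0" using K1[OF v] by blast+
    show "E' v (b v)" if "b v \<noteq> 0"
    proof -
      have "b v \<in> V" "E v (b v)" using K1[OF v] that by blast+
      then show ?thesis using assms(2) v by blast
    qed
    show "st w \<le> st (b v)" if "w \<in> V" "st w \<noteq> 0" "E' v w" for w
    proof -
      have "E v w" using assms(2) v that by blast
      then show ?thesis using K1[OF v] that by blast
    qed
    show "e v \<in> V" "anc f v (e v)" using K2[OF v] by blast+
    show "E' v (e v)" if "e v \<noteq> v"
    proof -
      have "e v \<in> V" "E v (e v)" using K2[OF v] that by blast+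
      then show ?thesis using assms(2) v by blast
    qed
    show "anc f z (e v)" if "z \<noteq> 0" "anc hv z v" "x \<in> V" "E' v x" "anc f z x" for z x
    proof -
      have "E v x" using assms(2) v that by blast
      then show ?thesis using K2[OF v] that by blast
    qed
  qed
qed

lemma (in machine) wp_seq_fun: "wp (c ;; d) Q = wp c (wp d Q)"
  by (rule ext) simp

lemma (in machine) wp_next_edge:
  "2 < S \<Longrightarrow> 1 < W \<Longrightarrow> u < W \<Longrightarrow> v < W \<Longrightarrow> Q (mem (\<rho>(0 := 1, 1 := u, 2 := v)) \<kappa>, es, i) \<Longrightarrow>
     wp NEXT Q (mem \<rho> \<kappa>, (u, v) # es, i)"
  unfolding wp_def using exec.Next_Edge[of S W u v \<sigma> "mem \<rho> \<kappa>" es i] by (auto simp: mem_upd_reg)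

lemma (in machine) wp_next_end:
  "0 < S \<Longrightarrow> 0 < W \<Longrightarrow> Q (mem (\<rho>(0 := 0)) \<kappa>, [], i) \<Longrightarrow> wp NEXT Q (mem \<rho> \<kappa>, [], i)"
  unfolding wp_def using exec.Next_End[of S W \<sigma> "mem \<rho> \<kappa>" i] by (auto simp: mem_upd_reg)

context rows
begin

text \<open>The inner loop descends the heavy path of row \<open>a\<close> to the first vertex whose
  subtree misses the recorded descendant. This position is the \<open>z\<close> of
  \<open>known_step\<close>; at the end of the path it is 0 and nothing is replaced.\<close>

lemma wp_record:
  assumes F: "forest V (\<kappa> 2)" and H: "heavy V (\<kappa> 2) (\<kappa> 6)"
    and K: "known V E (\<kappa> 2) (\<kappa> 6) (\<kappa> 4) (\<kappa> 8) (\<kappa> 7)"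
    and ab: "a \<in> {16, 17}" "b \<in> {16, 17}" and u: "\<rho> a \<in> V" and v: "\<rho> b \<in> V"
    and Q: "\<And>\<rho>' b' e'. keeps {10, 13, 14} \<rho> \<rho>' \<Longrightarrow>
       known V (\<lambda>x y. E x y \<or> (x = \<rho> a \<and> y = \<rho> b)) (\<kappa> 2) (\<kappa> 6) (\<kappa> 4) b' e' \<Longrightarrow>
       Q (mem \<rho>' (\<kappa>(7 := e', 8 := b')), es, i)"
  shows "wp (RECORD a b) Q (mem \<rho> \<kappa>, es, i)"
proof -
  let ?f = "\<kappa> 2" and ?hv = "\<kappa> 6" and ?e = "\<kappa> 7"
  define u v where "u = \<rho> a" and "v = \<rho> b"
  have uV: "u \<in> V" "u \<le> n" "u \<noteq> 0" and vV: "v \<in> V" "v \<le> n" "v \<noteq> 0" using u v unfolding u_def v_def by auto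
  have ab': "a < 20" "b < 20" "a \<noteq> 13" "a \<noteq> 14" "a \<noteq> 10" "b \<noteq> 13" "b \<noteq> 14" "b \<noteq> 10" using ab by auto
  have eu: "?e u \<in> V" using K uV(1) unfolding known_def by blast
  then have eun: "?e u \<le> n" by simp
  define b' where "b' = (if \<kappa> 4 (\<kappa> 8 u) < \<kappa> 4 v then (\<kappa> 8)(u := v) else \<kappa> 8)"
  define \<kappa>1 where "\<kappa>1 = \<kappa>(8 := b')"
  have c1: "\<kappa>1 2 = ?f" "\<kappa>1 6 = ?hv" "\<kappa>1 7 = ?e" "\<kappa>1 4 = \<kappa> 4" unfolding \<kappa>1_def by simp_all
  define I where "I \<rho>' \<kappa>' \<longleftrightarrow> keeps {10, 13, 14} \<rho> \<rho>' \<and> \<kappa>' = \<kappa>1 \<and> \<rho>' 13 \<le> n \<and> anc ?hv (\<rho>' 13) u \<and> \<rho>' 14 = ?e u \<and>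
      \<rho>' 10 = (if anc ?f (\<rho>' 13) (?e u) then \<rho>' 13 else 0) \<and>
      (\<forall>y. anc ?hv y u \<longrightarrow> anc ?f y (?e u) \<or> anc ?hv y (\<rho>' 13))"
    for \<rho>' :: "nat \<Rightarrow> nat" and \<kappa>' :: "nat \<Rightarrow> nat \<Rightarrow> nat"
  define REST where "REST = SET 14 (reg b) ;; IN_SUBTREE ;; COND (reg 10) (PUT 7 (reg a) (reg b)) SKIP"
  have loop: "wp (LOOP (reg 10) (SET 13 (col 6 (reg 13)) ;; IN_SUBTREE)) (wp REST Q) (mem \<rho>1 \<kappa>1, es, i)"
    if "I \<rho>1 \<kappa>1" for \<rho>1
  proof (rule wp_local_loop[where I = I and
        \<mu> = "\<lambda>\<rho>' \<kappa>'. if \<rho>' 13 = 0 then 0 else card (sub V ?f (\<rho>' 13))"])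
    show "I \<rho>1 \<kappa>1" by (rule that)
    fix \<rho>2 \<kappa>2 assume I: "I \<rho>2 \<kappa>2" and nz: "aval (reg 10) (mem \<rho>2 \<kappa>2) \<noteq> 0"
    define z where "z = \<rho>2 13"
    have kr: "keeps {10, 13, 14} \<rho> \<rho>2" and k2: "\<kappa>2 = \<kappa>1" and z: "z \<le> n" "anc ?hv z u" and r14: "\<rho>2 14 = ?e u"
      and r10: "\<rho>2 10 = (if anc ?f z (?e u) then z else 0)"
      and old: "\<forall>y. anc ?hv y u \<longrightarrow> anc ?f y (?e u) \<or> anc ?hv y z"
      using I unfolding I_def z_def by blast+
    have z0: "z \<noteq> 0" "anc ?f z (?e u)" using nz r10 by (auto split: if_splits)
    have zV: "z \<in> V" using z z0 by auto
    define h where "h = ?hv z"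
    have hn: "h \<le> n" using heavy_mem[OF F H zV[THEN insertI2]] unfolding h_def by (simp only: V_le)
    have hz: "anc ?hv h z" using anc_step[of ?hv h z] h_def by simp
    define w where "w = (if anc ?f h (?e u) then h else 0)"
    have "I (\<rho>2(13 := h, 10 := w)) \<kappa>1"
      unfolding I_def
    proof (intro conjI allI impI)
      fix y assume "anc ?hv y u"
      then have "anc ?f y (?e u) \<or> anc ?hv y z" using old by blast
      then show "anc ?f y (?e u) \<or> anc ?hv y ((\<rho>2(13 := h, 10 := w)) 13)"
        using anc_step[of ?hv y z] z0(2) h_def by auto
    qed (use kr hn r14 w_def anc_trans[OF hz z(2)] in \<open>auto simp: keeps_def\<close>)
    moreover have "card (sub V ?f h) < card (sub V ?f z)" if "h \<noteq> 0"
    proof (rule psubset_card_mono[OF finite_sub[OF F]])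
      have hz: "?f h = z" "h \<in> V" using heavy_parent[OF F H zV] hn that h_def by auto
      have "anc ?f z h" using anc_step[of ?f z h] hz by simp
      moreover have "\<not> anc ?f h z" using not_anc_parent[OF F hz(2)] hz(1) by simp
      ultimately show "sub V ?f h \<subset> sub V ?f z"
        using zV anc_trans[of ?f z h] unfolding sub_def by auto
    qed
    moreover have "card (sub V ?f z) > 0"
      using zV finite_sub[OF F] unfolding card_gt_0_iff sub_def by (auto intro: anc_refl)
    ultimately have L: "lift es i (\<lambda>\<rho>' \<kappa>'. I \<rho>' \<kappa>' \<and>
        (if \<rho>' 13 = 0 then 0 else card (sub V ?f (\<rho>' 13))) < (if \<rho>2 13 = 0 then 0 else card (sub V ?f (\<rho>2 13))))
        (mem (\<rho>2(13 := h, 10 := w)) \<kappa>1, es, i)"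
      using z0 z_def by (intro liftI) simp
    have "wp IN_SUBTREE (lift es i (\<lambda>\<rho>' \<kappa>'. I \<rho>' \<kappa>' \<and>
        (if \<rho>' 13 = 0 then 0 else card (sub V ?f (\<rho>' 13))) < (if \<rho>2 13 = 0 then 0 else card (sub V ?f (\<rho>2 13)))))
        (mem (\<rho>2(13 := h)) \<kappa>1, es, i)"
      by (rule wp_in_subtree)
        (use F c1 r14 eun L in \<open>simp_all add: w_def split del: if_split cong: if_cong\<close>)
    then show "wp (SET 13 (col 6 (reg 13)) ;; IN_SUBTREE) (lift es i (\<lambda>\<rho>' \<kappa>'. I \<rho>' \<kappa>' \<and>
        (if \<rho>' 13 = 0 then 0 else card (sub V ?f (\<rho>' 13))) < (if \<rho>2 13 = 0 then 0 else card (sub V ?f (\<rho>2 13)))))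
        (mem \<rho>2 \<kappa>2, es, i)"
      unfolding k2 wp_seq using hn c1 z_def h_def by simp
  next
    fix \<rho>2 \<kappa>2 assume I: "I \<rho>2 \<kappa>2" and nz: "aval (reg 10) (mem \<rho>2 \<kappa>2) = 0"
    define z where "z = \<rho>2 13"
    have kr: "keeps {10, 13, 14} \<rho> \<rho>2" and k2: "\<kappa>2 = \<kappa>1" and z: "z \<le> n" "anc ?hv z u"
      and r10: "\<rho>2 10 = (if anc ?f z (?e u) then z else 0)"
      and old: "\<forall>y. anc ?hv y u \<longrightarrow> anc ?f y (?e u) \<or> anc ?hv y z"
      using I unfolding I_def z_def by blast+
    have z0: "z = 0 \<or> \<not> anc ?f z (?e u)" using nz r10 by (auto split: if_splits)
    have r: "\<rho>2 a = u" "\<rho>2 b = v" using kr ab' unfolding keeps_def u_def v_def by simp_all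
    define w where "w = (if anc ?f z v then z else 0)"
    define e' where "e' = (if z \<noteq> 0 \<and> anc ?f z v then ?e(u := v) else ?e)"
    have kn: "known V (\<lambda>x y. E x y \<or> (x = \<rho> a \<and> y = \<rho> b)) ?f ?hv (\<kappa> 4) b' e'"
      by (rule known_step[OF F H K uV(1) vV(1) z(2) z0 old b'_def e'_def]) (simp add: u_def v_def)
    have kr': "keeps {10, 13, 14} \<rho> (\<rho>2(14 := v, 10 := w))" using kr unfolding keeps_def by simp
    have "Q (mem (\<rho>2(14 := v, 10 := w)) (\<kappa>(7 := e', 8 := b')), es, i)" by (rule Q[OF kr' kn])
    moreover have "\<kappa>(7 := e', 8 := b') = \<kappa>1(7 := e')" unfolding \<kappa>1_def by (simp add: fun_upd_twist)
    ultimately have Q': "Q (mem (\<rho>2(14 := v, 10 := w)) (\<kappa>1(7 := e')), es, i)" by simp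
    have "wp (COND (reg 10) (PUT 7 (reg a) (reg b)) SKIP) Q (mem (\<rho>2(14 := v, 10 := w)) \<kappa>1, es, i)"
    proof (cases "w = 0")
      case True
      then have "e' = \<kappa>1 7" unfolding e'_def w_def c1 by (auto split: if_splits)
      then have "\<kappa>1(7 := e') = \<kappa>1" by simp
      then show ?thesis using True Q' by simp
    next
      case False
      then have "e' = ?e(u := v)" unfolding e'_def w_def by (auto split: if_splits)
      then show ?thesis using False Q' r ab' uV vV c1 by simp
    qed
    then show "wp REST Q (mem \<rho>2 \<kappa>2, es, i)"
      unfolding REST_def k2
      by (rule wp_test_subtree[rotated -1]) (use F c1 r ab' vV w_def z_def in simp_all)
  qed
  define w where "w = (if anc ?f u (?e u) then u else 0)"
  have "I (\<rho>(13 := u, 14 := ?e u, 10 := w)) \<kappa>1"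
    unfolding I_def using uV w_def by (auto simp: keeps_def)
  then have L: "wp (LOOP (reg 10) (SET 13 (col 6 (reg 13)) ;; IN_SUBTREE)) (wp REST Q)
     (mem (\<rho>(13 := u, 14 := ?e u, 10 := w)) \<kappa>1, es, i)" by (rule loop)
  have 1: "wp (SET 14 (col 7 (reg a)) ;; IN_SUBTREE ;; LOOP (reg 10) (SET 13 (col 6 (reg 13)) ;; IN_SUBTREE))
     (wp REST Q) (mem (\<rho>(13 := u)) \<kappa>1, es, i)"
    using L by (rule wp_test_subtree[rotated -1]) (use F c1 ab' eun w_def u_def in simp_all)
  have "wp (SET 13 (reg a) ;; SET 14 (col 7 (reg a)) ;; IN_SUBTREE ;;
      LOOP (reg 10) (SET 13 (col 6 (reg 13)) ;; IN_SUBTREE) ;; REST) Q (mem \<rho> \<kappa>1, es, i)"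
    using 1 ab' uV u_def by (simp add: wp_seq_fun)
  moreover have "wp (COND (LT (col 4 (col 8 (reg a))) (col 4 (reg b))) (PUT 8 (reg a) (reg b)) SKIP) Q'
      (mem \<rho> \<kappa>, es, i) \<longleftrightarrow> Q' (mem \<rho> \<kappa>1, es, i)" for Q'
  proof (cases "\<kappa> 4 (\<kappa> 8 u) < \<kappa> 4 v")
    case True
    then show ?thesis using ab' uV vV unfolding \<kappa>1_def b'_def u_def v_def by simp
  next
    case False
    then have "\<kappa>1 = \<kappa>" unfolding \<kappa>1_def b'_def by simp
    then show ?thesis using False ab' unfolding u_def v_def by simp
  qed
  ultimately show ?thesis unfolding RECORD_def REST_def wp_seq by simp
qed

lemma is_row_unique:
  assumes "inj_on name V" "is_row n name (Suc u) r"
  shows "v \<in> V \<and> name v = u \<longleftrightarrow> v = r \<and> r \<noteq> 0"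
proof (cases "r = 0")
  case True
  then show ?thesis using assms(2) unfolding is_row_def by auto
next
  case False
  then have r: "r \<in> V" "name r = u" using assms(2) unfolding is_row_def by simp_all
  show ?thesis
  proof
    assume v: "v \<in> V \<and> name v = u"
    then have "v = r" using inj_onD[OF assms(1)] r by metis
    then show "v = r \<and> r \<noteq> 0" using False by simp
  qed (use r in simp)
qed

lemma wp_edge:
  assumes F: "forest V (\<kappa> 2)" and H: "heavy V (\<kappa> 2) (\<kappa> 6)"
    and K: "known V (pairs_edge (\<kappa> 0) D) (\<kappa> 2) (\<kappa> 6) (\<kappa> 4) (\<kappa> 8) (\<kappa> 7)"
    and n: "\<rho> 3 = n" and names: "inj_on (\<kappa> 0) V"
    and w: "Suc (\<rho> 1) < W" "Suc (\<rho> 2) < W"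
    and Q: "\<And>\<rho>' b' e'. keeps {8, 10, 13, 14, 15, 16, 17} \<rho> \<rho>' \<Longrightarrow>
       known V (pairs_edge (\<kappa> 0) ((\<rho> 1, \<rho> 2) # D)) (\<kappa> 2) (\<kappa> 6) (\<kappa> 4) b' e' \<Longrightarrow>
       Q (mem \<rho>' (\<kappa>(7 := e', 8 := b')), es, i)"
  shows "wp EDGE Q (mem \<rho> \<kappa>, es, i)"
proof -
  have last: "wp (COND (Times (reg 16) (reg 17)) (RECORD 16 17 ;; RECORD 17 16) SKIP) Q (mem \<rho>1 \<kappa>, es, i)"
    if kr: "keeps {8, 10, 13, 14, 15, 16, 17} \<rho> \<rho>1" and u: "is_row n (\<kappa> 0) (Suc (\<rho> 1)) (\<rho>1 16)"
      and v: "is_row n (\<kappa> 0) (Suc (\<rho> 2)) (\<rho>1 17)" for \<rho>1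
  proof -
    define x y where "x = \<rho>1 16" and "y = \<rho>1 17"
    have iff: "a \<in> V \<and> \<kappa> 0 a = \<rho> 1 \<longleftrightarrow> a = x \<and> x \<noteq> 0" "a \<in> V \<and> \<kappa> 0 a = \<rho> 2 \<longleftrightarrow> a = y \<and> y \<noteq> 0" for a
      using is_row_unique[OF names u] is_row_unique[OF names v] unfolding x_def y_def by blast+
    show ?thesis
    proof (cases "x = 0 \<or> y = 0")
      \<comment> \<open>One endpoint has no row, so the edge joins no two rows and the records stay
        valid as they are.\<close>
      case True
      have "pairs_edge (\<kappa> 0) ((\<rho> 1, \<rho> 2) # D) a b \<longleftrightarrow> pairs_edge (\<kappa> 0) D a b" if "a \<in> V" "b \<in> V" for a b
      proof -
        have "x = 0 \<Longrightarrow> \<kappa> 0 a \<noteq> \<rho> 1" "x = 0 \<Longrightarrow> \<kappa> 0 b \<noteq> \<rho> 1" "y = 0 \<Longrightarrow> \<kappa> 0 a \<noteq> \<rho> 2" "y = 0 \<Longrightarrow> \<kappa> 0 b \<noteq> \<rho> 2"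
          using iff[of a] iff[of b] that by blast+
        then show ?thesis using True unfolding pairs_edge_Cons by blast
      qed
      then have "known V (pairs_edge (\<kappa> 0) ((\<rho> 1, \<rho> 2) # D)) (\<kappa> 2) (\<kappa> 6) (\<kappa> 4) (\<kappa> 8) (\<kappa> 7)"
        by (intro known_cong[OF K]) simp
      then have "Q (mem \<rho>1 (\<kappa>(7 := \<kappa> 7, 8 := \<kappa> 8)), es, i)" by (rule Q[OF kr])
      then show ?thesis using True unfolding x_def y_def by simp
    next
      case False
      then have xy: "x \<in> V" "y \<in> V" using iff(1)[of x] iff(2)[of y] by blast+
      have "wp (RECORD 16 17) (wp (RECORD 17 16) Q) (mem \<rho>1 \<kappa>, es, i)"
      proof (rule wp_record[OF F H K])
        fix \<rho>2 b2 e2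
        assume k2: "keeps {10, 13, 14} \<rho>1 \<rho>2"
          and K2: "known V (\<lambda>x y. pairs_edge (\<kappa> 0) D x y \<or> x = \<rho>1 16 \<and> y = \<rho>1 17) (\<kappa> 2) (\<kappa> 6) (\<kappa> 4) b2 e2"
        have r2: "\<rho>2 16 = x" "\<rho>2 17 = y" using k2 unfolding keeps_def x_def y_def by simp_all
        show "wp (RECORD 17 16) Q (mem \<rho>2 (\<kappa>(7 := e2, 8 := b2)), es, i)"
        proof (rule wp_record)
          show "known V (\<lambda>x y. pairs_edge (\<kappa> 0) D x y \<or> x = \<rho>1 16 \<and> y = \<rho>1 17) ((\<kappa>(7 := e2, 8 := b2)) 2)
             ((\<kappa>(7 := e2, 8 := b2)) 6) ((\<kappa>(7 := e2, 8 := b2)) 4) ((\<kappa>(7 := e2, 8 := b2)) 8) ((\<kappa>(7 := e2, 8 := b2)) 7)"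
            using K2 by simp
          fix \<rho>3 b3 e3
          assume k3: "keeps {10, 13, 14} \<rho>2 \<rho>3"
            and K3: "known V (\<lambda>a b. (pairs_edge (\<kappa> 0) D a b \<or> a = \<rho>1 16 \<and> b = \<rho>1 17) \<or> (a = \<rho>2 17 \<and> b = \<rho>2 16))
              ((\<kappa>(7 := e2, 8 := b2)) 2) ((\<kappa>(7 := e2, 8 := b2)) 6) ((\<kappa>(7 := e2, 8 := b2)) 4) b3 e3"
          have "known V (pairs_edge (\<kappa> 0) ((\<rho> 1, \<rho> 2) # D)) (\<kappa> 2) (\<kappa> 6) (\<kappa> 4) b3 e3"
          proof (rule known_cong)
            show "known V (\<lambda>a b. (pairs_edge (\<kappa> 0) D a b \<or> a = x \<and> b = y) \<or> (a = y \<and> b = x)) (\<kappa> 2) (\<kappa> 6) (\<kappa> 4) b3 e3"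
              using K3 r2 unfolding x_def y_def by simp
            have *: "\<kappa> 0 a = \<rho> 1 \<longleftrightarrow> a = x" "\<kappa> 0 a = \<rho> 2 \<longleftrightarrow> a = y" if "a \<in> V" for a
              using iff[of a] that False by simp_all
            show "\<forall>a\<in>V. \<forall>b\<in>V. pairs_edge (\<kappa> 0) ((\<rho> 1, \<rho> 2) # D) a b \<longleftrightarrow>
              (pairs_edge (\<kappa> 0) D a b \<or> a = x \<and> b = y) \<or> (a = y \<and> b = x)"
            proof (intro ballI)
              fix a b assume ab: "a \<in> V" "b \<in> V"
              show "pairs_edge (\<kappa> 0) ((\<rho> 1, \<rho> 2) # D) a b \<longleftrightarrow>
                (pairs_edge (\<kappa> 0) D a b \<or> a = x \<and> b = y) \<or> (a = y \<and> b = x)"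
                unfolding pairs_edge_Cons *[OF ab(1)] *[OF ab(2)] by blast
            qed
          qed
          then have "Q (mem \<rho>3 (\<kappa>(7 := e3, 8 := b3)), es, i)"
            by (intro Q) (use kr k2 k3 in \<open>simp_all add: keeps_def\<close>)
          then show "Q (mem \<rho>3 ((\<kappa>(7 := e2, 8 := b2))(7 := e3, 8 := b3)), es, i)"
            by (simp add: fun_upd_twist)
        qed (use F H r2 xy in simp_all)
      qed (use xy x_def y_def in simp_all)
      then show ?thesis using False unfolding x_def y_def by simp
    qed
  qed
  have second: "wp (SET 14 (Plus (reg 2) (Const (Suc 0))) ;; LOOKUP ;; SET 17 (reg 15) ;;
     COND (Times (reg 16) (reg 17)) (RECORD 16 17 ;; RECORD 17 16) SKIP) Q (mem \<rho>1 \<kappa>, es, i)"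
    if kr: "keeps {8, 10, 13, 14, 15, 16} \<rho> \<rho>1" and u: "is_row n (\<kappa> 0) (Suc (\<rho> 1)) (\<rho>1 16)" for \<rho>1
  proof -
    have r: "\<rho>1 2 = \<rho> 2" "\<rho>1 3 = n" using kr n unfolding keeps_def by simp_all
    have "wp LOOKUP (wp (SET 17 (reg 15)) (wp (COND (Times (reg 16) (reg 17)) (RECORD 16 17 ;; RECORD 17 16) SKIP) Q))
      (mem (\<rho>1(14 := Suc (\<rho> 2))) \<kappa>, es, i)"
    proof (rule wp_lookup)
      fix v assume v: "is_row n (\<kappa> 0) ((\<rho>1(14 := Suc (\<rho> 2))) 14) v"
      have vn: "v \<le> n" using v unfolding is_row_def by auto
      have "wp (COND (Times (reg 16) (reg 17)) (RECORD 16 17 ;; RECORD 17 16) SKIP) Q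
        (mem (\<rho>1(14 := Suc (\<rho> 2), 15 := v, 8 := 0, 17 := v)) \<kappa>, es, i)"
        by (rule last) (use kr u v in \<open>simp_all add: keeps_def\<close>)
      then show "wp (SET 17 (reg 15)) (wp (COND (Times (reg 16) (reg 17)) (RECORD 16 17 ;; RECORD 17 16) SKIP) Q)
        (mem (\<rho>1(14 := Suc (\<rho> 2), 15 := v, 8 := 0)) \<kappa>, es, i)"
        using vn by simp
    qed (use r in simp)
    then show ?thesis using r w by (simp add: wp_seq_fun)
  qed
  have "wp LOOKUP (wp (SET 16 (reg 15)) (wp (SET 14 (Plus (reg 2) (Const (Suc 0))) ;; LOOKUP ;; SET 17 (reg 15) ;;
     COND (Times (reg 16) (reg 17)) (RECORD 16 17 ;; RECORD 17 16) SKIP) Q)) (mem (\<rho>(14 := Suc (\<rho> 1))) \<kappa>, es, i)"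
  proof (rule wp_lookup)
    fix v assume v: "is_row n (\<kappa> 0) ((\<rho>(14 := Suc (\<rho> 1))) 14) v"
    have vn: "v \<le> n" using v unfolding is_row_def by auto
    have "wp (SET 14 (Plus (reg 2) (Const (Suc 0))) ;; LOOKUP ;; SET 17 (reg 15) ;;
       COND (Times (reg 16) (reg 17)) (RECORD 16 17 ;; RECORD 17 16) SKIP) Q
      (mem (\<rho>(14 := Suc (\<rho> 1), 15 := v, 8 := 0, 16 := v)) \<kappa>, es, i)"
      by (rule second) (use v in \<open>simp_all add: keeps_def\<close>)
    then show "wp (SET 16 (reg 15)) (wp (SET 14 (Plus (reg 2) (Const (Suc 0))) ;; LOOKUP ;; SET 17 (reg 15) ;;
       COND (Times (reg 16) (reg 17)) (RECORD 16 17 ;; RECORD 17 16) SKIP) Q)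
      (mem (\<rho>(14 := Suc (\<rho> 1), 15 := v, 8 := 0)) \<kappa>, es, i)"
      using vn by simp
  qed (use n in simp)
  then show ?thesis unfolding EDGE_def using w by (simp add: wp_seq_fun)
qed

text \<open>The edges already read accumulate in reverse order, which is why only the set of
  \<open>D'\<close> is specified.\<close>

lemma wp_edges:
  assumes F: "forest V (\<kappa> 2)" and H: "heavy V (\<kappa> 2) (\<kappa> 6)" and names: "inj_on (\<kappa> 0) V"
    and K: "known V (pairs_edge (\<kappa> 0) D) (\<kappa> 2) (\<kappa> 6) (\<kappa> 4) (\<kappa> 8) (\<kappa> 7)"
    and n: "\<rho> 3 = n" and w: "\<forall>(u, v) \<in> set es. Suc u < W \<and> Suc v < W"
    and Q: "\<And>\<rho>' b' e' D'. keeps {0, 1, 2, 8, 10, 13, 14, 15, 16, 17} \<rho> \<rho>' \<Longrightarrow> set D' = set D \<union> set es \<Longrightarrow>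
       known V (pairs_edge (\<kappa> 0) D') (\<kappa> 2) (\<kappa> 6) (\<kappa> 4) b' e' \<Longrightarrow>
       Q (mem \<rho>' (\<kappa>(7 := e', 8 := b')), [], i)"
  shows "wp (NEXT ;; LOOP (reg 0) (EDGE ;; NEXT)) Q (mem \<rho> \<kappa>, es, i)"
proof -
  let ?L = "LOOP (reg 0) (EDGE ;; NEXT)"
  have "wp NEXT (wp ?L Q) (mem \<rho>1 (\<kappa>(7 := e1, 8 := b1)), es1, i)"
    if "keeps {0, 1, 2, 8, 10, 13, 14, 15, 16, 17} \<rho> \<rho>1" "set D1 \<union> set es1 = set D \<union> set es"
      "known V (pairs_edge (\<kappa> 0) D1) (\<kappa> 2) (\<kappa> 6) (\<kappa> 4) b1 e1"
      "\<forall>(u, v) \<in> set es1. Suc u < W \<and> Suc v < W" for \<rho>1 e1 b1 es1 D1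
    using that
  proof (induction es1 arbitrary: \<rho>1 e1 b1 D1)
    case Nil
    let ?\<kappa> = "\<kappa>(7 := e1, 8 := b1)"
    have "Q (mem (\<rho>1(0 := 0)) ?\<kappa>, [], i)"
      by (rule Q[of _ D1]) (use Nil.prems in \<open>simp_all add: keeps_def\<close>)
    then have L: "wp ?L Q (mem (\<rho>1(0 := 0)) ?\<kappa>, [], i)" by (subst wp_loop_unfold) simp
    show ?case by (rule wp_next_end[rotated -1], rule L) simp_all
  next
    case (Cons p es1)
    let ?\<kappa> = "\<kappa>(7 := e1, 8 := b1)"
    obtain u v where p: "p = (u, v)" by (cases p)
    have True: "Suc u < W" "Suc v < W" using Cons.prems(4) p by auto
      let ?\<rho> = "\<rho>1(0 := 1, 1 := u, 2 := v)"
      have "wp EDGE (wp NEXT (wp ?L Q)) (mem ?\<rho> ?\<kappa>, es1, i)"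
      proof (rule wp_edge[where D = D1])
        show "known V (pairs_edge (?\<kappa> 0) D1) (?\<kappa> 2) (?\<kappa> 6) (?\<kappa> 4) (?\<kappa> 8) (?\<kappa> 7)" using Cons.prems(3) by simp
        fix \<rho>2 b2 e2
        assume k2: "keeps {8, 10, 13, 14, 15, 16, 17} ?\<rho> \<rho>2"
          and K2: "known V (pairs_edge (?\<kappa> 0) ((?\<rho> 1, ?\<rho> 2) # D1)) (?\<kappa> 2) (?\<kappa> 6) (?\<kappa> 4) b2 e2"
        have "wp NEXT (wp ?L Q) (mem \<rho>2 (\<kappa>(7 := e2, 8 := b2)), es1, i)"
        proof (rule Cons.IH[of \<rho>2 "(u, v) # D1"])
          show "keeps {0, 1, 2, 8, 10, 13, 14, 15, 16, 17} \<rho> \<rho>2"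
            using k2 Cons.prems(1) unfolding keeps_def by simp
          show "set ((u, v) # D1) \<union> set es1 = set D \<union> set es" using Cons.prems(2) p by auto
          show "known V (pairs_edge (\<kappa> 0) ((u, v) # D1)) (\<kappa> 2) (\<kappa> 6) (\<kappa> 4) b2 e2" using K2 by simp
          show "\<forall>(u, v) \<in> set es1. Suc u < W \<and> Suc v < W" using Cons.prems(4) by simp
        qed
        then show "wp NEXT (wp ?L Q) (mem \<rho>2 (?\<kappa>(7 := e2, 8 := b2)), es1, i)"
          by (simp add: fun_upd_twist)
      qed (use F H names n Cons.prems(1) True in \<open>simp_all add: keeps_def\<close>)
      then have L: "wp ?L Q (mem ?\<rho> ?\<kappa>, es1, i)" by (subst wp_loop_unfold) (simp add: wp_seq_fun)
      show ?case unfolding p by (rule wp_next_edge[rotated -1], rule L) (use True in simp_all)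
  qed
  from this[of \<rho> D es "\<kappa> 8" "\<kappa> 7"] show ?thesis using K w by (simp add: keeps_def)
qed

end

text \<open>The walk from register 4 comes before any pass. The clock counts the dummy too, so all
  rows are visited when it exceeds their number by one. Row numbers are translated back into codes
  only at the end, in column 1.\<close>

definition CORE :: com where
  "CORE = ROWS ;; SIZES ;; HEAVY ;;
     SET 14 (reg 4) ;; LOOKUP ;; SET 11 (Const 0) ;; SET 12 (reg 15) ;; WALK ;;
     LOOP (LT (reg 5) (Plus (reg 3) (Const (Suc 0)))) ROUND ;;
     FOR 7 (COND (col 3 (reg 7)) (PUT (Suc 0) (reg 7) (Plus (col 0 (col 3 (reg 7))) (Const (Suc 0))))
       (PUT (Suc 0) (reg 7) (Const 0)))"

context rows
begin

lemma wp_pass: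
  assumes F: "forest V (\<kappa> 2)" and H: "heavy V (\<kappa> 2) (\<kappa> 6)" and names: "inj_on (\<kappa> 0) V"
    and s0: "\<kappa> 4 0 \<noteq> 0" and n: "\<rho> 3 = n"
    and w: "\<forall>(u, v) \<in> set (\<sigma> i). Suc u < W \<and> Suc v < W"
    and Q: "\<And>\<rho>' b' e'. keeps {0, 1, 2, 7, 8, 10, 13, 14, 15, 16, 17} \<rho> \<rho>' \<Longrightarrow>
       known V (pairs_edge (\<kappa> 0) (\<sigma> i)) (\<kappa> 2) (\<kappa> 6) (\<kappa> 4) b' e' \<Longrightarrow>
       Q (mem \<rho>' (\<kappa>(7 := e', 8 := b')), [], Suc i)"
  shows "wp PASS Q (mem \<rho> \<kappa>, es, i)"
proof -
  define I where "I k \<rho>' \<kappa>' \<longleftrightarrow> keeps {7} \<rho> \<rho>' \<and> keeps {7, 8} \<kappa> \<kappa>' \<and> (\<forall>v\<in>{Suc k..n}. \<kappa>' 7 v = v \<and> \<kappa>' 8 v = 0)"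
    for k and \<rho>' :: "nat \<Rightarrow> nat" and \<kappa>' :: "nat \<Rightarrow> nat \<Rightarrow> nat"
  show ?thesis
    unfolding PASS_def wp_seq[of "FOR _ _"]
  proof (rule wp_for[where I = I])
    show "I n (\<rho>(7 := n)) \<kappa>" unfolding I_def keeps_def by simp
    fix k \<rho>1 \<kappa>1 assume k: "k < n" and I: "I (Suc k) \<rho>1 \<kappa>1" and r7: "\<rho>1 7 = Suc k"
    have "I k (\<rho>1(7 := k)) (\<kappa>1(7 := (\<kappa>1 7)(Suc k := Suc k), 8 := (\<kappa>1 8)(Suc k := 0)))"
      unfolding I_def
    proof (intro conjI ballI)
      fix v assume v: "v \<in> {Suc k..n}"
      show "(\<kappa>1(7 := (\<kappa>1 7)(Suc k := Suc k), 8 := (\<kappa>1 8)(Suc k := 0))) 7 v = v"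
        "(\<kappa>1(7 := (\<kappa>1 7)(Suc k := Suc k), 8 := (\<kappa>1 8)(Suc k := 0))) 8 v = 0"
        using I v unfolding I_def by (cases "v = Suc k"; simp)+
    qed (use I in \<open>simp_all add: I_def keeps_def\<close>)
    then show "wp (PUT 7 (reg 7) (reg 7) ;; PUT 8 (reg 7) (Const 0))
      (lift es i (\<lambda>\<rho>' \<kappa>'. \<rho>' 7 = Suc k \<and> I k (\<rho>'(7 := k)) \<kappa>')) (mem \<rho>1 \<kappa>1, es, i)"
      using r7 k by (simp, intro liftI) simp
  next
    fix \<rho>1 \<kappa>1 assume I: "I 0 \<rho>1 \<kappa>1"
    have kr: "keeps {7} \<rho> \<rho>1" and kk: "keeps {7, 8} \<kappa> \<kappa>1" and z: "\<forall>v\<in>V. \<kappa>1 7 v = v" "\<forall>v\<in>V. \<kappa>1 8 v = 0"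
      using I unfolding I_def by simp_all
    have c: "\<kappa>1 0 = \<kappa> 0" "\<kappa>1 2 = \<kappa> 2" "\<kappa>1 4 = \<kappa> 4" "\<kappa>1 6 = \<kappa> 6" using kk unfolding keeps_def by simp_all
    have "wp (NEXT ;; LOOP (reg 0) (EDGE ;; NEXT)) Q (mem \<rho>1 \<kappa>1, \<sigma> i, Suc i)"
    proof (rule wp_edges[where D = "[]"])
      have "known V (\<lambda>_ _. False) (\<kappa>1 2) (\<kappa>1 6) (\<kappa>1 4) (\<kappa>1 8) (\<kappa>1 7)"
        using known_init[of "\<kappa>1 4" V "\<kappa>1 8" "\<kappa>1 7"] s0 c z by simp
      moreover have "pairs_edge (\<kappa>1 0) [] = (\<lambda>_ _. False)" unfolding pairs_edge_def by simp
      ultimately show "known V (pairs_edge (\<kappa>1 0) []) (\<kappa>1 2) (\<kappa>1 6) (\<kappa>1 4) (\<kappa>1 8) (\<kappa>1 7)" by simp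
      fix \<rho>' b' e' D'
      assume kr': "keeps {0, 1, 2, 8, 10, 13, 14, 15, 16, 17} \<rho>1 \<rho>'" and D: "set D' = set [] \<union> set (\<sigma> i)"
        and K: "known V (pairs_edge (\<kappa>1 0) D') (\<kappa>1 2) (\<kappa>1 6) (\<kappa>1 4) b' e'"
      have "pairs_edge (\<kappa>1 0) D' = pairs_edge (\<kappa> 0) (\<sigma> i)" unfolding pairs_edge_def c using D by simp
      then have "known V (pairs_edge (\<kappa> 0) (\<sigma> i)) (\<kappa> 2) (\<kappa> 6) (\<kappa> 4) b' e'" using K c by simp
      moreover have "keeps {0, 1, 2, 7, 8, 10, 13, 14, 15, 16, 17} \<rho> \<rho>'" using kr kr' unfolding keeps_def by simp
      ultimately have "Q (mem \<rho>' (\<kappa>(7 := e', 8 := b')), [], Suc i)" by (intro Q)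
      moreover have "\<kappa>(7 := e', 8 := b') = \<kappa>1(7 := e', 8 := b')" using kk unfolding keeps_def by auto
      ultimately show "Q (mem \<rho>' (\<kappa>1(7 := e', 8 := b')), [], Suc i)" by simp
    qed (use F H names n c w kr in \<open>simp_all add: keeps_def\<close>)
    then show "wp (REWIND ;; NEXT ;; LOOP (reg 0) (EDGE ;; NEXT)) Q (mem \<rho>1 \<kappa>1, es, i)"
      by (simp add: wp_seq_fun)
  qed (use n in simp_all)
qed

text \<open>The last two conclusions serve different ends: the halved subtree sizes bound the number
  of rounds, and the visit to the root of every remaining tree guarantees progress, on which the
  termination of the loop over the rounds rests.\<close>

lemma wp_round:
  assumes pre: "almost_dfs V E (\<kappa> 2) a" and H: "heavy V (\<kappa> 2) (\<kappa> 6)"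
    and part: "partial_dfs V E (\<kappa> 2) (\<kappa> 4) (\<kappa> 3) (\<rho> 5)"
    and a: "\<kappa> 4 a \<noteq> 0" and names: "inj_on (\<kappa> 0) V" and n: "\<rho> 3 = n"
    and w: "\<forall>(u, v) \<in> set (\<sigma> i). Suc u < W \<and> Suc v < W"
    and E: "\<forall>x\<in>V. \<forall>y\<in>V. E x y \<longleftrightarrow> pairs_edge (\<kappa> 0) (\<sigma> i) x y"
    and bound: "\<forall>v\<in>V. \<kappa> 4 v = 0 \<longrightarrow> card (sub V (\<kappa> 2) v) * 2 ^ k \<le> n"
    and Q: "\<And>\<rho>' \<kappa>'. keeps {0, 1, 2, 5, 6, 7, 8, 10, 11, 12, 13, 14, 15, 16, 17} \<rho> \<rho>' \<Longrightarrow>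
       keeps {3, 4, 7, 8} \<kappa> \<kappa>' \<Longrightarrow> partial_dfs V E (\<kappa> 2) (\<kappa>' 4) (\<kappa>' 3) (\<rho>' 5) \<Longrightarrow>
       (\<forall>v. \<kappa> 4 v \<noteq> 0 \<longrightarrow> \<kappa>' 4 v = \<kappa> 4 v) \<Longrightarrow>
       (\<forall>v\<in>V. \<kappa>' 4 v = 0 \<longrightarrow> card (sub V (\<kappa> 2) v) * 2 ^ Suc k \<le> n) \<Longrightarrow>
       (\<forall>v\<in>V. \<kappa> 4 v = 0 \<longrightarrow> \<kappa> 4 (\<kappa> 2 v) \<noteq> 0 \<longrightarrow> \<kappa>' 4 v \<noteq> 0) \<Longrightarrow>
       Q (mem \<rho>' \<kappa>', [], Suc i)"
  shows "wp ROUND Q (mem \<rho> \<kappa>, es, i)"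
proof -
  let ?f = "\<kappa> 2" and ?hv = "\<kappa> 6"
  define st0 where "st0 = \<kappa> 4"
  define c where "c = \<rho> 5"
  note PD = partial_dfsD[OF part]
  have F: "forest V ?f" using almost_dfsD(1)[OF pre] .
  have s00: "st0 0 \<noteq> 0" using PD(1) unfolding st0_def by simp
  have up0: "\<forall>v\<in>V. st0 v \<noteq> 0 \<longrightarrow> st0 (?f v) \<noteq> 0" using PD(3) unfolding st0_def .
  have cn: "c \<le> Suc n" using partial_dfs_c_le[OF F part] unfolding c_def by simp
  have c1: "1 \<le> c" using PD(5) unfolding c_def by simp
  have cle: "st0 v \<le> c" if "v \<le> n" for v
  proof (cases "v = 0")
    case True then show ?thesis using PD(1) c1 unfolding st0_def by simp
  next
    case False
    then have "v \<in> V" using that by simp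
    then show ?thesis using PD(6) unfolding st0_def c_def by blast
  qed
  let ?C = "COND (Times (col 4 (col 2 (reg 7))) (NOT (LT (reg 6) (col 4 (col 2 (reg 7)))))) CHAIN SKIP"
  have "wp PASS (wp (FOR 7 ?C) Q) (mem (\<rho>(6 := c)) \<kappa>, es, i)"
  proof (rule wp_pass)
    fix \<rho>0 b e
    assume kr0: "keeps {0, 1, 2, 7, 8, 10, 13, 14, 15, 16, 17} (\<rho>(6 := c)) \<rho>0"
      and K: "known V (pairs_edge (\<kappa> 0) (\<sigma> i)) ?f ?hv (\<kappa> 4) b e"
    define \<kappa>0 where "\<kappa>0 = \<kappa>(7 := e, 8 := b)"
    have K0: "known V E ?f ?hv st0 b e" unfolding st0_def by (rule known_cong[OF K]) (use E in blast)
    define I where "I k' \<rho>' \<kappa>' \<longleftrightarrow> keeps {5, 7, 8, 10, 11, 12, 13, 14} \<rho>0 \<rho>' \<and> keeps {3, 4} \<kappa>0 \<kappa>' \<and>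
        partial_dfs V E ?f (\<kappa>' 4) (\<kappa>' 3) (\<rho>' 5) \<and> c \<le> \<rho>' 5 \<and> (\<forall>v. st0 v \<noteq> 0 \<longrightarrow> \<kappa>' 4 v = st0 v) \<and>
        (\<forall>v. st0 v = 0 \<longrightarrow> \<kappa>' 4 v = 0 \<or> c < \<kappa>' 4 v) \<and>
        (\<forall>j\<in>{Suc k'..n}. st0 (?f j) \<noteq> 0 \<longrightarrow> (\<forall>u. u \<noteq> 0 \<longrightarrow> anc ?hv u j \<longrightarrow> \<kappa>' 4 u \<noteq> 0))"
      for k' and \<rho>' :: "nat \<Rightarrow> nat" and \<kappa>' :: "nat \<Rightarrow> nat \<Rightarrow> nat"
    have "wp (FOR 7 ?C) Q (mem \<rho>0 \<kappa>0, [], Suc i)"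
    proof (rule wp_for[where I = I])
      show "I n (\<rho>0(7 := n)) \<kappa>0"
        unfolding I_def \<kappa>0_def st0_def using kr0 part by (simp add: keeps_def c_def)
      fix k' \<rho>1 \<kappa>1 assume k: "k' < n" and I: "I (Suc k') \<rho>1 \<kappa>1" and r7: "\<rho>1 7 = Suc k'"
      have kr: "keeps {5, 7, 8, 10, 11, 12, 13, 14} \<rho>0 \<rho>1" and kk: "keeps {3, 4} \<kappa>0 \<kappa>1"
        and p1: "partial_dfs V E ?f (\<kappa>1 4) (\<kappa>1 3) (\<rho>1 5)" and cl: "c \<le> \<rho>1 5"
        and ext: "\<forall>v. st0 v \<noteq> 0 \<longrightarrow> \<kappa>1 4 v = st0 v" "\<forall>v. st0 v = 0 \<longrightarrow> \<kappa>1 4 v = 0 \<or> c < \<kappa>1 4 v"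
        and old: "\<forall>j\<in>{Suc (Suc k')..n}. st0 (?f j) \<noteq> 0 \<longrightarrow> (\<forall>u. u \<noteq> 0 \<longrightarrow> anc ?hv u j \<longrightarrow> \<kappa>1 4 u \<noteq> 0)"
        using I unfolding I_def by blast+
      have c1: "\<kappa>1 2 = ?f" "\<kappa>1 6 = ?hv" "\<kappa>1 7 = e" "\<kappa>1 8 = b"
        using kk unfolding keeps_def \<kappa>0_def by simp_all
      define j where "j = Suc k'"
      have j: "j \<in> V" "j \<le> n" using k unfolding j_def by simp_all
      have fj: "?f j \<le> n" using forest_closed[OF F j(1)[THEN insertI2]] by (simp only: V_le)
      have r6: "\<rho>1 6 = c" "\<rho>1 3 = n" using kr kr0 n unfolding keeps_def by simp_all
      have ins: "{Suc k'..n} = insert j {Suc (Suc k')..n}" using k unfolding j_def by auto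
      \<comment> \<open>Vertices visited during the round have times above \<open>c\<close>, and
        older ones keep theirs. The current time therefore tells whether the vertex was visited
        before the round, with no copy of \<open>st0\<close> in memory.\<close>
      have cond: "aval (Times (col 4 (col 2 (reg 7))) (NOT (LT (reg 6) (col 4 (col 2 (reg 7)))))) (mem \<rho>1 \<kappa>1) \<noteq> 0
         \<longleftrightarrow> st0 (?f j) \<noteq> 0"
      proof -
        have "aval (Times (col 4 (col 2 (reg 7))) (NOT (LT (reg 6) (col 4 (col 2 (reg 7)))))) (mem \<rho>1 \<kappa>1) \<noteq> 0
          \<longleftrightarrow> \<kappa>1 4 (?f j) \<noteq> 0 \<and> \<kappa>1 4 (?f j) \<le> c"
          using r7 r6 c1 unfolding j_def by auto
        also have "\<dots> \<longleftrightarrow> st0 (?f j) \<noteq> 0"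
        proof (cases "st0 (?f j) = 0")
          case True
          then show ?thesis using ext(2) by (metis not_less)
        next
          case False
          then show ?thesis using ext(1) cle[OF fj] by simp
        qed
        finally show ?thesis .
      qed
      show "wp ?C (lift [] (Suc i) (\<lambda>\<rho>' \<kappa>'. \<rho>' 7 = Suc k' \<and> I k' (\<rho>'(7 := k')) \<kappa>')) (mem \<rho>1 \<kappa>1, [], Suc i)"
      proof (cases "st0 (?f j) = 0")
        case True
        have "I k' (\<rho>1(7 := k')) \<kappa>1"
          unfolding I_def ins using kr kk p1 cl ext old True by (simp add: keeps_def)
        then have "lift [] (Suc i) (\<lambda>\<rho>' \<kappa>'. \<rho>' 7 = Suc k' \<and> I k' (\<rho>'(7 := k')) \<kappa>') (mem \<rho>1 \<kappa>1, [], Suc i)"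
          using r7 by (intro liftI) simp
        then show ?thesis using cond True by (simp only: wp_cond fst_conv if_False not_True_eq_False wp_skip simp_thms)
      next
        case False
        have "wp CHAIN (lift [] (Suc i) (\<lambda>\<rho>' \<kappa>'. \<rho>' 7 = Suc k' \<and> I k' (\<rho>'(7 := k')) \<kappa>')) (mem \<rho>1 \<kappa>1, [], Suc i)"
        proof (rule wp_chain[where E = E and a = a and ?st0.0 = st0])
          fix \<rho>2 st' sp'
          assume k2: "keeps {5, 8, 10, 11, 12, 13, 14} \<rho>1 \<rho>2" and p2: "partial_dfs V E (\<kappa>1 2) st' sp' (\<rho>2 5)"
            and e2: "\<forall>v. \<kappa>1 4 v \<noteq> 0 \<longrightarrow> st' v = \<kappa>1 4 v" "\<forall>v. \<kappa>1 4 v = 0 \<longrightarrow> st' v = 0 \<or> \<rho>1 5 < st' v"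
            and le: "\<rho>1 5 \<le> \<rho>2 5" and vis: "\<forall>u. u \<noteq> 0 \<longrightarrow> anc (\<kappa>1 6) u (\<rho>1 7) \<longrightarrow> st' u \<noteq> 0"
          let ?\<kappa> = "\<kappa>1(3 := sp', 4 := st')"
          have "I k' (\<rho>2(7 := k')) ?\<kappa>"
            unfolding I_def
          proof (intro conjI allI ballI impI)
            fix v
            show "?\<kappa> 4 v = st0 v" if "st0 v \<noteq> 0" using ext(1) e2(1) that by simp
            show "?\<kappa> 4 v = 0 \<or> c < ?\<kappa> 4 v" if "st0 v = 0"
            proof (cases "\<kappa>1 4 v = 0")
              case True
              then have "st' v = 0 \<or> \<rho>1 5 < st' v" using e2(2) by blast
              then show ?thesis using cl by auto
            next
              case False
              then have "st' v = \<kappa>1 4 v" "c < \<kappa>1 4 v" using e2(1) ext(2) that by metis+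
              then show ?thesis by simp
            qed
          next
            fix j' u assume j': "j' \<in> {Suc k'..n}" "st0 (?f j') \<noteq> 0" "u \<noteq> 0" "anc ?hv u j'"
            show "?\<kappa> 4 u \<noteq> 0"
            proof (cases "j' = j")
              case True
              then show ?thesis using vis j' c1 r7 unfolding j_def by simp
            next
              case False
              then have "\<kappa>1 4 u \<noteq> 0" using old j' unfolding ins by blast
              then show ?thesis using e2(1) by simp
            qed
          qed (use kr kk k2 p2 c1 cl le in \<open>simp_all add: keeps_def\<close>)
          then show "lift [] (Suc i) (\<lambda>\<rho>' \<kappa>'. \<rho>' 7 = Suc k' \<and> I k' (\<rho>'(7 := k')) \<kappa>') (mem \<rho>2 ?\<kappa>, [], Suc i)"
            using r7 k2 by (intro liftI) (simp add: keeps_def)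
        qed (use pre H p1 K0 up0 s00 a ext r6 j False r7 c1 in \<open>simp_all add: st0_def j_def\<close>)
        then show ?thesis using cond False by (simp only: wp_cond fst_conv if_True simp_thms)
      qed
    next
      fix \<rho>1 \<kappa>1 assume I: "I 0 \<rho>1 \<kappa>1"
      have kr: "keeps {5, 7, 8, 10, 11, 12, 13, 14} \<rho>0 \<rho>1" and kk: "keeps {3, 4} \<kappa>0 \<kappa>1"
        and p1: "partial_dfs V E ?f (\<kappa>1 4) (\<kappa>1 3) (\<rho>1 5)"
        and ext: "\<forall>v. st0 v \<noteq> 0 \<longrightarrow> \<kappa>1 4 v = st0 v"
        and old: "\<forall>j\<in>V. st0 (?f j) \<noteq> 0 \<longrightarrow> (\<forall>u. u \<noteq> 0 \<longrightarrow> anc ?hv u j \<longrightarrow> \<kappa>1 4 u \<noteq> 0)"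
        using I unfolding I_def by simp_all
      show "Q (mem \<rho>1 \<kappa>1, [], Suc i)"
      proof (rule Q)
        show "keeps {0, 1, 2, 5, 6, 7, 8, 10, 11, 12, 13, 14, 15, 16, 17} \<rho> \<rho>1"
          using kr kr0 unfolding keeps_def by simp
        show "keeps {3, 4, 7, 8} \<kappa> \<kappa>1" using kk unfolding keeps_def \<kappa>0_def by simp
        show "\<forall>v\<in>V. \<kappa>1 4 v = 0 \<longrightarrow> card (sub V ?f v) * 2 ^ Suc k \<le> n"
        proof (rule round_halves[where ?st0.0 = st0, OF F H s00])
          show "\<forall>v\<in>V. st0 v = 0 \<longrightarrow> card (sub V ?f v) * 2 ^ k \<le> n" using bound unfolding st0_def .
          show "\<forall>v. st0 v \<noteq> 0 \<longrightarrow> \<kappa>1 4 v \<noteq> 0" using ext by simp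
          show "\<forall>z\<in>V. st0 z = 0 \<longrightarrow> st0 (?f z) \<noteq> 0 \<longrightarrow> (\<forall>u. u \<noteq> 0 \<longrightarrow> anc ?hv u z \<longrightarrow> \<kappa>1 4 u \<noteq> 0)"
            using old by blast
        qed
        show "\<forall>v\<in>V. \<kappa> 4 v = 0 \<longrightarrow> \<kappa> 4 (?f v) \<noteq> 0 \<longrightarrow> \<kappa>1 4 v \<noteq> 0"
          using old unfolding st0_def by (metis anc_refl forest_pos[OF F])
      qed (use p1 ext in \<open>simp_all add: st0_def\<close>)
    qed (use kr0 n in \<open>simp_all add: keeps_def\<close>)
    then show "wp (FOR 7 ?C) Q (mem \<rho>0 (\<kappa>(7 := e, 8 := b)), [], Suc i)" unfolding \<kappa>0_def .
  qed (use F H names s00 n w in \<open>simp_all add: st0_def\<close>)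
  then show ?thesis unfolding ROUND_def using cn c_def by (simp add: wp_seq_fun)
qed

end

section \<open>Codes of vertices versus rows of the table\<close>

definition row_codes :: "nat \<Rightarrow> (nat \<Rightarrow> nat) \<Rightarrow> nat set" where
  "row_codes n name = (\<lambda>v. Suc (name v)) ` {1..n}"

text \<open>The search as a total function; the default 0 agrees with \<open>is_row\<close> and
  sends the dummy to itself.\<close>

definition row_of :: "nat \<Rightarrow> (nat \<Rightarrow> nat) \<Rightarrow> nat \<Rightarrow> nat" where
  "row_of n name c = (if c \<in> row_codes n name then inv_into {1..n} (\<lambda>v. Suc (name v)) c else 0)"

lemma row_of_code:
  assumes "inj_on name {1..n}" "v \<in> {1..n}"
  shows "row_of n name (Suc (name v)) = v"
proof -
  have "inj_on (\<lambda>v. Suc (name v)) {1..n}" using assms(1) by (simp only: inj_on_def nat.inject)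
  then have "inv_into {1..n} (\<lambda>v. Suc (name v)) (Suc (name v)) = v"
    by (rule inv_into_f_f) (rule assms(2))
  moreover have "Suc (name v) \<in> row_codes n name" using assms(2) unfolding row_codes_def by (rule imageI)
  ultimately show ?thesis unfolding row_of_def by (simp only: if_True)
qed

lemma row_of_0: "row_of n name 0 = 0"
  unfolding row_of_def row_codes_def by auto

lemma is_row_row_of:
  assumes "inj_on name {1..n}" "is_row n name q v"
  shows "v = row_of n name q"
proof (cases "v = 0")
  case True
  then have "\<forall>v\<in>{1..n}. Suc (name v) \<noteq> q" using assms(2) unfolding is_row_def by auto
  then have "q \<notin> row_codes n name" unfolding row_codes_def by auto
  then show ?thesis using True unfolding row_of_def by simp
next
  case False
  then have v: "v \<in> {1..n}" "Suc (name v) = q" using assms(2) unfolding is_row_def by blast+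
  show ?thesis using row_of_code[OF assms(1) v(1)] v(2) by simp
qed

lemma row_of_bij:
  assumes "inj_on name {1..n}"
  shows "bij_betw (row_of n name) (row_codes n name) {1..n}"
proof -
  have "inj_on (\<lambda>v. Suc (name v)) {1..n}" using assms by (simp only: inj_on_def nat.inject)
  then have "bij_betw (inv_into {1..n} (\<lambda>v. Suc (name v))) (row_codes n name) {1..n}"
    unfolding row_codes_def by (intro bij_betw_inv_into inj_on_imp_bij_betw)
  then show ?thesis
    by (rule bij_betw_cong[THEN iffD1, rotated]) (simp add: row_of_def)
qed

context rows
begin

lemma rows_to_almost_dfs:
  assumes A: "almost_dfs (row_codes n name) E f a" and inj: "inj_on name V"
    and f: "\<forall>v\<in>V. f (Suc (name v)) = (if out v \<in> row_codes n name then out v else 0)"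
    and tp: "\<forall>v\<in>V. is_row n name (out v) (tp v)" "tp 0 = 0"
  shows "almost_dfs V (\<lambda>x y. E (Suc (name x)) (Suc (name y))) tp (row_of n name a)"
proof (rule almost_dfs_transfer[OF A row_of_bij[OF inj] row_of_0])
  have code: "\<exists>v\<in>V. c = Suc (name v) \<and> row_of n name c = v" if "c \<in> row_codes n name" for c
    using that row_of_code[OF inj] unfolding row_codes_def by auto
  show "0 \<notin> V" by simp
  show "tp 0 = 0" by (rule tp)
  show "\<forall>c\<in>row_codes n name. tp (row_of n name c) = row_of n name (f c)"
  proof
    fix c assume "c \<in> row_codes n name"
    then obtain v where v: "v \<in> V" "c = Suc (name v)" "row_of n name c = v" using code by blast
    have "tp v = row_of n name (out v)" using is_row_row_of[OF inj] tp(1) v(1) by blast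
    moreover have "row_of n name (f c) = row_of n name (out v)"
    proof (cases "out v \<in> row_codes n name")
      case False
      then have "row_of n name (out v) = 0" unfolding row_of_def by simp
      then show ?thesis using f v(1,2) False row_of_0 by simp
    qed (use f v in simp)
    ultimately show "tp (row_of n name c) = row_of n name (f c)" using v by simp
  qed
  show "\<forall>u\<in>row_codes n name. \<forall>v\<in>row_codes n name.
    E (Suc (name (row_of n name u))) (Suc (name (row_of n name v))) \<longleftrightarrow> E u v"
  proof (intro ballI)
    fix c d assume "c \<in> row_codes n name" "d \<in> row_codes n name"
    then have "Suc (name (row_of n name c)) = c" "Suc (name (row_of n name d)) = d" using code by metis+
    then show "E (Suc (name (row_of n name c))) (Suc (name (row_of n name d))) \<longleftrightarrow> E c d" by simp
  qed
  show "\<forall>u v. E (Suc (name u)) (Suc (name v)) \<longrightarrow> E (Suc (name v)) (Suc (name u))"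
    using almost_dfsD(3)[OF A] by blast
qed

lemma almost_dfs_to_rows:
  assumes A: "almost_dfs V (\<lambda>x y. E (Suc (name x)) (Suc (name y))) sp 0" and inj: "inj_on name V"
    and sym: "\<forall>u v. E u v \<longrightarrow> E v u"
    and f: "f 0 = 0" "\<forall>v\<in>V. f (Suc (name v)) = (if sp v = 0 then 0 else Suc (name (sp v)))"
  shows "almost_dfs (row_codes n name) E f 0"
proof -
  define g where "g v = (if v = 0 then 0 else Suc (name v))" for v
  have F: "forest V sp" using almost_dfsD(1)[OF A] .
  have "almost_dfs (row_codes n name) E f (g 0)"
  proof (rule almost_dfs_transfer[OF A])
    have g: "g v = Suc (name v)" if "v \<in> V" for v using that unfolding g_def by simp
    have "inj_on (\<lambda>v. Suc (name v)) V" using inj by (simp only: inj_on_def nat.inject)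
    then have "inj_on g V" by (rule inj_on_cong[THEN iffD2, rotated]) (rule g)
    moreover have "g ` V = row_codes n name" unfolding row_codes_def by (rule image_cong[OF refl g])
    ultimately show "bij_betw g V (row_codes n name)" unfolding bij_betw_def by blast
    show "g 0 = 0" unfolding g_def by simp
    show "0 \<notin> row_codes n name" unfolding row_codes_def by blast
    show "f 0 = 0" by (rule f)
    show "\<forall>v\<in>V. f (g v) = g (sp v)" using f unfolding g_def by simp
    show "\<forall>u\<in>V. \<forall>v\<in>V. E (g u) (g v) \<longleftrightarrow> E (Suc (name u)) (Suc (name v))" unfolding g_def by simp
  qed (rule sym)
  then show ?thesis unfolding g_def by simp
qed

text \<open>Nothing but the dummy is visited yet, so the walk from \<open>a\<close> needs no choice
  of an edge. Afterwards the root path of \<open>a\<close> is visited, which disarms the cross edges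
  of the old forest. For \<open>a = 0\<close> there are none, and the walk is empty.\<close>

lemma wp_initial_walk:
  assumes pre: "almost_dfs V E (\<kappa> 2) a" and n: "\<rho> 3 = n" and c: "\<rho> 5 = 1"
    and st: "\<kappa> 4 0 = 1" "\<forall>v\<in>V. \<kappa> 4 v = 0" and sp: "\<kappa> 3 0 = 0"
    and x: "\<rho> 11 = 0" "\<rho> 12 = a"
    and Q: "\<And>\<rho>' st' sp'. keeps {5, 11, 12} \<rho> \<rho>' \<Longrightarrow> partial_dfs V E (\<kappa> 2) st' sp' (\<rho>' 5) \<Longrightarrow>
       st' a \<noteq> 0 \<Longrightarrow> Q (mem \<rho>' (\<kappa>(3 := sp', 4 := st')), es, i)"
  shows "wp WALK Q (mem \<rho> \<kappa>, es, i)"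
proof -
  let ?f = "\<kappa> 2"
  have F: "forest V ?f" using almost_dfsD(1)[OF pre] .
  have part: "partial_dfs V E ?f (\<kappa> 4) (\<kappa> 3) 1" by (rule partial_dfs_init) (use F st sp in simp_all)
  have aV: "a \<in> insert 0 V" using almost_dfsD(2)[OF pre] .
  have an: "a \<le> n" using aV by (simp only: V_le)
  show ?thesis
  proof (cases "a = 0")
    case True
    show ?thesis
    proof (rule wp_walk[where k = 0])
      fix st' sp' s' x'
      assume "walked ?f (\<rho> 11) (\<rho> 12) 0 (\<kappa> 4) (\<kappa> 3) (\<rho> 5) st' sp'"
      then have "st' = \<kappa> 4" "sp' = \<kappa> 3" unfolding walked_def by auto
      then show "Q (mem (\<rho>(5 := \<rho> 5 + 0, 11 := s', 12 := x')) (\<kappa>(3 := sp', 4 := st')), es, i)"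
        by (intro Q) (use part st True c in \<open>simp_all add: keeps_def\<close>)
    qed (use F x an st c True in simp_all)
  next
    case False
    then have aV: "a \<in> V" using aV by simp
    have "\<exists>k. (?f ^^ k) a = 0" using anc_zero[OF F, of a] aV unfolding anc_def by simp
    \<comment> \<open>The least number of steps to the dummy; the vertex just before it is the root
      of the tree of \<open>a\<close>.\<close>
    then obtain k where k: "(?f ^^ k) a = 0" "\<forall>j<k. (?f ^^ j) a \<noteq> 0"
      using exists_least_iff[of "\<lambda>k. (?f ^^ k) a = 0"] by blast
    then obtain m where m: "k = Suc m" using False by (cases k) simp_all
    have pV: "(?f ^^ j) a \<in> V" if "j \<le> m" for j
      using anc_mem[OF F anc_funpow, of a j] aV k(2) m that by auto
    have unv: "\<forall>j<Suc m. \<kappa> 4 ((?f ^^ j) a) = 0" using pV st(2) by (simp add: less_Suc_eq_le)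
    show ?thesis
    proof (rule wp_walk[where k = "Suc m"])
      have "Suc (card {v \<in> V. \<kappa> 4 v \<noteq> 0}) + Suc m \<le> card V + 1"
        by (rule unvisited_path_room[OF F _ _ unv]) (use aV st in simp_all)
      then show "\<rho> 5 + Suc m \<le> n + 1" using c by simp
      show "\<kappa> 4 ((?f ^^ Suc m) (\<rho> 12)) \<noteq> 0" using k(1) m x st by simp
      show "\<forall>j<Suc m. \<kappa> 4 ((?f ^^ j) (\<rho> 12)) = 0" using unv x by simp
      fix st' sp' s' x'
      assume w: "walked ?f (\<rho> 11) (\<rho> 12) (Suc m) (\<kappa> 4) (\<kappa> 3) (\<rho> 5) st' sp'"
      have w': "walked ?f 0 a (Suc m) (\<kappa> 4) (\<kappa> 3) 1 st' sp'" using w x c by simp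
      have z: "\<kappa> 4 ((?f ^^ m) a) = 0" "\<kappa> 4 (?f ((?f ^^ m) a)) \<noteq> 0"
        using unv k(1) m st by simp_all
      have best: "\<forall>y\<in>sub V ?f ((?f ^^ m) a). \<forall>w\<in>V. \<kappa> 4 w \<noteq> 0 \<longrightarrow> E y w \<longrightarrow> \<kappa> 4 w \<le> \<kappa> 4 0"
        using st(2) by simp
      have s: "(0::nat) \<in> insert 0 V" "\<kappa> 4 0 \<noteq> 0" "(0::nat) \<noteq> 0 \<longrightarrow> E a 0" using st by simp_all
      have ac: "\<kappa> 4 a \<noteq> 0 \<or> (a = a \<and> (\<forall>v\<in>V. \<kappa> 4 v = 0))" using st(2) by blast
      note W = partial_dfs_walk[OF pre part aV refl z s best w' ac]
      show "Q (mem (\<rho>(5 := \<rho> 5 + Suc m, 11 := s', 12 := x')) (\<kappa>(3 := sp', 4 := st')), es, i)"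
        by (rule Q) (use W(1,5) c in \<open>simp_all add: keeps_def\<close>)
    qed (use F x an st in simp_all)
  qed
qed

text \<open>After \<open>k\<close> rounds an unvisited vertex has at most \<open>n / 2 ^ k\<close>
  descendants, itself included. Another round starts only if such a vertex exists, so
  \<open>2 ^ k \<le> n\<close> at that point; counting this round gives the exponent
  \<open>k - 1\<close> of the conclusion.\<close>

lemma wp_rounds:
  assumes pre: "almost_dfs V E (\<kappa> 2) a" and H: "heavy V (\<kappa> 2) (\<kappa> 6)"
    and part: "partial_dfs V E (\<kappa> 2) (\<kappa> 4) (\<kappa> 3) (\<rho> 5)"
    and a: "\<kappa> 4 a \<noteq> 0" and names: "inj_on (\<kappa> 0) V" and n: "\<rho> 3 = n"
    and w: "\<forall>j. \<forall>(u, v) \<in> set (\<sigma> j). Suc u < W \<and> Suc v < W"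
    and E: "\<forall>j. \<forall>x\<in>V. \<forall>y\<in>V. E x y \<longleftrightarrow> pairs_edge (\<kappa> 0) (\<sigma> j) x y"
    and Q: "\<And>\<rho>' \<kappa>' es' k. keeps {0, 1, 2, 5, 6, 7, 8, 10, 11, 12, 13, 14, 15, 16, 17} \<rho> \<rho>' \<Longrightarrow>
       keeps {3, 4, 7, 8} \<kappa> \<kappa>' \<Longrightarrow> almost_dfs V E (\<kappa>' 3) 0 \<Longrightarrow> k = 0 \<or> 2 ^ (k - 1) \<le> n \<Longrightarrow>
       Q (mem \<rho>' \<kappa>', es', i + k)"
  shows "wp (LOOP (LT (reg 5) (Plus (reg 3) (Const (Suc 0)))) ROUND) Q (mem \<rho> \<kappa>, es, i)"
proof -
  let ?f = "\<kappa> 2"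
  have F: "forest V ?f" using almost_dfsD(1)[OF pre] .
  define J where "J \<rho>' \<kappa>' k \<longleftrightarrow> keeps {0, 1, 2, 5, 6, 7, 8, 10, 11, 12, 13, 14, 15, 16, 17} \<rho> \<rho>' \<and>
       keeps {3, 4, 7, 8} \<kappa> \<kappa>' \<and> partial_dfs V E ?f (\<kappa>' 4) (\<kappa>' 3) (\<rho>' 5) \<and> \<kappa>' 4 a \<noteq> 0 \<and>
       (\<forall>v\<in>V. \<kappa>' 4 v = 0 \<longrightarrow> card (sub V ?f v) * 2 ^ k \<le> n) \<and> (k = 0 \<or> 2 ^ (k - 1) \<le> n)"
    for \<rho>' \<kappa>' and k :: nat
  \<comment> \<open>The clock is one more than the number of visited vertices, so it reaches
    \<open>Suc n\<close> exactly when none is left.\<close>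
  have vis: "(\<forall>v\<in>V. st v \<noteq> 0) \<longleftrightarrow> \<not> c < Suc n" if "partial_dfs V E ?f st sp c" for st sp c
  proof -
    have c: "c = Suc (card {v \<in> V. st v \<noteq> 0})" using partial_dfsD(5)[OF that] .
    show ?thesis
    proof
      assume "\<forall>v\<in>V. st v \<noteq> 0"
      then have "{v \<in> V. st v \<noteq> 0} = V" by blast
      then show "\<not> c < Suc n" using c by simp
    next
      assume "\<not> c < Suc n"
      then have "card V \<le> card {v \<in> V. st v \<noteq> 0}" using c by simp
      then have "{v \<in> V. st v \<noteq> 0} = V" by (intro card_seteq) auto
      then show "\<forall>v\<in>V. st v \<noteq> 0" by blast
    qed
  qed
  show ?thesis
  proof (rule wp_loop[where I = "\<lambda>x. \<exists>\<rho>' \<kappa>' es' k. x = (mem \<rho>' \<kappa>', es' :: stream, i + k) \<and> J \<rho>' \<kappa>' k" and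
        \<mu> = "\<lambda>(m, _, _). Suc n - m 5"])
    have "card (sub V ?f v) \<le> n" for v
    proof -
      have "card (sub V ?f v) \<le> card V" by (rule card_mono) (auto simp: sub_def)
      then show ?thesis by simp
    qed
    then have "J \<rho> \<kappa> 0" unfolding J_def using part a by (simp add: keeps_def)
    moreover have "(mem \<rho> \<kappa>, es, i) = (mem \<rho> \<kappa>, es, i + 0)" by simp
    ultimately show "\<exists>\<rho>' \<kappa>' es' k. (mem \<rho> \<kappa>, es, i) = (mem \<rho>' \<kappa>', es', i + k) \<and> J \<rho>' \<kappa>' k" by blast
  next
    fix x assume "\<exists>\<rho>' \<kappa>' es' k. x = (mem \<rho>' \<kappa>', es' :: stream, i + k) \<and> J \<rho>' \<kappa>' k"
      and g: "aval (LT (reg 5) (Plus (reg 3) (Const (Suc 0)))) (fst x) \<noteq> 0"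
    then obtain \<rho>1 \<kappa>1 es1 k where x: "x = (mem \<rho>1 \<kappa>1, es1, i + k)" and J: "J \<rho>1 \<kappa>1 k" by blast
    have kr: "keeps {0, 1, 2, 5, 6, 7, 8, 10, 11, 12, 13, 14, 15, 16, 17} \<rho> \<rho>1"
      and kk: "keeps {3, 4, 7, 8} \<kappa> \<kappa>1" and p1: "partial_dfs V E ?f (\<kappa>1 4) (\<kappa>1 3) (\<rho>1 5)" and a1: "\<kappa>1 4 a \<noteq> 0"
      and bound: "\<forall>v\<in>V. \<kappa>1 4 v = 0 \<longrightarrow> card (sub V ?f v) * 2 ^ k \<le> n" and k: "k = 0 \<or> 2 ^ (k - 1) \<le> n"
      using J unfolding J_def by blast+
    have c: "\<kappa>1 0 = \<kappa> 0" "\<kappa>1 2 = ?f" "\<kappa>1 6 = \<kappa> 6" "\<rho>1 3 = n" using kr kk n unfolding keeps_def by simp_all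
    have lt: "\<rho>1 5 < Suc n" using g c unfolding x by simp
    then obtain v where v: "v \<in> V" "\<kappa>1 4 v = 0" using vis[OF p1] by blast
    have "card (sub V ?f v) > 0"
      using v finite_sub[OF F] unfolding card_gt_0_iff sub_def by (auto intro: anc_refl)
    then have "2 ^ k \<le> card (sub V ?f v) * 2 ^ k" by simp
    also have "\<dots> \<le> n" using bound v by blast
    finally have k': "2 ^ (Suc k - 1) \<le> n" by simp
    have s1: "\<kappa>1 4 0 \<noteq> 0" using partial_dfsD(1)[OF p1] by simp
    obtain z where z: "z \<in> V" "\<kappa>1 4 z = 0" "\<kappa>1 4 (?f z) \<noteq> 0"
      using unvisited_root[where st = "\<kappa>1 4", OF F s1 v] by blast
    have "wp ROUND (\<lambda>y. (\<exists>\<rho>' \<kappa>' es' k. y = (mem \<rho>' \<kappa>', es', i + k) \<and> J \<rho>' \<kappa>' k) \<and>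
       (case y of (m, _, _) \<Rightarrow> Suc n - m 5) < Suc n - \<rho>1 5) (mem \<rho>1 \<kappa>1, es1, i + k)"
    proof (rule wp_round[where E = E and a = a and k = k])
      fix \<rho>2 \<kappa>2
      assume kr2: "keeps {0, 1, 2, 5, 6, 7, 8, 10, 11, 12, 13, 14, 15, 16, 17} \<rho>1 \<rho>2"
        and kk2: "keeps {3, 4, 7, 8} \<kappa>1 \<kappa>2" and p2: "partial_dfs V E (\<kappa>1 2) (\<kappa>2 4) (\<kappa>2 3) (\<rho>2 5)"
        and ext: "\<forall>v. \<kappa>1 4 v \<noteq> 0 \<longrightarrow> \<kappa>2 4 v = \<kappa>1 4 v"
        and b2: "\<forall>v\<in>V. \<kappa>2 4 v = 0 \<longrightarrow> card (sub V (\<kappa>1 2) v) * 2 ^ Suc k \<le> n"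
        and new: "\<forall>v\<in>V. \<kappa>1 4 v = 0 \<longrightarrow> \<kappa>1 4 (\<kappa>1 2 v) \<noteq> 0 \<longrightarrow> \<kappa>2 4 v \<noteq> 0"
      have J2: "J \<rho>2 \<kappa>2 (Suc k)"
        unfolding J_def
      proof (intro conjI)
        show "keeps {0, 1, 2, 5, 6, 7, 8, 10, 11, 12, 13, 14, 15, 16, 17} \<rho> \<rho>2"
          using kr kr2 unfolding keeps_def by simp
        show "keeps {3, 4, 7, 8} \<kappa> \<kappa>2" using kk kk2 unfolding keeps_def by simp
        show "\<kappa>2 4 a \<noteq> 0" using ext a1 by metis
        show "Suc k = 0 \<or> 2 ^ (Suc k - 1) \<le> n" using k' by blast
      qed (use p2 b2 c in simp_all)
      have "{v \<in> V. \<kappa>1 4 v \<noteq> 0} \<subset> {v \<in> V. \<kappa>2 4 v \<noteq> 0}"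
      proof
        show "{v \<in> V. \<kappa>1 4 v \<noteq> 0} \<subseteq> {v \<in> V. \<kappa>2 4 v \<noteq> 0}" using ext by auto
        have "z \<in> {v \<in> V. \<kappa>2 4 v \<noteq> 0}" "z \<notin> {v \<in> V. \<kappa>1 4 v \<noteq> 0}" using z new c by simp_all
        then show "{v \<in> V. \<kappa>1 4 v \<noteq> 0} \<noteq> {v \<in> V. \<kappa>2 4 v \<noteq> 0}" by metis
      qed
      then have "card {v \<in> V. \<kappa>1 4 v \<noteq> 0} < card {v \<in> V. \<kappa>2 4 v \<noteq> 0}" by (intro psubset_card_mono) simp_all
      then have "\<rho>1 5 < \<rho>2 5" using partial_dfsD(5)[OF p1] partial_dfsD(5)[OF p2] by simp
      then have "Suc n - mem \<rho>2 \<kappa>2 5 < Suc n - \<rho>1 5" using lt by (simp add: mem_reg)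
      moreover have "(mem \<rho>2 \<kappa>2, [], Suc (i + k)) = (mem \<rho>2 \<kappa>2, [], i + Suc k)" by simp
      ultimately show "(\<exists>\<rho>' \<kappa>' es' k'. (mem \<rho>2 \<kappa>2, [], Suc (i + k)) = (mem \<rho>' \<kappa>', es', i + k') \<and> J \<rho>' \<kappa>' k') \<and>
          (case (mem \<rho>2 \<kappa>2, [], Suc (i + k)) of (m, _, _) \<Rightarrow> Suc n - m 5) < Suc n - \<rho>1 5"
        using J2 by fastforce
    qed (use pre H p1 a1 names c w E bound in simp_all)
    then show "wp ROUND (\<lambda>y. (\<exists>\<rho>' \<kappa>' es' k. y = (mem \<rho>' \<kappa>', es', i + k) \<and> J \<rho>' \<kappa>' k) \<and>
       (case y of (m, _, _) \<Rightarrow> Suc n - m 5) < (case x of (m, _, _) \<Rightarrow> Suc n - m 5)) x"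
      unfolding x by (simp add: mem_reg)
  next
    fix x assume "\<exists>\<rho>' \<kappa>' es' k. x = (mem \<rho>' \<kappa>', es' :: stream, i + k) \<and> J \<rho>' \<kappa>' k"
      and g: "aval (LT (reg 5) (Plus (reg 3) (Const (Suc 0)))) (fst x) = 0"
    then obtain \<rho>1 \<kappa>1 es1 k where x: "x = (mem \<rho>1 \<kappa>1, es1, i + k)" and J: "J \<rho>1 \<kappa>1 k" by blast
    have kr: "keeps {0, 1, 2, 5, 6, 7, 8, 10, 11, 12, 13, 14, 15, 16, 17} \<rho> \<rho>1"
      and kk: "keeps {3, 4, 7, 8} \<kappa> \<kappa>1" and p1: "partial_dfs V E ?f (\<kappa>1 4) (\<kappa>1 3) (\<rho>1 5)"
      and k: "k = 0 \<or> 2 ^ (k - 1) \<le> n"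
      using J unfolding J_def by blast+
    have "\<rho>1 3 = n" using kr n unfolding keeps_def by simp
    then have "\<forall>v\<in>V. \<kappa>1 4 v \<noteq> 0" using vis[OF p1] g unfolding x by simp
    then have "almost_dfs V E (\<kappa>1 3) 0" using partial_dfs_done[OF pre p1] by blast
    then show "Q x" unfolding x by (intro Q[OF kr kk _ k])
  qed
qed

end

context rows
begin

lemma wp_write_table:
  assumes n: "\<rho> 3 = n" and sp: "\<forall>v\<in>V. \<kappa> 3 v \<le> n" and w: "\<forall>v\<in>V. Suc (\<kappa> 0 v) < W"
    and Q: "\<And>\<rho>' \<kappa>'. keeps {7} \<rho> \<rho>' \<Longrightarrow> keeps {1} \<kappa> \<kappa>' \<Longrightarrow>
       (\<forall>v\<in>V. \<kappa>' 1 v = (if \<kappa> 3 v = 0 then 0 else Suc (\<kappa> 0 (\<kappa> 3 v)))) \<Longrightarrow> Q (mem \<rho>' \<kappa>', es, i)"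
  shows "wp (FOR 7 (COND (col 3 (reg 7)) (PUT (Suc 0) (reg 7) (Plus (col 0 (col 3 (reg 7))) (Const (Suc 0))))
       (PUT (Suc 0) (reg 7) (Const 0)))) Q (mem \<rho> \<kappa>, es, i)"
proof -
  define g where "g v = (if \<kappa> 3 v = 0 then 0 else Suc (\<kappa> 0 (\<kappa> 3 v)))" for v
  define I where "I k \<rho>' \<kappa>' \<longleftrightarrow> keeps {7} \<rho> \<rho>' \<and> keeps {1} \<kappa> \<kappa>' \<and> (\<forall>v\<in>{Suc k..n}. \<kappa>' 1 v = g v)"
    for k and \<rho>' :: "nat \<Rightarrow> nat" and \<kappa>' :: "nat \<Rightarrow> nat \<Rightarrow> nat"
  show ?thesis
  proof (rule wp_for[where I = I])
    show "I n (\<rho>(7 := n)) \<kappa>" unfolding I_def keeps_def by simp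
    fix k \<rho>1 \<kappa>1 assume k: "k < n" and I: "I (Suc k) \<rho>1 \<kappa>1" and r7: "\<rho>1 7 = Suc k"
    have kk: "keeps {1} \<kappa> \<kappa>1" using I unfolding I_def by blast
    have c: "\<kappa>1 0 = \<kappa> 0" "\<kappa>1 3 = \<kappa> 3" using kk unfolding keeps_def by simp_all
    have j: "Suc k \<in> V" using k by simp
    have gw: "g (Suc k) < W"
    proof (cases "\<kappa> 3 (Suc k) = 0")
      case False
      then have "\<kappa> 3 (Suc k) \<in> V" using sp j by auto
      then show ?thesis using w False unfolding g_def by simp
    qed (simp add: g_def)
    have "I k (\<rho>1(7 := k)) (\<kappa>1(1 := (\<kappa>1 1)(Suc k := g (Suc k))))"
      unfolding I_def
    proof (intro conjI ballI)
      fix v assume v: "v \<in> {Suc k..n}"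
      show "(\<kappa>1(1 := (\<kappa>1 1)(Suc k := g (Suc k)))) 1 v = g v"
        using I v unfolding I_def by (cases "v = Suc k") simp_all
    qed (use I in \<open>simp_all add: I_def keeps_def\<close>)
    then have L: "lift es i (\<lambda>\<rho>' \<kappa>'. \<rho>' 7 = Suc k \<and> I k (\<rho>'(7 := k)) \<kappa>')
       (mem \<rho>1 (\<kappa>1(1 := (\<kappa>1 1)(Suc k := g (Suc k)))), es, i)"
      using r7 by (intro liftI) simp
    show "wp (COND (col 3 (reg 7)) (PUT (Suc 0) (reg 7) (Plus (col 0 (col 3 (reg 7))) (Const (Suc 0))))
       (PUT (Suc 0) (reg 7) (Const 0)))
      (lift es i (\<lambda>\<rho>' \<kappa>'. \<rho>' 7 = Suc k \<and> I k (\<rho>'(7 := k)) \<kappa>')) (mem \<rho>1 \<kappa>1, es, i)"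
    proof (cases "\<kappa> 3 (Suc k) = 0")
      case True
      then have "g (Suc k) = 0" unfolding g_def by simp
      then show ?thesis using L True r7 k c by simp
    next
      case False
      then have "g (Suc k) = Suc (\<kappa> 0 (\<kappa> 3 (Suc k)))" unfolding g_def by simp
      then show ?thesis using L gw False r7 k c by simp
    qed
  next
    fix \<rho>1 \<kappa>1 assume I: "I 0 \<rho>1 \<kappa>1"
    show "Q (mem \<rho>1 \<kappa>1, es, i)"
      by (rule Q) (use I in \<open>simp_all add: I_def g_def\<close>)
  qed (use n in simp_all)
qed

lemma wp_core:
  assumes n: "\<rho> 3 = n" and names: "inj_on (\<kappa> 0) V"
    and words: "\<forall>v\<in>V. Suc (\<kappa> 0 v) < W" "\<forall>v\<in>V. \<kappa> 1 v < W" "\<rho> 4 < W"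
    and w: "\<forall>j. \<forall>(u, v) \<in> set (\<sigma> j). Suc u < W \<and> Suc v < W"
    and E: "\<forall>j. \<forall>x\<in>V. \<forall>y\<in>V. E (Suc (\<kappa> 0 x)) (Suc (\<kappa> 0 y)) \<longleftrightarrow> pairs_edge (\<kappa> 0) (\<sigma> j) x y"
    and pre: "almost_dfs (row_codes n (\<kappa> 0)) E f a"
    and f: "\<forall>v\<in>V. f (Suc (\<kappa> 0 v)) = (if \<kappa> 1 v \<in> row_codes n (\<kappa> 0) then \<kappa> 1 v else 0)"
    and a: "a = (if \<rho> 4 \<in> row_codes n (\<kappa> 0) then \<rho> 4 else 0)"
    and Q: "\<And>\<rho>' \<kappa>' es' k f'. keeps ({0..17} - {3, 4}) \<rho> \<rho>' \<Longrightarrow> \<kappa>' 0 = \<kappa> 0 \<Longrightarrow>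
       almost_dfs (row_codes n (\<kappa> 0)) E f' 0 \<Longrightarrow> (\<forall>v\<in>V. \<kappa>' 1 v = f' (Suc (\<kappa> 0 v))) \<Longrightarrow>
       k = 0 \<or> 2 ^ (k - 1) \<le> n \<Longrightarrow> Q (mem \<rho>' \<kappa>', es', i + k)"
  shows "wp CORE Q (mem \<rho> \<kappa>, es, i)"
proof -
  define E' where "E' = (\<lambda>x y. E (Suc (\<kappa> 0 x)) (Suc (\<kappa> 0 y)))"
  define r where "r = row_of n (\<kappa> 0) a"
  have r4: "row_of n (\<kappa> 0) (\<rho> 4) = r"
  proof (cases "\<rho> 4 \<in> row_codes n (\<kappa> 0)")
    case False
    then have "row_of n (\<kappa> 0) (\<rho> 4) = 0" by (simp add: row_of_def)
    then show ?thesis using False row_of_0 unfolding r_def a by simp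
  qed (simp add: r_def a)
  define W1 where "W1 = wp (FOR 7 (COND (col 3 (reg 7))
      (PUT (Suc 0) (reg 7) (Plus (col 0 (col 3 (reg 7))) (Const (Suc 0)))) (PUT (Suc 0) (reg 7) (Const 0)))) Q"
  define W2 where "W2 = wp (LOOP (LT (reg 5) (Plus (reg 3) (Const (Suc 0)))) ROUND) W1"
  have "wp ROWS (wp SIZES (wp HEAVY (wp (SET 14 (reg 4)) (wp LOOKUP (wp (SET 11 (Const 0))
     (wp (SET 12 (reg 15)) (wp WALK W2))))))) (mem \<rho> \<kappa>, es, i)"
  proof (rule wp_rows)
    fix \<rho>1 \<kappa>1
    assume kr1: "keeps {5, 7, 8, 14, 15} \<rho> \<rho>1" and c1: "\<rho>1 5 = 1" and kk1: "keeps {2, 3, 4, 5, 6} \<kappa> \<kappa>1"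
      and rows: "\<forall>v\<in>V. is_row n (\<kappa> 0) (\<kappa> 1 v) (\<kappa>1 2 v) \<and> \<kappa>1 4 v = 0 \<and> \<kappa>1 5 v = 0 \<and> \<kappa>1 6 v = 0"
      and z1: "\<kappa>1 2 0 = 0" "\<kappa>1 3 0 = 0" "\<kappa>1 4 0 = 1" "\<kappa>1 5 0 = 0" "\<kappa>1 6 0 = 0"
    have A: "almost_dfs V E' (\<kappa>1 2) r"
      unfolding E'_def r_def
      by (rule rows_to_almost_dfs[OF pre names f]) (use rows z1 in blast)+
    have F: "forest V (\<kappa>1 2)" using almost_dfsD(1)[OF A] .
    have le0: "v = 0 \<or> v \<in> V" if "v \<le> n" for v using that by auto
    show "wp SIZES (wp HEAVY (wp (SET 14 (reg 4)) (wp LOOKUP (wp (SET 11 (Const 0))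
     (wp (SET 12 (reg 15)) (wp WALK W2)))))) (mem \<rho>1 \<kappa>1, es, i)"
    proof (rule wp_sizes)
      show "\<forall>v\<le>n. \<kappa>1 5 v = 0" using rows z1 le0 by metis
      fix \<rho>2 \<kappa>2
      assume kr2: "keeps {7, 9} \<rho>1 \<rho>2" and kk2: "keeps {5} \<kappa>1 \<kappa>2" and s0: "\<kappa>2 5 0 = 0"
        and sz: "\<forall>v\<in>V. \<kappa>2 5 v = card (sub V (\<kappa>1 2) v)"
      have d2: "\<kappa>2 2 = \<kappa>1 2" "\<kappa>2 3 = \<kappa>1 3" "\<kappa>2 4 = \<kappa>1 4" "\<kappa>2 6 = \<kappa>1 6" using kk2 unfolding keeps_def by simp_all
      show "wp HEAVY (wp (SET 14 (reg 4)) (wp LOOKUP (wp (SET 11 (Const 0))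
       (wp (SET 12 (reg 15)) (wp WALK W2))))) (mem \<rho>2 \<kappa>2, es, i)"
      proof (rule wp_heavy)
        show "\<forall>v\<le>n. \<kappa>2 6 v = 0" unfolding d2 using rows z1 le0 by metis
        fix \<rho>3 \<kappa>3
        assume kr3: "keeps {7, 9} \<rho>2 \<rho>3" and kk3: "keeps {6} \<kappa>2 \<kappa>3" and H: "heavy V (\<kappa>2 2) (\<kappa>3 6)"
        have kr: "keeps {5, 7, 8, 9, 14, 15} \<rho> \<rho>3" using kr1 kr2 kr3 unfolding keeps_def by simp
        have kk: "keeps {2, 3, 4, 5, 6} \<kappa> \<kappa>3" using kk1 kk2 kk3 unfolding keeps_def by simp
        have d3: "\<kappa>3 2 = \<kappa>1 2" "\<kappa>3 3 = \<kappa>1 3" "\<kappa>3 4 = \<kappa>1 4" "\<kappa>3 0 = \<kappa> 0"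
          using kk3 kk d2 unfolding keeps_def by simp_all
        have e3: "\<rho>3 3 = n" "\<rho>3 4 = \<rho> 4" "\<rho>3 5 = 1"
          using kr n kr2 kr3 c1 unfolding keeps_def by simp_all
        have "wp LOOKUP (wp (SET 11 (Const 0)) (wp (SET 12 (reg 15)) (wp WALK W2)))
           (mem (\<rho>3(14 := \<rho> 4)) \<kappa>3, es, i)"
        proof (rule wp_lookup)
          fix v assume "is_row n (\<kappa>3 0) ((\<rho>3(14 := \<rho> 4)) 14) v"
          then have v: "v = r" using is_row_row_of[OF names] d3 r4 by simp
          have rn: "r \<le> n" using almost_dfsD(2)[OF A] by (simp only: V_le)
          let ?\<rho> = "\<rho>3(14 := \<rho> 4, 15 := r, 8 := 0, 11 := 0, 12 := r)"
          have "wp WALK W2 (mem ?\<rho> \<kappa>3, es, i)"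
          proof (rule wp_initial_walk)
            show "almost_dfs V E' (\<kappa>3 2) r" using A d3 by simp
            show "\<forall>v\<in>V. \<kappa>3 4 v = 0" using rows d3 by simp
            fix \<rho>4 st' sp'
            assume kr4: "keeps {5, 11, 12} ?\<rho> \<rho>4" and part: "partial_dfs V E' (\<kappa>3 2) st' sp' (\<rho>4 5)"
              and vis: "st' r \<noteq> 0"
            let ?\<kappa> = "\<kappa>3(3 := sp', 4 := st')"
            show "W2 (mem \<rho>4 ?\<kappa>, es, i)"
              unfolding W2_def
            proof (rule wp_rounds)
              show "almost_dfs V E' (?\<kappa> 2) r" using A d3 by simp
              show "heavy V (?\<kappa> 2) (?\<kappa> 6)" using H d2 d3 by simp
              show "partial_dfs V E' (?\<kappa> 2) (?\<kappa> 4) (?\<kappa> 3) (\<rho>4 5)" using part by simp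
              show "?\<kappa> 4 r \<noteq> 0" using vis by simp
              show "\<forall>j. \<forall>x\<in>V. \<forall>y\<in>V. E' x y \<longleftrightarrow> pairs_edge (?\<kappa> 0) (\<sigma> j) x y" using E d3 unfolding E'_def by simp
              show "\<rho>4 3 = n" using kr4 e3 unfolding keeps_def by simp
              fix \<rho>5 \<kappa>5 es5 k
              assume kr5: "keeps {0, 1, 2, 5, 6, 7, 8, 10, 11, 12, 13, 14, 15, 16, 17} \<rho>4 \<rho>5"
                and kk5: "keeps {3, 4, 7, 8} ?\<kappa> \<kappa>5" and A5: "almost_dfs V E' (\<kappa>5 3) 0"
                and k: "k = 0 \<or> 2 ^ (k - 1) \<le> n"
              have kr': "keeps ({0..17} - {3, 4}) \<rho> \<rho>5"
                using kr kr4 kr5 unfolding keeps_def by auto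
              have kk': "keeps {2, 3, 4, 5, 6, 7, 8} \<kappa> \<kappa>5"
                using kk kk5 unfolding keeps_def by simp
              have n5: "\<kappa>5 0 = \<kappa> 0" using kk' unfolding keeps_def by simp
              have F5: "forest V (\<kappa>5 3)" using almost_dfsD(1)[OF A5] .
              show "W1 (mem \<rho>5 \<kappa>5, es5, i + k)"
                unfolding W1_def
              proof (rule wp_write_table)
                show "\<rho>5 3 = n" using kr' n unfolding keeps_def by simp
                show "\<forall>v\<in>V. \<kappa>5 3 v \<le> n"
                proof
                  fix v assume v: "v \<in> V"
                  show "\<kappa>5 3 v \<le> n" using forest_closed[OF F5 insertI2[OF v]] by (simp only: V_le)
                qed
                show "\<forall>v\<in>V. Suc (\<kappa>5 0 v) < W" using words n5 by simp
                fix \<rho>6 \<kappa>6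
                assume kr6: "keeps {7} \<rho>5 \<rho>6" and kk6: "keeps {1} \<kappa>5 \<kappa>6"
                  and out: "\<forall>v\<in>V. \<kappa>6 1 v = (if \<kappa>5 3 v = 0 then 0 else Suc (\<kappa>5 0 (\<kappa>5 3 v)))"
                define f' where "f' c = (if c \<in> row_codes n (\<kappa> 0) then \<kappa>6 1 (row_of n (\<kappa> 0) c) else 0)" for c
                have f'v: "f' (Suc (\<kappa> 0 v)) = \<kappa>6 1 v" if "v \<in> V" for v
                  using row_of_code[OF names that] that unfolding f'_def row_codes_def by auto
                show "Q (mem \<rho>6 \<kappa>6, es5, i + k)"
                proof (rule Q[of \<rho>6 \<kappa>6 f' k])
                  show "keeps ({0..17} - {3, 4}) \<rho> \<rho>6" using kr' kr6 unfolding keeps_def by auto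
                  show "\<kappa>6 0 = \<kappa> 0" using kk6 n5 unfolding keeps_def by simp
                  show "almost_dfs (row_codes n (\<kappa> 0)) E f' 0"
                  proof (rule almost_dfs_to_rows[OF _ names])
                    show "almost_dfs V (\<lambda>x y. E (Suc (\<kappa> 0 x)) (Suc (\<kappa> 0 y))) (\<kappa>5 3) 0" using A5 unfolding E'_def .
                    show "\<forall>u v. E u v \<longrightarrow> E v u" using almost_dfsD(3)[OF pre] by blast
                    show "f' 0 = 0" unfolding f'_def row_codes_def by auto
                    show "\<forall>v\<in>V. f' (Suc (\<kappa> 0 v)) = (if \<kappa>5 3 v = 0 then 0 else Suc (\<kappa> 0 (\<kappa>5 3 v)))"
                      using f'v out n5 by simp
                  qed
                  show "\<forall>v\<in>V. \<kappa>6 1 v = f' (Suc (\<kappa> 0 v))" using f'v by simp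
                qed (rule k)
              qed
            qed (use names w d3 in simp_all)
          qed (use e3 z1 d3 in simp_all)
          then show "wp (SET 11 (Const 0)) (wp (SET 12 (reg 15)) (wp WALK W2))
              (mem (\<rho>3(14 := \<rho> 4, 15 := v, 8 := 0)) \<kappa>3, es, i)"
            using v rn by simp
        qed (use e3 in simp)
        then show "wp (SET 14 (reg 4)) (wp LOOKUP (wp (SET 11 (Const 0)) (wp (SET 12 (reg 15)) (wp WALK W2))))
           (mem \<rho>3 \<kappa>3, es, i)"
          using e3 words(3) by simp
      qed (use F n kr1 kr2 d2 s0 sz in \<open>simp_all add: keeps_def\<close>)
    qed (use F n kr1 in \<open>simp_all add: keeps_def\<close>)
  qed (use n words in simp_all)
  then show ?thesis unfolding CORE_def wp_seq_fun W2_def W1_def .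
qed

end

section \<open>The stored forest under updates\<close>

text \<open>The semantics checks every write against \<open>S\<close> and \<open>W\<close>, so
  bounds on the memory are inherited by the final state and can be added to a finished
  \<open>wp\<close> statement.\<close>

lemma exec_fits: "exec \<sigma> S W c x y \<Longrightarrow> fits S W (fst x) \<Longrightarrow> fits S W (fst y)"
  by (induction rule: exec.induct) (auto simp: fits_def)

text \<open>Parts of an update are verified under the space they require and combined under the
  largest of these bounds.\<close>

lemma exec_mono: "exec \<sigma> S W c x y \<Longrightarrow> S \<le> S' \<Longrightarrow> exec \<sigma> S' W c x y"
  by (induction rule: exec.induct) (auto intro: exec.intros simp del: One_nat_def)

lemma wp_space_mono: "machine.wp \<sigma> S W c Q x \<Longrightarrow> S \<le> S' \<Longrightarrow> machine.wp \<sigma> S' W c Q x"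
  unfolding machine.wp_def using exec_mono by blast

lemma wp_fits:
  assumes "machine.wp \<sigma> S W c Q x" "fits S W (fst x)"
  shows "machine.wp \<sigma> S W c (\<lambda>y. Q y \<and> fits S W (fst y)) x"
  using assms exec_fits unfolding machine.wp_def by blast

text \<open>What an update leaves for the rerooting: the table lists the vertices of the new graph, and
  its parent column, in which parents that no longer exist count as the dummy, is a forest whose
  cross edges meet the path from the vertex in register 4 to its root.\<close>

definition ready :: "nat graph \<Rightarrow> (nat \<Rightarrow> nat) \<Rightarrow> (nat \<Rightarrow> nat \<Rightarrow> nat) \<Rightarrow> bool" where
  "ready G \<rho> \<kappa> \<longleftrightarrow> \<rho> 3 = card (fst G) \<and> inj_on (\<kappa> 0) {1..\<rho> 3} \<and> \<kappa> 0 ` {1..\<rho> 3} = fst G \<and>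
     (\<exists>f. (\<forall>v\<in>{1..\<rho> 3}. f (Suc (\<kappa> 0 v)) = (if \<kappa> 1 v \<in> codes G then \<kappa> 1 v else 0)) \<and>
        almost_dfs (codes G) (code_edge G) f (if \<rho> 4 \<in> codes G then \<rho> 4 else 0))"

text \<open>In contrast to \<open>ready\<close>, column 1 holds the parents literally, with no stale
  codes, and the forest has no exceptional path.\<close>

definition stores :: "nat graph \<Rightarrow> (nat \<Rightarrow> nat) \<Rightarrow> (nat \<Rightarrow> nat \<Rightarrow> nat) \<Rightarrow> bool" where
  "stores G \<rho> \<kappa> \<longleftrightarrow> \<rho> 3 = card (fst G) \<and> inj_on (\<kappa> 0) {1..\<rho> 3} \<and> \<kappa> 0 ` {1..\<rho> 3} = fst G \<and>
     (\<exists>f. (\<forall>v\<in>{1..\<rho> 3}. \<kappa> 1 v = f (Suc (\<kappa> 0 v))) \<and> almost_dfs (codes G) (code_edge G) f 0)"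

text \<open>Rows 0 to \<open>card (fst G)\<close> and zeros beyond them: traces of larger graphs
  have to be erased, because the bound follows the current graph and the next one may be smaller
  still.\<close>

definition reached :: "nat graph \<Rightarrow> nat \<Rightarrow> memory \<Rightarrow> bool" where
  "reached G W m \<longleftrightarrow> fits (20 + 9 * (card (fst G) + 1)) W m \<and> (\<exists>\<rho> \<kappa>. m = mem \<rho> \<kappa> \<and> stores G \<rho> \<kappa>)"

lemma row_codes_codes: "name ` {1..n} = fst G \<Longrightarrow> row_codes n name = codes G"
  unfolding row_codes_def codes_def by (metis image_image)

lemma edge_stream_pairs_edge:
  assumes "edge_stream G es"
  shows "code_edge G (Suc (name x)) (Suc (name y)) \<longleftrightarrow> pairs_edge name es x y"
proof -
  have "{name x, name y} \<in> snd G \<longleftrightarrow> (\<exists>p\<in>set es. (\<lambda>(u, v). {u, v}) p = {name x, name y})"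
  proof -
    have "snd G = (\<lambda>(u, v). {u, v}) ` set es" using assms unfolding edge_stream_def by simp
    then show ?thesis by (simp only: image_iff) (metis (no_types, lifting))
  qed
  also have "\<dots> \<longleftrightarrow> pairs_edge name es x y"
    unfolding pairs_edge_def by (rule bex_cong) (auto simp: doubleton_eq_iff)
  finally show ?thesis unfolding code_edge_def by simp
qed

lemma edge_stream_less:
  assumes "simple_graph G" "edge_stream G es" "fst G \<subseteq> {..<N}" "(u, v) \<in> set es"
  shows "u < N" "v < N"
proof -
  have "{u, v} \<in> snd G" using assms(2,4) unfolding edge_stream_def by force
  moreover have "snd G \<subseteq> {{u, v} |u v. u \<in> fst G \<and> v \<in> fst G \<and> u \<noteq> v}"
    using assms(1) unfolding simple_graph_def by blast
  ultimately obtain u' v' where "{u, v} = {u', v'}" "u' \<in> fst G" "v' \<in> fst G" by blast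
  then have "u \<in> fst G" "v \<in> fst G" by (auto simp: doubleton_eq_iff)
  then show "u < N" "v < N" using assms(3) by auto
qed

lemma almost_dfs_value:
  assumes "almost_dfs C E f a" "c \<in> C"
  shows "f c = (if f c \<in> C then f c else 0)"
  using forest_closed[OF almost_dfsD(1)[OF assms(1)], of c] assms(2) by auto

lemma core_correct:
  assumes G: "simple_graph G" "fst G \<subseteq> {..<N}" and es: "\<forall>j. edge_stream G (\<sigma> j)"
    and W: "N + 5 < W" and m: "m = mem \<rho> \<kappa>" and r: "ready G \<rho> \<kappa>"
    and fits: "fits (20 + 9 * (card (fst G) + 1)) W m"
  shows "machine.wp \<sigma> (20 + 9 * (card (fst G) + 1)) W CORE
    (\<lambda>(m', es', i'). reached G W m' \<and> (\<exists>k. i' = i + k \<and> (k = 0 \<or> 2 ^ (k - 1) \<le> card (fst G)))) (m, es', i)"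
proof -
  define n where "n = card (fst G)"
  define S where "S = 20 + 9 * (n + 1)"
  have "n \<le> card {..<N}" unfolding n_def using G(2) by (intro card_mono) simp_all
  then have nN: "n \<le> N" by simp
  interpret rows \<sigma> S W n by unfold_locales (use S_def nN W in simp_all)
  obtain f where n3: "\<rho> 3 = n" and inj: "inj_on (\<kappa> 0) V" and img: "\<kappa> 0 ` V = fst G"
    and f: "\<forall>v\<in>V. f (Suc (\<kappa> 0 v)) = (if \<kappa> 1 v \<in> codes G then \<kappa> 1 v else 0)"
    and pre: "almost_dfs (codes G) (code_edge G) f (if \<rho> 4 \<in> codes G then \<rho> 4 else 0)"
    using r unfolding ready_def n_def by auto
  have rc: "row_codes n (\<kappa> 0) = codes G" using row_codes_codes[OF img] .
  have mW: "m b < W" for b using fits unfolding fits_def by blast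
  let ?Q = "\<lambda>(m', es', i'). reached G W m' \<and> (\<exists>k. i' = i + k \<and> (k = 0 \<or> 2 ^ (k - 1) \<le> n))"
  have "wp CORE (\<lambda>(m', es', i'). (\<exists>\<rho> \<kappa>. m' = mem \<rho> \<kappa> \<and> stores G \<rho> \<kappa>) \<and>
      (\<exists>k. i' = i + k \<and> (k = 0 \<or> 2 ^ (k - 1) \<le> n))) (mem \<rho> \<kappa>, es', i)"
  proof (rule wp_core[where E = "code_edge G" and f = f and a = "if \<rho> 4 \<in> codes G then \<rho> 4 else 0"])
    show "\<forall>v\<in>V. Suc (\<kappa> 0 v) < W"
    proof
      fix v assume "v \<in> V"
      then have "\<kappa> 0 v \<in> fst G" using img by blast
      then show "Suc (\<kappa> 0 v) < W" using G(2) W by auto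
    qed
    show "\<forall>v\<in>V. \<kappa> 1 v < W"
    proof
      fix v
      show "\<kappa> 1 v < W" using mW[of "20 + 1 + 9 * v"] mem_col[of 1 \<rho> \<kappa> v] unfolding m by simp
    qed
    show "\<rho> 4 < W" using mW[of 4] unfolding m by (simp add: mem_reg)
    show "\<forall>j. \<forall>(u, v)\<in>set (\<sigma> j). Suc u < W \<and> Suc v < W"
      using edge_stream_less[OF G(1) es[rule_format] G(2)] W by fastforce
    show "\<forall>j. \<forall>x\<in>V. \<forall>y\<in>V. code_edge G (Suc (\<kappa> 0 x)) (Suc (\<kappa> 0 y)) \<longleftrightarrow> pairs_edge (\<kappa> 0) (\<sigma> j) x y"
      using edge_stream_pairs_edge es by blast
    fix \<rho>' and \<kappa>' :: "nat \<Rightarrow> nat \<Rightarrow> nat" and es'' k f'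
    assume kr: "keeps ({0..17} - {3, 4}) \<rho> \<rho>'" and names: "\<kappa>' 0 = \<kappa> 0"
      and A: "almost_dfs (row_codes n (\<kappa> 0)) (code_edge G) f' 0"
      and out: "\<forall>v\<in>V. \<kappa>' 1 v = f' (Suc (\<kappa> 0 v))" and k: "k = 0 \<or> 2 ^ (k - 1) \<le> n"
    have "\<rho>' 3 = n" using kr n3 unfolding keeps_def by simp
    then have "stores G \<rho>' \<kappa>'" unfolding stores_def using A out names inj img rc n_def by auto
    then show "case (mem \<rho>' \<kappa>', es'', i + k) of (m', es', i') \<Rightarrow> (\<exists>\<rho> \<kappa>. m' = mem \<rho> \<kappa> \<and> stores G \<rho> \<kappa>) \<and>
      (\<exists>k. i' = i + k \<and> (k = 0 \<or> 2 ^ (k - 1) \<le> n))" using k by blast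
  qed (use n3 inj f pre rc in simp_all)
  then have "wp CORE (\<lambda>y. (case y of (m', es', i') \<Rightarrow> (\<exists>\<rho> \<kappa>. m' = mem \<rho> \<kappa> \<and> stores G \<rho> \<kappa>) \<and>
      (\<exists>k. i' = i + k \<and> (k = 0 \<or> 2 ^ (k - 1) \<le> n))) \<and> fits S W (fst y)) (m, es', i)"
    unfolding m by (rule wp_fits) (use fits m S_def n_def in simp)
  then have "wp CORE ?Q (m, es', i)"
    by (rule wp_mono) (auto simp: reached_def S_def n_def)
  then show ?thesis unfolding S_def n_def .
qed

text \<open>Entry \<open>i\<close> of the table is row \<open>Suc i\<close>, since row 0 is skipped;
  hence the base 29, which is 20 plus one row.\<close>

lemma reached_dfs_tree:
  assumes G: "simple_graph G" and m: "reached G W m" and A: "table_base A = 29" "table_stride A = 9"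
  shows "is_dfs_tree (augment G) None (stored_tree A (card (fst G)) m)"
proof -
  obtain \<rho> \<kappa> f where mem: "m = mem \<rho> \<kappa>" and n: "\<rho> 3 = card (fst G)" and img: "\<kappa> 0 ` {1..\<rho> 3} = fst G"
    and out: "\<forall>v\<in>{1..\<rho> 3}. \<kappa> 1 v = f (Suc (\<kappa> 0 v))"
    and dfs: "almost_dfs (codes G) (code_edge G) f 0"
    using m unfolding reached_def stores_def by blast
  let ?n = "card (fst G)"
  let ?h = "\<lambda>c. (vertex_of (f c), vertex_of c)"
  have cell: "m (29 + 9 * i) = \<kappa> 0 (Suc i)" "m (Suc (29 + 9 * i)) = \<kappa> 1 (Suc i)" for i
    using mem_col[of 0 \<rho> \<kappa> "Suc i"] mem_col[of 1 \<rho> \<kappa> "Suc i"] unfolding mem by simp_all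
  have "stored_tree A ?n m = (\<lambda>i. ?h (Suc (\<kappa> 0 (Suc i)))) ` {..<?n}"
    unfolding stored_tree_def Let_def A
  proof (rule image_cong[OF refl])
    fix i assume "i \<in> {..<?n}"
    then have "\<kappa> 1 (Suc i) = f (Suc (\<kappa> 0 (Suc i)))" using out n by simp
    then show "(case m (29 + 9 * i + 1) of 0 \<Rightarrow> None | Suc u \<Rightarrow> Some u, Some (m (29 + 9 * i))) =
       ?h (Suc (\<kappa> 0 (Suc i)))"
      using cell by (simp add: vertex_of_def)
  qed
  also have "\<dots> = ?h ` (\<lambda>v. Suc (\<kappa> 0 v)) ` Suc ` {..<?n}" by (simp add: image_image)
  also have "Suc ` {..<?n} = {1..\<rho> 3}"
    unfolding n by (simp add: image_Suc_lessThan)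
  also have "(\<lambda>v. Suc (\<kappa> 0 v)) ` {1..\<rho> 3} = codes G" using row_codes_codes[OF img] unfolding row_codes_def .
  finally show ?thesis using almost_dfs_is_dfs_tree[OF G dfs] by simp
qed

section \<open>Bringing the table up to date\<close>

definition INSERT_ROW :: com where
  "INSERT_ROW = SET 3 (Plus (reg 3) (Const (Suc 0))) ;; PUT 0 (reg 3) (reg (Suc 0)) ;;
     PUT (Suc 0) (reg 3) (Const 0)"

text \<open>All nine cells of the abandoned last row are zeroed, as \<open>fits\<close> for the
  smaller graph demands.\<close>

definition CLEAR_ROW :: com where
  "CLEAR_ROW = PUT 0 (reg 3) (Const 0) ;; PUT (Suc 0) (reg 3) (Const 0) ;; PUT 2 (reg 3) (Const 0) ;;
     PUT 3 (reg 3) (Const 0) ;; PUT 4 (reg 3) (Const 0) ;; PUT 5 (reg 3) (Const 0) ;;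
     PUT 6 (reg 3) (Const 0) ;; PUT 7 (reg 3) (Const 0) ;; PUT 8 (reg 3) (Const 0)"

text \<open>The last row fills the gap, after the parent of the deleted vertex has been saved in
  register 4 as the start of the rerooting. The children keep the code of the deleted vertex; it no
  longer has a row and counts as the dummy.\<close>

definition DELETE_ROW :: com where
  "DELETE_ROW = SET 14 (reg 4) ;; LOOKUP ;; SET 4 (col (Suc 0) (reg 15)) ;;
     PUT 0 (reg 15) (col 0 (reg 3)) ;; PUT (Suc 0) (reg 15) (col (Suc 0) (reg 3)) ;;
     CLEAR_ROW ;; SET 3 (Minus (reg 3) (Const (Suc 0)))"

text \<open>Register 4 arrives with the code of the first endpoint and changes only if the second
  endpoint is its parent, so that it ends up with the upper end of a cut tree edge.\<close>

definition CUT_EDGE :: com where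
  "CUT_EDGE = FOR 7
     (COND (Times (EQ (col 0 (reg 7)) (reg 2)) (EQ (col (Suc 0) (reg 7)) (Plus (reg (Suc 0)) (Const (Suc 0)))))
        (PUT (Suc 0) (reg 7) (Const 0)) SKIP ;;
      COND (Times (EQ (col 0 (reg 7)) (reg (Suc 0))) (EQ (col (Suc 0) (reg 7)) (Plus (reg 2) (Const (Suc 0)))))
        (PUT (Suc 0) (reg 7) (Const 0) ;; SET 4 (Plus (reg 2) (Const (Suc 0)))) SKIP)"

definition MODIFY :: com where
  "MODIFY = SET 4 (Plus (reg (Suc 0)) (Const (Suc 0))) ;;
     COND (reg 0)
       (COND (EQ (reg 0) (Const (Suc 0))) DELETE_ROW (COND (EQ (reg 0) (Const 3)) CUT_EDGE SKIP))
       INSERT_ROW"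

lemma stores_dest:
  assumes "stores G \<rho> \<kappa>"
  obtains f where "\<rho> 3 = card (fst G)" "inj_on (\<kappa> 0) {1..card (fst G)}" "\<kappa> 0 ` {1..card (fst G)} = fst G"
    "\<forall>v\<in>{1..card (fst G)}. \<kappa> 1 v = f (Suc (\<kappa> 0 v))" "almost_dfs (codes G) (code_edge G) f 0"
    "\<forall>v\<in>{1..card (fst G)}. Suc (\<kappa> 0 v) \<in> codes G"
proof -
  obtain f where f: "\<rho> 3 = card (fst G)" "inj_on (\<kappa> 0) {1..\<rho> 3}" "\<kappa> 0 ` {1..\<rho> 3} = fst G"
    "\<forall>v\<in>{1..\<rho> 3}. \<kappa> 1 v = f (Suc (\<kappa> 0 v))" "almost_dfs (codes G) (code_edge G) f 0"
    using assms unfolding stores_def by blast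
  show ?thesis
  proof (rule that[of f])
    show "\<forall>v\<in>{1..card (fst G)}. Suc (\<kappa> 0 v) \<in> codes G"
      using f(3) unfolding codes_def f(1) by blast
  qed (use f in simp_all)
qed

lemma table_value:
  assumes "almost_dfs C E f a" "c \<in> C" "p = f c"
  shows "f c = (if p \<in> C then p else 0)"
  unfolding assms(3) by (rule almost_dfs_value[OF assms(1,2)])

lemma insert_vertex_ready:
  assumes G: "simple_graph G" and u: "valid_update G (Insert_Vertex v X)" and st: "stores G \<rho> \<kappa>"
    and r: "\<rho>' 3 = Suc (card (fst G))" "\<rho>' 4 = Suc v"
    and k: "\<kappa>' 0 = (\<kappa> 0)(Suc (card (fst G)) := v)" "\<kappa>' 1 = (\<kappa> 1)(Suc (card (fst G)) := 0)"
  shows "ready (apply_update G (Insert_Vertex v X)) \<rho>' \<kappa>'"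
proof -
  let ?n = "card (fst G)" and ?G = "apply_update G (Insert_Vertex v X)"
  obtain f where n: "\<rho> 3 = ?n" and inj: "inj_on (\<kappa> 0) {1..?n}" and img: "\<kappa> 0 ` {1..?n} = fst G"
    and out: "\<forall>v\<in>{1..?n}. \<kappa> 1 v = f (Suc (\<kappa> 0 v))" and A: "almost_dfs (codes G) (code_edge G) f 0"
    and codes: "\<forall>v\<in>{1..?n}. Suc (\<kappa> 0 v) \<in> codes G"
    using stores_dest[OF st] by blast
  have v: "v \<notin> fst G" using u by (cases G) simp
  have V: "fst ?G = insert v (fst G)" by (cases G) simp
  have fin: "finite (fst G)" using G unfolding simple_graph_def by blast
  have card: "card (fst ?G) = Suc ?n" using v fin V by simp
  have A': "almost_dfs (codes ?G) (code_edge ?G) (f(Suc v := 0)) (Suc v)"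
    by (rule insert_vertex_almost_dfs[OF G u A])
  have ins: "{1..Suc ?n} = insert (Suc ?n) {1..?n}" by auto
  have old: "\<kappa>' 0 w = \<kappa> 0 w" "\<kappa>' 1 w = \<kappa> 1 w" "\<kappa> 0 w \<noteq> v" "\<kappa> 0 w \<in> fst G" if "w \<in> {1..?n}" for w
    using that k img v by auto
  have names: "\<kappa>' 0 ` {1..?n} = fst G" using img old(1) by simp
  show ?thesis
    unfolding ready_def r card
  proof (intro conjI exI[of _ "f(Suc v := 0)"])
    have "inj_on (\<kappa>' 0) {1..?n}"
      by (rule inj_on_cong[THEN iffD2, OF _ inj]) (rule old(1))
    moreover have "\<kappa>' 0 (Suc ?n) \<notin> \<kappa>' 0 ` {1..?n}" using names v k by simp
    ultimately show "inj_on (\<kappa>' 0) {1..Suc ?n}" unfolding ins by (simp add: inj_on_insert)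
    show "\<kappa>' 0 ` {1..Suc ?n} = fst ?G" unfolding ins V image_insert names using k by simp
    show "\<forall>w\<in>{1..Suc ?n}. (f(Suc v := 0)) (Suc (\<kappa>' 0 w)) = (if \<kappa>' 1 w \<in> codes ?G then \<kappa>' 1 w else 0)"
    proof
      fix w assume w: "w \<in> {1..Suc ?n}"
      have c: "Suc (\<kappa>' 0 w) \<in> codes ?G"
        unfolding codes_def V using w old names k unfolding ins by auto
      have "\<kappa>' 1 w = (f(Suc v := 0)) (Suc (\<kappa>' 0 w))"
      proof (cases "w = Suc ?n")
        case False
        then have "w \<in> {1..?n}" using w unfolding ins by simp
        then show ?thesis using old[of w] out by simp
      qed (use k in simp)
      then show "(f(Suc v := 0)) (Suc (\<kappa>' 0 w)) = (if \<kappa>' 1 w \<in> codes ?G then \<kappa>' 1 w else 0)"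
        by (rule table_value[OF A' c])
    qed
    have "Suc v \<in> codes ?G" unfolding codes_def V by simp
    then show "almost_dfs (codes ?G) (code_edge ?G) (f(Suc v := 0)) (if Suc v \<in> codes ?G then Suc v else 0)"
      using A' by simp
  qed simp
qed

lemma insert_edge_ready:
  assumes u: "valid_update G (Insert_Edge u v)" and st: "stores G \<rho> \<kappa>"
    and r: "\<rho>' 3 = \<rho> 3" "\<rho>' 4 = Suc u"
  shows "ready (apply_update G (Insert_Edge u v)) \<rho>' \<kappa>"
proof -
  let ?n = "card (fst G)" and ?G = "apply_update G (Insert_Edge u v)"
  obtain f where n: "\<rho> 3 = ?n" and inj: "inj_on (\<kappa> 0) {1..?n}" and img: "\<kappa> 0 ` {1..?n} = fst G"
    and out: "\<forall>v\<in>{1..?n}. \<kappa> 1 v = f (Suc (\<kappa> 0 v))" and A: "almost_dfs (codes G) (code_edge G) f 0"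
    and codes: "\<forall>v\<in>{1..?n}. Suc (\<kappa> 0 v) \<in> codes G"
    using stores_dest[OF st] by blast
  have V: "fst ?G = fst G" by (cases G) simp
  have C: "codes ?G = codes G" unfolding codes_def V ..
  have A': "almost_dfs (codes ?G) (code_edge ?G) f (Suc u)" by (rule insert_edge_almost_dfs[OF u A])
  have uc: "Suc u \<in> codes G" using u unfolding codes_def by (cases G) simp
  show ?thesis
    unfolding ready_def r V n C
  proof (intro conjI exI[of _ f] ballI)
    fix w assume w: "w \<in> {1..?n}"
    then have o: "\<kappa> 1 w = f (Suc (\<kappa> 0 w))" using out by blast
    show "f (Suc (\<kappa> 0 w)) = (if \<kappa> 1 w \<in> codes G then \<kappa> 1 w else 0)"
      by (rule table_value[OF A _ o]) (use codes w in blast)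
  next
    show "almost_dfs (codes G) (code_edge ?G) f (if Suc u \<in> codes G then Suc u else 0)"
      using A' C uc by simp
  qed (use inj img in simp_all)
qed

lemma delete_edge_ready:
  assumes G: "simple_graph G" and u: "valid_update G (Delete_Edge u v)" and st: "stores G \<rho> \<kappa>"
    and r: "\<rho>' 3 = \<rho> 3" "\<rho>' 4 = (if \<exists>w\<in>{1..\<rho> 3}. \<kappa> 0 w = u \<and> \<kappa> 1 w = Suc v then Suc v else Suc u)"
    and k: "\<kappa>' 0 = \<kappa> 0" "\<forall>w\<in>{1..\<rho> 3}. \<kappa>' 1 w =
      (if \<kappa> 0 w = v \<and> \<kappa> 1 w = Suc u \<or> \<kappa> 0 w = u \<and> \<kappa> 1 w = Suc v then 0 else \<kappa> 1 w)"
  shows "ready (apply_update G (Delete_Edge u v)) \<rho>' \<kappa>'"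
proof -
  let ?n = "card (fst G)" and ?G = "apply_update G (Delete_Edge u v)"
  obtain f where n: "\<rho> 3 = ?n" and inj: "inj_on (\<kappa> 0) {1..?n}" and img: "\<kappa> 0 ` {1..?n} = fst G"
    and out: "\<forall>v\<in>{1..?n}. \<kappa> 1 v = f (Suc (\<kappa> 0 v))" and A: "almost_dfs (codes G) (code_edge G) f 0"
    and codes: "\<forall>v\<in>{1..?n}. Suc (\<kappa> 0 v) \<in> codes G"
    using stores_dest[OF st] by blast
  have V: "fst ?G = fst G" by (cases G) simp
  have C: "codes ?G = codes G" unfolding codes_def V ..
  have E: "{u, v} \<in> snd G" using u by (cases G) simp
  moreover have "snd G \<subseteq> {{u, v} |u v. u \<in> fst G \<and> v \<in> fst G \<and> u \<noteq> v}"
    using G unfolding simple_graph_def by blast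
  ultimately obtain u' v' where "{u, v} = {u', v'}" "u' \<in> fst G" "v' \<in> fst G" by blast
  then have uV: "u \<in> fst G" "v \<in> fst G" by (auto simp: doubleton_eq_iff)
  let ?f = "\<lambda>c. if c = Suc v \<and> f c = Suc u \<or> c = Suc u \<and> f c = Suc v then 0 else f c"
  let ?a = "if f (Suc u) = Suc v then Suc v else Suc u"
  have A': "almost_dfs (codes ?G) (code_edge ?G) ?f ?a" by (rule delete_edge_almost_dfs[OF G u A])
  have "(\<exists>w\<in>{1..?n}. \<kappa> 0 w = u \<and> \<kappa> 1 w = Suc v) \<longleftrightarrow> f (Suc u) = Suc v"
  proof
    assume fu: "f (Suc u) = Suc v"
    have "u \<in> \<kappa> 0 ` {1..?n}" unfolding img by (rule uV(1))
    then obtain w where w: "w \<in> {1..?n}" "\<kappa> 0 w = u" by blast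
    then have "\<kappa> 1 w = Suc v" using out fu by simp
    then show "\<exists>w\<in>{1..?n}. \<kappa> 0 w = u \<and> \<kappa> 1 w = Suc v" using w by blast
  next
    assume "\<exists>w\<in>{1..?n}. \<kappa> 0 w = u \<and> \<kappa> 1 w = Suc v"
    then obtain w where "w \<in> {1..?n}" "\<kappa> 0 w = u" "\<kappa> 1 w = Suc v" by blast
    then show "f (Suc u) = Suc v" using out by simp
  qed
  then have a: "\<rho>' 4 = ?a" using r(2) unfolding n by simp
  have "?a \<in> codes G" unfolding codes_def using uV by simp
  then have "?a \<in> codes ?G" unfolding C .
  then have A'': "almost_dfs (codes ?G) (code_edge ?G) ?f (if \<rho>' 4 \<in> codes ?G then \<rho>' 4 else 0)"
    using A' unfolding a by simp
  have "?f (Suc (\<kappa>' 0 w)) = (if \<kappa>' 1 w \<in> codes ?G then \<kappa>' 1 w else 0)" if w: "w \<in> {1..?n}" for w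
  proof -
    have o: "\<kappa> 1 w = f (Suc (\<kappa> 0 w))" using out w by blast
    have "\<kappa>' 1 w = (if \<kappa> 0 w = v \<and> \<kappa> 1 w = Suc u \<or> \<kappa> 0 w = u \<and> \<kappa> 1 w = Suc v then 0 else \<kappa> 1 w)"
      using k(2) w unfolding n by blast
    then have "\<kappa>' 1 w = ?f (Suc (\<kappa>' 0 w))" by (simp only: o k(1) nat.inject)
    moreover have "Suc (\<kappa>' 0 w) \<in> codes ?G" using codes w unfolding C k(1) by blast
    ultimately show ?thesis by (intro table_value[OF A'])
  qed
  then show ?thesis
    unfolding ready_def r(1) V n k(1) using inj img A'' k(1)
    by (intro conjI exI[of _ ?f]) simp_all
qed

lemma delete_vertex_ready:
  assumes G: "simple_graph G" and u: "valid_update G (Delete_Vertex v)" and st: "stores G \<rho> \<kappa>"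
    and x: "x \<in> {1..\<rho> 3}" "\<kappa> 0 x = v"
    and r: "\<rho>' 3 = \<rho> 3 - 1" "\<rho>' 4 = \<kappa> 1 x"
    and k: "\<forall>w\<in>{1..<\<rho> 3}. \<kappa>' 0 w = \<kappa> 0 (if w = x then \<rho> 3 else w) \<and> \<kappa>' 1 w = \<kappa> 1 (if w = x then \<rho> 3 else w)"
  shows "ready (apply_update G (Delete_Vertex v)) \<rho>' \<kappa>'"
proof -
  let ?n = "card (fst G)" and ?G = "apply_update G (Delete_Vertex v)"
  obtain f where n: "\<rho> 3 = ?n" and inj: "inj_on (\<kappa> 0) {1..?n}" and img: "\<kappa> 0 ` {1..?n} = fst G"
    and out: "\<forall>v\<in>{1..?n}. \<kappa> 1 v = f (Suc (\<kappa> 0 v))" and A: "almost_dfs (codes G) (code_edge G) f 0"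
    and codes: "\<forall>v\<in>{1..?n}. Suc (\<kappa> 0 v) \<in> codes G"
    using stores_dest[OF st] by blast
  have xn: "x \<in> {1..?n}" using x n by simp
  have V: "fst ?G = fst G - {v}" by (cases G) simp
  have vV: "v \<in> fst G" using x(2) xn img by blast
  have C: "codes ?G = codes G - {Suc v}" unfolding codes_def V by auto
  have fin: "finite (fst G)" using G unfolding simple_graph_def by blast
  have card: "card (fst ?G) = ?n - 1" unfolding V using vV fin by simp
  let ?f = "\<lambda>c. if f c = Suc v then 0 else f c"
  have A': "almost_dfs (codes ?G) (code_edge ?G) ?f (f (Suc v))" by (rule delete_vertex_almost_dfs[OF G u A])
  \<comment> \<open>The renumbering caused by moving the last row into the gap; on the remaining
    rows it is the identity if \<open>x\<close> is the last row itself.\<close>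
  define \<tau> where "\<tau> w = (if w = x then ?n else w)" for w
  have k': "\<kappa>' 0 w = \<kappa> 0 (\<tau> w)" "\<kappa>' 1 w = \<kappa> 1 (\<tau> w)" "\<tau> w \<in> {1..?n} - {x}" if "w \<in> {1..?n - 1}" for w
    using k that xn unfolding n \<tau>_def by auto
  have \<tau>inj: "inj_on \<tau> {1..?n - 1}" by (intro inj_onI) (auto simp: \<tau>_def split: if_splits)
  have \<tau>img: "\<tau> ` {1..?n - 1} = {1..?n} - {x}"
  proof
    show "\<tau> ` {1..?n - 1} \<subseteq> {1..?n} - {x}" using k'(3) by blast
    show "{1..?n} - {x} \<subseteq> \<tau> ` {1..?n - 1}"
    proof
      fix w assume w: "w \<in> {1..?n} - {x}"
      show "w \<in> \<tau> ` {1..?n - 1}"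
      proof (cases "w = ?n")
        case True
        then have "x \<in> {1..?n - 1}" "w = \<tau> x" using w xn unfolding \<tau>_def by auto
        then show ?thesis by blast
      next
        case False
        then have "w \<in> {1..?n - 1}" "w = \<tau> w" using w unfolding \<tau>_def by auto
        then show ?thesis by blast
      qed
    qed
  qed
  have names: "\<kappa>' 0 ` {1..?n - 1} = fst ?G"
  proof -
    have "\<kappa>' 0 ` {1..?n - 1} = \<kappa> 0 ` \<tau> ` {1..?n - 1}"
      unfolding image_image by (rule image_cong[OF refl k'(1)])
    also have "\<dots> = \<kappa> 0 ` {1..?n} - \<kappa> 0 ` {x}"
      unfolding \<tau>img using inj_on_image_set_diff[OF inj, of "{1..?n}" "{x}"] xn by simp
    finally show ?thesis unfolding V img using x(2) by simp
  qed
  have "inj_on (\<kappa> 0 \<circ> \<tau>) {1..?n - 1}"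
    by (rule comp_inj_on[OF \<tau>inj]) (rule inj_on_subset[OF inj], use \<tau>img in blast)
  then have ninj: "inj_on (\<kappa>' 0) {1..?n - 1}" by (rule inj_on_cong[THEN iffD2, rotated]) (simp add: k'(1))
  \<comment> \<open>Children of the deleted vertex still carry \<open>Suc v\<close>, which is not in
    \<open>codes ?G\<close> and thus reads as 0, in agreement with \<open>?f\<close>.\<close>
  have val: "?f (Suc (\<kappa>' 0 w)) = (if \<kappa>' 1 w \<in> codes ?G then \<kappa>' 1 w else 0)" if w: "w \<in> {1..?n - 1}" for w
  proof -
    have t: "\<tau> w \<in> {1..?n}" using k'(3)[OF w] by blast
    then have o: "\<kappa>' 1 w = f (Suc (\<kappa>' 0 w))" "Suc (\<kappa>' 0 w) \<in> codes G" using out codes k'(1,2)[OF w] by simp_all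
    then have "f (Suc (\<kappa>' 0 w)) = 0 \<or> f (Suc (\<kappa>' 0 w)) \<in> codes G"
      using forest_closed[OF almost_dfsD(1)[OF A], of "Suc (\<kappa>' 0 w)"] by simp
    then show ?thesis unfolding C o(1) by auto
  qed
  have "\<kappa> 1 x = f (Suc v)" using out xn x(2) by simp
  moreover have "f (Suc v) \<in> insert 0 (codes ?G)" using almost_dfsD(2)[OF A'] .
  ultimately have a: "(if \<kappa> 1 x \<in> codes ?G then \<kappa> 1 x else 0) = f (Suc v)" by auto
  show ?thesis
    unfolding ready_def r card n a
  proof (intro conjI exI[of _ ?f] ballI)
    show "almost_dfs (codes ?G) (code_edge ?G) ?f (f (Suc v))" by (rule A')
  qed (use ninj names val in simp_all)
qed

context rows
begin

lemma wp_cut_edge: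
  assumes n: "\<rho> 3 = n" and uv: "\<rho> 1 = u" "\<rho> 2 = v" "u \<noteq> v" "Suc u < W" "Suc v < W" and r4: "\<rho> 4 = Suc u"
    and Q: "\<And>\<rho>' \<kappa>'. \<rho>' 3 = n \<Longrightarrow> \<rho>' 4 = (if \<exists>w\<in>V. \<kappa> 0 w = u \<and> \<kappa> 1 w = Suc v then Suc v else Suc u) \<Longrightarrow>
      \<kappa>' 0 = \<kappa> 0 \<Longrightarrow> (\<forall>w\<in>V. \<kappa>' 1 w =
        (if \<kappa> 0 w = v \<and> \<kappa> 1 w = Suc u \<or> \<kappa> 0 w = u \<and> \<kappa> 1 w = Suc v then 0 else \<kappa> 1 w)) \<Longrightarrow> Q (mem \<rho>' \<kappa>', es, i)"
  shows "wp CUT_EDGE Q (mem \<rho> \<kappa>, es, i)"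
proof -
  define g where "g w = (if \<kappa> 0 w = v \<and> \<kappa> 1 w = Suc u \<or> \<kappa> 0 w = u \<and> \<kappa> 1 w = Suc v then 0 else \<kappa> 1 w)" for w
  define I where "I k \<rho>' \<kappa>' \<longleftrightarrow> keeps {4, 7} \<rho> \<rho>' \<and> keeps {1} \<kappa> \<kappa>' \<and>
      (\<forall>w\<in>V. \<kappa>' 1 w = (if k < w then g w else \<kappa> 1 w)) \<and>
      \<rho>' 4 = (if \<exists>w\<in>{Suc k..n}. \<kappa> 0 w = u \<and> \<kappa> 1 w = Suc v then Suc v else Suc u)"
    for k and \<rho>' :: "nat \<Rightarrow> nat" and \<kappa>' :: "nat \<Rightarrow> nat \<Rightarrow> nat"
  show ?thesis
    unfolding CUT_EDGE_def
  proof (rule wp_for[where I = I])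
    show "I n (\<rho>(7 := n)) \<kappa>" unfolding I_def keeps_def using r4 by simp
    fix k \<rho>1 \<kappa>1 assume k: "k < n" and I: "I (Suc k) \<rho>1 \<kappa>1" and r7: "\<rho>1 7 = Suc k"
    have kr: "keeps {4, 7} \<rho> \<rho>1" and kk: "keeps {1} \<kappa> \<kappa>1"
      and out: "\<forall>w\<in>V. \<kappa>1 1 w = (if Suc k < w then g w else \<kappa> 1 w)"
      and a: "\<rho>1 4 = (if \<exists>w\<in>{Suc (Suc k)..n}. \<kappa> 0 w = u \<and> \<kappa> 1 w = Suc v then Suc v else Suc u)"
      using I unfolding I_def by blast+
    define j where "j = Suc k"
    have j: "j \<in> V" "j \<le> n" using k unfolding j_def by simp_all
    have c: "\<kappa>1 0 = \<kappa> 0" "\<kappa>1 (Suc 0) j = \<kappa> 1 j" "\<rho>1 (Suc 0) = u" "\<rho>1 2 = v" "\<rho>1 7 = j"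
      using kk out kr uv j r7 unfolding keeps_def j_def by simp_all
    have ins: "{Suc k..n} = insert j {Suc (Suc k)..n}" using k unfolding j_def by auto
    have I': "I k (\<rho>2(7 := k)) (\<kappa>1(1 := (\<kappa>1 1)(j := g j)))"
      if r2: "keeps {4} \<rho>1 \<rho>2" "\<rho>2 4 = (if \<kappa> 0 j = u \<and> \<kappa> 1 j = Suc v then Suc v else \<rho>1 4)" for \<rho>2
      unfolding I_def
    proof (intro conjI ballI)
      fix w assume w: "w \<in> V"
      show "(\<kappa>1(1 := (\<kappa>1 1)(j := g j))) 1 w = (if k < w then g w else \<kappa> 1 w)"
        using out w unfolding j_def by (cases "w = Suc k") auto
    next
      show "(\<rho>2(7 := k)) 4 = (if \<exists>w\<in>{Suc k..n}. \<kappa> 0 w = u \<and> \<kappa> 1 w = Suc v then Suc v else Suc u)"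
      proof (cases "\<kappa> 0 j = u \<and> \<kappa> 1 j = Suc v")
        case True
        then show ?thesis unfolding ins using r2(2) by simp
      next
        case False
        then have "\<rho>2 4 = \<rho>1 4" using r2(2) by (simp only: if_False)
        moreover have "(\<exists>w\<in>{Suc k..n}. \<kappa> 0 w = u \<and> \<kappa> 1 w = Suc v) \<longleftrightarrow>
            (\<exists>w\<in>{Suc (Suc k)..n}. \<kappa> 0 w = u \<and> \<kappa> 1 w = Suc v)"
          unfolding ins using False by blast
        ultimately show ?thesis using a by (simp only: fun_upd_apply numeral_eq_iff num.distinct if_False)
      qed
    qed (use kr kk r2(1) in \<open>simp_all add: keeps_def\<close>)
    let ?C1 = "COND (Times (EQ (col 0 (reg 7)) (reg 2)) (EQ (col (Suc 0) (reg 7)) (Plus (reg (Suc 0)) (Const (Suc 0)))))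
        (PUT (Suc 0) (reg 7) (Const 0)) SKIP"
    let ?C2 = "COND (Times (EQ (col 0 (reg 7)) (reg (Suc 0))) (EQ (col (Suc 0) (reg 7)) (Plus (reg 2) (Const (Suc 0)))))
        (PUT (Suc 0) (reg 7) (Const 0) ;; SET 4 (Plus (reg 2) (Const (Suc 0)))) SKIP"
    let ?L = "lift es i (\<lambda>\<rho>' \<kappa>'. \<rho>' 7 = Suc k \<and> I k (\<rho>'(7 := k)) \<kappa>')"
    consider (1) "\<kappa> 0 j = v" "\<kappa> 1 j = Suc u" | (2) "\<kappa> 0 j = u" "\<kappa> 1 j = Suc v"
      | (3) "\<not> (\<kappa> 0 j = v \<and> \<kappa> 1 j = Suc u)" "\<not> (\<kappa> 0 j = u \<and> \<kappa> 1 j = Suc v)" by blast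
    then show "wp (?C1 ;; ?C2) ?L (mem \<rho>1 \<kappa>1, es, i)"
    proof cases
      case 1
      then have g: "g j = 0" "\<not> (\<kappa> 0 j = u \<and> \<kappa> 1 j = Suc v)" using uv(3) unfolding g_def by simp_all
      have "\<rho>1 4 = (if \<kappa> 0 j = u \<and> \<kappa> 1 j = Suc v then Suc v else \<rho>1 4)" using g(2) by (simp only: if_False)
      then have "I k (\<rho>1(7 := k)) (\<kappa>1(1 := (\<kappa>1 1)(j := g j)))" by (intro I') (simp_all add: keeps_def)
      then have "?L (mem \<rho>1 (\<kappa>1(1 := (\<kappa>1 1)(j := 0))), es, i)"
        using g r7 by (intro liftI) simp
      then show ?thesis using 1 g c j uv by simp
    next
      case 2
      then have g: "g j = 0" unfolding g_def by simp
      have "I k (\<rho>1(4 := Suc v, 7 := k)) (\<kappa>1(1 := (\<kappa>1 1)(j := g j)))" by (intro I') (use 2 in \<open>simp_all add: keeps_def\<close>)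
      then have "?L (mem (\<rho>1(4 := Suc v)) (\<kappa>1(1 := (\<kappa>1 1)(j := 0))), es, i)"
        using g r7 by (intro liftI) simp
      then show ?thesis using 2 g c j uv by simp
    next
      case 3
      then have g: "g j = \<kappa>1 1 j" using c(2) unfolding g_def by simp
      have "\<rho>1 4 = (if \<kappa> 0 j = u \<and> \<kappa> 1 j = Suc v then Suc v else \<rho>1 4)" using 3(2) by (simp only: if_False)
      then have "I k (\<rho>1(7 := k)) (\<kappa>1(1 := (\<kappa>1 1)(j := g j)))" by (intro I') (simp_all add: keeps_def)
      moreover have "\<kappa>1(1 := (\<kappa>1 1)(j := g j)) = \<kappa>1" unfolding g by simp
      ultimately have "?L (mem \<rho>1 \<kappa>1, es, i)"
        using r7 by (intro liftI) simp
      then show ?thesis using 3 c j uv by auto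
    qed
  next
    fix \<rho>1 \<kappa>1 assume I: "I 0 \<rho>1 \<kappa>1"
    show "Q (mem \<rho>1 \<kappa>1, es, i)"
      by (rule Q) (use I n in \<open>simp_all add: I_def keeps_def g_def\<close>)
  qed (use n in simp_all)
qed

lemma wp_delete_row:
  assumes n: "\<rho> 3 = n" and inj: "inj_on (\<kappa> 0) V" and x: "x \<in> V" "\<kappa> 0 x = v" and r4: "\<rho> 4 = Suc v"
    and w: "Suc v < W" "\<forall>c<9. \<forall>w. \<kappa> c w < W"
    and Q: "\<And>\<rho>' \<kappa>'. \<rho>' 3 = n - 1 \<Longrightarrow> \<rho>' 4 = \<kappa> 1 x \<Longrightarrow> (\<forall>w\<in>{1..<n}. \<kappa>' 0 w = \<kappa> 0 (if w = x then n else w) \<and>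
       \<kappa>' 1 w = \<kappa> 1 (if w = x then n else w)) \<Longrightarrow> (\<forall>c<9. \<kappa>' c n = 0) \<Longrightarrow> Q (mem \<rho>' \<kappa>', es, i)"
  shows "wp DELETE_ROW Q (mem \<rho> \<kappa>, es, i)"
proof -
  have n0: "1 \<le> n" "x \<le> n" using x by auto
  let ?CL = "wp CLEAR_ROW (wp (SET 3 (Minus (reg 3) (Const (Suc 0)))) Q)"
  have clear: "?CL (mem \<rho>1 \<kappa>1, es, i)" if r: "\<rho>1 3 = n" "\<rho>1 4 = \<kappa> 1 x"
      and k: "\<kappa>1 = \<kappa>(0 := (\<kappa> 0)(x := \<kappa> 0 n), 1 := (\<kappa> 1)(x := \<kappa> 1 n))" for \<rho>1 \<kappa>1
  proof -
    let ?\<kappa> = "\<kappa>1(0 := (\<kappa>1 0)(n := 0), 1 := (\<kappa>1 1)(n := 0), 2 := (\<kappa>1 2)(n := 0), 3 := (\<kappa>1 3)(n := 0),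
      4 := (\<kappa>1 4)(n := 0), 5 := (\<kappa>1 5)(n := 0), 6 := (\<kappa>1 6)(n := 0), 7 := (\<kappa>1 7)(n := 0), 8 := (\<kappa>1 8)(n := 0))"
    have "Q (mem (\<rho>1(3 := n - 1)) ?\<kappa>, es, i)"
    proof (rule Q)
      have "c = 0 \<or> c = 1 \<or> c = 2 \<or> c = 3 \<or> c = 4 \<or> c = 5 \<or> c = 6 \<or> c = 7 \<or> c = 8" if "c < 9" for c :: nat
        using that by linarith
      then show "\<forall>c<9. ?\<kappa> c n = 0" by fastforce
    qed (use r in \<open>simp_all add: k\<close>)
    then show ?thesis unfolding CLEAR_ROW_def wp_seq_fun using r(1) by simp
  qed
  have "wp LOOKUP (wp (SET 4 (col (Suc 0) (reg 15))) (wp (PUT 0 (reg 15) (col 0 (reg 3)))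
     (wp (PUT (Suc 0) (reg 15) (col (Suc 0) (reg 3))) ?CL))) (mem (\<rho>(14 := Suc v)) \<kappa>, es, i)"
  proof (rule wp_lookup)
    fix r assume r: "is_row n (\<kappa> 0) ((\<rho>(14 := Suc v)) 14) r"
    then have "is_row n (\<kappa> 0) (Suc v) r" by simp
    then have rx: "r = x" using is_row_unique[OF inj, of v r x] x by blast
    have "?CL (mem (\<rho>(14 := Suc v, 15 := x, 8 := 0, 4 := \<kappa> 1 x))
        (\<kappa>(0 := (\<kappa> 0)(x := \<kappa> 0 n), 1 := (\<kappa> 1)(x := \<kappa> 1 n))), es, i)"
      by (rule clear) (use n in simp_all)
    then show "wp (SET 4 (col (Suc 0) (reg 15))) (wp (PUT 0 (reg 15) (col 0 (reg 3)))
     (wp (PUT (Suc 0) (reg 15) (col (Suc 0) (reg 3))) ?CL)) (mem (\<rho>(14 := Suc v, 15 := r, 8 := 0)) \<kappa>, es, i)"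
      unfolding rx using n n0 w by simp
  qed (use n in simp)
  then show ?thesis unfolding DELETE_ROW_def wp_seq_fun using r4 w(1) by simp
qed

end

text \<open>The bounds refer to the new graph. A deletion starts with one row more than the new
  graph has, hence \<open>n' + 2\<close>; in the end the memory fits \<open>n' + 1\<close>, the
  bound under which the rerooting is verified. The other three updates run within the smaller bound
  from the start and are lifted by \<open>easy\<close>.\<close>

lemma modify_correct:
  assumes G: "simple_graph G" and u: "valid_update G x" and m: "reached G W m"
    and N: "fst G \<subseteq> {..<N}" "fst (apply_update G x) \<subseteq> {..<N}" and W: "N + 5 < W"
  defines "n' \<equiv> card (fst (apply_update G x))"
  shows "fits (20 + 9 * (n' + 2)) W (announce x m)"
    and "machine.wp \<sigma> (20 + 9 * (n' + 2)) W MODIFY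
      (\<lambda>(m', es', i'). i' = i \<and> (\<exists>\<rho> \<kappa>. m' = mem \<rho> \<kappa> \<and> ready (apply_update G x) \<rho> \<kappa>) \<and>
         fits (20 + 9 * (n' + 1)) W m') (announce x m, es, i)"
proof -
  define S1 S2 where "S1 = 20 + 9 * (n' + 1)" and "S2 = 20 + 9 * (n' + 2)"
  have room: "k < 29 + 9 * n' \<Longrightarrow> k < S1" "k < 38 + 9 * n' \<Longrightarrow> k < S2" for k
    unfolding S1_def S2_def by simp_all
  let ?G = "apply_update G x"
  let ?Q = "\<lambda>(m', es', i'). i' = i \<and> (\<exists>\<rho> \<kappa>. m' = mem \<rho> \<kappa> \<and> ready ?G \<rho> \<kappa>) \<and> fits S1 W m'"
  define n where "n = card (fst G)"
  have fin: "finite (fst G)" using G unfolding simple_graph_def by blast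
  have "n \<le> card {..<N}" "n' \<le> card {..<N}" unfolding n_def n'_def using N by (intro card_mono; simp)+
  then have nN: "n \<le> N" "n' \<le> N" by simp_all
  obtain \<rho> \<kappa> where mm: "m = mem \<rho> \<kappa>" and st: "stores G \<rho> \<kappa>" using m unfolding reached_def by blast
  have fm: "fits (20 + 9 * (n + 1)) W m" using m unfolding reached_def n_def by blast
  obtain f where n3: "\<rho> 3 = n" and inj: "inj_on (\<kappa> 0) {1..n}" and img: "\<kappa> 0 ` {1..n} = fst G"
    and out: "\<forall>v\<in>{1..n}. \<kappa> 1 v = f (Suc (\<kappa> 0 v))" and A: "almost_dfs (codes G) (code_edge G) f 0"
    by (rule stores_dest[OF st, folded n_def])
  have fits: "fits S W (m(0 := a, 1 := b, 2 := c))" if "20 + 9 * (n + 1) \<le> S" "a \<le> 3" "b \<le> N" "c \<le> N" for S a b c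
    using fm that W unfolding fits_def by auto
  have fits': "fits S2 W (m(0 := a, 1 := b, 2 := c)) \<and>
      (n \<le> n' \<longrightarrow> fits S1 W (m(0 := a, 1 := b, 2 := c)))"
    if "n \<le> n' + 1" "a \<le> 3" "b \<le> N" "c \<le> N" for a b c
    using fits[of S1 a b c] fits[of S2 a b c] that unfolding S1_def S2_def by simp
  have ann: "m(0 := a, 1 := b, 2 := c) = mem (\<rho>(0 := a, 1 := b, 2 := c)) \<kappa>" for a b c
    unfolding mm by (simp add: mem_upd_reg)
  have easy: "machine.wp \<sigma> S2 W MODIFY ?Q (m0, es, i)"
    if "machine.wp \<sigma> S1 W MODIFY (\<lambda>(m', es', i'). i' = i \<and> (\<exists>\<rho> \<kappa>. m' = mem \<rho> \<kappa> \<and> ready ?G \<rho> \<kappa>)) (m0, es, i)"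
      "fits S1 W m0" for m0
  proof -
    have "machine.wp \<sigma> S1 W MODIFY ?Q (m0, es, i)"
      by (rule machine.wp_mono[OF wp_fits[OF that(1)]]) (use that(2) in auto)
    then show ?thesis by (rule wp_space_mono) (simp add: S1_def S2_def)
  qed
  interpret M: machine \<sigma> S1 W .
  have "fits S2 W (announce x m) \<and>
     machine.wp \<sigma> S2 W MODIFY ?Q (announce x m, es, i)"
  proof (cases x)
    case (Insert_Vertex v X)
    have v: "v \<notin> fst G" "fst ?G = insert v (fst G)" using u unfolding Insert_Vertex by (cases G; simp)+
    have n': "n' = Suc n" unfolding n'_def n_def v(2) using v(1) fin by simp
    have vN: "v < N" using N(2) v(2) by auto
    have f: "fits S1 W (announce x m)" "fits S2 W (announce x m)"
      using fits'[of 0 v 0] n' vN unfolding Insert_Vertex by simp_all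
    let ?\<rho> = "\<rho>(0 := 0, 1 := v, 2 := 0)"
    let ?\<kappa> = "\<kappa>(0 := (\<kappa> 0)(Suc n := v), 1 := (\<kappa> 1)(Suc n := 0))"
    have "ready ?G (?\<rho>(4 := Suc v, 3 := Suc n)) ?\<kappa>"
      unfolding Insert_Vertex
      by (rule insert_vertex_ready[OF G u[unfolded Insert_Vertex] st]) (simp_all add: n_def)
    then have "M.wp MODIFY (\<lambda>(m', es', i'). i' = i \<and> (\<exists>\<rho> \<kappa>. m' = mem \<rho> \<kappa> \<and> ready ?G \<rho> \<kappa>)) (announce x m, es, i)"
      unfolding Insert_Vertex announce.simps ann MODIFY_def INSERT_ROW_def M.wp_seq_fun
      using n3 n' nN W vN by (auto simp: room)
    then show ?thesis using easy f by blast
  next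
    case (Insert_Edge a b)
    have ab: "a \<in> fst G" "b \<in> fst G" "fst ?G = fst G" using u unfolding Insert_Edge by (cases G; simp)+
    have n': "n' = n" unfolding n'_def n_def ab(3) ..
    have abN: "a < N" "b < N" using N(1) ab by auto
    have f: "fits S1 W (announce x m)" "fits S2 W (announce x m)"
      using fits'[of 2 a b] n' abN unfolding Insert_Edge by simp_all
    let ?\<rho> = "\<rho>(0 := 2, 1 := a, 2 := b)"
    have "ready ?G (?\<rho>(4 := Suc a)) \<kappa>"
      unfolding Insert_Edge
      by (rule insert_edge_ready[OF u[unfolded Insert_Edge] st]) simp_all
    then have "M.wp MODIFY (\<lambda>(m', es', i'). i' = i \<and> (\<exists>\<rho> \<kappa>. m' = mem \<rho> \<kappa> \<and> ready ?G \<rho> \<kappa>)) (announce x m, es, i)"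
      unfolding Insert_Edge announce.simps ann MODIFY_def M.wp_seq_fun
      using W abN by (auto simp: room)
    then show ?thesis using easy f by blast
  next
    case (Delete_Edge a b)
    have ab: "{a, b} \<in> snd G" "fst ?G = fst G" using u unfolding Delete_Edge by (cases G; simp)+
    moreover have "snd G \<subseteq> {{u, v} |u v. u \<in> fst G \<and> v \<in> fst G \<and> u \<noteq> v}"
      using G unfolding simple_graph_def by blast
    ultimately obtain u' v' where "{a, b} = {u', v'}" "u' \<in> fst G" "v' \<in> fst G" "u' \<noteq> v'" by blast
    then have ab2: "a \<in> fst G" "b \<in> fst G" "a \<noteq> b" by (auto simp: doubleton_eq_iff)
    have n': "n' = n" unfolding n'_def n_def ab(2) ..
    have abN: "a < N" "b < N" using N(1) ab2 by auto
    have f: "fits S1 W (announce x m)" "fits S2 W (announce x m)"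
      using fits'[of 3 a b] n' abN unfolding Delete_Edge by simp_all
    let ?\<rho> = "\<rho>(0 := 3, 1 := a, 2 := b, 4 := Suc a)"
    interpret R: rows \<sigma> S1 W n by unfold_locales (use n' nN W S1_def in simp_all)
    have "M.wp CUT_EDGE (\<lambda>(m', es', i'). i' = i \<and> (\<exists>\<rho> \<kappa>. m' = mem \<rho> \<kappa> \<and> ready ?G \<rho> \<kappa>)) (mem ?\<rho> \<kappa>, es, i)"
    proof (rule R.wp_cut_edge[where u = a and v = b])
      fix \<rho>' :: "nat \<Rightarrow> nat" and \<kappa>' :: "nat \<Rightarrow> nat \<Rightarrow> nat"
      assume r: "\<rho>' 3 = n" "\<rho>' 4 = (if \<exists>w\<in>{1..n}. \<kappa> 0 w = a \<and> \<kappa> 1 w = Suc b then Suc b else Suc a)"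
        and k: "\<kappa>' 0 = \<kappa> 0" "\<forall>w\<in>{1..n}. \<kappa>' 1 w =
          (if \<kappa> 0 w = b \<and> \<kappa> 1 w = Suc a \<or> \<kappa> 0 w = a \<and> \<kappa> 1 w = Suc b then 0 else \<kappa> 1 w)"
      have "ready ?G \<rho>' \<kappa>'"
        unfolding Delete_Edge
        by (rule delete_edge_ready[OF G u[unfolded Delete_Edge] st]) (use r k n3 in simp_all)
      then show "case (mem \<rho>' \<kappa>', es, i) of (m', es', i') \<Rightarrow> i' = i \<and> (\<exists>\<rho> \<kappa>. m' = mem \<rho> \<kappa> \<and> ready ?G \<rho> \<kappa>)"
        by blast
    qed (use n3 ab2 abN W in simp_all)
    then have "M.wp MODIFY (\<lambda>(m', es', i'). i' = i \<and> (\<exists>\<rho> \<kappa>. m' = mem \<rho> \<kappa> \<and> ready ?G \<rho> \<kappa>)) (announce x m, es, i)"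
      unfolding Delete_Edge announce.simps ann MODIFY_def M.wp_seq_fun
      using W abN by (simp add: room)
    then show ?thesis using easy f by blast
  next
    case (Delete_Vertex v)
    have v: "v \<in> fst G" "fst ?G = fst G - {v}" using u unfolding Delete_Vertex by (cases G; simp)+
    have "n' = n - 1" unfolding n'_def n_def v(2) using v(1) fin by simp
    moreover have "0 < n" unfolding n_def using v(1) fin card_gt_0_iff by blast
    ultimately have n': "n = Suc n'" by simp
    have vN: "v < N" using N(1) v by auto
    have f: "fits S2 W (announce x m)"
      using fits'[of 1 v 0] n' vN unfolding Delete_Vertex by simp
    have "v \<in> \<kappa> 0 ` {1..n}" unfolding img by (rule v(1))
    then obtain y where y: "y \<in> {1..n}" "\<kappa> 0 y = v" by blast
    let ?\<rho> = "\<rho>(0 := 1, 1 := v, 2 := 0, 4 := Suc v)"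
    interpret R: rows \<sigma> S2 W n by unfold_locales (use n' nN W S2_def in simp_all)
    have kW: "\<kappa> c w < W" if "c < 9" for c w
      using fm mem_col[OF that, of \<rho> \<kappa> w] unfolding fits_def mm by metis
    have "R.wp DELETE_ROW (\<lambda>(m', es', i'). i' = i \<and> (\<exists>\<rho> \<kappa>. m' = mem \<rho> \<kappa> \<and> ready ?G \<rho> \<kappa> \<and> (\<forall>c<9. \<kappa> c n = 0)))
       (mem ?\<rho> \<kappa>, es, i)"
    proof (rule R.wp_delete_row[where x = y and v = v])
      fix \<rho>' :: "nat \<Rightarrow> nat" and \<kappa>' :: "nat \<Rightarrow> nat \<Rightarrow> nat"
      assume r: "\<rho>' 3 = n - 1" "\<rho>' 4 = \<kappa> 1 y"
        and k: "\<forall>w\<in>{1..<n}. \<kappa>' 0 w = \<kappa> 0 (if w = y then n else w) \<and> \<kappa>' 1 w = \<kappa> 1 (if w = y then n else w)"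
        and z: "\<forall>c<9. \<kappa>' c n = 0"
      have "ready ?G \<rho>' \<kappa>'"
        unfolding Delete_Vertex
        by (rule delete_vertex_ready[OF G u[unfolded Delete_Vertex] st, where x = y]) (use r k n3 y in simp_all)
      then show "case (mem \<rho>' \<kappa>', es, i) of (m', es', i') \<Rightarrow> i' = i \<and>
          (\<exists>\<rho> \<kappa>. m' = mem \<rho> \<kappa> \<and> ready ?G \<rho> \<kappa> \<and> (\<forall>c<9. \<kappa> c n = 0))"
        using z by blast
    qed (use n3 inj y vN W kW in simp_all)
    then have "R.wp MODIFY (\<lambda>(m', es', i'). i' = i \<and> (\<exists>\<rho> \<kappa>. m' = mem \<rho> \<kappa> \<and> ready ?G \<rho> \<kappa> \<and> (\<forall>c<9. \<kappa> c n = 0)))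
       (announce x m, es, i)"
      unfolding Delete_Vertex announce.simps ann MODIFY_def R.wp_seq_fun
      using W vN by (simp add: room)
    then have w: "R.wp MODIFY (\<lambda>y. (case y of (m', es', i') \<Rightarrow> i' = i \<and>
        (\<exists>\<rho> \<kappa>. m' = mem \<rho> \<kappa> \<and> ready ?G \<rho> \<kappa> \<and> (\<forall>c<9. \<kappa> c n = 0))) \<and> fits S2 W (fst y))
       (announce x m, es, i)"
      by (rule wp_fits) (use f in simp)
    have "R.wp MODIFY ?Q (announce x m, es, i)"
    proof (rule R.wp_mono[OF w])
      fix c :: config
      obtain m' es' i' where c: "c = (m', es', i')" by (cases c)
      assume c': "(case c of (m', es', i') \<Rightarrow> i' = i \<and>
        (\<exists>\<rho> \<kappa>. m' = mem \<rho> \<kappa> \<and> ready ?G \<rho> \<kappa> \<and> (\<forall>c<9. \<kappa> c n = 0))) \<and> fits S2 W (fst c)"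
      then obtain \<rho>' \<kappa>' where m': "m' = mem \<rho>' \<kappa>'" "ready ?G \<rho>' \<kappa>'" "\<forall>c<9. \<kappa>' c n = 0" "i' = i"
        and f': "fits S2 W m'"
        unfolding c by auto
      \<comment> \<open>The only cells between the two bounds are those of the last row, which has
        been cleared.\<close>
      have "m' a = 0" if a: "S1 \<le> a" for a
      proof (cases "S2 \<le> a")
        case True then show ?thesis using f' unfolding fits_def by blast
      next
        case False
        define c where "c = a - (20 + 9 * n)"
        have "a = 20 + c + 9 * n" "c < 9" using a False n' unfolding c_def S1_def S2_def by simp_all
        then show ?thesis using m'(1,3) mem_col by simp
      qed
      then have "fits S1 W m'" using f' unfolding fits_def by blast
      then show "?Q c" unfolding c using m' by blast
    qed
    then show ?thesis using f by blast
  qed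
  then show "fits (20 + 9 * (n' + 2)) W (announce x m)"
    "machine.wp \<sigma> (20 + 9 * (n' + 2)) W MODIFY ?Q (announce x m, es, i)" unfolding S1_def S2_def by blast+
qed

section \<open>The streaming algorithm\<close>

text \<open>The counter is cell 1 because the cells from 3 on still hold names, among them later
  registers. Names are moved from the last to the first: the target \<open>20 + 9 * k\<close> lies
  beyond all sources \<open>2 + j\<close> with \<open>j < k\<close>, so no name is overwritten
  before it is read.\<close>

definition LOAD :: com where
  "LOAD = SET (Suc 0) (reg 0) ;;
     LOOP (reg (Suc 0)) (PUT 0 (reg (Suc 0)) (Cell (Plus (reg (Suc 0)) (Const 2))) ;;
       SET (Suc 0) (Minus (reg (Suc 0)) (Const (Suc 0))))"

text \<open>Each turn is a vertex insertion followed by the rerooting. The total is kept in register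
  18, as \<open>CORE\<close> changes only registers up to 17.\<close>

definition GROW :: com where
  "GROW = SET 18 (reg 0) ;; SET 3 (Const 0) ;;
     LOOP (LT (reg 3) (reg 18))
       (SET 3 (Plus (reg 3) (Const (Suc 0))) ;; SET 4 (Plus (col 0 (reg 3)) (Const (Suc 0))) ;;
        PUT (Suc 0) (reg 3) (Const 0) ;; CORE)"

definition dfs_algorithm :: streaming_algorithm where
  "dfs_algorithm = \<lparr>preprocess = LOAD ;; GROW, process_update = MODIFY ;; CORE,
     table_base = 29, table_stride = 9\<rparr>"

section \<open>The asymptotic bounds\<close>

definition num_passes :: "nat \<Rightarrow> nat" where
  "num_passes n = (if n = 0 then 0 else Suc (nat \<lfloor>log 2 (real n)\<rfloor>))"

text \<open>Row 0, one row per vertex, and one to spare: a deletion starts with the table of the old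
  graph, while the bound counts the vertices of the new one.\<close>

definition space_bound :: "nat \<Rightarrow> nat" where
  "space_bound n = 20 + 9 * (n + 2)"

lemma num_passes_bound:
  assumes "k = 0 \<or> 2 ^ (k - 1) \<le> n"
  shows "k \<le> num_passes n"
proof (cases k)
  case (Suc j)
  then have le: "2 ^ j \<le> n" using assms by simp
  moreover have "(0::nat) < 2 ^ j" by simp
  ultimately have n: "0 < n" by linarith
  have "real (2 ^ j) \<le> real n" using le by (simp only: of_nat_le_iff)
  then have "(2::real) ^ j \<le> real n" by simp
  then have "real j \<le> log 2 (real n)" using n by (simp add: le_log_iff powr_realpow)
  then have "int j \<le> \<lfloor>log 2 (real n)\<rfloor>" by (simp add: le_floor_iff)
  then show ?thesis unfolding num_passes_def Suc using n by simp
qed simp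

lemma num_passes_bigo: "(\<lambda>n. real (num_passes n)) \<in> O(\<lambda>n. (ln (real n))\<^sup>2)"
\<comment> \<open>One unit pays for the successor in \<open>num_passes\<close>, and
  \<open>1 / ln 2\<close> changes the base of the logarithm. Both estimates use
  \<open>1 \<le> ln n\<close>, which holds from 3 on because \<open>exp 1\<close> is at most
  3.\<close>
proof (rule bigoI[where c = "1 + 1 / ln 2"])
  show "\<forall>\<^sub>F n in sequentially. norm (real (num_passes n)) \<le> (1 + 1 / ln 2) * norm ((ln (real n))\<^sup>2)"
    using eventually_ge_at_top[of 3]
  proof eventually_elim
    case (elim n)
    have "exp 1 \<le> real n" using elim exp_le by linarith
    then have l: "1 \<le> ln (real n)" using elim by (simp add: ln_ge_iff)
    have "ln (real n) \<le> (ln (real n))\<^sup>2" using l by (simp add: power2_eq_square)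
    moreover have "0 < ln (2::real)" by simp
    ultimately have "log 2 (real n) \<le> (ln (real n))\<^sup>2 / ln 2"
      unfolding log_def by (simp add: divide_right_mono)
    moreover have "1 \<le> (ln (real n))\<^sup>2" using l by (simp add: one_le_power)
    moreover have "0 \<le> log 2 (real n)" using elim by simp
    then have "real (num_passes n) \<le> 1 + log 2 (real n)"
      using elim unfolding num_passes_def by simp
    ultimately have "real (num_passes n) \<le> (ln (real n))\<^sup>2 + (ln (real n))\<^sup>2 / ln 2" by linarith
    then show ?case by (simp add: algebra_simps)
  qed
qed

lemma space_bound_bigo: "(\<lambda>n. real (space_bound n)) \<in> O(\<lambda>n. real n)"
\<comment> \<open>The bound equals \<open>38 + 9 * n\<close>, at most \<open>47 * n\<close> for
  positive \<open>n\<close>.\<close>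
proof (rule bigoI[where c = 47])
  show "\<forall>\<^sub>F n in sequentially. norm (real (space_bound n)) \<le> 47 * norm (real n)"
    using eventually_ge_at_top[of 1] by eventually_elim (simp add: space_bound_def)
qed

lemma (in machine) wp_load:
  assumes S: "29 + 9 * length vs \<le> S" and W: "length vs < W" "\<forall>v\<in>set vs. v < W"
    and Q: "\<And>\<rho> \<kappa>. \<rho> 0 = length vs \<Longrightarrow> (\<forall>j\<in>{1..length vs}. \<kappa> 0 j = vs ! (j - 1)) \<Longrightarrow> Q (mem \<rho> \<kappa>, es, i)"
  shows "wp LOAD Q (initial_memory vs, es, i)"
proof -
  define n where "n = length vs"
  have room: "k < 29 + 9 * n \<Longrightarrow> k < S" for k using S unfolding n_def by simp
  obtain \<rho> \<kappa> where mem: "initial_memory vs = mem \<rho> \<kappa>" using mem_exists by blast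
  have r0: "\<rho> 0 = n" using mem_reg[of 0 \<rho> \<kappa>] unfolding mem[symmetric] initial_memory_def n_def by simp
  \<comment> \<open>Names up to the counter are still at their original addresses
    \<open>2 + j\<close>, and those above it have arrived in column 0.\<close>
  define I where "I \<rho> \<kappa> \<longleftrightarrow> \<rho> 0 = n \<and> \<rho> 1 \<le> n \<and> (\<forall>j\<in>{1..\<rho> 1}. mem \<rho> \<kappa> (2 + j) = vs ! (j - 1)) \<and>
      (\<forall>j\<in>{1..n}. \<rho> 1 < j \<longrightarrow> \<kappa> 0 j = vs ! (j - 1))" for \<rho> :: "nat \<Rightarrow> nat" and \<kappa> :: "nat \<Rightarrow> nat \<Rightarrow> nat"
  have "wp (LOOP (reg (Suc 0)) (PUT 0 (reg (Suc 0)) (Cell (Plus (reg (Suc 0)) (Const 2))) ;;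
       SET (Suc 0) (Minus (reg (Suc 0)) (Const (Suc 0))))) Q (mem (\<rho>(1 := n)) \<kappa>, es, i)"
  proof (rule wp_local_loop[where I = I and \<mu> = "\<lambda>\<rho> \<kappa>. \<rho> 1"])
    have "mem (\<rho>(1 := n)) \<kappa> (2 + j) = vs ! (j - 1)" if j: "j \<in> {1..n}" for j
    proof -
      have "mem (\<rho>(1 := n)) \<kappa> (2 + j) = ((initial_memory vs)(1 := n)) (2 + j)"
        unfolding mem by (simp add: mem_upd_reg)
      then show ?thesis using j unfolding initial_memory_def n_def by auto
    qed
    then show "I (\<rho>(1 := n)) \<kappa>" unfolding I_def using r0 by simp
  next
    fix \<rho>1 \<kappa>1 assume I: "I \<rho>1 \<kappa>1" and nz: "aval (reg (Suc 0)) (mem \<rho>1 \<kappa>1) \<noteq> 0"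
    define k where "k = \<rho>1 1"
    have I1: "\<rho>1 0 = n" "k \<le> n" and I2: "\<forall>j\<in>{1..k}. mem \<rho>1 \<kappa>1 (2 + j) = vs ! (j - 1)"
      and I3: "\<forall>j\<in>{1..n}. k < j \<longrightarrow> \<kappa>1 0 j = vs ! (j - 1)"
      using I unfolding I_def k_def by blast+
    have k: "1 \<le> k" using nz unfolding k_def by simp
    define x where "x = vs ! (k - 1)"
    have x: "mem \<rho>1 \<kappa>1 (Suc (Suc k)) = x" using I2 k unfolding x_def by simp
    have "x < W" using W(2) k I1(2) unfolding x_def n_def by simp
    have m': "mem (\<rho>1(1 := k - 1)) (\<kappa>1(0 := (\<kappa>1 0)(k := x))) = (mem \<rho>1 \<kappa>1)(20 + 0 + 9 * k := x, 1 := k - 1)"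
      using mem_upd_col[of 0 \<rho>1 \<kappa>1 k x] mem_upd_reg[of 1 \<rho>1 "\<kappa>1(0 := (\<kappa>1 0)(k := x))" "k - 1"] by simp
    have "I (\<rho>1(1 := k - 1)) (\<kappa>1(0 := (\<kappa>1 0)(k := x)))"
      unfolding I_def
    proof (intro conjI ballI impI)
      fix j assume "j \<in> {1..(\<rho>1(1 := k - 1)) 1}"
      then have j: "1 \<le> j" "j \<le> k - 1" by simp_all
      then show "mem (\<rho>1(1 := k - 1)) (\<kappa>1(0 := (\<kappa>1 0)(k := x))) (2 + j) = vs ! (j - 1)"
        unfolding m' using I2 by auto
    next
      fix j assume "j \<in> {1..n}" "(\<rho>1(1 := k - 1)) 1 < j"
      then show "(\<kappa>1(0 := (\<kappa>1 0)(k := x))) 0 j = vs ! (j - 1)"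
        using I3 x_def by (cases "j = k") auto
    qed (use I1 in simp_all)
    then have "lift es i (\<lambda>\<rho>' \<kappa>'. I \<rho>' \<kappa>' \<and> \<rho>' 1 < \<rho>1 1) (mem (\<rho>1(1 := k - 1)) (\<kappa>1(0 := (\<kappa>1 0)(k := x))), es, i)"
      using k unfolding k_def by (intro liftI) simp
    then show "wp (PUT 0 (reg (Suc 0)) (Cell (Plus (reg (Suc 0)) (Const 2))) ;;
       SET (Suc 0) (Minus (reg (Suc 0)) (Const (Suc 0)))) (lift es i (\<lambda>\<rho>' \<kappa>'. I \<rho>' \<kappa>' \<and> \<rho>' 1 < \<rho>1 1)) (mem \<rho>1 \<kappa>1, es, i)"
      using k I1 W(1) x \<open>x < W\<close> unfolding k_def n_def by (simp add: room n_def)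
  next
    fix \<rho>1 \<kappa>1 assume I: "I \<rho>1 \<kappa>1" and nz: "aval (reg (Suc 0)) (mem \<rho>1 \<kappa>1) = 0"
    show "Q (mem \<rho>1 \<kappa>1, es, i)" by (rule Q) (use I nz in \<open>simp_all add: I_def n_def\<close>)
  qed
  then show ?thesis unfolding LOAD_def mem using r0 W(1) by (simp add: room n_def)
qed

lemma row_codes_Suc: "row_codes (Suc n) name = insert (Suc (name (Suc n))) (row_codes n name)"
proof -
  have "{1..Suc n} = insert (Suc n) {1..n}" by auto
  then show ?thesis unfolding row_codes_def by simp
qed

text \<open>The graph is fixed and complete from the beginning; the invariant concerns the subgraph
  induced by the rows inserted so far, which is why \<open>almost_dfs\<close> takes the vertex set
  as an argument of its own.\<close>

lemma wp_grow:
  assumes G: "simple_graph G" "fst G \<subseteq> {..<N}" and es: "\<forall>j. edge_stream G (\<sigma> j)" and W: "N + 5 < W"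
    and inj: "inj_on (\<kappa> 0) {1..n}" and img: "\<kappa> 0 ` {1..n} = fst G" and n: "\<rho> 0 = n" "n = card (fst G)"
  shows "machine.wp \<sigma> (20 + 9 * (n + 1)) W GROW (\<lambda>(m, _, _). \<exists>\<rho> \<kappa>. m = mem \<rho> \<kappa> \<and> stores G \<rho> \<kappa>) (mem \<rho> \<kappa>, es0, i)"
proof -
  define S where "S = 20 + 9 * (n + 1)"
  have room: "k < 29 + 9 * n \<Longrightarrow> k < S" for k unfolding S_def by simp
  interpret machine \<sigma> S W .
  let ?Q = "\<lambda>(m, _, _). \<exists>\<rho> \<kappa>. m = mem \<rho> \<kappa> \<and> stores G \<rho> \<kappa>"
  have "n \<le> card {..<N}" unfolding n(2) using G(2) by (intro card_mono) simp_all
  then have nN: "n \<le> N" by simp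
  have word: "k \<le> N + 5 \<Longrightarrow> k < W" for k using W by linarith
  have nameN: "\<kappa> 0 v < N" if "v \<in> {1..n}" for v using that img G(2) by blast
  define J where "J \<rho>' \<kappa>' \<longleftrightarrow> \<rho>' 18 = n \<and> \<rho>' 3 \<le> n \<and> \<kappa>' 0 = \<kappa> 0 \<and>
      (\<exists>f. almost_dfs (row_codes (\<rho>' 3) (\<kappa> 0)) (code_edge G) f 0 \<and> (\<forall>v\<in>{1..\<rho>' 3}. \<kappa>' 1 v = f (Suc (\<kappa> 0 v))))"
    for \<rho>' :: "nat \<Rightarrow> nat" and \<kappa>' :: "nat \<Rightarrow> nat \<Rightarrow> nat"
  let ?B = "SET 3 (Plus (reg 3) (Const (Suc 0))) ;; SET 4 (Plus (col 0 (reg 3)) (Const (Suc 0))) ;;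
        PUT (Suc 0) (reg 3) (Const 0) ;; CORE"
  have "wp (LOOP (LT (reg 3) (reg 18)) ?B) ?Q (mem (\<rho>(18 := n, 3 := 0)) \<kappa>, es0, i)"
  proof (rule wp_loop[where I = "\<lambda>x. \<exists>\<rho> \<kappa> es' i'. x = (mem \<rho> \<kappa>, es' :: stream, i') \<and> J \<rho> \<kappa>" and
        \<mu> = "\<lambda>x. n - fst x 3"])
    have "forest {} (\<lambda>_. 0)" unfolding forest_def by simp
    then have "almost_dfs {} (code_edge G) (\<lambda>_. 0) 0"
      unfolding almost_dfs_def using code_edge_sym by simp
    then have "J (\<rho>(18 := n, 3 := 0)) \<kappa>" unfolding J_def row_codes_def by auto
    then show "\<exists>\<rho>' \<kappa>' es' i'. (mem (\<rho>(18 := n, 3 := 0)) \<kappa>, es0, i) = (mem \<rho>' \<kappa>', es', i') \<and> J \<rho>' \<kappa>'" by blast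
  next
    fix x :: config assume "\<exists>\<rho> \<kappa> es' i'. x = (mem \<rho> \<kappa>, es' :: stream, i') \<and> J \<rho> \<kappa>"
      and g: "aval (LT (reg 3) (reg 18)) (fst x) \<noteq> 0"
    then obtain \<rho>1 \<kappa>1 es1 i1 where x: "x = (mem \<rho>1 \<kappa>1, es1, i1)" and J: "J \<rho>1 \<kappa>1" by blast
    define c where "c = \<rho>1 3"
    obtain f where J1: "\<rho>1 18 = n" "\<kappa>1 0 = \<kappa> 0" and A: "almost_dfs (row_codes c (\<kappa> 0)) (code_edge G) f 0"
      and out: "\<forall>v\<in>{1..c}. \<kappa>1 1 v = f (Suc (\<kappa> 0 v))"
      using J unfolding J_def c_def by blast
    have cn: "c < n" using g J1 unfolding x c_def by simp
    define v where "v = \<kappa> 0 (Suc c)"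
    have vN: "v < N" using nameN[of "Suc c"] cn unfolding v_def by simp
    have injc: "inj_on (\<kappa> 0) {1..Suc c}" by (rule inj_on_subset[OF inj]) (use cn in auto)
    let ?f = "f(Suc v := 0)"
    have new: "\<kappa> 0 w \<noteq> v" if "w \<in> {1..c}" for w
      using inj_onD[OF injc, of w "Suc c"] that unfolding v_def by auto
    have "Suc v \<notin> row_codes c (\<kappa> 0)"
    proof
      assume "Suc v \<in> row_codes c (\<kappa> 0)"
      then obtain w where "w \<in> {1..c}" "Suc v = Suc (\<kappa> 0 w)" unfolding row_codes_def by (rule imageE)
      then show False using new[of w] by simp
    qed
    then have A': "almost_dfs (row_codes (Suc c) (\<kappa> 0)) (code_edge G) ?f (Suc v)"
      unfolding row_codes_Suc v_def[symmetric] by (intro almost_dfs_insert[OF A]) simp_all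
    let ?\<rho> = "\<rho>1(3 := Suc c, 4 := Suc v)" and ?\<kappa> = "\<kappa>1(1 := (\<kappa>1 1)(Suc c := 0))"
    interpret R: rows \<sigma> S W "Suc c" by unfold_locales (use cn nN W S_def in simp_all)
    have tab: "?\<kappa> 1 w = ?f (Suc (\<kappa> 0 w))" "Suc (\<kappa> 0 w) \<in> row_codes (Suc c) (\<kappa> 0)" if w: "w \<in> {1..Suc c}" for w
    proof -
      show "Suc (\<kappa> 0 w) \<in> row_codes (Suc c) (\<kappa> 0)" using w unfolding row_codes_def by blast
      show "?\<kappa> 1 w = ?f (Suc (\<kappa> 0 w))"
      proof (cases "w = Suc c")
        case True then show ?thesis by (simp add: v_def)
      next
        case False
        then have "w \<in> {1..c}" using w by simp
        then show ?thesis using out new[of w] False by simp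
      qed
    qed
    have codeN: "d \<le> N" if "d \<in> insert 0 (row_codes (Suc c) (\<kappa> 0))" for d
      using that nameN cn unfolding row_codes_def by (auto simp: Suc_le_eq)
    have "wp CORE (\<lambda>z. (\<exists>\<rho> \<kappa> es' i'. z = (mem \<rho> \<kappa>, es', i') \<and> J \<rho> \<kappa>) \<and> n - fst z 3 < n - c)
       (mem ?\<rho> ?\<kappa>, es1, i1)"
    proof (rule R.wp_core[where E = "code_edge G" and f = ?f and a = "Suc v"])
      show "inj_on (?\<kappa> 0) {1..Suc c}" using injc J1 by simp
      show "\<forall>w\<in>{1..Suc c}. Suc (?\<kappa> 0 w) < W"
      proof
        fix w assume "w \<in> {1..Suc c}"
        then have "\<kappa> 0 w < N" using nameN cn by simp
        then show "Suc (?\<kappa> 0 w) < W" using J1 word by simp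
      qed
      show "\<forall>w\<in>{1..Suc c}. ?\<kappa> 1 w < W"
      proof
        fix w assume w: "w \<in> {1..Suc c}"
        have "?f (Suc (\<kappa> 0 w)) \<in> insert 0 (row_codes (Suc c) (\<kappa> 0))"
          by (rule forest_closed[OF almost_dfsD(1)[OF A']]) (use tab(2)[OF w] in simp)
        then show "?\<kappa> 1 w < W" using codeN word tab(1)[OF w] by (metis trans_le_add1)
      qed
      show "?\<rho> 4 < W" using vN word by simp
      show "\<forall>j. \<forall>(u, v)\<in>set (\<sigma> j). Suc u < W \<and> Suc v < W"
        using edge_stream_less[OF G(1) es[rule_format] G(2)] W by fastforce
      show "\<forall>j. \<forall>x\<in>{1..Suc c}. \<forall>y\<in>{1..Suc c}.
        code_edge G (Suc (?\<kappa> 0 x)) (Suc (?\<kappa> 0 y)) \<longleftrightarrow> pairs_edge (?\<kappa> 0) (\<sigma> j) x y"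
        using edge_stream_pairs_edge es by blast
      show "almost_dfs (row_codes (Suc c) (?\<kappa> 0)) (code_edge G) ?f (Suc v)" using A' J1 by simp
      show "\<forall>w\<in>{1..Suc c}. ?f (Suc (?\<kappa> 0 w)) = (if ?\<kappa> 1 w \<in> row_codes (Suc c) (?\<kappa> 0) then ?\<kappa> 1 w else 0)"
      proof
        fix w assume w: "w \<in> {1..Suc c}"
        have k0: "?\<kappa> 0 = \<kappa> 0" using J1 by simp
        show "?f (Suc (?\<kappa> 0 w)) = (if ?\<kappa> 1 w \<in> row_codes (Suc c) (?\<kappa> 0) then ?\<kappa> 1 w else 0)"
          unfolding k0 by (rule table_value[OF A' tab(2)[OF w] tab(1)[OF w]])
      qed
      show "Suc v = (if ?\<rho> 4 \<in> row_codes (Suc c) (?\<kappa> 0) then ?\<rho> 4 else 0)"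
        using J1 unfolding row_codes_Suc v_def by simp
      fix \<rho>2 and \<kappa>2 :: "nat \<Rightarrow> nat \<Rightarrow> nat" and es2 k f2
      assume kr: "keeps ({0..17} - {3, 4}) ?\<rho> \<rho>2" and k0: "\<kappa>2 0 = ?\<kappa> 0"
        and A2: "almost_dfs (row_codes (Suc c) (?\<kappa> 0)) (code_edge G) f2 0"
        and out2: "\<forall>w\<in>{1..Suc c}. \<kappa>2 1 w = f2 (Suc (?\<kappa> 0 w))"
      have r: "\<rho>2 3 = Suc c" "\<rho>2 18 = n" using kr J1 unfolding keeps_def by simp_all
      have k0': "?\<kappa> 0 = \<kappa> 0" using J1 by simp
      have "J \<rho>2 \<kappa>2"
        unfolding J_def r(1)
      proof (intro conjI exI[of _ f2])
        show "almost_dfs (row_codes (Suc c) (\<kappa> 0)) (code_edge G) f2 0" using A2 unfolding k0' .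
        show "\<forall>v\<in>{1..Suc c}. \<kappa>2 1 v = f2 (Suc (\<kappa> 0 v))" using out2 unfolding k0' .
      qed (use r k0 k0' cn in simp_all)
      moreover have "n - mem \<rho>2 \<kappa>2 3 < n - c" using r cn by (simp add: mem_reg)
      ultimately show "(\<exists>\<rho> \<kappa> es' i'. (mem \<rho>2 \<kappa>2, es2, i1 + k) = (mem \<rho> \<kappa>, es', i') \<and> J \<rho> \<kappa>) \<and>
          n - fst (mem \<rho>2 \<kappa>2, es2, i1 + k) 3 < n - c" by auto
    qed simp
    then show "wp ?B (\<lambda>z. (\<exists>\<rho> \<kappa> es' i'. z = (mem \<rho> \<kappa>, es' :: stream, i') \<and> J \<rho> \<kappa>) \<and>
        n - fst z 3 < n - fst x 3) x"
      unfolding x wp_seq_fun using J1 vN cn nN word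
      by (simp add: room mem_reg c_def[symmetric] v_def[symmetric])
  next
    fix x :: config assume "\<exists>\<rho> \<kappa> es' i'. x = (mem \<rho> \<kappa>, es' :: stream, i') \<and> J \<rho> \<kappa>"
      and g: "aval (LT (reg 3) (reg 18)) (fst x) = 0"
    then obtain \<rho>1 \<kappa>1 es1 i1 where x: "x = (mem \<rho>1 \<kappa>1, es1, i1)" and J: "J \<rho>1 \<kappa>1" by blast
    have r: "\<rho>1 3 = n" using g J unfolding x J_def by simp
    have "stores G \<rho>1 \<kappa>1"
      using J inj img n(2) row_codes_codes[OF img] unfolding stores_def J_def r by auto
    then show "?Q x" unfolding x by blast
  qed
  then have "wp GROW ?Q (mem \<rho> \<kappa>, es0, i)"
    unfolding GROW_def wp_seq_fun using n(1) nN word by (simp add: room)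
  then show ?thesis unfolding S_def .
qed

lemma preprocess_correct:
  assumes G: "simple_graph G" "fst G \<subseteq> {..<N}" and es: "\<forall>j. edge_stream G (\<sigma> j)" and W: "N + 5 < W"
    and vs: "distinct vs" "set vs = fst G"
  shows "fits (20 + 9 * (card (fst G) + 1)) W (initial_memory vs)"
    and "\<exists>m es' i'. exec \<sigma> (20 + 9 * (card (fst G) + 1)) W (LOAD ;; GROW) (initial_memory vs, [], 0) (m, es', i') \<and>
      reached G W m"
proof -
  define n where "n = card (fst G)"
  define S where "S = 20 + 9 * (n + 1)"
  have len: "length vs = n" using vs distinct_card[of vs] unfolding n_def by simp
  have "n \<le> card {..<N}" unfolding n_def using G(2) by (intro card_mono) simp_all
  then have nN: "n \<le> N" by simp
  have vW: "v < W" if "v \<in> set vs" for v using that vs(2) G(2) W by auto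
  have f: "fits S W (initial_memory vs)"
    unfolding fits_def initial_memory_def len S_def using nN W len by (auto intro!: vW)
  then show "fits (20 + 9 * (card (fst G) + 1)) W (initial_memory vs)" unfolding S_def n_def .
  interpret machine \<sigma> S W .
  have "wp LOAD (wp GROW (\<lambda>(m, _, _). \<exists>\<rho> \<kappa>. m = mem \<rho> \<kappa> \<and> stores G \<rho> \<kappa>)) (initial_memory vs, [], 0)"
  proof (rule wp_load)
    fix \<rho> :: "nat \<Rightarrow> nat" and \<kappa> :: "nat \<Rightarrow> nat \<Rightarrow> nat" assume r: "\<rho> 0 = length vs" and k: "\<forall>j\<in>{1..length vs}. \<kappa> 0 j = vs ! (j - 1)"
    have inj: "inj_on (\<kappa> 0) {1..n}"
    proof (rule inj_onI)
      fix a b assume ab: "a \<in> {1..n}" "b \<in> {1..n}" "\<kappa> 0 a = \<kappa> 0 b"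
      then have "vs ! (a - 1) = vs ! (b - 1)" using k len by simp
      then have "a - 1 = b - 1" using nth_eq_iff_index_eq[OF vs(1), of "a - 1" "b - 1"] ab len by auto
      then show "a = b" using ab by auto
    qed
    have "\<kappa> 0 ` {1..n} \<subseteq> fst G" using k len vs(2) by (auto intro!: nth_mem simp: vs(2)[symmetric])
    moreover have "card (\<kappa> 0 ` {1..n}) = card (fst G)" using card_image[OF inj] n_def by simp
    moreover have "finite (fst G)" using G unfolding simple_graph_def by blast
    ultimately have img: "\<kappa> 0 ` {1..n} = fst G" using card_subset_eq by blast
    show "wp GROW (\<lambda>(m, _, _). \<exists>\<rho> \<kappa>. m = mem \<rho> \<kappa> \<and> stores G \<rho> \<kappa>) (mem \<rho> \<kappa>, [], 0)"
      using wp_grow[where \<rho> = \<rho> and \<kappa> = \<kappa> and n = n, OF G es W inj img _ n_def] r len unfolding S_def by simp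
  qed (use len S_def nN W vW in auto)
  then have "wp (LOAD ;; GROW) (\<lambda>(m, _, _). \<exists>\<rho> \<kappa>. m = mem \<rho> \<kappa> \<and> stores G \<rho> \<kappa>) (initial_memory vs, [], 0)" by simp
  then obtain m es' i' \<rho> \<kappa> where e: "exec \<sigma> S W (LOAD ;; GROW) (initial_memory vs, [], 0) (m, es', i')"
    and m: "m = mem \<rho> \<kappa>" "stores G \<rho> \<kappa>"
    unfolding wp_def by auto
  have "fits S W m" using exec_fits[OF e] f by simp
  then have "reached G W m" unfolding reached_def using m S_def n_def by blast
  then show "\<exists>m es' i'. exec \<sigma> (20 + 9 * (card (fst G) + 1)) W (LOAD ;; GROW) (initial_memory vs, [], 0) (m, es', i') \<and>
      reached G W m"
    using e unfolding S_def n_def by blast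
qed

lemma update_correct:
  assumes G: "simple_graph G" and u: "valid_update G x" and G': "simple_graph (apply_update G x)"
    and N: "fst G \<subseteq> {..<N}" "fst (apply_update G x) \<subseteq> {..<N}" and W: "N + 5 < W"
    and es: "\<forall>j. edge_stream (apply_update G x) (\<sigma> j)" and m: "reached G W m"
  defines "n' \<equiv> card (fst (apply_update G x))"
  shows "fits (space_bound n') W (announce x m)"
    and "\<exists>m' es' i'. exec \<sigma> (space_bound n') W (MODIFY ;; CORE) (announce x m, [], 0) (m', es', i') \<and>
      i' \<le> num_passes n' \<and> reached (apply_update G x) W m'"
proof -
  let ?G = "apply_update G x"
  define S where "S = space_bound n'"
  interpret machine \<sigma> S W .
  note M = modify_correct[OF G u m N W, folded n'_def]
  show "fits (space_bound n') W (announce x m)" using M(1) unfolding space_bound_def .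
  let ?Q = "\<lambda>(m', es', i'). reached ?G W m' \<and> i' \<le> num_passes n'"
  have "wp MODIFY (wp CORE ?Q) (announce x m, [], 0)"
  proof (rule wp_mono[OF M(2)[where \<sigma> = \<sigma> and i = 0 and es = "[]", folded space_bound_def, folded S_def]])
    fix c :: config
    obtain m' es' i' where c: "c = (m', es', i')" by (cases c)
    assume "case c of (m', es', i') \<Rightarrow> i' = 0 \<and> (\<exists>\<rho> \<kappa>. m' = mem \<rho> \<kappa> \<and> ready ?G \<rho> \<kappa>) \<and> fits (20 + 9 * (n' + 1)) W m'"
    then obtain \<rho> \<kappa> where i: "i' = 0" and r: "m' = mem \<rho> \<kappa>" "ready ?G \<rho> \<kappa>" and f: "fits (20 + 9 * (n' + 1)) W m'"
      unfolding c by auto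
    have "machine.wp \<sigma> (20 + 9 * (n' + 1)) W CORE (\<lambda>(m'', es'', i''). reached ?G W m'' \<and>
        (\<exists>k. i'' = 0 + k \<and> (k = 0 \<or> 2 ^ (k - 1) \<le> n'))) (m', es', 0)"
      using core_correct[OF G' N(2) es W r, folded n'_def, OF f] .
    then have "machine.wp \<sigma> S W CORE (\<lambda>(m'', es'', i''). reached ?G W m'' \<and>
        (\<exists>k. i'' = 0 + k \<and> (k = 0 \<or> 2 ^ (k - 1) \<le> n'))) (m', es', 0)"
      by (rule wp_space_mono) (simp add: S_def space_bound_def)
    then show "wp CORE ?Q c"
      unfolding c i by (rule wp_mono) (auto intro: num_passes_bound simp del: One_nat_def)
  qed
  then have "wp (MODIFY ;; CORE) ?Q (announce x m, [], 0)" by simp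
  then show "\<exists>m' es' i'. exec \<sigma> (space_bound n') W (MODIFY ;; CORE) (announce x m, [], 0) (m', es', i') \<and>
      i' \<le> num_passes n' \<and> reached (apply_update G x) W m'"
    unfolding wp_def S_def[symmetric] by auto
qed

section \<open>Runs over a whole sequence of updates\<close>

lemma simple_graph_apply_update:
  assumes "simple_graph G" "valid_update G x"
  shows "simple_graph (apply_update G x)"
proof -
  obtain V E where G: "G = (V, E)" by (cases G)
  have fin: "finite V" and E: "E \<subseteq> {{u, v} | u v. u \<in> V \<and> v \<in> V \<and> u \<noteq> v}"
    using assms(1) unfolding G simple_graph_def by simp_all
  show ?thesis
  proof (cases x)
    case (Insert_Vertex v X)
    have v: "v \<notin> V" "X \<subseteq> V" using assms(2) unfolding G Insert_Vertex by simp_all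
    have "E \<subseteq> {{a, b} | a b. a \<in> insert v V \<and> b \<in> insert v V \<and> a \<noteq> b}" using E by blast
    moreover have "(\<lambda>x. {v, x}) ` X \<subseteq> {{a, b} | a b. a \<in> insert v V \<and> b \<in> insert v V \<and> a \<noteq> b}"
      using v by blast
    ultimately show ?thesis using fin unfolding G Insert_Vertex simple_graph_def by simp
  next
    case (Delete_Vertex v)
    have "{e \<in> E. v \<notin> e} \<subseteq> {{a, b} | a b. a \<in> V - {v} \<and> b \<in> V - {v} \<and> a \<noteq> b}"
    proof
      fix e assume e: "e \<in> {e \<in> E. v \<notin> e}"
      then obtain a b where "e = {a, b}" "a \<in> V" "b \<in> V" "a \<noteq> b" using E by blast
      then show "e \<in> {{a, b} | a b. a \<in> V - {v} \<and> b \<in> V - {v} \<and> a \<noteq> b}" using e by blast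
    qed
    then show ?thesis using fin unfolding G Delete_Vertex simple_graph_def by simp
  next
    case (Insert_Edge a b)
    have "a \<in> V" "b \<in> V" "a \<noteq> b" using assms(2) unfolding G Insert_Edge by simp_all
    then have "{a, b} \<in> {{u, v} | u v. u \<in> V \<and> v \<in> V \<and> u \<noteq> v}" by blast
    then show ?thesis using fin E unfolding G Insert_Edge simple_graph_def by simp
  next
    case (Delete_Edge a b)
    show ?thesis using fin E unfolding G Delete_Edge simple_graph_def by auto
  qed
qed

lemma valid_updates_nth: "valid_updates G us \<Longrightarrow> t < length us \<Longrightarrow> valid_update (graph_after G us t) (us ! t)"
proof (induction us arbitrary: G t)
  case (Cons x us)
  then show ?case by (cases t) (simp_all add: graph_after_def)
qed simp

lemma graph_after_Suc: "t < length us \<Longrightarrow> graph_after G us (Suc t) = apply_update (graph_after G us t) (us ! t)"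
  unfolding graph_after_def by (simp add: take_Suc_conv_app_nth)

theorem mainTheorem4:
  shows "\<exists>(A :: streaming_algorithm) (space :: nat \<Rightarrow> nat) (passes :: nat \<Rightarrow> nat).
           (\<lambda>n. real (space n)) \<in> O(\<lambda>n. real n) \<and>
           (\<lambda>n. real (passes n)) \<in> O(\<lambda>n. (ln (real n))\<^sup>2) \<and>
           maintains_dfs_tree A space passes"
proof (intro exI conjI)
  show "(\<lambda>n. real (space_bound n)) \<in> O(\<lambda>n. real n)" by (rule space_bound_bigo)
  show "(\<lambda>n. real (num_passes n)) \<in> O(\<lambda>n. (ln (real n))\<^sup>2)" by (rule num_passes_bigo)
  show "maintains_dfs_tree dfs_algorithm space_bound num_passes"
    unfolding maintains_dfs_tree_def
  \<comment> \<open>The cube exceeds \<open>N + 5\<close> for every \<open>N\<close>; the square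
    would fail for \<open>N = 0\<close>.\<close>
  proof (intro exI[of _ 3] allI impI)
    fix N G us and vs :: "nat list" and \<sigma> :: "nat \<Rightarrow> nat \<Rightarrow> stream"
    assume asm: "simple_graph G \<and> valid_updates G us \<and>
        (\<forall>t\<le>length us. fst (graph_after G us t) \<subseteq> {..<N}) \<and> distinct vs \<and> set vs = fst G \<and>
        (\<forall>t\<le>length us. \<forall>i. edge_stream (graph_after G us t) (\<sigma> t i))"
    define W where "W = (N + 2) ^ 3"
    define H where "H = graph_after G us"
    have W: "N + 5 < W" unfolding W_def by (simp add: power3_eq_cube algebra_simps)
    have H0: "H 0 = G" unfolding H_def graph_after_def by simp
    have HS: "H (Suc t) = apply_update (H t) (us ! t)" "valid_update (H t) (us ! t)" if "t < length us" for t
      using graph_after_Suc[OF that] valid_updates_nth that asm unfolding H_def by blast+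
    have HN: "fst (H t) \<subseteq> {..<N}" "\<forall>i. edge_stream (H t) (\<sigma> t i)" if "t \<le> length us" for t
      using asm that unfolding H_def by blast+
    have simple: "simple_graph (H t)" if "t \<le> length us" for t
      using that
    proof (induction t)
      case 0 then show ?case using asm H0 by simp
    next
      case (Suc t)
      then show ?case using HS[of t] simple_graph_apply_update by simp
    qed
    \<comment> \<open>Both predicates hold vacuously beyond the last update, so that the memories
      form an infinite sequence and dependent choice applies.\<close>
    define P where "P t m \<longleftrightarrow> (t = 0 \<longrightarrow> (\<exists>es i. exec (\<sigma> 0) (space_bound (card (fst (H 0)))) W (preprocess dfs_algorithm)
        (initial_memory vs, [], 0) (m, es, i))) \<and> (t \<le> length us \<longrightarrow> reached (H t) W m)" for t m
    define R where "R t m m' \<longleftrightarrow> (t < length us \<longrightarrow> (fits (space_bound (card (fst (H (Suc t))))) W (announce (us ! t) m) \<and>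
        (\<exists>es i. exec (\<sigma> (Suc t)) (space_bound (card (fst (H (Suc t))))) W (process_update dfs_algorithm)
          (announce (us ! t) m, [], 0) (m', es, i) \<and> i \<le> num_passes (card (fst (H (Suc t)))))))" for t m m'
    have pre: "simple_graph (H 0)" "fst (H 0) \<subseteq> {..<N}" "\<forall>j. edge_stream (H 0) (\<sigma> 0 j)" "distinct vs" "set vs = fst (H 0)"
      using simple[of 0] HN[of 0] asm H0 by simp_all
    note PRE = preprocess_correct[OF pre(1-3) W pre(4-5)]
    have le: "20 + 9 * (card (fst (H 0)) + 1) \<le> space_bound (card (fst (H 0)))" unfolding space_bound_def by simp
    have base: "\<exists>m. P 0 m" using PRE(2) exec_mono[OF _ le] unfolding P_def dfs_algorithm_def by fastforce
    have step: "\<exists>m'. P (Suc t) m' \<and> R t m m'" if m: "P t m" for t m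
    proof (cases "t < length us")
      case True
      then have r: "reached (H t) W m" using m unfolding P_def by simp
      have s: "simple_graph (H t)" "simple_graph (apply_update (H t) (us ! t))" "fst (H t) \<subseteq> {..<N}"
        "fst (apply_update (H t) (us ! t)) \<subseteq> {..<N}" "\<forall>j. edge_stream (apply_update (H t) (us ! t)) (\<sigma> (Suc t) j)"
        using simple[of t] simple[of "Suc t"] HN[of t] HN[of "Suc t"] True unfolding HS(1)[OF True, symmetric] by simp_all
      note U = update_correct[OF s(1) HS(2)[OF True] s(2-4) W s(5) r, folded HS(1)[OF True]]
      obtain m' es' i' where "exec (\<sigma> (Suc t)) (space_bound (card (fst (H (Suc t))))) W (MODIFY ;; CORE)
          (announce (us ! t) m, [], 0) (m', es', i')" "i' \<le> num_passes (card (fst (H (Suc t))))"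
        "reached (H (Suc t)) W m'"
        using U(2) by blast
      then have "P (Suc t) m' \<and> R t m m'" using U(1) unfolding P_def R_def dfs_algorithm_def by auto
      then show ?thesis by blast
    qed (simp add: P_def R_def)
    obtain M where M: "\<And>t. P t (M t)" "\<And>t. R t (M t) (M (Suc t))"
      using dependent_nat_choice[of P R, OF base step] by blast
    show "run_respects dfs_algorithm space_bound num_passes ((N + 2) ^ 3) G us vs \<sigma>"
      unfolding run_respects_def Let_def H_def[symmetric] W_def[symmetric]
    proof (intro exI[of _ M] conjI allI impI)
      show "fits (space_bound (card (fst (H 0)))) W (initial_memory vs)"
        using PRE(1) le unfolding fits_def by simp
      show "\<exists>es i. exec (\<sigma> 0) (space_bound (card (fst (H 0)))) W (preprocess dfs_algorithm)
          (initial_memory vs, [], 0) (M 0, es, i)"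
        using M(1)[of 0] unfolding P_def by simp
    next
      fix t assume t: "t < length us"
      note Rt = M(2)[of t, unfolded R_def, rule_format, OF t]
      show "fits (space_bound (card (fst (H (Suc t))))) W (announce (us ! t) (M t))"
        by (rule conjunct1[OF Rt])
      show "\<exists>es i. exec (\<sigma> (Suc t)) (space_bound (card (fst (H (Suc t))))) W (process_update dfs_algorithm)
          (announce (us ! t) (M t), [], 0) (M (Suc t), es, i) \<and> i \<le> num_passes (card (fst (H (Suc t))))"
        by (rule conjunct2[OF Rt])
    next
      fix t assume t: "t \<le> length us"
      then have "reached (H t) W (M t)" using M(1)[of t] unfolding P_def by blast
      then show "is_dfs_tree (augment (H t)) None (stored_tree dfs_algorithm (card (fst (H t))) (M t))"
        unfolding dfs_algorithm_def using reached_dfs_tree[OF simple[OF t]] by simp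
    qed
  qed
qed

end
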